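(* Let $(M,g)$ be a smooth manifold with a continuous complete Riemannian metric $g$, let $F:M\to M$ be a Lipeomorphism of $(M,g)$ and let $\tilde g=F^*g$. Then the quadratic estimate is invariant under passing from $g$ to the Lipschitz transformation $\tilde g$. Precisely: let $a\in L^\infty(M)$ be complex valued and $A$ an essentially bounded measurable section of endomorphisms of $\mathbb{C}\oplus T^*M$, such that for some $\kappa_1,\kappa_2>0$ $$\operatorname{Re}\langle ASv,Sv\rangle_{\tilde g}\ge\kappa_1\|v\|^2_{W^{1,2},\tilde g},\qquad\operatorname{Re}\langle au,u\rangle_{\tilde g}\ge\kappa_2\|u\|_{\tilde g}^2$$ for all $v\in W^{1,2}(M,\tilde g)$, $u\in L^2(M,\tilde g)$. With the notation of the context, $$\int_0^\infty\|t\Pi_{B,\tilde g}(I+t^2\Pi_{B,\tilde g}^2)^{-1}u\|_{\tilde g}^2\,\frac{dt}{t}\simeq\|u\|_{\tilde g}^2\quad\text{for all }u\in\overline{\mathcal{R}(\Pi_{B,\tilde g})}$$ holds if and only if $$\int_0^\infty\|t\Pi_{\tilde B,g}(I+t^2\Pi_{\tilde B,g}^2)^{-1}v\|_{g}^2\,\frac{dt}{t}\simeq\|v\|_{g}^2\quad\text{for all }v\in\overline{\mathcal{R}(\Pi_{\tilde B,g})}.$$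
   Context: Let $\rho_g$ be the distance induced by $g$ (infimum of lengths of absolutely continuous curves); complete means $\rho_g$ is complete. A Lipeomorphism $F:(M,g)\to(M,g)$ is an invertible map for which there is $C\ge1$ with $C^{-1}\rho_g(x,y)\le\rho_g(F(x),F(y))\le C\rho_g(x,y)$ for all $x,y$. Such $F$ is differentiable almost everywhere (in charts, with respect to Lebesgue measure $\mathcal{L}$), and $\tilde g=F^*g$ is defined almost everywhere. For $k\in\{g,\tilde g\}$, $d\mu_k=\sqrt{\det(k_{ij})}\,d\mathcal{L}$ in charts; $L^2(\cdot,k)$ is the space of complex functions or covector fields square integrable with respect to $k$ and $\mu_k$; $W^{1,2}(M,k)$ is the closure of $\{u\in C^\infty\cap L^2(M,k):\nabla u\in L^2(T^*M,k)\}$ in the norm $\|u\|+\|\nabla u\|$, where $\nabla$ is the exterior derivative on functions. $S=(I,\overline{\nabla_c})$, where $\overline{\nabla_c}$ is the closure in $L^2$ (with respect to $k$) of $\nabla$ on $C_c^\infty(M)$; its domain is $W^{1,2}(M,k)$. Let $\mathcal{H}_k=L^2(M,k)\oplus\big(L^2(M,k)\oplus L^2(T^*M,k)\big)$, $$\Gamma=\begin{pmatrix}0&0\\S&0\end{pmatrix},\quad B_1=\begin{pmatrix}a&0\\0&0\end{pmatrix},\quad B_2=\begin{pmatrix}0&0\\0&A\end{pmatrix},$$ let $\Gamma_k^*$ be the adjoint of $\Gamma$ in $\mathcal{H}_k$, let $\Phi:\mathcal{H}_{\tilde g}\to\mathcal{H}_g$ be $\Phi(u,v,w)=((F^{-1})^*u,(F^{-1})^*v,(F^{-1})^*w)$,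 $\tilde B_i=\Phi B_i\Phi^{-1}$, $\Pi_{B,\tilde g}=\Gamma+B_1\Gamma_{\tilde g}^*B_2$ on $\mathcal{H}_{\tilde g}$ and $\Pi_{\tilde B,g}=\Gamma+\tilde B_1\Gamma_g^*\tilde B_2$ on $\mathcal{H}_g$. $\mathcal{R}$ denotes range; $\simeq$ means two-sided bounds with constants independent of the vector. *)

theory Defs
  imports "HOL-Analysis.Analysis"
begin

section \<open>Smooth manifolds\<close>

text \<open>
  A chart is a pair of an open set \<open>U\<close> and a coordinate map, of which only the values on \<open>U\<close> matter.
  The topological space \<open>M\<close> is the whole type \<open>'m\<close>, the dimension is the cardinality of \<open>'n\<close>.
  Connectedness is not assumed.
\<close>

type_synonym ('m, 'n) chart = "'m set \<times> ('m \<Rightarrow> real^'n)"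

abbreviation chart_dom :: "('m, 'n) chart \<Rightarrow> 'm set" where
  "chart_dom c \<equiv> fst c"

abbreviation chart_map :: "('m, 'n) chart \<Rightarrow> 'm \<Rightarrow> real^'n" where
  "chart_map c \<equiv> snd c"

definition chart_inv :: "('m, 'n) chart \<Rightarrow> real^'n \<Rightarrow> 'm" where
  "chart_inv c = inv_into (chart_dom c) (chart_map c)"

definition is_chart :: "('m::topological_space, 'n::finite) chart \<Rightarrow> bool" where
  "is_chart c \<longleftrightarrow>
     open (chart_dom c) \<and> open (chart_map c ` chart_dom c) \<and>
     homeomorphism (chart_dom c) (chart_map c ` chart_dom c) (chart_map c) (chart_inv c)"

primrec Ck_on :: "nat \<Rightarrow> (real^'n::finite) set \<Rightarrow> (real^'n \<Rightarrow> 'b::real_normed_vector) \<Rightarrow> bool" where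
  "Ck_on 0 S f \<longleftrightarrow> continuous_on S f"
| "Ck_on (Suc k) S f \<longleftrightarrow>
     f differentiable_on S \<and> (\<forall>v. Ck_on k S (\<lambda>x. frechet_derivative f (at x) v))"

text \<open>Only used for open sets \<open>S\<close>.\<close>

definition smooth_on :: "(real^'n::finite) set \<Rightarrow> (real^'n \<Rightarrow> 'b::real_normed_vector) \<Rightarrow> bool" where
  "smooth_on S f \<longleftrightarrow> (\<forall>k. Ck_on k S f)"

definition smooth_manifold ::
    "('m::{t2_space, second_countable_topology}, 'n::finite) chart set \<Rightarrow> bool" where
  "smooth_manifold \<A> \<longleftrightarrow>
     (\<forall>c\<in>\<A>. is_chart c) \<and> (\<Union>c\<in>\<A>. chart_dom c) = UNIV \<and>
     (\<forall>c\<in>\<A>. \<forall>d\<in>\<A>.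
        smooth_on (chart_map c ` (chart_dom c \<inter> chart_dom d)) (chart_map d \<circ> chart_inv c))"

definition smooth_fun ::
    "('m, 'n::finite) chart set \<Rightarrow> ('m \<Rightarrow> complex) \<Rightarrow> bool" where
  "smooth_fun \<A> u \<longleftrightarrow> (\<forall>c\<in>\<A>. smooth_on (chart_map c ` chart_dom c) (u \<circ> chart_inv c))"

section \<open>Tangent and cotangent spaces\<close>

text \<open>
  At every point one chart around it is selected, and the tangent space at the point is identified
  with \<open>real^'n\<close> by means of this chart. A metric is thus a field of symmetric matrices, a
  complex covector field is a function into \<open>complex^'n\<close>, and the differential of a map is a field of
  Jacobian matrices. The selection is arbitrary and need not depend on the point in any regular
  way; hence continuity and measurability are always expressed by the components with respect to
  the coordinate frame of a fixed chart.
\<close>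

definition chart_at :: "('m, 'n) chart set \<Rightarrow> 'm \<Rightarrow> ('m, 'n) chart" where
  "chart_at \<A> p = (SOME c. c \<in> \<A> \<and> p \<in> chart_dom c)"

text \<open>The columns of \<open>frame \<A> c p\<close> are the coordinate vectors of the chart \<open>c\<close> at \<open>p\<close>.\<close>

definition frame :: "('m, 'n::finite) chart set \<Rightarrow> ('m, 'n) chart \<Rightarrow> 'm \<Rightarrow> real^'n^'n" where
  "frame \<A> c p = jacobian (chart_map (chart_at \<A> p) \<circ> chart_inv c) (at (chart_map c p))"

definition cmatrix :: "real^'n^'m \<Rightarrow> complex^'n^'m" where
  "cmatrix J = (\<chi> i j. complex_of_real (J $ i $ j))"

definition metric_in_chart ::
    "('m, 'n::finite) chart set \<Rightarrow> ('m \<Rightarrow> real^'n^'n) \<Rightarrow> ('m, 'n) chart \<Rightarrow> 'm \<Rightarrow> real^'n^'n" where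
  "metric_in_chart \<A> k c p = transpose (frame \<A> c p) ** k p ** frame \<A> c p"

definition covector_in_chart ::
    "('m, 'n::finite) chart set \<Rightarrow> ('m, 'n) chart \<Rightarrow> 'm \<Rightarrow> complex^'n \<Rightarrow> complex^'n" where
  "covector_in_chart \<A> c p w = transpose (cmatrix (frame \<A> c p)) *v w"

definition covector_from_chart ::
    "('m, 'n::finite) chart set \<Rightarrow> ('m, 'n) chart \<Rightarrow> 'm \<Rightarrow> complex^'n \<Rightarrow> complex^'n" where
  "covector_from_chart \<A> c p x = transpose (cmatrix (matrix_inv (frame \<A> c p))) *v x"

text \<open>The exterior derivative on functions.\<close>

definition ext_deriv ::
    "('m, 'n::finite) chart set \<Rightarrow> ('m \<Rightarrow> complex) \<Rightarrow> 'm \<Rightarrow> complex^'n" where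
  "ext_deriv \<A> u p =
     (\<chi> i. frechet_derivative (u \<circ> chart_inv (chart_at \<A> p)) (at (chart_map (chart_at \<A> p) p))
             (axis i 1))"

text \<open>
  The differential of a map at a point. At points where the map is not differentiable it
  is some unspecified matrix.
\<close>

definition differential ::
    "('m, 'n::finite) chart set \<Rightarrow> ('m \<Rightarrow> 'm) \<Rightarrow> 'm \<Rightarrow> real^'n^'n" where
  "differential \<A> F p =
     jacobian (chart_map (chart_at \<A> (F p)) \<circ> F \<circ> chart_inv (chart_at \<A> p))
       (at (chart_map (chart_at \<A> p) p))"

definition pullback_metric ::
    "('m, 'n::finite) chart set \<Rightarrow> ('m \<Rightarrow> 'm) \<Rightarrow> ('m \<Rightarrow> real^'n^'n) \<Rightarrow> 'm \<Rightarrow> real^'n^'n" where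
  "pullback_metric \<A> F k p =
     transpose (differential \<A> F p) ** k (F p) ** differential \<A> F p"

definition pullback_covector ::
    "('m, 'n::finite) chart set \<Rightarrow> ('m \<Rightarrow> 'm) \<Rightarrow> ('m \<Rightarrow> complex^'n) \<Rightarrow> 'm \<Rightarrow> complex^'n" where
  "pullback_covector \<A> F w p = transpose (cmatrix (differential \<A> F p)) *v w (F p)"

section \<open>Continuous metrics and their distance\<close>

definition continuous_metric ::
    "('m::topological_space, 'n::finite) chart set \<Rightarrow> ('m \<Rightarrow> real^'n^'n) \<Rightarrow> bool" where
  "continuous_metric \<A> g \<longleftrightarrow>
     (\<forall>p. transpose (g p) = g p \<and> (\<forall>v. v \<noteq> 0 \<longrightarrow> v \<bullet> (g p *v v) > 0)) \<and>
     (\<forall>c\<in>\<A>. continuous_on (chart_dom c) (metric_in_chart \<A> g c))"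

text \<open>
  \<open>d division_of T\<close> says that \<open>d\<close> is a finite set of non-overlapping closed intervals with union \<open>T\<close>.
\<close>

definition abs_continuous_on :: "real \<Rightarrow> real \<Rightarrow> (real \<Rightarrow> 'a::real_normed_vector) \<Rightarrow> bool" where
  "abs_continuous_on s t f \<longleftrightarrow>
     (\<forall>e>0. \<exists>\<delta>>0. \<forall>d T. d division_of T \<and> T \<subseteq> {s..t} \<and> (\<Sum>I\<in>d. measure lborel I) < \<delta> \<longrightarrow>
        (\<Sum>I\<in>d. norm (f (Sup I) - f (Inf I))) < e)"

definition abs_continuous_curve ::
    "('m::topological_space, 'n::finite) chart set \<Rightarrow> (real \<Rightarrow> 'm) \<Rightarrow> bool" where
  "abs_continuous_curve \<A> \<gamma> \<longleftrightarrow>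
     continuous_on {0..1} \<gamma> \<and>
     (\<forall>c\<in>\<A>. \<forall>s t. 0 \<le> s \<and> s \<le> t \<and> t \<le> 1 \<and> \<gamma> ` {s..t} \<subseteq> chart_dom c \<longrightarrow>
        abs_continuous_on s t (chart_map c \<circ> \<gamma>))"

definition velocity ::
    "('m, 'n::finite) chart set \<Rightarrow> (real \<Rightarrow> 'm) \<Rightarrow> real \<Rightarrow> real^'n" where
  "velocity \<A> \<gamma> t = vector_derivative (chart_map (chart_at \<A> (\<gamma> t)) \<circ> \<gamma>) (at t)"

definition curve_length ::
    "('m, 'n::finite) chart set \<Rightarrow> ('m \<Rightarrow> real^'n^'n) \<Rightarrow> (real \<Rightarrow> 'm) \<Rightarrow> ennreal" where
  "curve_length \<A> g \<gamma> =
     (\<integral>\<^sup>+t\<in>{0..1}. ennreal (sqrt (velocity \<A> \<gamma> t \<bullet> (g (\<gamma> t) *v velocity \<A> \<gamma> t))) \<partial>lebesgue)"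

text \<open>The distance of points in different connected components is infinite.\<close>

definition riem_dist ::
    "('m::topological_space, 'n::finite) chart set \<Rightarrow> ('m \<Rightarrow> real^'n^'n) \<Rightarrow> 'm \<Rightarrow> 'm \<Rightarrow> ennreal" where
  "riem_dist \<A> g x y =
     (INF \<gamma>\<in>{\<gamma>. abs_continuous_curve \<A> \<gamma> \<and> \<gamma> 0 = x \<and> \<gamma> 1 = y}. curve_length \<A> g \<gamma>)"

definition complete_metric ::
    "('m::topological_space, 'n::finite) chart set \<Rightarrow> ('m \<Rightarrow> real^'n^'n) \<Rightarrow> bool" where
  "complete_metric \<A> g \<longleftrightarrow>
     (\<forall>x :: nat \<Rightarrow> 'm.
        (\<forall>e>0. \<exists>N. \<forall>i\<ge>N. \<forall>j\<ge>N. riem_dist \<A> g (x i) (x j) < e) \<longrightarrow>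
        (\<exists>l. (\<lambda>i. riem_dist \<A> g (x i) l) \<longlonglongrightarrow> 0))"

definition lipeomorphism ::
    "('m::topological_space, 'n::finite) chart set \<Rightarrow> ('m \<Rightarrow> real^'n^'n) \<Rightarrow> ('m \<Rightarrow> 'm) \<Rightarrow> bool" where
  "lipeomorphism \<A> g F \<longleftrightarrow>
     bij F \<and>
     (\<exists>C::real\<ge>1. \<forall>x y.
        ennreal (inverse C) * riem_dist \<A> g x y \<le> riem_dist \<A> g (F x) (F y) \<and>
        riem_dist \<A> g (F x) (F y) \<le> ennreal C * riem_dist \<A> g x y)"

section \<open>Square integrable functions and covector fields\<close>

text \<open>
  From here on \<open>k\<close> is a metric of which only the values almost everywhere matter, such as the pullback
  of a continuous metric by a Lipeomorphism.
\<close>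

definition lebesgue_sets :: "('m, 'n::finite) chart set \<Rightarrow> 'm set set" where
  "lebesgue_sets \<A> = {E. \<forall>c\<in>\<A>. chart_map c ` (E \<inter> chart_dom c) \<in> sets lebesgue}"

text \<open>
  The measure which is \<open>sqrt (det k) dx\<close> in every chart. For \<open>k\<close> measurable and positive definite almost
  everywhere it exists and is unique, by the change of variables formula and a countable cover by
  charts.
\<close>

definition vol :: "('m, 'n::finite) chart set \<Rightarrow> ('m \<Rightarrow> real^'n^'n) \<Rightarrow> 'm measure" where
  "vol \<A> k = (THE \<mu>. space \<mu> = UNIV \<and> sets \<mu> = lebesgue_sets \<A> \<and>
     (\<forall>c\<in>\<A>. \<forall>E\<in>lebesgue_sets \<A>. E \<subseteq> chart_dom c \<longrightarrow>
        emeasure \<mu> E =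
          (\<integral>\<^sup>+x\<in>chart_map c ` E. ennreal (sqrt (det (metric_in_chart \<A> k c (chart_inv c x)))) \<partial>lebesgue)))"

text \<open>
  Elements of the spaces below are represented by functions. All operators are given by their
  graphs, that is, as relations between representatives, and all graphs are closed under equality
  almost everywhere in both arguments.
\<close>

definition L2_fun :: "('m, 'n::finite) chart set \<Rightarrow> ('m \<Rightarrow> real^'n^'n) \<Rightarrow> ('m \<Rightarrow> complex) set" where
  "L2_fun \<A> k =
     {u. u \<in> borel_measurable (vol \<A> k) \<and> integrable (vol \<A> k) (\<lambda>p. (cmod (u p))\<^sup>2)}"

definition L2_fun_inner ::
    "('m, 'n::finite) chart set \<Rightarrow> ('m \<Rightarrow> real^'n^'n) \<Rightarrow> ('m \<Rightarrow> complex) \<Rightarrow> ('m \<Rightarrow> complex) \<Rightarrow> complex" where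
  "L2_fun_inner \<A> k u v = (LINT p|vol \<A> k. u p * cnj (v p))"

definition L2_fun_norm ::
    "('m, 'n::finite) chart set \<Rightarrow> ('m \<Rightarrow> real^'n^'n) \<Rightarrow> ('m \<Rightarrow> complex) \<Rightarrow> real" where
  "L2_fun_norm \<A> k u = sqrt (Re (L2_fun_inner \<A> k u u))"

text \<open>The inner product on complex covectors which is dual to the metric with matrix \<open>G\<close>.\<close>

definition cov_inner :: "real^'n::finite^'n \<Rightarrow> complex^'n \<Rightarrow> complex^'n \<Rightarrow> complex" where
  "cov_inner G w z = (\<Sum>i\<in>UNIV. \<Sum>j\<in>UNIV. complex_of_real (matrix_inv G $ i $ j) * w $ i * cnj (z $ j))"

definition measurable_covector_field ::
    "('m, 'n::finite) chart set \<Rightarrow> ('m \<Rightarrow> complex^'n) \<Rightarrow> bool" where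
  "measurable_covector_field \<A> w \<longleftrightarrow>
     (\<forall>c\<in>\<A>. (\<lambda>x. covector_in_chart \<A> c (chart_inv c x) (w (chart_inv c x)))
        \<in> borel_measurable (lebesgue_on (chart_map c ` chart_dom c)))"

definition L2_cov :: "('m, 'n::finite) chart set \<Rightarrow> ('m \<Rightarrow> real^'n^'n) \<Rightarrow> ('m \<Rightarrow> complex^'n) set" where
  "L2_cov \<A> k =
     {w. measurable_covector_field \<A> w \<and>
         integrable (vol \<A> k) (\<lambda>p. Re (cov_inner (k p) (w p) (w p)))}"

definition L2_cov_inner ::
    "('m, 'n::finite) chart set \<Rightarrow> ('m \<Rightarrow> real^'n^'n) \<Rightarrow>
     ('m \<Rightarrow> complex^'n) \<Rightarrow> ('m \<Rightarrow> complex^'n) \<Rightarrow> complex" where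
  "L2_cov_inner \<A> k w z = (LINT p|vol \<A> k. cov_inner (k p) (w p) (z p))"

definition L2_cov_norm ::
    "('m, 'n::finite) chart set \<Rightarrow> ('m \<Rightarrow> real^'n^'n) \<Rightarrow> ('m \<Rightarrow> complex^'n) \<Rightarrow> real" where
  "L2_cov_norm \<A> k w = sqrt (Re (L2_cov_inner \<A> k w w))"

section \<open>The gradient and the Sobolev space\<close>

definition L2_closure ::
    "('m, 'n::finite) chart set \<Rightarrow> ('m \<Rightarrow> real^'n^'n) \<Rightarrow>
     (('m \<Rightarrow> complex) \<times> ('m \<Rightarrow> complex^'n)) set \<Rightarrow> (('m \<Rightarrow> complex) \<times> ('m \<Rightarrow> complex^'n)) set" where
  "L2_closure \<A> k T =
     {(u, w). u \<in> L2_fun \<A> k \<and> w \<in> L2_cov \<A> k \<and>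
        (\<exists>us ws. (\<forall>j::nat. (us j, ws j) \<in> T \<inter> L2_fun \<A> k \<times> L2_cov \<A> k) \<and>
           (\<lambda>j. L2_fun_norm \<A> k (\<lambda>p. us j p - u p)) \<longlonglongrightarrow> 0 \<and>
           (\<lambda>j. L2_cov_norm \<A> k (\<lambda>p. ws j p - w p)) \<longlonglongrightarrow> 0)}"

text \<open>
  The closure of the smooth functions in the Sobolev norm, each limit being kept together with its
  gradient.
\<close>

definition sobolev_grad ::
    "('m, 'n::finite) chart set \<Rightarrow> ('m \<Rightarrow> real^'n^'n) \<Rightarrow>
     (('m \<Rightarrow> complex) \<times> ('m \<Rightarrow> complex^'n)) set" where
  "sobolev_grad \<A> k = L2_closure \<A> k {(u, ext_deriv \<A> u) | u. smooth_fun \<A> u}"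

definition W12 :: "('m, 'n::finite) chart set \<Rightarrow> ('m \<Rightarrow> real^'n^'n) \<Rightarrow> ('m \<Rightarrow> complex) set" where
  "W12 \<A> k = Domain (sobolev_grad \<A> k)"

text \<open>The gradient is unique up to equality almost everywhere, so the norm does not depend on the choice.\<close>

definition W12_norm ::
    "('m, 'n::finite) chart set \<Rightarrow> ('m \<Rightarrow> real^'n^'n) \<Rightarrow> ('m \<Rightarrow> complex) \<Rightarrow> real" where
  "W12_norm \<A> k u =
     L2_fun_norm \<A> k u + L2_cov_norm \<A> k (SOME w. (u, w) \<in> sobolev_grad \<A> k)"

definition grad_c ::
    "('m::topological_space, 'n::finite) chart set \<Rightarrow> ('m \<Rightarrow> real^'n^'n) \<Rightarrow>
     (('m \<Rightarrow> complex) \<times> ('m \<Rightarrow> complex^'n)) set" where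
  "grad_c \<A> k =
     L2_closure \<A> k
       {(u, ext_deriv \<A> u) | u. smooth_fun \<A> u \<and> compact (closure {p. u p \<noteq> 0})}"

section \<open>The bundle of pairs and its endomorphisms\<close>

text \<open>
  The fibre of \<open>\<complex> \<oplus> T\<^sup>*M\<close> is \<open>complex \<times> (complex^'n)\<close>.
\<close>

definition pair_inner ::
    "real^'n::finite^'n \<Rightarrow> complex \<times> (complex^'n) \<Rightarrow> complex \<times> (complex^'n) \<Rightarrow> complex" where
  "pair_inner G x y = fst x * cnj (fst y) + cov_inner G (snd x) (snd y)"

definition pair_norm :: "real^'n::finite^'n \<Rightarrow> complex \<times> (complex^'n) \<Rightarrow> real" where
  "pair_norm G x = sqrt (Re (pair_inner G x x))"

definition L2_pair ::
    "('m, 'n::finite) chart set \<Rightarrow> ('m \<Rightarrow> real^'n^'n) \<Rightarrow> ('m \<Rightarrow> complex \<times> (complex^'n)) set" where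
  "L2_pair \<A> k = {z. fst \<circ> z \<in> L2_fun \<A> k \<and> snd \<circ> z \<in> L2_cov \<A> k}"

definition L2_pair_inner ::
    "('m, 'n::finite) chart set \<Rightarrow> ('m \<Rightarrow> real^'n^'n) \<Rightarrow>
     ('m \<Rightarrow> complex \<times> (complex^'n)) \<Rightarrow> ('m \<Rightarrow> complex \<times> (complex^'n)) \<Rightarrow> complex" where
  "L2_pair_inner \<A> k x y =
     L2_fun_inner \<A> k (fst \<circ> x) (fst \<circ> y) + L2_cov_inner \<A> k (snd \<circ> x) (snd \<circ> y)"

definition endomorphism ::
    "(complex \<times> (complex^'n::finite) \<Rightarrow> complex \<times> (complex^'n)) \<Rightarrow> bool" where
  "endomorphism T \<longleftrightarrow>
     (\<forall>x y. T (x + y) = T x + T y) \<and>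
     (\<forall>c z w. T (c * z, c *s w) = (c * fst (T (z, w)), c *s snd (T (z, w))))"

definition endo_in_chart ::
    "('m, 'n::finite) chart set \<Rightarrow> ('m, 'n) chart \<Rightarrow> 'm \<Rightarrow>
     (complex \<times> (complex^'n) \<Rightarrow> complex \<times> (complex^'n)) \<Rightarrow> complex \<times> (complex^'n) \<Rightarrow> complex \<times> (complex^'n)" where
  "endo_in_chart \<A> c p T x =
     (let y = T (fst x, covector_from_chart \<A> c p (snd x))
      in (fst y, covector_in_chart \<A> c p (snd y)))"

definition Linf_endo ::
    "('m, 'n::finite) chart set \<Rightarrow> ('m \<Rightarrow> real^'n^'n) \<Rightarrow>
     ('m \<Rightarrow> complex \<times> (complex^'n) \<Rightarrow> complex \<times> (complex^'n)) set" where
  "Linf_endo \<A> k =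
     {A. (\<forall>p. endomorphism (A p)) \<and>
         (\<forall>c\<in>\<A>. \<forall>x. (\<lambda>y. endo_in_chart \<A> c (chart_inv c y) (A (chart_inv c y)) x)
            \<in> borel_measurable (lebesgue_on (chart_map c ` chart_dom c))) \<and>
         (\<exists>K. AE p in vol \<A> k. \<forall>x. pair_norm (k p) (A p x) \<le> K * pair_norm (k p) x)}"

definition Linf_fun ::
    "('m, 'n::finite) chart set \<Rightarrow> ('m \<Rightarrow> real^'n^'n) \<Rightarrow> ('m \<Rightarrow> complex) set" where
  "Linf_fun \<A> k =
     {a. a \<in> borel_measurable (vol \<A> k) \<and> (\<exists>K. AE p in vol \<A> k. cmod (a p) \<le> K)}"

text \<open>The operator \<open>S = (I, \<nabla>)\<close>, with the closure of the gradient on compactly supported functions.\<close>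

definition S_op ::
    "('m::topological_space, 'n::finite) chart set \<Rightarrow> ('m \<Rightarrow> real^'n^'n) \<Rightarrow>
     (('m \<Rightarrow> complex) \<times> ('m \<Rightarrow> complex \<times> (complex^'n))) set" where
  "S_op \<A> k =
     {(u, z). z \<in> L2_pair \<A> k \<and> (u, snd \<circ> z) \<in> grad_c \<A> k \<and> (AE p in vol \<A> k. fst (z p) = u p)}"

section \<open>Operators on the direct sum\<close>

text \<open>
  An element \<open>(u, (v, w))\<close> of the direct sum is represented by the section
  \<open>p \<mapsto> (u p, (v p, w p))\<close>.
\<close>

type_synonym ('m, 'n) sect = "'m \<Rightarrow> complex \<times> (complex \<times> (complex^'n))"
type_synonym ('m, 'n) oper = "(('m, 'n) sect \<times> ('m, 'n) sect) set"

definition H_space :: "('m, 'n::finite) chart set \<Rightarrow> ('m \<Rightarrow> real^'n^'n) \<Rightarrow> ('m, 'n) sect set" where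
  "H_space \<A> k = {h. fst \<circ> h \<in> L2_fun \<A> k \<and> snd \<circ> h \<in> L2_pair \<A> k}"

definition H_inner ::
    "('m, 'n::finite) chart set \<Rightarrow> ('m \<Rightarrow> real^'n^'n) \<Rightarrow> ('m, 'n) sect \<Rightarrow> ('m, 'n) sect \<Rightarrow> complex" where
  "H_inner \<A> k h h' =
     L2_fun_inner \<A> k (fst \<circ> h) (fst \<circ> h') + L2_pair_inner \<A> k (snd \<circ> h) (snd \<circ> h')"

definition H_norm :: "('m, 'n::finite) chart set \<Rightarrow> ('m \<Rightarrow> real^'n^'n) \<Rightarrow> ('m, 'n) sect \<Rightarrow> real" where
  "H_norm \<A> k h = sqrt (Re (H_inner \<A> k h h))"

definition H_closure ::
    "('m, 'n::finite) chart set \<Rightarrow> ('m \<Rightarrow> real^'n^'n) \<Rightarrow> ('m, 'n) sect set \<Rightarrow> ('m, 'n) sect set" where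
  "H_closure \<A> k R =
     {h \<in> H_space \<A> k. \<forall>e>0. \<exists>y\<in>R. H_norm \<A> k (\<lambda>p. h p - y p) < e}"

definition id_op :: "('m, 'n::finite) chart set \<Rightarrow> ('m \<Rightarrow> real^'n^'n) \<Rightarrow> ('m, 'n) oper" where
  "id_op \<A> k = {(h, z). h \<in> H_space \<A> k \<and> z \<in> H_space \<A> k \<and> (AE p in vol \<A> k. z p = h p)}"

text \<open>
  With operators as graphs, the composition \<open>T\<close> after \<open>R\<close> is \<open>R O T\<close>, and the inverse is the
  converse relation.
\<close>

definition op_add :: "('m, 'n::finite) oper \<Rightarrow> ('m, 'n) oper \<Rightarrow> ('m, 'n) oper" where
  "op_add T R = {(h, \<lambda>p. y p + z p) | h y z. (h, y) \<in> T \<and> (h, z) \<in> R}"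

definition op_scale :: "real \<Rightarrow> ('m, 'n::finite) oper \<Rightarrow> ('m, 'n) oper" where
  "op_scale t T = {(h, \<lambda>p. t *\<^sub>R y p) | h y. (h, y) \<in> T}"

definition adjoint_op ::
    "('m, 'n::finite) chart set \<Rightarrow> ('m \<Rightarrow> real^'n^'n) \<Rightarrow> ('m, 'n) oper \<Rightarrow> ('m, 'n) oper" where
  "adjoint_op \<A> k T =
     {(x, y). x \<in> H_space \<A> k \<and> y \<in> H_space \<A> k \<and>
        (\<forall>(h, z)\<in>T. H_inner \<A> k z x = H_inner \<A> k h y)}"

definition \<Gamma>_op ::
    "('m::topological_space, 'n::finite) chart set \<Rightarrow> ('m \<Rightarrow> real^'n^'n) \<Rightarrow> ('m, 'n) oper" where
  "\<Gamma>_op \<A> k =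
     {(h, z). h \<in> H_space \<A> k \<and> z \<in> H_space \<A> k \<and>
        (AE p in vol \<A> k. fst (z p) = 0) \<and> (fst \<circ> h, snd \<circ> z) \<in> S_op \<A> k}"

definition B1_op ::
    "('m, 'n::finite) chart set \<Rightarrow> ('m \<Rightarrow> real^'n^'n) \<Rightarrow> ('m \<Rightarrow> complex) \<Rightarrow> ('m, 'n) oper" where
  "B1_op \<A> k a =
     {(h, z). h \<in> H_space \<A> k \<and> z \<in> H_space \<A> k \<and>
        (AE p in vol \<A> k. z p = (a p * fst (h p), 0))}"

definition B2_op ::
    "('m, 'n::finite) chart set \<Rightarrow> ('m \<Rightarrow> real^'n^'n) \<Rightarrow>
     ('m \<Rightarrow> complex \<times> (complex^'n) \<Rightarrow> complex \<times> (complex^'n)) \<Rightarrow> ('m, 'n) oper" where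
  "B2_op \<A> k A =
     {(h, z). h \<in> H_space \<A> k \<and> z \<in> H_space \<A> k \<and>
        (AE p in vol \<A> k. z p = (0, A p (snd (h p))))}"

text \<open>
  \<open>\<Gamma> + B\<^sub>1 \<Gamma>\<^sup>* B\<^sub>2\<close>, with the domain of a sum and product of unbounded operators.
\<close>

definition \<Pi>_op ::
    "('m::topological_space, 'n::finite) chart set \<Rightarrow> ('m \<Rightarrow> real^'n^'n) \<Rightarrow>
     ('m, 'n) oper \<Rightarrow> ('m, 'n) oper \<Rightarrow> ('m, 'n) oper" where
  "\<Pi>_op \<A> k B1 B2 = op_add (\<Gamma>_op \<A> k) (B2 O adjoint_op \<A> k (\<Gamma>_op \<A> k) O B1)"

text \<open>The map \<open>\<Phi>\<close> from \<open>H_space \<A> gt\<close> to \<open>H_space \<A> g\<close> is the pullback by the inverse of \<open>F\<close>.\<close>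

definition \<Phi>_op ::
    "('m, 'n::finite) chart set \<Rightarrow> ('m \<Rightarrow> real^'n^'n) \<Rightarrow> ('m \<Rightarrow> real^'n^'n) \<Rightarrow> ('m \<Rightarrow> 'm) \<Rightarrow>
     ('m, 'n) oper" where
  "\<Phi>_op \<A> gt g F =
     {(h, x). h \<in> H_space \<A> gt \<and> x \<in> H_space \<A> g \<and>
        (AE q in vol \<A> g.
           x q = (fst (h (inv F q)), fst (snd (h (inv F q))),
                  pullback_covector \<A> (inv F) (snd \<circ> snd \<circ> h) q))}"

definition conj_op :: "('m, 'n::finite) oper \<Rightarrow> ('m, 'n) oper \<Rightarrow> ('m, 'n) oper" where
  "conj_op \<Phi> B = \<Phi>\<inverse> O B O \<Phi>"

section \<open>Quadratic estimates\<close>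

text \<open>The operator \<open>t\<Pi>(I + t\<^sup>2\<Pi>\<^sup>2)\<^sup>-\<^sup>1\<close>.\<close>

definition Q_op ::
    "('m, 'n::finite) chart set \<Rightarrow> ('m \<Rightarrow> real^'n^'n) \<Rightarrow> ('m, 'n) oper \<Rightarrow> real \<Rightarrow> ('m, 'n) oper" where
  "Q_op \<A> k P t = (op_add (id_op \<A> k) (op_scale (t\<^sup>2) (P O P)))\<inverse> O op_scale t P"

text \<open>
  The square of the norm of \<open>T u\<close>. All representatives of \<open>T u\<close> have the same norm, so the infimum
  only serves to select it; it is infinite if \<open>u\<close> is not in the domain of \<open>T\<close>.
\<close>

definition op_norm_sq ::
    "('m, 'n::finite) chart set \<Rightarrow> ('m \<Rightarrow> real^'n^'n) \<Rightarrow> ('m, 'n) oper \<Rightarrow> ('m, 'n) sect \<Rightarrow> ennreal" where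
  "op_norm_sq \<A> k T u = (INF w\<in>T `` {u}. ennreal ((H_norm \<A> k w)\<^sup>2))"

definition quadratic_estimate ::
    "('m, 'n::finite) chart set \<Rightarrow> ('m \<Rightarrow> real^'n^'n) \<Rightarrow> ('m, 'n) oper \<Rightarrow> bool" where
  "quadratic_estimate \<A> k P \<longleftrightarrow>
     (\<exists>C::real\<ge>1. \<forall>u\<in>H_closure \<A> k (Range P).
        ennreal (inverse C * (H_norm \<A> k u)\<^sup>2)
          \<le> (\<integral>\<^sup>+t\<in>{0<..}. op_norm_sq \<A> k (Q_op \<A> k P t) u / ennreal t \<partial>lborel) \<and>
        (\<integral>\<^sup>+t\<in>{0<..}. op_norm_sq \<A> k (Q_op \<A> k P t) u / ennreal t \<partial>lborel)
          \<le> ennreal (C * (H_norm \<A> k u)\<^sup>2))"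

end

theory Submission
  imports Defs "HOL-Analysis.Analysis"
begin

text \<open>
  In charts a Lipeomorphism and its inverse are locally Lipschitz: straight segments bound the distance
  from above, and absolutely continuous curves cannot leave a coordinate ball without being long.
  By Rademacher's theorem and the change of variables formula the pullback of covectors and functions
  is then isometric between the \<open>L\<^sup>2\<close> spaces of \<open>g\<close> and the pullback metric. It also intertwines
  the closures of the gradient: the pullback of a smooth compactly supported function is Lipschitz,
  and mollification in charts puts a compactly supported Lipschitz function together with its almost everywhere defined
  differential in the closure. Hence \<open>\<Phi>\<close> is an isometry which carries every operator built from \<open>\<Gamma>\<close>,
  its adjoint and the coefficients to its counterpart, and the quadratic estimates are transported.
\<close>

text \<open>The obstacle is regularity. Pulling back by \<open>F\<close> destroys smoothness, and
  the differential of \<open>F\<close> exists only almost everywhere; so neither the smooth test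
  functions of the gradient nor the continuous metrics are preserved. Both are enlarged to classes
  that are: compactly supported Lipschitz functions, and metrics that are measurable and, near every
  point, elliptic almost everywhere (\<open>rough\<close>). Within these classes the metric and its
  pullback play the same role, and so do \<open>F\<close> and its inverse. Transport statements are
  therefore proved as a single inclusion or inequality; the converse is the same statement after
  \<open>lip_pull_swap\<close>. The distance is an infimum over absolutely continuous curves, whose
  speed exists only almost everywhere. This is the reason for the differentiation theory on the
  line: the lower bound for the length of a curve that leaves a coordinate ball is the fundamental
  theorem of calculus for such curves. The same theory gives the one-dimensional case from which
  Rademacher's theorem is deduced.\<close>

section \<open>Differentiability of absolutely continuous functions on the line\<close>

text \<open>A Vitali covering argument for sets that need not be measurable; \<open>c\<close> plays
  the role of the outer measure of \<open>X\<close>. Countably many disjoint intervals with property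
  \<open>R\<close> exhaust \<open>X\<close> up to a null set, so their union has measure at least
  \<open>c\<close>, and by continuity from below finitely many of them exceed
  \<open>c - e\<close>.\<close>

lemma Vitali_finite_intervals:
 fixes X U :: "real set" and R :: "real => real => bool"
 assumes U: "open U" "X \<subseteq> U"
  and R: "!!x et. x \<in> X ==> et > 0 ==> EX u v. u <= x & x <= v & u < v & v - u < et & R u v"
  and c: "!!V. open V ==> X \<subseteq> V ==> ennreal c <= emeasure lborel V"
  and e: "e > 0" "c > 0"
 obtains D where "finite D" "disjoint D" "\<Union>D \<subseteq> U"
  "!!k. k \<in> D ==> EX u v. k = {u..v} & u < v & R u v"
  "measure lborel (\<Union>D) > c - e"
proof -
 define K where "K = {(a, r). r > (0::real) & cball a r \<subseteq> U & R (a - r) (a + r)}"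
 have 1: "!!i. i \<in> K ==> 0 < snd i" unfolding K_def by auto
 have 2: "EX i. i \<in> K & x \<in> cball (fst i) (snd i) & snd i < d" if "x \<in> X" "d > 0" for x d
 proof -
  obtain ep where ep: "ep > 0" "ball x ep \<subseteq> U" using U `x \<in> X` open_contains_ball by blast
  have dm: "min d ep > 0" using ep(1) `d > 0` by simp
  obtain u v where uv: "u <= x" "x <= v" "u < v" "v - u < min d ep" "R u v"
   using R[OF `x \<in> X` dm] by blast
  have cb: "cball ((u+v)/2) ((v-u)/2) = {u..v}" by (auto simp: cball_eq_atLeastAtMost field_simps)
  have "{u..v} \<subseteq> ball x ep" using uv by (auto simp: dist_real_def)
  then have "((u+v)/2, (v-u)/2) \<in> K" unfolding K_def using uv ep cb by (auto simp: field_simps)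
  moreover have "x \<in> cball ((u+v)/2) ((v-u)/2)" using cb uv by auto
  ultimately show ?thesis using uv by (intro exI[of _ "((u+v)/2, (v-u)/2)"]) auto
 qed
 obtain C where C: "countable C" "C \<subseteq> K"
  "pairwise (%i j. disjnt (cball (fst i) (snd i)) (cball (fst j) (snd j))) C"
  "negligible (X - (\<Union>i \<in> C. cball (fst i) (snd i)))"
  using Vitali_covering_theorem_cballs[where K=K and r=snd and S=X and a=fst, OF 1 2] by blast
 let ?B = "%i::real\<times>real. cball (fst i) (snd i)"
 let ?W = "\<Union>i \<in> C. ?B i"
 have Wm: "?W \<in> sets lborel" using C(1) by (intro sets.countable_UN') auto
 \<comment> \<open>The bound \<open>c\<close> concerns open supersets of \<open>X\<close> only. The
   union together with the uncovered null set is Lebesgue measurable, hence has an open superset of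
   nearly the same measure, and this one contains \<open>X\<close>.\<close>
 have cW: "ennreal c <= emeasure lborel ?W"
 proof (rule ennreal_le_epsilon)
  fix e' :: real assume e': "e' > 0"
  define Z where "Z = ?W Un (X - ?W)"
  have neg: "X - ?W \<in> null_sets lebesgue" using C(4) negligible_iff_null_sets by blast
  have Zm: "Z \<in> sets lebesgue" unfolding Z_def using Wm neg by (intro sets.Un) auto
  obtain V where V: "open V" "Z \<subseteq> V" "emeasure lebesgue (V - Z) < ennreal e'"
   using sets_lebesgue_outer_open[OF Zm e'] by blast
  have "ennreal c <= emeasure lborel V" using c[OF V(1)] V(2) unfolding Z_def by auto
  also have "... = emeasure lebesgue V" using V(1) by (simp add: emeasure_completion)
  also have "... = emeasure lebesgue (Z Un (V - Z))" using V by (simp add: Un_absorb1)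
  also have "... <= emeasure lebesgue Z + emeasure lebesgue (V - Z)"
   using V Zm by (intro emeasure_subadditive) auto
  also have "emeasure lebesgue Z <= emeasure lebesgue ?W + emeasure lebesgue (X - ?W)" unfolding Z_def
   using Wm neg by (intro emeasure_subadditive) auto
  also have "emeasure lebesgue (X - ?W) = 0" using neg by auto
  finally have "ennreal c <= emeasure lborel ?W + emeasure lebesgue (V - Z)"
   using Wm by (simp add: emeasure_completion)
  also have "... <= emeasure lborel ?W + ennreal e'" using V(3) by (intro add_left_mono) auto
  finally show "ennreal c <= emeasure lborel ?W + ennreal e'" .
 qed
 have Cne: "C ~= {}" using cW e by auto
 define f where "f = from_nat_into C"
 have fC: "range f = C" unfolding f_def using C(1) Cne range_from_nat_into by metis
 let ?A = "%n::nat. \<Union>i\<in>f ` {..<n}. ?B i"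
 have "(%n. emeasure lborel (?A n)) \<longlonglongrightarrow> emeasure lborel (\<Union>n. ?A n)"
  by (rule Lim_emeasure_incseq) (auto simp: incseq_def intro: less_le_trans)
 moreover have "(\<Union>n. ?A n) = ?W" using fC by (auto 0 4 intro: lessI)
 ultimately have lim: "(%n. emeasure lborel (?A n)) \<longlonglongrightarrow> emeasure lborel ?W" by simp
 have "ennreal (c - e) < emeasure lborel ?W"
  using e cW by (intro less_le_trans[OF _ cW]) (auto simp: ennreal_lessI)
 then obtain n where n: "ennreal (c - e) < emeasure lborel (?A n)"
  using order_tendstoD(1)[OF lim] by (auto simp: eventually_sequentially)
 have fin: "emeasure lborel (?A n) < \<infinity>"
  by (intro emeasure_bounded_finite) auto
 have m: "c - e < measure lborel (?A n)"
 proof -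
  have "emeasure lborel (?A n) = ennreal (measure lborel (?A n))"
   using fin by (intro emeasure_eq_ennreal_measure) auto
  then have "ennreal (c - e) < ennreal (measure lborel (?A n))" using n by (simp only:)
  then show ?thesis by (cases "c - e \<ge> 0") (simp_all add: ennreal_less_iff less_le_trans[OF _ measure_nonneg])
 qed
 show ?thesis
 proof (rule that[of "?B ` f ` {..<n}"])
  show "disjoint (?B ` f ` {..<n})"
  proof (unfold disjoint_def, intro ballI impI)
   fix K L assume "K \<in> ?B ` f ` {..<n}" "L \<in> ?B ` f ` {..<n}" "K ~= L"
   then obtain i j where KL: "K = ?B (f i)" "L = ?B (f j)" by blast
   with `K ~= L` have "f i ~= f j" by auto
   moreover have "f i \<in> C" "f j \<in> C" using fC by auto
   ultimately show "K Int L = {}" using C(3) unfolding KL pairwise_def disjnt_def by blast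
  qed
  have fK: "f i \<in> K" for i using fC C(2) by auto
  have "?B (f i) \<subseteq> U" for i using fK[of i] unfolding K_def by (cases "f i") simp
  then show "\<Union>(?B ` f ` {..<n}) \<subseteq> U" by blast
  show "EX u v. k = {u..v} & u < v & R u v" if kB: "k \<in> ?B ` f ` {..<n}" for k
  proof -
   obtain i where i: "k = ?B (f i)" using kB by auto
   have "snd (f i) > 0" "R (fst (f i) - snd (f i)) (fst (f i) + snd (f i))"
    using fK[of i] unfolding K_def by auto
   then show ?thesis using i by (intro exI[of _ "fst (f i) - snd (f i)"] exI[of _ "fst (f i) + snd (f i)"])
    (auto simp: cball_eq_atLeastAtMost)
  qed
 qed (use m in auto)
qed

lemma disjoint_intervals_division:
 assumes "finite D" "disjoint D" "!!k. k \<in> D ==> \<exists>u v::real. k = {u..v} & u < v"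
 shows "D division_of \<Union>D"
 unfolding division_of_def
proof (intro conjI ballI impI)
 fix k assume k: "k \<in> D"
 show "k ~= {}" "EX a b. k = cbox a b" using assms(3)[OF k] by auto
 fix l assume "l \<in> D" "k ~= l"
 then have "k Int l = {}" using k assms(2) by (auto simp: disjoint_def)
 then show "interior k Int interior l = {}" using interior_subset by blast
qed (use assms in auto)

lemma division_sum_measure:
 fixes D :: "real set set"
 assumes "D division_of T"
 shows "(\<Sum>k\<in>D. measure lborel k) = measure lborel T"
proof -
 have T: "T = \<Union>D" using division_ofD(6)[OF assms] by simp
 have "T \<in> sets lborel" unfolding T using division_ofD(1,4)[OF assms]
  by (intro sets.finite_Union) fastforce+
 moreover have "measure lborel k = measure lebesgue k" if "k \<in> D" for k
  using division_ofD(4)[OF assms that] by fastforce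
 ultimately show ?thesis using content_division[OF assms] by (simp add: T)
qed

lemma division_sum_increments:
 fixes f :: "real => 'a::real_normed_vector"
 assumes "D division_of {a..b}" "a <= b"
 shows "(\<Sum>k\<in>D. f (Sup k) - f (Inf k)) = f b - f a"
proof -
 have *: "(%k. (Inf k, k)) ` D tagged_division_of {a..b}"
  unfolding tagged_division_of
 proof (intro conjI allI impI)
  show "finite ((%k. (Inf k, k)) ` D)" using division_ofD(1)[OF assms(1)] by simp
  show "\<Union>{K. EX x. (x, K) \<in> (%k. (Inf k, k)) ` D} = {a..b}" using division_ofD(6)[OF assms(1)] by (simp add: image_iff)
 next
  fix x k assume xk: "(x, k) \<in> (%k. (Inf k, k)) ` D"
  then have k: "k \<in> D" "x = Inf k" by auto
  obtain u v where "k = cbox u v" "k ~= {}" using division_ofD(3,4)[OF assms(1)] k by metis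
  then show "x \<in> k" "k \<subseteq> {a..b}" "EX a b. k = cbox a b" using k division_ofD(2)[OF assms(1), of k] by auto
 next
  fix x k x' k' assume "(x, k) \<in> (%k. (Inf k, k)) ` D & (x', k') \<in> (%k. (Inf k, k)) ` D & (x, k) ~= (x', k')"
  then show "interior k Int interior k' = {}" using division_ofD(5)[OF assms(1)] by auto
 qed
 have "(\<Sum>k\<in>D. f (Sup k) - f (Inf k)) = (\<Sum>(x,k)\<in>(%k. (Inf k, k)) ` D. f (Sup k) - f (Inf k))"
  by (simp add: sum.reindex inj_on_def)
 then show ?thesis using additive_tagged_division_1[OF assms(2) *] by simp
qed


lemma bounded_box_real: "bounded {a<..<b::real}"
 using bounded_box[of a b] by simp

text \<open>Here \<open>c\<close> is the outer measure of \<open>X\<close>, the infimum over its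
  open supersets. It is positive, since open supersets of arbitrarily small measure would make
  \<open>X\<close> negligible. Measurability of \<open>X\<close> is thereby avoided: the sets of bad
  points below are described by quantifiers over all small intervals.\<close>

lemma not_negligible_outer:
 fixes X :: "real set"
 assumes X: "~ negligible X" "X \<subseteq> {a<..<b}"
 obtains c where "c > 0"
  "!!B. B \<in> sets lborel ==> X \<subseteq> B ==> ennreal c <= emeasure lborel B"
  "!!e. e > 0 ==> EX U. open U & X \<subseteq> U & U \<subseteq> {a<..<b} & measure lborel U < c + e"
proof -
 define S where "S = {V. open V & X \<subseteq> V}"
 define c where "c = (INF V\<in>S. emeasure lborel V)"
 have ab: "{a<..<b} \<in> S" using X unfolding S_def by auto
 have cfin: "c < \<infinity>"
 proof -
  have "c <= emeasure lborel {a<..<b}" unfolding c_def using ab by (rule INF_lower)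
  then show ?thesis using emeasure_bounded_finite[of "{a<..<b}"] by (auto simp: less_top[symmetric] top_unique)
 qed
 then obtain c' where c': "c = ennreal c'" "c' \<ge> 0" by (cases c) auto
 have U: "EX U. open U & X \<subseteq> U & U \<subseteq> {a<..<b} & measure lborel U < c' + e" if "e > 0" for e
 proof -
  have "c < ennreal (c' + e)" using c' that by (simp add: ennreal_lessI)
  then obtain V where V: "V \<in> S" "emeasure lborel V < ennreal (c' + e)"
   unfolding c_def by (auto simp: INF_less_iff)
  have le: "emeasure lborel (V Int {a<..<b}) <= emeasure lborel V"
   using V by (intro emeasure_mono) (auto simp: S_def)
  then have "emeasure lborel (V Int {a<..<b}) < ennreal (c' + e)" using V by simp
  moreover have "emeasure lborel (V Int {a<..<b}) = ennreal (measure lborel (V Int {a<..<b}))"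
   using calculation by (intro emeasure_eq_ennreal_measure) auto
  ultimately have "measure lborel (V Int {a<..<b}) < c' + e"
   by (simp add: ennreal_less_iff)
  then show ?thesis using V X by (intro exI[of _ "V Int {a<..<b}"]) (auto simp: S_def)
 qed
 have B: "ennreal c' <= emeasure lborel B" if B: "B \<in> sets lborel" "X \<subseteq> B" for B
 proof (rule ennreal_le_epsilon)
  fix e :: real assume "e > 0"
  have Bm: "B \<in> sets lebesgue" using B by auto
  obtain V where V: "open V" "B \<subseteq> V" "emeasure lebesgue (V - B) < ennreal e"
   using sets_lebesgue_outer_open[OF Bm \<open>e > 0\<close>] by metis
  have "ennreal c' <= emeasure lborel V" unfolding c'(1)[symmetric] c_def
   using V B by (intro INF_lower) (auto simp: S_def)
  also have "V = B Un (V - B)" using V by auto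
  also have "emeasure lborel (B Un (V - B)) <= emeasure lborel B + emeasure lborel (V - B)"
   using V B by (intro emeasure_subadditive) auto
  also have "emeasure lborel (V - B) = emeasure lebesgue (V - B)" using V B by (simp add: emeasure_completion)
  also have "... <= ennreal e" using V by simp
  finally show "ennreal c' <= emeasure lborel B + ennreal e" by (simp add: add_left_mono)
 qed
 have "c' ~= 0"
 proof
  assume 0: "c' = 0"
  have "negligible X" unfolding negligible_outer
  proof (intro allI impI)
   fix e :: real assume "e > 0"
   then obtain U where "open U" "X \<subseteq> U" "U \<subseteq> {a<..<b}" "measure lborel U < e" using U[of e] 0 by auto
   moreover from this have "U \<in> lmeasurable" using bounded_subset lmeasurable_open bounded_box_real by metis
   ultimately show "EX T. X \<subseteq> T & T \<in> lmeasurable & measure lebesgue T < e" by (intro exI[of _ U]) auto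
  qed
  then show False using X by simp
 qed
 then show ?thesis using that[of c'] c'(2) U B by simp
qed

lemma abs_continuous_onD:
 assumes "abs_continuous_on s t f" "e > 0"
 obtains de where "de > 0" "!!d T. d division_of T ==> T \<subseteq> {s..t} ==> measure lborel T < de ==>
  (\<Sum>I\<in>d. norm (f (Sup I) - f (Inf I))) < e"
proof -
 from assms obtain de where de: "de > 0" and *: "!!d T. d division_of T & T \<subseteq> {s..t} & (\<Sum>I\<in>d. measure lborel I) < de ==>
    (\<Sum>I\<in>d. norm (f (Sup I) - f (Inf I))) < e"
  unfolding abs_continuous_on_def by blast
 show ?thesis
  by (rule that[OF de]) (rule *, simp add: division_sum_measure)
qed

text \<open>On a set of positive outer measure \<open>c\<close> two covers would conflict. Intervals
  \<open>I\<close> with slope above \<open>m + de\<close> cover nearly all of \<open>X\<close>, and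
  intervals \<open>J\<close> inside them with slope below \<open>m - de\<close> still cover nearly
  all of it. The gaps between them have small measure, so by absolute continuity \<open>f\<close>
  changes little over the gaps; yet the increments over \<open>I\<close> and over \<open>J\<close>
  differ by about \<open>2 * de * c\<close>.\<close>

lemma abs_continuous_oscillation_negligible:
 fixes f :: "real => real"
 assumes ac: "abs_continuous_on a b f" and de: "de > 0"
  and X: "X \<subseteq> {a<..<b}"
  and up: "!!x et. x \<in> X ==> et > 0 ==>
   EX u v. u <= x & x <= v & u < v & v - u < et & f v - f u > (m + de) * (v - u)"
  and lo: "!!x et. x \<in> X ==> et > 0 ==>
   EX u v. u <= x & x <= v & u < v & v - u < et & f v - f u < (m - de) * (v - u)"
 shows "negligible X"
proof (rule ccontr)
 assume "~ negligible X"
 from not_negligible_outer[OF this X] obtain c where c: "c > 0"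
  "!!B. B \<in> sets lborel ==> X \<subseteq> B ==> ennreal c <= emeasure lborel B"
  "!!e. e > 0 ==> EX U. open U & X \<subseteq> U & U \<subseteq> {a<..<b} & measure lborel U < c + e"
  by metis
 have "de * c / 2 > 0" using de c by simp
 from abs_continuous_onD[OF ac this] obtain et where et: "et > 0"
  "!!d T. d division_of T ==> T \<subseteq> {a..b} ==> measure lborel T < et ==>
   (\<Sum>I\<in>d. norm (f (Sup I) - f (Inf I))) < de * c / 2" by metis
 \<comment> \<open>The gaps will have measure below \<open>(c + e) - (c - 3 * e) = 4 * e\<close>.
   The three terms of the minimum make this less than \<open>et\<close>, keep the total lengths of
   \<open>I\<close> and \<open>J\<close> close to \<open>c\<close>, and make \<open>m\<close> times
   the difference of these lengths negligible against \<open>de * c\<close>.\<close>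
 define e where "e = min (et / 8) (min (c / 8) (de * c / (16 * (\<bar>m\<bar> + 1))))"
 have e: "e > 0" "4 * e < et" "4 * e <= c / 2" "\<bar>m\<bar> * (4 * e) <= de * c / 4"
 proof -
  show "e > 0" unfolding e_def using et c de by (auto intro!: divide_pos_pos)
  have "e <= et / 8" unfolding e_def by (rule min.cobounded1)
  moreover have "e <= c / 8" unfolding e_def by (rule order_trans[OF min.cobounded2 min.cobounded1])
  moreover have em: "e <= de * c / (16 * (\<bar>m\<bar> + 1))" unfolding e_def
   by (rule order_trans[OF min.cobounded2 min.cobounded2])
  ultimately
  show "4 * e < et" "4 * e <= c / 2" using et(1) by linarith+
  have "\<bar>m\<bar> * (4 * e) <= (\<bar>m\<bar> + 1) * (4 * e)" using `e > 0` by (intro mult_right_mono) auto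
  also have "... <= (\<bar>m\<bar> + 1) * (4 * (de * c / (16 * (\<bar>m\<bar> + 1))))"
   using em by (intro mult_left_mono) auto
  also have "... = de * c / 4" by (simp add: field_simps)
  finally show "\<bar>m\<bar> * (4 * e) <= de * c / 4" .
 qed
 obtain U where U: "open U" "X \<subseteq> U" "U \<subseteq> {a<..<b}" "measure lborel U < c + e" using c(3)[OF e(1)] by blast
 have Ufin: "emeasure lborel U ~= \<infinity>"
  using emeasure_bounded_finite[of U] U(3) bounded_subset[OF bounded_box_real] by (metis less_irrefl)
 obtain I where I: "finite I" "disjoint I" "\<Union>I \<subseteq> U"
  "!!k. k \<in> I ==> EX u v. k = {u..v} & u < v & f v - f u > (m + de) * (v - u)"
  "measure lborel (\<Union>I) > c - e"
 proof (rule Vitali_finite_intervals[OF U(1,2) up _ e(1) c(1)])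
  show "ennreal c <= emeasure lborel V" if "open V" "X \<subseteq> V" for V using c(2) that by auto
 qed blast+
 define W where "W = (\<Union>k\<in>I. interior k)"
 have WI: "W \<subseteq> \<Union>I" unfolding W_def using interior_subset by fast
 have Idiv: "I division_of \<Union>I" using I(4) by (intro disjoint_intervals_division I) blast
 \<comment> \<open>The second cover is chosen in the interiors of the first. The part of
   \<open>X\<close> outside them lies in \<open>U - \<Union>I\<close>, of measure below
   \<open>2 * e\<close>, or among finitely many endpoints; so \<open>c - 2 * e\<close> still bounds
   the outer measure of the rest.\<close>
 obtain J where J: "finite J" "disjoint J" "\<Union>J \<subseteq> W"
  "!!k. k \<in> J ==> EX u v. k = {u..v} & u < v & (f v - f u < (m - de) * (v - u) & (\<exists>k\<in>I. {u..v} \<subseteq> k))"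
  "measure lborel (\<Union>J) > (c - 2 * e) - e"
 proof (rule Vitali_finite_intervals)
  show "open W" unfolding W_def by auto
  show "X Int W \<subseteq> W" by auto
  show "EX u v. u <= x & x <= v & u < v & v - u < et & (f v - f u < (m - de) * (v - u) & (\<exists>k\<in>I. {u..v} \<subseteq> k))"
   if xW: "x \<in> X Int W" "et > 0" for x et
  proof -
   obtain k where k: "k \<in> I" "x \<in> interior k" using `x \<in> X Int W` W_def by auto
   then obtain ep where ep: "ep > 0" "ball x ep \<subseteq> k" using mem_interior by blast
   have e': "min et ep > 0" using xW ep by simp
   obtain u v where uv: "u <= x" "x <= v" "u < v" "v - u < min et ep" "f v - f u < (m - de) * (v - u)"
    using lo[OF _ e'] xW by blast
   then have "{u..v} \<subseteq> ball x ep" by (auto simp: dist_real_def)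
   then show ?thesis using uv ep k by (meson min_less_iff_conj order_trans)
  qed
  show "e > 0" "c - 2 * e > 0" using e c by auto
  show "ennreal (c - 2 * e) <= emeasure lborel V" if V: "open V" "X Int W \<subseteq> V" for V
  proof -
   define P where "P = Inf ` I Un Sup ` I"
   have P: "finite P" unfolding P_def using I by auto
   then have Pm: "P \<in> sets lborel" by (auto intro: borel_closed finite_imp_closed)
   have IP: "\<Union>I \<subseteq> W Un P"
   proof
    fix x assume "x \<in> \<Union>I"
    then obtain k where k: "k \<in> I" "x \<in> k" by auto
    obtain u v where uv: "k = {u..v}" "u < v" using I(4)[OF k(1)] by blast
    show "x \<in> W Un P"
    proof (cases "x = u \<or> x = v")
     case True
     then show ?thesis unfolding P_def using k uv by force
    next
     case False
     then have "x \<in> interior k" using uv k by auto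
     then show ?thesis unfolding W_def using k by auto
    qed
   qed
   have Im: "\<Union>I \<in> sets lborel" using I(1,4) by (intro sets.finite_Union) fastforce+
   have "ennreal c <= emeasure lborel (V Un ((U - \<Union>I) Un P))"
    using IP V U Im Pm by (intro c(2)) (auto intro!: sets.Un sets.Diff)
   also have "... <= emeasure lborel V + (emeasure lborel (U - \<Union>I) + emeasure lborel P)"
    using V U Im Pm
    by (intro order_trans[OF emeasure_subadditive] add_left_mono emeasure_subadditive)
     (auto intro!: sets.Un sets.Diff)
   also have "emeasure lborel P = 0" using P by (simp add: emeasure_lborel_countable countable_finite)
   also have "emeasure lborel (U - \<Union>I) = ennreal (measure lborel (U - \<Union>I))"
    using emeasure_mono[of "U - \<Union>I" U lborel] U Ufin
    by (intro emeasure_eq_ennreal_measure) (auto simp: top_unique)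
   also have "measure lborel (U - \<Union>I) = measure lborel U - measure lborel (\<Union>I)"
    using measurable_measure_Diff[of U lborel "\<Union>I"] Ufin U I Im by (auto simp: fmeasurable_def less_top)
   also have "ennreal ... <= ennreal (2 * e)" using U I by (intro ennreal_leI) auto
   finally have "ennreal c <= emeasure lborel V + ennreal (2 * e)" by (simp add: add_left_mono)
   then have "ennreal c - ennreal (2 * e) <= emeasure lborel V" by (simp add: ennreal_minus_le_iff add.commute)
   then show ?thesis using e c by (simp add: ennreal_minus)
  qed
 qed blast+
 have Jdiv: "J division_of \<Union>J" using J(4) by (intro disjoint_intervals_division J) blast
 \<comment> \<open>Every interval of the first cover is divided in such a way that the members of
   \<open>J\<close> inside it are pieces of the division. The remaining pieces, collected in
   \<open>d\<close>, are the gaps.\<close>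
 define Jk where "Jk k = {j\<in>J. j \<subseteq> k}" for k
 have "EX r. Jk k \<subseteq> r & r division_of k" if k: "k \<in> I" for k
 proof -
  obtain u v where uv: "k = {u..v}" "u < v" using I(4)[OF k] by blast
  have "Jk k division_of \<Union>(Jk k)" using division_of_subset[OF Jdiv, of "Jk k"] unfolding Jk_def by auto
  moreover have "\<Union>(Jk k) \<subseteq> cbox u v" unfolding Jk_def uv by auto
  ultimately show ?thesis using partial_division_extend_interval[of "Jk k" u v] unfolding uv cbox_interval by metis
 qed
 then obtain r where r: "!!k. k \<in> I ==> Jk k \<subseteq> r k" "!!k. k \<in> I ==> r k division_of k" by metis
 define d where "d = (\<Union>k\<in>I. r k - Jk k)"
 have rk: "l \<subseteq> k" "l ~= {}" "finite (r k)" "EX a b. l = cbox a b" if "l \<in> r k" "k \<in> I" for l k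
  using division_ofD[OF r(2)[OF that(2)]] that(1) by auto
 have finr: "finite (r k)" if "k \<in> I" for k using division_ofD(1)[OF r(2)[OF that]] .
 have ddiv: "d division_of \<Union>d"
  unfolding division_of_def
 proof (intro conjI ballI impI)
  show "finite d" unfolding d_def using I(1) finr by auto
  fix l assume l: "l \<in> d"
  then obtain k where k: "k \<in> I" "l \<in> r k" unfolding d_def by auto
  show "l ~= {}" "EX a b. l = cbox a b" using rk[OF k(2,1)] by auto
  fix l' assume l': "l' \<in> d" "l ~= l'"
  then obtain k' where k': "k' \<in> I" "l' \<in> r k'" unfolding d_def by auto
  show "interior l Int interior l' = {}"
  proof (cases "k = k'")
   case True
   then show ?thesis using division_ofD(5)[OF r(2)[OF k(1)] k(2)] k' l' by auto
  next
   case False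
   then have "k Int k' = {}" using I(2) k k' by (auto simp: disjoint_def)
   then show ?thesis using rk(1)[OF k(2,1)] rk(1)[OF k'(2,1)] interior_subset by blast
  qed
 qed auto
 have disjk: "l ~: r k'" if "l \<in> r k" "k \<in> I" "k' \<in> I" "k ~= k'" for l k k'
 proof
  assume "l \<in> r k'"
  then have "l \<subseteq> k Int k'" "l ~= {}" using rk that by auto
  then show False using disjointD[OF I(2) `k \<in> I` `k' \<in> I` \<open>k ~= k'\<close>] by auto
 qed
 have JU: "J = (\<Union>k\<in>I. Jk k)" unfolding Jk_def using J(4) by blast
 have sums: "(\<Sum>l\<in>d. h l) = (\<Sum>k\<in>I. \<Sum>l\<in>r k. h l) - (\<Sum>l\<in>J. h l)" for h :: "real set => real"
 proof -
  have fJ: "finite (Jk k)" for k unfolding Jk_def using J(1) by auto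
  have "(\<Sum>l\<in>d. h l) = (\<Sum>k\<in>I. \<Sum>l\<in>r k - Jk k. h l)" unfolding d_def
   using I(1) finr disjk by (intro sum.UNION_disjoint) auto
  also have "... = (\<Sum>k\<in>I. (\<Sum>l\<in>r k. h l) - (\<Sum>l\<in>Jk k. h l))"
   using finr r(1) by (intro sum.cong refl sum_diff) auto
  also have "... = (\<Sum>k\<in>I. \<Sum>l\<in>r k. h l) - (\<Sum>k\<in>I. \<Sum>l\<in>Jk k. h l)" by (simp add: sum_subtractf)
  also have "(\<Sum>k\<in>I. \<Sum>l\<in>Jk k. h l) = (\<Sum>l\<in>J. h l)"
   unfolding JU using I(1) fJ disjk r(1) by (intro sum.UNION_disjoint[symmetric]) blast+
  finally show ?thesis .
 qed
 let ?M = "measure lborel" and ?\<Delta> = "%l::real set. f (Sup l) - f (Inf l)"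
 have mI: "(\<Sum>k\<in>I. ?M k) = ?M (\<Union>I)" by (rule division_sum_measure[OF Idiv])
 have mJ: "(\<Sum>k\<in>J. ?M k) = ?M (\<Union>J)" by (rule division_sum_measure[OF Jdiv])
 have "?M (\<Union>d) = (\<Sum>l\<in>d. ?M l)" by (rule division_sum_measure[OF ddiv, symmetric])
 also have "... = (\<Sum>k\<in>I. ?M k) - (\<Sum>l\<in>J. ?M l)"
  unfolding sums by (intro arg_cong2[where f="(-)"] refl sum.cong division_sum_measure r)
 finally have Md: "?M (\<Union>d) = ?M (\<Union>I) - ?M (\<Union>J)" unfolding mI mJ .
 have MI: "?M (\<Union>I) <= ?M U"
  using I(3) U Ufin I(1,4) by (intro measure_mono_fmeasurable sets.finite_Union) (fastforce simp: fmeasurable_def less_top)+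
 have "?M (\<Union>d) < et" using Md MI U J e by linarith
 moreover have "\<Union>d \<subseteq> {a..b}"
 proof -
  have "\<Union>d \<subseteq> \<Union>I" unfolding d_def using rk(1) by blast
  then show ?thesis using I(3) U(3) by (fastforce simp: greaterThanLessThan_subseteq_atLeastAtMost_iff)
 qed
 ultimately have "(\<Sum>l\<in>d. norm (?\<Delta> l)) < de * c / 2" using et(2)[OF ddiv] by blast
 then have "(\<Sum>l\<in>d. ?\<Delta> l) < de * c / 2"
  by (rule le_less_trans[rotated]) (auto intro!: sum_mono)
 moreover have "(\<Sum>l\<in>d. ?\<Delta> l) = (\<Sum>k\<in>I. ?\<Delta> k) - (\<Sum>l\<in>J. ?\<Delta> l)"
 proof -
  have "(\<Sum>l\<in>r k. ?\<Delta> l) = ?\<Delta> k" if kI: "k \<in> I" for k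
  proof -
   obtain u v where "k = {u..v}" "u < v" using I(4)[OF kI] by blast
   then show ?thesis using division_sum_increments[of "r k" u v f] r(2)[OF kI] by simp
  qed
  then show ?thesis unfolding sums by (simp cong: sum.cong)
 qed
 moreover have "(\<Sum>k\<in>I. ?\<Delta> k) \<ge> (m + de) * ?M (\<Union>I)"
 proof -
  have "(m + de) * ?M k <= ?\<Delta> k" if "k \<in> I" for k using I(4)[OF that] by auto
  then show ?thesis unfolding mI[symmetric] sum_distrib_left by (intro sum_mono)
 qed
 moreover have "(\<Sum>k\<in>J. ?\<Delta> k) <= (m - de) * ?M (\<Union>J)"
 proof -
  have "?\<Delta> k <= (m - de) * ?M k" if "k \<in> J" for k using J(4)[OF that] by auto
  then show ?thesis unfolding mJ[symmetric] sum_distrib_left by (intro sum_mono)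
 qed
 ultimately have 1: "(m + de) * ?M (\<Union>I) - (m - de) * ?M (\<Union>J) < de * c / 2" by linarith
 let ?i = "?M (\<Union>I)" and ?j = "?M (\<Union>J)"
 \<comment> \<open>The first term is small because the two lengths nearly agree, the second is at
   least \<open>de * c\<close>; the sum is at least three quarters of \<open>de * c\<close>, against
   the upper bound of one half.\<close>
 have "(m + de) * ?i - (m - de) * ?j = m * (?i - ?j) + de * (?i + ?j)" by (simp add: algebra_simps)
 moreover have "m * (?i - ?j) \<ge> - (de * c / 4)"
 proof -
  have "0 <= ?M (\<Union>d)" by simp
  then have "\<bar>?i - ?j\<bar> <= 4 * e" using Md MI U(4) J(5) by linarith
  then have "\<bar>m * (?i - ?j)\<bar> <= \<bar>m\<bar> * (4 * e)" unfolding abs_mult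
   by (intro mult_left_mono) auto
  then show ?thesis using e(4) by linarith
 qed
 moreover have "de * (?i + ?j) \<ge> de * c"
 proof -
  have "c <= ?i + ?j" using I(5) J(5) e(3) c(1) by linarith
  then show ?thesis using de by (intro mult_left_mono) auto
 qed
 moreover have "de * c > 0" using de c by simp
 ultimately show False using 1 by linarith
qed


text \<open>Absolute continuity controls the variation over small total length only, so
  \<open>X\<close> is first cut into windows of length at most \<open>de / 2\<close>. There the
  variation is below 1, whereas disjoint intervals of slope above \<open>2 / c\<close> that cover
  more than half of the outer measure \<open>c\<close> would contribute at least 1.\<close>

lemma abs_continuous_unbounded_negligible:
 fixes f :: "real => real"
 assumes ac: "abs_continuous_on a b f" and X: "X \<subseteq> {a<..<b}"
  and unb: "!!x M et. x \<in> X ==> et > 0 ==>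
   EX u v. u <= x & x <= v & u < v & v - u < et & \<bar>f v - f u\<bar> > M * (v - u)"
 shows "negligible X"
proof (rule ccontr)
 assume neg: "~ negligible X"
 obtain de where de: "de > 0" "!!d T. d division_of T ==> T \<subseteq> {a..b} ==> measure lborel T < de ==>
  (\<Sum>I\<in>d. norm (f (Sup I) - f (Inf I))) < 1"
  using abs_continuous_onD[OF ac zero_less_one] by metis
 define d where "d = de / 4"
 define Y where "Y k = X Int {(of_int k - 1) * d<..<(of_int k + 1) * d}" for k :: int
 have "X \<subseteq> (\<Union>k. Y k)"
 proof
  fix x assume "x \<in> X"
  moreover have "(of_int \<lfloor>x / d\<rfloor> - 1) * d < x" "x < (of_int \<lfloor>x / d\<rfloor> + 1) * d"
  proof -
   have d: "d > 0" using de by (simp add: d_def)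
   have "of_int \<lfloor>x / d\<rfloor> * d <= x" "x < (of_int \<lfloor>x / d\<rfloor> + 1) * d"
    using of_int_floor_le[of "x / d"] real_of_int_floor_add_one_gt[of "x / d"]
    by (simp_all only: pos_le_divide_eq[OF d] pos_divide_less_eq[OF d])
   then show "(of_int \<lfloor>x / d\<rfloor> - 1) * d < x" "x < (of_int \<lfloor>x / d\<rfloor> + 1) * d"
    using d by (simp_all add: left_diff_distrib)
  qed
  ultimately show "x \<in> (\<Union>k. Y k)" unfolding Y_def by auto
 qed
 then have "~ (ALL k. negligible (Y k))"
  using neg negligible_subset[of "\<Union>k. Y k" X] negligible_countable_Union[of "range Y"] by auto
 then obtain k where k: "~ negligible (Y k)" by auto
 define a' b' where "a' = max a ((of_int k - 1) * d)" and "b' = min b ((of_int k + 1) * d)"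
 have Yk: "Y k \<subseteq> {a'<..<b'}" unfolding Y_def a'_def b'_def using X by auto
 from not_negligible_outer[OF k this] obtain c where c: "c > 0"
  "!!B. B \<in> sets lborel ==> Y k \<subseteq> B ==> ennreal c <= emeasure lborel B" by metis
 have Ro: "EX u v. u <= x & x <= v & u < v & v - u < et & \<bar>f v - f u\<bar> > 2 / c * (v - u)"
  if "x \<in> Y k" "et > 0" for x et using unb[of x et "2 / c"] that unfolding Y_def by blast
 have c2: "c / 2 > 0" using c by simp
 obtain D where D: "finite D" "disjoint D" "\<Union>D \<subseteq> {a'<..<b'}"
  "!!k. k \<in> D ==> EX u v. k = {u..v} & u < v & \<bar>f v - f u\<bar> > 2 / c * (v - u)"
  "measure lborel (\<Union>D) > c - c / 2"
 proof (rule Vitali_finite_intervals[OF _ Yk Ro _ c2 c(1)])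
  show "ennreal c <= emeasure lborel V" if "open V" "Y k \<subseteq> V" for V using c(2) that by auto
 qed auto
 have Ddiv: "D division_of \<Union>D" using D(4) by (intro disjoint_intervals_division D) blast
 have "measure lborel (\<Union>D) <= measure lborel {a'..b'}"
 proof (rule measure_mono_fmeasurable)
  show "\<Union>D \<in> sets lborel" using D(1,4) by (intro sets.finite_Union) fastforce+
  show "\<Union>D \<subseteq> {a'..b'}" using D(3) by (meson greaterThanLessThan_subseteq_atLeastAtMost_iff order_refl order_trans)
 qed (auto simp: fmeasurable_def emeasure_lborel_Icc_eq)
 also have "measure lborel {a'..b'} < de"
 proof (cases "a' <= b'")
  case True
  then have "measure lborel {a'..b'} = b' - a'" by simp
  also have "... <= (of_int k + 1) * d - (of_int k - 1) * d" unfolding a'_def b'_def by linarith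
  also have "... = 2 * d" by (simp add: algebra_simps)
  finally show ?thesis using de(1) unfolding d_def by linarith
 qed (use de(1) in simp)
 finally have "(\<Sum>I\<in>D. norm (f (Sup I) - f (Inf I))) < 1"
  using D(3) by (intro de(2)[OF Ddiv]) (force simp: a'_def b'_def)+
 moreover have "(\<Sum>I\<in>D. norm (f (Sup I) - f (Inf I))) \<ge> 2 / c * measure lborel (\<Union>D)"
 proof -
  have "2 / c * measure lborel I <= norm (f (Sup I) - f (Inf I))" if "I \<in> D" for I using D(4)[OF that] by auto
  then show ?thesis unfolding division_sum_measure[OF Ddiv, symmetric] sum_distrib_left by (intro sum_mono)
 qed
 moreover have "2 / c * measure lborel (\<Union>D) \<ge> 1" using D(5) c by (simp add: field_simps)
 ultimately show False by linarith
qed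

text \<open>The derivative is the upper limit \<open>L\<close> of the slopes over intervals around
  \<open>x\<close>. For rational \<open>p < q < L\<close> slopes above \<open>q\<close> recur at
  every scale, and then \<open>osc\<close>, with \<open>m\<close> the midpoint and \<open>de\<close>
  half the length of the interval from \<open>p\<close> to \<open>q\<close>, forbids slopes below
  \<open>p\<close> to do so. Rational parameters suffice, which later leaves only countably many
  exceptional sets.\<close>

lemma differentiable_if_straddling:
 fixes f :: "real => real"
 assumes bdd: "et0 > 0" "!!u v. u <= x ==> x <= v ==> u < v ==> v - u < et0 ==> \<bar>f v - f u\<bar> <= M * (v - u)"
  and osc: "!!m de. m \<in> \<rat> ==> de \<in> \<rat> ==> de > 0 ==>
   ~ ((\<forall>et>0. EX u v. u <= x & x <= v & u < v & v - u < et & f v - f u > (m + de) * (v - u)) &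
    (\<forall>et>0. EX u v. u <= x & x <= v & u < v & v - u < et & f v - f u < (m - de) * (v - u)))"
 shows "f differentiable at x"
proof -
 define P where "P m \<longleftrightarrow> (\<exists>et>0. ALL u v. u <= x --> x <= v --> u < v --> v - u < et --> f v - f u <= m * (v - u))" for m
 define L where "L = Inf (Collect P)"
 have PM: "P M" unfolding P_def using bdd by (intro exI[of _ et0]) (auto simp: abs_le_iff)
 have lb: "- M <= m" if "P m" for m
 proof -
  obtain et where et: "et > 0" "!!u v. u <= x ==> x <= v ==> u < v ==> v - u < et ==> f v - f u <= m * (v - u)"
   using `P m` unfolding P_def by auto
  define h where "h = min et et0 / 2"
  have h: "h > 0" "h < et" "h < et0" unfolding h_def using et bdd by auto
  have "f (x + h) - f x <= m * h" "\<bar>f (x + h) - f x\<bar> <= M * h" using et(2)[of x "x + h"] bdd(2)[of x "x+h"] h by auto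
  then have "(- M) * h <= m * h" by (simp add: abs_le_iff)
  then show ?thesis using h by (simp only: mult_le_cancel_right_pos)
 qed
 have bb: "bdd_below (Collect P)" using lb by (auto intro: bdd_belowI[of _ "- M"])
 have lower: "\<exists>et>0. ALL u v. u <= x --> x <= v --> u < v --> v - u < et --> f v - f u \<ge> l * (v - u)" if lL: "l < L" for l
 proof -
  obtain p where p: "p \<in> \<rat>" "l < p" "p < L" using Rats_dense_in_real[OF lL] by blast
  obtain q where q: "q \<in> \<rat>" "p < q" "q < L" using Rats_dense_in_real[OF p(3)] by blast
  have "~ P q" using cInf_lower[OF _ bb, of q] q by (auto simp: L_def)
  moreover have "(p + q) / 2 + (q - p) / 2 = q" "(p + q) / 2 - (q - p) / 2 = p" by (auto simp: field_simps)
  moreover have "(p + q) / 2 \<in> \<rat>" "(q - p) / 2 \<in> \<rat>" "(q - p) / 2 > 0" using p q by auto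
  ultimately have n: "~ ((\<forall>et>0. EX u v. u <= x & x <= v & u < v & v - u < et & f v - f u > q * (v - u)) &
    (\<forall>et>0. EX u v. u <= x & x <= v & u < v & v - u < et & f v - f u < p * (v - u)))"
   and "~ P q"
   using osc[of "(p+q)/2" "(q-p)/2"] by simp_all
  then have "\<forall>et>0. EX u v. u <= x & x <= v & u < v & v - u < et & f v - f u > q * (v - u)"
   unfolding P_def by (meson not_le)
  with n have "\<exists>et>0. ALL u v. u <= x --> x <= v --> u < v --> v - u < et --> f v - f u \<ge> p * (v - u)"
   by (meson not_le)
  then show ?thesis using p(2) by (meson order_trans mult_right_mono less_imp_le diff_ge_0_iff_ge)
 qed
 have upper: "\<exists>et>0. ALL u v. u <= x --> x <= v --> u < v --> v - u < et --> f v - f u <= l * (v - u)" if lL: "L < l" for l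
 proof -
  obtain m where m: "P m" "m < l" using cInf_lessD[of "Collect P" l] lL PM unfolding L_def by auto
  then show ?thesis unfolding P_def by (meson order_trans mult_right_mono less_imp_le diff_ge_0_iff_ge)
 qed
 have "((%y. (f y - f x) / (y - x)) \<longlongrightarrow> L) (at x)"
 proof (rule tendstoI)
  fix e :: real assume e: "e > 0"
  obtain et1 where et1: "et1 > 0" "!!u v. u <= x ==> x <= v ==> u < v ==> v - u < et1 ==> f v - f u <= (L + e/2) * (v - u)"
   using upper[of "L + e/2"] e by auto
  obtain et2 where et2: "et2 > 0" "!!u v. u <= x ==> x <= v ==> u < v ==> v - u < et2 ==> f v - f u \<ge> (L - e/2) * (v - u)"
   using lower[of "L - e/2"] e by auto
  have "dist ((f y - f x) / (y - x)) L < e" if y: "y ~= x" "dist y x < min et1 et2" for y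
  proof -
   have "(f y - f x) / (y - x) <= L + e/2 & (f y - f x) / (y - x) \<ge> L - e/2"
   proof (cases "y > x")
    case True
    then show ?thesis using et1(2)[of x y] et2(2)[of x y] y by (auto simp: dist_real_def field_simps)
   next
    case False
    then have "y < x" using y by auto
    then show ?thesis using et1(2)[of y x] et2(2)[of y x] y by (auto simp: dist_real_def field_simps)
   qed
   then show ?thesis using e by (auto simp: dist_real_def abs_less_iff)
  qed
  then show "\<forall>\<^sub>F y in at x. dist ((f y - f x) / (y - x)) L < e"
   unfolding eventually_at using et1 et2 by (intro exI[of _ "min et1 et2"]) auto
 qed
 then have "(f has_field_derivative L) (at x)" by (simp add: has_field_derivative_iff)
 then show ?thesis unfolding has_field_derivative_def differentiable_def by blast
qed

lemma abs_continuous_differentiable_ae_real: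
 fixes f :: "real => real"
 assumes ac: "abs_continuous_on a b f"
 shows "negligible {x\<in>{a<..<b}. ~ f differentiable at x}"
proof -
 define X where "X = {x\<in>{a<..<b}. ALL M. \<forall>et>0. EX u v. u <= x & x <= v & u < v & v - u < et & \<bar>f v - f u\<bar> > M * (v - u)}"
 define E where "E = (%(m, de). {x\<in>{a<..<b}.
  (\<forall>et>0. EX u v. u <= x & x <= v & u < v & v - u < et & f v - f u > (m + de) * (v - u)) &
  (\<forall>et>0. EX u v. u <= x & x <= v & u < v & v - u < et & f v - f u < (m - de) * (v - u))})"
 let ?Q = "\<rat> \<times> (\<rat> Int {0<..}) :: (real \<times> real) set"
 have "negligible X" by (rule abs_continuous_unbounded_negligible[OF ac]) (auto simp: X_def)
 moreover have "negligible (E p)" if "p \<in> ?Q" for p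
 proof (cases p)
  case (Pair m de)
  then have "de > 0" using that by auto
  show ?thesis unfolding Pair E_def
   by (rule abs_continuous_oscillation_negligible[OF ac \<open>de > 0\<close>, of _ m]) auto
 qed
 then have "negligible (\<Union>p\<in>?Q. E p)"
  by (intro negligible_countable_Union) (auto simp: countable_rat)
 ultimately have "negligible (X Un (\<Union>p\<in>?Q. E p))" by (rule negligible_Un)
 then show ?thesis
 proof (rule negligible_subset, intro subsetI)
  fix x assume x: "x \<in> {x\<in>{a<..<b}. ~ f differentiable at x}"
  show "x \<in> X Un (\<Union>p\<in>?Q. E p)"
  proof (rule ccontr)
   assume n: "x ~: X Un (\<Union>p\<in>?Q. E p)"
   then obtain M et where "et > 0" "!!u v. u <= x ==> x <= v ==> u < v ==> v - u < et ==> \<bar>f v - f u\<bar> <= M * (v - u)"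
   proof -
    from n x obtain M et where *: "et > 0" "~ (EX u v. u <= x & x <= v & u < v & v - u < et & \<bar>f v - f u\<bar> > M * (v - u))"
     unfolding X_def by blast
    show ?thesis by (rule that[OF *(1), of M]) (use *(2) in "meson not_le")
   qed
   then have "f differentiable at x"
   proof (rule differentiable_if_straddling)
    fix m de :: real assume "m \<in> \<rat>" "de \<in> \<rat>" "de > 0"
    then have "x ~: E (m, de)" using n by auto
    then show "~ ((\<forall>et>0. EX u v. u <= x & x <= v & u < v & v - u < et & f v - f u > (m + de) * (v - u)) &
    (\<forall>et>0. EX u v. u <= x & x <= v & u < v & v - u < et & f v - f u < (m - de) * (v - u)))"
     using x unfolding E_def by blast
   qed
   then show False using x by simp
  qed
 qed
qed

lemma abs_continuous_on_inner:
 assumes "abs_continuous_on a b f"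
 shows "abs_continuous_on a b (%x. f x \<bullet> i)"
 unfolding abs_continuous_on_def
proof (intro allI impI)
 fix e :: real assume "e > 0"
 then have e': "e / (norm i + 1) > 0" by (simp add: add_nonneg_pos)
 obtain de where de: "de > 0" "!!d T. d division_of T ==> T \<subseteq> {a..b} ==> measure lborel T < de ==>
  (\<Sum>I\<in>d. norm (f (Sup I) - f (Inf I))) < e / (norm i + 1)"
  using abs_continuous_onD[OF assms e'] by metis
 show "\<exists>de>0. ALL d T. d division_of T & T \<subseteq> {a..b} & sum (measure lborel) d < de -->
       (\<Sum>I\<in>d. norm (f (Sup I) \<bullet> i - f (Inf I) \<bullet> i)) < e"
 proof (intro exI[of _ de] conjI allI impI de(1))
  fix d T assume d: "d division_of T & T \<subseteq> {a..b} & sum (measure lborel) d < de"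
  have "(\<Sum>I\<in>d. norm (f (Sup I) \<bullet> i - f (Inf I) \<bullet> i)) <= (\<Sum>I\<in>d. norm (f (Sup I) - f (Inf I)) * (norm i + 1))"
  proof (rule sum_mono)
   fix I
   have "norm (f (Sup I) \<bullet> i - f (Inf I) \<bullet> i) <= norm (f (Sup I) - f (Inf I)) * norm i"
    unfolding inner_diff_left[symmetric] real_norm_def by (rule Cauchy_Schwarz_ineq2)
   also have "... <= norm (f (Sup I) - f (Inf I)) * (norm i + 1)" by (intro mult_left_mono) auto
   finally show "norm (f (Sup I) \<bullet> i - f (Inf I) \<bullet> i) <= norm (f (Sup I) - f (Inf I)) * (norm i + 1)" .
  qed
  also have "... < e"
   using de(2)[of d T] d division_sum_measure[of d T] `e > 0`
   by (simp add: sum_distrib_right[symmetric] pos_less_divide_eq add_nonneg_pos)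
  finally show "(\<Sum>I\<in>d. norm (f (Sup I) \<bullet> i - f (Inf I) \<bullet> i)) < e" .
 qed
qed

lemma abs_continuous_differentiable_ae:
 fixes f :: "real => 'a::euclidean_space"
 assumes ac: "abs_continuous_on a b f"
 shows "negligible {x\<in>{a<..<b}. ~ f differentiable at x}"
proof -
 have "negligible (\<Union>i\<in>Basis. {x\<in>{a<..<b}. ~ (%x. f x \<bullet> i) differentiable at x})"
  by (intro negligible_Union finite_imageI finite_Basis)
   (elim imageE, simp only: abs_continuous_differentiable_ae_real[OF abs_continuous_on_inner[OF ac]])
 then show ?thesis
  by (rule negligible_subset) (use differentiable_componentwise_within in blast)
qed


section \<open>The fundamental theorem of calculus for absolutely continuous functions\<close>

text \<open>The gauge integral treats the two kinds of tags separately. At a tag outside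
  \<open>N\<close> the derivative controls the increment over a short interval; at tags in
  \<open>N\<close>, where \<open>f'\<close> is set to 0, the increments are small in total by
  absolute continuity, because all their intervals lie in one open set of small measure.\<close>

lemma abs_continuous_has_integral:
 fixes f :: "real => 'a::euclidean_space"
 assumes ac: "abs_continuous_on a b f" and ab: "a <= b"
  and N: "negligible N" "!!x. x \<in> {a..b} - N ==> (f has_vector_derivative f' x) (at x)"
   "!!x. x \<in> N ==> f' x = 0"
 shows "(f' has_integral (f b - f a)) {a..b}"
 unfolding has_integral_factor_content_real
proof (intro allI impI)
 fix e :: real assume e: "e > 0"
 show "EX d. gauge d & (ALL p. p tagged_division_of {a..b} & d fine p -->
  norm ((\<Sum>(x, k)\<in>p. measure lborel k *\<^sub>R f' x) - (f b - f a)) <= e * measure lborel {a..b})"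
 proof (cases "a = b")
  case True
  then have "(\<Sum>(x, k)\<in>p. measure lborel k *\<^sub>R f' x) = 0" if "p tagged_division_of {a..b}" for p
   using sum_content_null[of a b p f'] that by simp
  with True show ?thesis
   by (intro exI[of _ "%x. ball x 1"]) auto
 next
  case False
  with ab have "a < b" by simp
  then have e2: "e * (b - a) / 2 > 0" using e by simp
  obtain de where de: "de > 0" "!!d T. d division_of T ==> T \<subseteq> {a..b} ==> measure lborel T < de ==>
   (\<Sum>I\<in>d. norm (f (Sup I) - f (Inf I))) < e * (b - a) / 2"
   using abs_continuous_onD[OF ac e2] by metis
  obtain G where G: "open G" "N \<subseteq> G" "G \<in> lmeasurable" "measure lebesgue G < de"
  proof -
   have "N \<in> sets lebesgue" using N(1) by (simp add: negligible_imp_sets)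
   from sets_lebesgue_outer_open[OF this de(1)] obtain T where
    T: "open T" "N \<subseteq> T" "T - N \<in> lmeasurable" "emeasure lebesgue (T - N) < ennreal de" by blast
   have "T = (T - N) Un N" using T by auto
   moreover have "N \<in> lmeasurable" "measure lebesgue N = 0"
    using N(1) by (auto simp: negligible_iff_measure)
   ultimately have "T \<in> lmeasurable" "measure lebesgue T <= measure lebesgue (T - N)"
    using T(3) fmeasurable.Un[of "T - N" lebesgue N] measure_Un_le[of "T - N" lebesgue N] by (auto simp: fmeasurableD)
   moreover have "measure lebesgue (T - N) < de"
    using T(3,4) by (simp add: emeasure_eq_measure2 ennreal_less_iff)
   ultimately show ?thesis using that[of T] T by auto
  qed
  have "\<exists>r>0. ALL y. \<bar>y - x\<bar> < r --> norm (f y - f x - (y - x) *\<^sub>R f' x) <= e / 2 * \<bar>y - x\<bar>"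
   if x: "x \<in> {a..b} - N" for x
  proof -
   have "(f has_derivative (%h. h *\<^sub>R f' x)) (at x)" using N(2)[OF x] by (simp add: has_vector_derivative_def)
   then have "\<exists>d>0. ALL y. norm (y - x) < d --> norm (f y - f x - (y - x) *\<^sub>R f' x) <= e / 2 * norm (y - x)"
    unfolding has_derivative_at_alt using e by (meson half_gt_zero)
   then show ?thesis by simp
  qed
  then obtain r where r: "!!x. x \<in> {a..b} - N ==> r x > 0"
   "!!x y. x \<in> {a..b} - N ==> \<bar>y - x\<bar> < r x ==> norm (f y - f x - (y - x) *\<^sub>R f' x) <= e / 2 * \<bar>y - x\<bar>"
   by metis
  \<comment> \<open>A tag in \<open>N\<close> receives the whole open set \<open>G\<close>, of
    measure below \<open>de\<close>, instead of a ball: what matters there is the total length of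
    the intervals and not the length of each.\<close>
  define D where "D x = (if x \<in> N then G else if x \<in> {a..b} then ball x (r x) else ball x 1)" for x
  have gD: "gauge D" unfolding gauge_def D_def using G r by auto
  show ?thesis
  proof (intro exI[of _ D] conjI allI impI)
   show "gauge D" by (rule gD)
  next
   fix p assume p: "p tagged_division_of {a..b} & D fine p"
   note pD = tagged_division_ofD[OF conjunct1[OF p]]
   define q where "q = {xk\<in>p. fst xk \<in> N}"
   have fq: "finite q" "finite p" unfolding q_def using pD(1) by auto
   have qp: "q \<subseteq> p" unfolding q_def by auto
   have kk: "EX u v. k = {u..v} & u <= x & x <= v" if "(x, k) \<in> p" for x k
    using pD(4)[OF that] pD(2)[OF that] by fastforce
   let ?E = "%(x::real, k::real set). measure lborel k *\<^sub>R f' x - (f (Sup k) - f (Inf k))"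
   have "(\<Sum>(x, k)\<in>p. measure lborel k *\<^sub>R f' x) - (f b - f a) = (\<Sum>xk\<in>p. ?E xk)"
    using additive_tagged_division_1[OF ab conjunct1[OF p], of f] by (simp add: sum_subtractf split_def)
   also have "... = (\<Sum>xk\<in>p - q. ?E xk) + (\<Sum>xk\<in>q. ?E xk)"
    using fq qp by (simp add: sum.subset_diff)
   finally have eq: "norm ((\<Sum>(x, k)\<in>p. measure lborel k *\<^sub>R f' x) - (f b - f a)) <=
    norm (\<Sum>xk\<in>p - q. ?E xk) + norm (\<Sum>xk\<in>q. ?E xk)" by (simp add: norm_triangle_ineq)
   have "norm (\<Sum>xk\<in>p - q. ?E xk) <= (\<Sum>xk\<in>p - q. e / 2 * measure lborel (snd xk))"
   proof (rule sum_norm_le)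
    fix xk assume xk: "xk \<in> p - q"
    obtain x k where xk': "xk = (x, k)" by force
    have x: "x \<in> {a..b} - N" using xk xk' pD(2,3)[of x k] unfolding q_def by auto
    obtain u v where uv: "k = {u..v}" "u <= x" "x <= v" using kk xk xk' by blast
    have "k \<subseteq> D x" using p xk xk' unfolding fine_def by auto
    moreover have "D x = ball x (r x)" using x unfolding D_def by auto
    ultimately have "k \<subseteq> ball x (r x)" by simp
    moreover have "u \<in> k" "v \<in> k" using uv by auto
    ultimately have "u \<in> ball x (r x)" "v \<in> ball x (r x)" by blast+
    then have d: "\<bar>u - x\<bar> < r x" "\<bar>v - x\<bar> < r x" by (auto simp: dist_real_def)
    have "?E xk = (f u - f x - (u - x) *\<^sub>R f' x) - (f v - f x - (v - x) *\<^sub>R f' x)"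
     using uv xk' by (simp add: algebra_simps)
    also have "norm ... <= e / 2 * \<bar>u - x\<bar> + e / 2 * \<bar>v - x\<bar>"
     using r(2)[OF x d(1)] r(2)[OF x d(2)] norm_triangle_ineq4 by (smt (verit, best))
    also have "... = e / 2 * ((x - u) + (v - x))" using uv by (simp only: distrib_left abs_of_nonneg abs_of_nonpos) auto
    also have "... = e / 2 * measure lborel (snd xk)" using uv xk' by simp
    finally show "norm (?E xk) <= e / 2 * measure lborel (snd xk)" .
   qed
   also have "... <= (\<Sum>xk\<in>p. e / 2 * measure lborel (snd xk))"
    using fq e by (intro sum_mono2) auto
   also have "... = e / 2 * (b - a)"
    using additive_content_tagged_division[of p a b] p ab
    by (simp only: sum_distrib_left[symmetric]) (simp add: split_def)
   finally have 1: "norm (\<Sum>xk\<in>p - q. ?E xk) <= e / 2 * (b - a)" .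
   have qdiv: "q tagged_division_of \<Union>(snd ` q)"
    using tagged_partial_division_subset[OF _ qp] p tagged_partial_division_of_Union_self
    by (metis tagged_division_of_def)
   have sdiv: "snd ` q division_of \<Union>(snd ` q)"
    using division_of_tagged_division[OF qdiv] .
   have "norm (\<Sum>xk\<in>q. ?E xk) <= (\<Sum>(x, k)\<in>q. norm (f (Sup k) - f (Inf k)))"
    by (rule sum_norm_le) (auto simp: q_def N(3) norm_minus_commute)
   \<comment> \<open>To pass from tagged pairs to intervals, the summand must vanish on every
     degenerate box. The guard settles the empty box, on which \<open>Sup\<close> and
     \<open>Inf\<close> have arbitrary values.\<close>
   also have "... = (\<Sum>(x, k)\<in>q. if k = {} then 0 else norm (f (Sup k) - f (Inf k)))"
    using kk qp by (intro sum.cong) fastforce+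
   also have "... = (\<Sum>k\<in>snd ` q. if k = {} then 0 else norm (f (Sup k) - f (Inf k)))"
   proof (rule sum.over_tagged_division_lemma[OF qdiv])
    fix u v :: real assume "box u v = {}"
    then have "v <= u" by simp
    then have "v = u \<or> cbox u v = {}" by auto
    then show "(if cbox u v = {} then 0 else norm (f (Sup (cbox u v)) - f (Inf (cbox u v)))) = 0" by auto
   qed
   also have "... = (\<Sum>k\<in>snd ` q. norm (f (Sup k) - f (Inf k)))"
    using kk qp by (intro sum.cong) fastforce+
   also have "... < e * (b - a) / 2"
   proof (rule de(2)[OF sdiv])
    show "\<Union>(snd ` q) \<subseteq> {a..b}" using pD(3) qp by fastforce
    have "\<Union>(snd ` q) \<subseteq> G" using p unfolding q_def fine_def D_def by force
    then have "measure lebesgue (\<Union>(snd ` q)) <= measure lebesgue G"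
     using G sdiv by (intro measure_mono_fmeasurable) (auto intro: fmeasurableD lmeasurable_division)
    moreover have "\<Union>(snd ` q) \<in> sets lborel" using fq kk qp by (intro sets.finite_Union) fastforce+
    ultimately show "measure lborel (\<Union>(snd ` q)) < de" using G by (simp add: measure_completion)
   qed
   finally have "norm (\<Sum>xk\<in>q. ?E xk) < e * (b - a) / 2" .
   then show "norm ((\<Sum>(x, k)\<in>p. measure lborel k *\<^sub>R f' x) - (f b - f a)) <= e * measure lborel {a..b}"
    using eq 1 ab by (simp add: algebra_simps)
  qed
 qed
qed

text \<open>An infinite right side leaves nothing to prove. A finite one makes the derivative
  Lebesgue integrable, so that the gauge integral of the previous lemma is a Lebesgue integral and
  the norm may be taken inside.\<close>

lemma abs_continuous_increment_le:
 fixes f :: "real => 'a::euclidean_space"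
 assumes ac: "abs_continuous_on a b f" and ab: "a <= b"
 shows "ennreal (norm (f b - f a)) <= (\<integral>\<^sup>+x\<in>{a..b}. ennreal (norm (vector_derivative f (at x))) \<partial>lebesgue)"
proof -
 define N where "N = {a, b} Un {x\<in>{a<..<b}. ~ f differentiable at x}"
 have N: "negligible N" unfolding N_def
  using abs_continuous_differentiable_ae[OF ac] by (intro negligible_Un) auto
 define f' where "f' x = (if x \<in> N then 0 else vector_derivative f (at x))" for x
 have int: "(f' has_integral (f b - f a)) {a..b}"
 proof (rule abs_continuous_has_integral[OF ac ab N])
  fix x assume "x \<in> {a..b} - N"
  then have "f differentiable at x" "f' x = vector_derivative f (at x)" unfolding N_def f'_def by auto
  then show "(f has_vector_derivative f' x) (at x)" by (simp add: vector_derivative_works)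
 qed (simp add: f'_def)
 have "AE x in lebesgue. x ~: N" using N by (simp add: negligible_iff_null_sets AE_not_in)
 then have eq: "(\<integral>\<^sup>+x\<in>{a..b}. ennreal (norm (vector_derivative f (at x))) \<partial>lebesgue) =
  (\<integral>\<^sup>+x. ennreal (norm (indicator {a..b} x *\<^sub>R f' x)) \<partial>lebesgue)"
  by (intro nn_integral_cong_AE) (auto simp: f'_def indicator_def)
 show ?thesis
 proof (cases "(\<integral>\<^sup>+x. ennreal (norm (indicator {a..b} x *\<^sub>R f' x)) \<partial>lebesgue) = \<infinity>")
  case False
  have m: "(%x. indicator {a..b} x *\<^sub>R f' x) \<in> borel_measurable lebesgue"
   by (rule has_integral_implies_lebesgue_measurable[OF int])
  have i: "integrable lebesgue (%x. indicator {a..b} x *\<^sub>R f' x)"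
   using m False by (intro integrableI_bounded) (auto simp: less_top)
  then have "f b - f a = (LINT x|lebesgue. indicator {a..b} x *\<^sub>R f' x)"
   using int set_lebesgue_integral_eq_integral(2)[of "{a..b}" f']
   by (simp add: set_integrable_def set_lebesgue_integral_def integral_unique)
  then show ?thesis unfolding eq
   using integral_norm_bound_ennreal[OF i] by simp
 qed (simp add: eq)
qed

lemma lipschitz_imp_abs_continuous:
 fixes f :: "real => 'a::real_normed_vector"
 assumes L: "L-lipschitz_on {a..b} f"
 shows "abs_continuous_on a b f"
 unfolding abs_continuous_on_def
proof (intro allI impI)
 fix e :: real assume e: "e > 0"
 have L0: "L \<ge> 0" using L by (rule lipschitz_on_nonneg)
 show "\<exists>de>0. ALL d T. d division_of T & T \<subseteq> {a..b} & sum (measure lborel) d < de -->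
       (\<Sum>I\<in>d. norm (f (Sup I) - f (Inf I))) < e"
 proof (intro exI[of _ "e / (L + 1)"] conjI allI impI)
  show "e / (L + 1) > 0" using e L0 by simp
  fix d T assume d: "d division_of T & T \<subseteq> {a..b} & sum (measure lborel) d < e / (L + 1)"
  have "(\<Sum>I\<in>d. norm (f (Sup I) - f (Inf I))) <= (\<Sum>I\<in>d. (L + 1) * measure lborel I)"
  proof (rule sum_mono)
   fix I assume I: "I \<in> d"
   obtain u v where uv: "I = {u..v}" "u <= v"
    using division_ofD(3,4)[OF conjunct1[OF d] I] by fastforce
   have "I \<subseteq> {a..b}" using d division_ofD(2)[OF conjunct1[OF d] I] by auto
   then have "u \<in> {a..b}" "v \<in> {a..b}" using uv by auto
   then have "norm (f v - f u) <= L * norm (v - u)" using lipschitz_on_normD[OF L] by blast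
   also have "... <= (L + 1) * norm (v - u)" by (intro mult_right_mono) auto
   finally show "norm (f (Sup I) - f (Inf I)) <= (L + 1) * measure lborel I" using uv by simp
  qed
  also have "... < e" using d L0 by (simp add: sum_distrib_left[symmetric] pos_less_divide_eq mult.commute)
  finally show "(\<Sum>I\<in>d. norm (f (Sup I) - f (Inf I))) < e" .
 qed
qed

lemma lipschitz_differentiable_ae_real:
 fixes f :: "real => real"
 assumes L: "L-lipschitz_on UNIV f"
 shows "negligible {x. ~ f differentiable at x}"
proof -
 have "negligible {x\<in>{- real n<..<real n}. ~ f differentiable at x}" for n
  by (rule abs_continuous_differentiable_ae_real[OF lipschitz_imp_abs_continuous[OF lipschitz_on_subset[OF L subset_UNIV]]])
 then have "negligible (\<Union>n. {x\<in>{- real n<..<real n}. ~ f differentiable at x})"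
  by (intro negligible_countable_Union) auto
 then show ?thesis
 proof (rule negligible_subset, intro subsetI)
  fix x assume "x \<in> {x. ~ f differentiable at x}"
  moreover obtain n :: nat where "\<bar>x\<bar> < real n" using reals_Archimedean2 by blast
  ultimately show "x \<in> (\<Union>n. {x\<in>{- real n<..<real n}. ~ f differentiable at x})"
   by (intro UN_I[of n]) (auto simp: abs_less_iff)
 qed
qed

section \<open>Rademacher's theorem\<close>

definition dq :: "('a::real_normed_vector => real) => 'a => real => 'a => real" where
 "dq u v t x = (u (x + t *\<^sub>R v) - u x) / t"

definition dir_regular :: "('a::real_normed_vector => real) => 'a => 'a set" where
 "dir_regular u v = {x. EX l. ((%t. dq u v t x) \<longlongrightarrow> l) (at 0)}"

text \<open>The default 0 makes this, for Lipschitz \<open>u\<close>, a bounded Borel function on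
  the whole space, so that it can be integrated over boxes without reference to the exceptional
  set.\<close>

definition dir_deriv :: "('a::real_normed_vector => real) => 'a => 'a => real" where
 "dir_deriv u v x = (if x \<in> dir_regular u v then Lim (at 0) (%t. dq u v t x) else 0)"

lemma dir_deriv_tendsto:
 assumes "x \<in> dir_regular u v"
 shows "((%t. dq u v t x) \<longlongrightarrow> dir_deriv u v x) (at 0)"
 using assms unfolding dir_deriv_def dir_regular_def by (auto simp: tendsto_Lim)

lemma dir_deriv_eqI:
 assumes "((%t. dq u v t x) \<longlongrightarrow> l) (at 0)"
 shows "x \<in> dir_regular u v" "dir_deriv u v x = l"
 using assms unfolding dir_deriv_def dir_regular_def by (auto simp: tendsto_Lim)

lemma dq_bound:
 assumes "L-lipschitz_on UNIV u"
 shows "\<bar>dq u v t x\<bar> <= L * norm v"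
proof (cases "t = 0")
 case False
 have "\<bar>u (x + t *\<^sub>R v) - u x\<bar> <= L * (\<bar>t\<bar> * norm v)"
  using lipschitz_on_normD[OF assms, of "x + t *\<^sub>R v" x] by simp
 then show ?thesis using False by (simp add: dq_def abs_divide pos_divide_le_eq mult_ac)
qed (use lipschitz_on_nonneg[OF assms] in "simp add: dq_def")

lemma dir_deriv_bound:
 assumes "L-lipschitz_on UNIV u"
 shows "\<bar>dir_deriv u v x\<bar> <= L * norm v"
proof (cases "x \<in> dir_regular u v")
 case True
 show ?thesis
  by (rule tendsto_upperbound[OF tendsto_rabs[OF dir_deriv_tendsto[OF True]]])
   (auto simp: dq_bound[OF assms])
qed (use lipschitz_on_nonneg[OF assms] in "simp add: dir_deriv_def")

lemma dir_deriv_scale: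
 assumes x: "x \<in> dir_regular u v"
 shows "x \<in> dir_regular u (c *\<^sub>R v)" "dir_deriv u (c *\<^sub>R v) x = c * dir_deriv u v x"
proof -
 have "((%t. dq u (c *\<^sub>R v) t x) \<longlongrightarrow> c * dir_deriv u v x) (at 0)"
 proof (cases "c = 0")
  case False
  have "filterlim (%t. t * c) (at 0) (at 0)"
   unfolding filterlim_at using False
   by (auto intro!: tendsto_eq_intros simp: eventually_at intro: exI[of _ 1])
  from filterlim_compose[OF dir_deriv_tendsto[OF x] this]
  have "((%t. c * dq u v (t * c) x) \<longlongrightarrow> c * dir_deriv u v x) (at 0)"
   by (intro tendsto_intros)
  moreover have "c * dq u v (t * c) x = dq u (c *\<^sub>R v) t x" for t
   using False by (simp add: dq_def)
  ultimately show ?thesis by simp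
 qed (simp add: dq_def)
 from dir_deriv_eqI[OF this] show "x \<in> dir_regular u (c *\<^sub>R v)" "dir_deriv u (c *\<^sub>R v) x = c * dir_deriv u v x" .
qed

text \<open>This is the Cauchy criterion for the limit at 0 with rational increments; continuity of
  the quotient in \<open>t ~= 0\<close> extends it to real ones. As all quantifiers range over
  countable sets, the set of regular points is seen to be Borel.\<close>

lemma dir_regular_iff_rat:
 fixes u :: "'a::real_normed_vector => real"
 assumes u: "continuous_on UNIV u"
 shows "x \<in> dir_regular u v \<longleftrightarrow>
  (\<forall>n::nat. \<exists>m::nat. \<forall>p q::rat. 0 < \<bar>real_of_rat p\<bar> & \<bar>real_of_rat p\<bar> < 1 / real (Suc m) &
    0 < \<bar>real_of_rat q\<bar> & \<bar>real_of_rat q\<bar> < 1 / real (Suc m) -->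
    \<bar>dq u v (real_of_rat p) x - dq u v (real_of_rat q) x\<bar> <= 1 / real (Suc n))"
  (is "_ \<longleftrightarrow> (ALL n. EX m. ?R n m)")
proof
 assume "x \<in> dir_regular u v"
 then obtain l where l: "((%t. dq u v t x) \<longlongrightarrow> l) (at 0)" unfolding dir_regular_def by auto
 show "ALL n. EX m. ?R n m"
 proof
  fix n :: nat
  have "1 / real (Suc n) / 2 > 0" by simp
  from tendstoD[OF l this] obtain d where d: "d > 0" "!!t. t ~= 0 ==> \<bar>t\<bar> < d ==> dist (dq u v t x) l < 1 / real (Suc n) / 2"
   unfolding eventually_at by (auto simp: dist_real_def)
  obtain m where m: "1 / real (Suc m) < d" using nat_approx_posE[OF d(1)] by blast
  have "?R n m"
  proof (intro allI impI)
   fix p q :: rat assume pq: "0 < \<bar>real_of_rat p\<bar> & \<bar>real_of_rat p\<bar> < 1 / real (Suc m) &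
    0 < \<bar>real_of_rat q\<bar> & \<bar>real_of_rat q\<bar> < 1 / real (Suc m)"
   define h where "h = 1 / real (Suc n)"
   have "dist (dq u v (real_of_rat p) x) l < h / 2"
    "dist (dq u v (real_of_rat q) x) l < h / 2"
    unfolding h_def by (rule d(2); use pq m in linarith)+
   then show "\<bar>dq u v (real_of_rat p) x - dq u v (real_of_rat q) x\<bar> <= 1 / real (Suc n)"
    unfolding dist_real_def h_def[symmetric] by linarith
  qed
  then show "EX m. ?R n m" ..
 qed
next
 assume R: "ALL n. EX m. ?R n m"
 have cont: "isCont (%t. dq u v t x) t" if "t ~= 0" for t
 proof -
  have "continuous_on UNIV (%t. u (x + t *\<^sub>R v))"
   by (rule continuous_on_compose2[OF u]) (auto intro!: continuous_intros)
  then have "isCont (%t. u (x + t *\<^sub>R v)) t" by (simp add: continuous_on_eq_continuous_at)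
  then show ?thesis unfolding dq_def using that by (intro continuous_intros) auto
 qed
 have dens: "EX q. \<bar>real_of_rat q\<bar> < d & 0 < \<bar>real_of_rat q\<bar> & \<bar>dq u v t x - dq u v (real_of_rat q) x\<bar> < e"
  if t: "t ~= 0" "\<bar>t\<bar> < d" and e: "e > 0" for t d e
 proof -
  obtain de where de: "de > 0" "!!s. \<bar>s - t\<bar> < de ==> \<bar>dq u v s x - dq u v t x\<bar> < e"
   using cont[OF t(1)] e unfolding continuous_at_eps_delta dist_real_def by blast
  have "t < t + min de (min \<bar>t\<bar> (d - \<bar>t\<bar>))" using t de by auto
  from Rats_dense_in_real[OF this] obtain s where s: "s \<in> \<rat>" "t < s" "s < t + min de (min \<bar>t\<bar> (d - \<bar>t\<bar>))" by blast
  then obtain q where "s = real_of_rat q" by (auto elim: Rats_cases)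
  moreover have "\<bar>s\<bar> < d" "0 < \<bar>s\<bar>" "\<bar>s - t\<bar> < de" using s by linarith+
  ultimately show ?thesis using de(2)[of s] by (intro exI[of _ q]) (simp add: abs_minus_commute)
 qed
 have R': "EX m. ALL s t. s ~= 0 & \<bar>s\<bar> < 1 / real (Suc m) & t ~= 0 & \<bar>t\<bar> < 1 / real (Suc m) -->
   \<bar>dq u v s x - dq u v t x\<bar> <= 1 / real (Suc n)" for n
 proof -
  obtain m where m: "?R n m" using R by blast
  have "\<bar>dq u v s x - dq u v t x\<bar> <= 1 / real (Suc n)"
   if st: "s ~= 0" "\<bar>s\<bar> < 1 / real (Suc m)" "t ~= 0" "\<bar>t\<bar> < 1 / real (Suc m)" for s t
  proof (rule field_le_epsilon)
   fix e :: real assume "e > 0"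
   then have e2: "e / 2 > 0" by simp
   obtain p q where p: "\<bar>real_of_rat p\<bar> < 1 / real (Suc m)" "0 < \<bar>real_of_rat p\<bar>"
     "\<bar>dq u v s x - dq u v (real_of_rat p) x\<bar> < e / 2"
    and q: "\<bar>real_of_rat q\<bar> < 1 / real (Suc m)" "0 < \<bar>real_of_rat q\<bar>"
     "\<bar>dq u v t x - dq u v (real_of_rat q) x\<bar> < e / 2"
    using dens[OF st(1,2) e2] dens[OF st(3,4) e2] by blast
   have "\<bar>dq u v (real_of_rat p) x - dq u v (real_of_rat q) x\<bar> <= 1 / real (Suc n)"
    using m p q by blast
   then show "\<bar>dq u v s x - dq u v t x\<bar> <= 1 / real (Suc n) + e" using p(3) q(3) by linarith
  qed
  then show ?thesis by blast
 qed
 define Y where "Y k = dq u v (1 / (real k + 2)) x" for k :: nat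
 have "Cauchy Y"
 proof (rule CauchyI')
  fix e :: real assume "e > 0"
  then obtain n where n: "1 / real (Suc n) < e" using nat_approx_posE by blast
  obtain m where m: "!!s t. s ~= 0 & \<bar>s\<bar> < 1 / real (Suc m) & t ~= 0 & \<bar>t\<bar> < 1 / real (Suc m) ==>
   \<bar>dq u v s x - dq u v t x\<bar> <= 1 / real (Suc n)" using R' by blast
  have "dist (Y i) (Y j) < e" if "i \<ge> m" "i < j" for i j
  proof -
   have "\<bar>Y i - Y j\<bar> <= 1 / real (Suc n)" unfolding Y_def
    using that by (intro m) (auto simp: frac_less2)
   then show ?thesis using n by (simp add: dist_real_def)
  qed
  then show "EX M. \<forall>m\<ge>M. \<forall>n>m. dist (Y m) (Y n) < e" by blast
 qed
 then obtain l where l: "Y \<longlonglongrightarrow> l" using Cauchy_convergent_iff convergent_def by blast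
 have "((%t. dq u v t x) \<longlongrightarrow> l) (at 0)"
 proof (rule tendstoI)
  fix e :: real assume "e > 0"
  then obtain n where n: "1 / real (Suc n) < e" using nat_approx_posE by blast
  obtain m where m: "!!s t. s ~= 0 & \<bar>s\<bar> < 1 / real (Suc m) & t ~= 0 & \<bar>t\<bar> < 1 / real (Suc m) ==>
   \<bar>dq u v s x - dq u v t x\<bar> <= 1 / real (Suc n)" using R' by blast
  have "dist (dq u v t x) l < e" if t: "t ~= 0" "\<bar>t\<bar> < 1 / real (Suc m)" for t
  proof -
   have "\<bar>dq u v t x - l\<bar> <= 1 / real (Suc n)"
   proof (rule tendsto_upperbound)
    show "((%k. \<bar>dq u v t x - Y k\<bar>) \<longlongrightarrow> \<bar>dq u v t x - l\<bar>) sequentially"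
     by (intro tendsto_intros l)
    show "\<forall>\<^sub>F k in sequentially. \<bar>dq u v t x - Y k\<bar> <= 1 / real (Suc n)"
     using eventually_ge_at_top[of m]
    proof eventually_elim
     case (elim k)
     then show ?case unfolding Y_def using t by (intro m) (auto simp: frac_less2)
    qed
   qed simp
   then show ?thesis using n by (simp add: dist_real_def)
  qed
  then show "\<forall>\<^sub>F t in at 0. dist (dq u v t x) l < e"
   unfolding eventually_at by (intro exI[of _ "1 / real (Suc m)"]) auto
 qed
 then show "x \<in> dir_regular u v" unfolding dir_regular_def by blast
qed

lemma dq_borel:
 fixes u :: "'a::euclidean_space => real"
 assumes "continuous_on UNIV u"
 shows "dq u v t \<in> borel_measurable borel"
proof -
 have [measurable]: "u \<in> borel_measurable borel" by (rule borel_measurable_continuous_onI[OF assms])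
 show ?thesis unfolding dq_def[abs_def] by measurable
qed

lemma dir_regular_borel:
 fixes u :: "'a::euclidean_space => real"
 assumes u: "continuous_on UNIV u"
 shows "dir_regular u v \<in> sets borel"
proof -
 note [measurable] = dq_borel[OF u]
 have "{x\<in>space borel. x \<in> dir_regular u v} \<in> sets borel"
  unfolding dir_regular_iff_rat[OF u] by measurable
 then show ?thesis by simp
qed

lemma dir_deriv_borel:
 fixes u :: "'a::euclidean_space => real"
 assumes u: "continuous_on UNIV u"
 shows "dir_deriv u v \<in> borel_measurable borel"
proof (rule borel_measurable_LIMSEQ_metric)
 fix n :: nat
 note [measurable] = dq_borel[OF u] dir_regular_borel[OF u]
 show "(%x. indicator (dir_regular u v) x * dq u v (1 / real (Suc n)) x) \<in> borel_measurable borel"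
  by measurable
next
 fix x :: 'a
 have f: "filterlim (%n. 1 / real (Suc n)) (at 0) sequentially"
  unfolding filterlim_at using LIMSEQ_inverse_real_of_nat by (auto simp: inverse_eq_divide)
 show "(%n. indicator (dir_regular u v) x * dq u v (1 / real (Suc n)) x) \<longlonglongrightarrow> dir_deriv u v x"
 proof (cases "x \<in> dir_regular u v")
  case True
  from filterlim_compose[OF dir_deriv_tendsto[OF True] f] show ?thesis using True by simp
 qed (simp add: dir_deriv_def)
qed

text \<open>By translation invariance the measure of the bad set \<open>N\<close> equals its average
  over the shifts by \<open>t *\<^sub>R v\<close> with \<open>t\<close> between 0 and 1. Fubini
  turns the average into an integral of the lengths of \<open>N\<close> along segments in direction
  \<open>v\<close>, on which \<open>u\<close> is a Lipschitz function of one variable. No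
  coordinates adapted to \<open>v\<close> are required.\<close>

lemma dir_regular_ae:
 fixes u :: "'a::euclidean_space => real"
 assumes L: "L-lipschitz_on UNIV u"
 shows "AE x in lborel. x \<in> dir_regular u v"
proof -
 have u: "continuous_on UNIV u" using L by (rule lipschitz_on_continuous_on)
 define N where "N = - dir_regular u v"
 have N[measurable]: "N \<in> sets borel" unfolding N_def using dir_regular_borel[OF u] by auto
 have line: "(\<integral>\<^sup>+t. indicator N (x + t *\<^sub>R v) * indicator {0..1} t \<partial>lborel) = 0" for x
 proof -
  have "(L * norm v)-lipschitz_on UNIV (%t. u (x + t *\<^sub>R v))"
  proof (rule lipschitz_onI)
   fix s t :: real
   have "dist (u (x + s *\<^sub>R v)) (u (x + t *\<^sub>R v)) <= L * dist (x + s *\<^sub>R v) (x + t *\<^sub>R v)"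
    by (rule lipschitz_onD[OF L]) auto
   also have "dist (x + s *\<^sub>R v) (x + t *\<^sub>R v) = norm v * dist s t"
    by (simp add: dist_norm scaleR_diff_left[symmetric])
   finally show "dist (u (x + s *\<^sub>R v)) (u (x + t *\<^sub>R v)) <= L * norm v * dist s t" by simp
  qed (use lipschitz_on_nonneg[OF L] in simp)
  from lipschitz_differentiable_ae_real[OF this]
  have neg: "negligible {t. ~ (%t. u (x + t *\<^sub>R v)) differentiable at t}" .
  have "{t. x + t *\<^sub>R v \<in> N} \<subseteq> {t. ~ (%t. u (x + t *\<^sub>R v)) differentiable at t}"
  proof (rule subsetI, rule CollectI, rule notI)
   fix t assume t: "t \<in> {t. x + t *\<^sub>R v \<in> N}" and "(%t. u (x + t *\<^sub>R v)) differentiable at t"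
   then obtain l where "((%t. u (x + t *\<^sub>R v)) has_field_derivative l) (at t)"
    using real_differentiable_def by blast
   then have "((%h. dq u v h (x + t *\<^sub>R v)) \<longlongrightarrow> l) (at 0)"
    by (simp add: DERIV_def dq_def algebra_simps)
   then show False using t dir_deriv_eqI(1) unfolding N_def by blast
  qed
  then have "negligible {t. x + t *\<^sub>R v \<in> N}" using neg negligible_subset by blast
  then have "AE t in lebesgue. x + t *\<^sub>R v ~: N"
   by (auto simp: negligible_iff_null_sets dest: AE_not_in)
  then have "AE t in lborel. x + t *\<^sub>R v ~: N" by (simp add: AE_completion_iff)
  then have "(\<integral>\<^sup>+t. indicator N (x + t *\<^sub>R v) * indicator {0..1} t \<partial>lborel) = (\<integral>\<^sup>+t. 0 \<partial>(lborel::real measure))"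
   by (intro nn_integral_cong_AE) auto
  then show ?thesis by simp
 qed
 have trans: "(\<integral>\<^sup>+x. indicator N (x + t *\<^sub>R v) \<partial>lborel) = emeasure lborel N" for t
 proof -
  have "emeasure lborel N = (\<integral>\<^sup>+x. indicator N x \<partial>distr lborel borel ((+) (t *\<^sub>R v)))"
   unfolding lborel_distr_plus by simp
  also have "... = (\<integral>\<^sup>+x. indicator N (t *\<^sub>R v + x) \<partial>lborel)"
   by (subst nn_integral_distr) auto
  finally show ?thesis by (simp add: add.commute)
 qed
 have "emeasure lborel N = (\<integral>\<^sup>+t. emeasure lborel N * indicator {0..1::real} t \<partial>lborel)"
  by (simp add: nn_integral_cmult)
 also have "... = (\<integral>\<^sup>+t. (\<integral>\<^sup>+x. indicator N (x + t *\<^sub>R v) * indicator {0..1::real} t \<partial>lborel) \<partial>lborel)"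
 proof (rule nn_integral_cong)
  fix t :: real
  have "(\<integral>\<^sup>+x. indicator N (x + t *\<^sub>R v) * indicator {0..1::real} t \<partial>lborel) =
   (\<integral>\<^sup>+x. indicator N (x + t *\<^sub>R v) \<partial>lborel) * indicator {0..1::real} t"
   by (intro nn_integral_multc) measurable
  then show "emeasure lborel N * indicator {0..1} t = (\<integral>\<^sup>+x. indicator N (x + t *\<^sub>R v) * indicator {0..1::real} t \<partial>lborel)"
   using trans[of t] by simp
 qed
 also have "... = (\<integral>\<^sup>+x. (\<integral>\<^sup>+t. indicator N (x + t *\<^sub>R v) * indicator {0..1::real} t \<partial>lborel) \<partial>lborel)"
  by (rule lborel_pair.Fubini') measurable
 also have "... = 0" by (simp add: line)
 finally have "N \<in> null_sets lborel" by (auto simp: null_sets_def)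
 from AE_not_in[OF this] show ?thesis unfolding N_def by simp
qed


lemma dq_integrable:
 fixes u :: "'a::euclidean_space => real"
 assumes L: "L-lipschitz_on UNIV u" and Q: "Q \<in> sets borel" "bounded Q"
 shows "integrable lborel (%x. indicator Q x * dq u v t x)"
proof (rule Bochner_Integration.integrable_bound)
 show "integrable lborel (%x. (L * norm v) * indicator Q x :: real)"
  using Q emeasure_bounded_finite[of Q] by (intro integrable_mult_right) (simp add: integrable_indicator_iff)
 show "(%x. indicator Q x * dq u v t x) \<in> borel_measurable lborel"
  using Q dq_borel[OF lipschitz_on_continuous_on[OF L], of v t] by measurable
 show "AE x in lborel. norm (indicator Q x * dq u v t x) <= norm (L * norm v * indicator Q x :: real)"
  using dq_bound[OF L, of v t] lipschitz_on_nonneg[OF L] by (auto simp: indicator_def abs_mult)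
qed

lemma dir_deriv_integrable:
 fixes u :: "'a::euclidean_space => real"
 assumes L: "L-lipschitz_on UNIV u" and Q: "Q \<in> sets borel" "bounded Q"
 shows "integrable lborel (%x. indicator Q x * dir_deriv u v x)"
proof (rule Bochner_Integration.integrable_bound)
 show "integrable lborel (%x. (L * norm v) * indicator Q x :: real)"
  using Q emeasure_bounded_finite[of Q] by (intro integrable_mult_right) (simp add: integrable_indicator_iff)
 show "(%x. indicator Q x * dir_deriv u v x) \<in> borel_measurable lborel"
  using Q dir_deriv_borel[OF lipschitz_on_continuous_on[OF L], of v] by measurable
 show "AE x in lborel. norm (indicator Q x * dir_deriv u v x) <= norm (L * norm v * indicator Q x :: real)"
  using dir_deriv_bound[OF L, of v] lipschitz_on_nonneg[OF L] by (auto simp: indicator_def abs_mult)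
qed

lemma integral_dq_tendsto:
 fixes u :: "'a::euclidean_space => real"
 assumes L: "L-lipschitz_on UNIV u" and Q: "Q \<in> sets borel" "bounded Q"
  and t: "filterlim t (at 0) sequentially"
 shows "(%n::nat. LINT x|lborel. indicator Q x * dq u v (t n) x) \<longlonglongrightarrow>
  (LINT x|lborel. indicator Q x * dir_deriv u v x)"
proof (rule integral_dominated_convergence)
 show "integrable lborel (%x. (L * norm v) * indicator Q x :: real)"
  using Q emeasure_bounded_finite[of Q] by (intro integrable_mult_right) (simp add: integrable_indicator_iff)
 show "(%x. indicator Q x * dq u v (t n) x) \<in> borel_measurable lborel" for n
  using Q dq_borel[OF lipschitz_on_continuous_on[OF L], of v "t n"] by measurable
 show "(%x. indicator Q x * dir_deriv u v x) \<in> borel_measurable lborel"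
  using Q dir_deriv_borel[OF lipschitz_on_continuous_on[OF L], of v] by measurable
 show "AE x in lborel. norm (indicator Q x * dq u v (t n) x) <= (L * norm v) * indicator Q x" for n
  using dq_bound[OF L, of v "t n"] by (auto simp: indicator_def abs_mult)
 show "AE x in lborel. (%n. indicator Q x * dq u v (t n) x) \<longlonglongrightarrow> indicator Q x * dir_deriv u v x"
  using dir_regular_ae[OF L, of v]
  by eventually_elim (intro tendsto_intros filterlim_compose[OF dir_deriv_tendsto t])
qed

text \<open>A small multiple of \<open>h\<close> is added to the density 1 of Lebesgue measure. The
  new measure agrees with the old one on boxes, hence everywhere, and densities are unique almost
  everywhere.\<close>

lemma ae_zero_if_box_integrals_zero:
 fixes h :: "'a::euclidean_space => real"
 assumes h[measurable]: "h \<in> borel_measurable borel" and K: "!!x. \<bar>h x\<bar> <= K"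
  and box: "!!l r. (LINT x|lborel. indicator (box l r) x * h x) = 0"
 shows "AE x in lborel. h x = 0"
proof -
 \<comment> \<open>Any positive bound of \<open>h\<close> makes the perturbed density nonnegative;
   the summand 1 excludes division by 0.\<close>
 define K' where "K' = \<bar>K\<bar> + 1"
 have K': "K' > 0" "\<bar>h x\<bar> <= K'" for x using K[of x] unfolding K'_def by linarith+
 have pos: "1 + h x / K' \<ge> 0" for x using K'(2)[of x] K'(1) by (simp add: field_simps abs_le_iff)
 let ?M = "density lborel (%x. ennreal (1 + h x / K'))"
 have "lborel = ?M"
 proof (rule lborel_eqI)
  fix l r :: 'a assume lr: "!!b. b \<in> Basis ==> l \<bullet> b <= r \<bullet> b"
  have i1: "integrable lborel (%x. indicator (box l r) x :: real)"
   using emeasure_bounded_finite[OF bounded_box[of l r]] by (simp add: integrable_indicator_iff)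
  have i2: "integrable lborel (%x. indicator (box l r) x * h x)"
   by (rule Bochner_Integration.integrable_bound[OF integrable_mult_right[OF i1, of K']])
    (use K' in "auto simp: indicator_def abs_mult")
  have i3: "integrable lborel (%x. indicator (box l r) x * (1 + h x / K'))"
   using Bochner_Integration.integrable_add[OF i1 integrable_divide[OF i2, of K']] by (simp add: distrib_left)
  have "emeasure ?M (box l r) = (\<integral>\<^sup>+x. ennreal (indicator (box l r) x * (1 + h x / K')) \<partial>lborel)"
   by (subst emeasure_density) (auto intro!: nn_integral_cong simp: indicator_def)
  also have "... = ennreal (LINT x|lborel. indicator (box l r) x * (1 + h x / K'))"
   using pos by (intro nn_integral_eq_integral i3) auto
  also have "(LINT x|lborel. indicator (box l r) x * (1 + h x / K')) =
    (LINT x|lborel. indicator (box l r) x) + (LINT x|lborel. indicator (box l r) x * h x) / K'"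
   using i1 i2 by (simp add: distrib_left)
  also have "... = measure lborel (box l r)" unfolding box by simp
  also have "ennreal ... = emeasure lborel (box l r)"
   using emeasure_bounded_finite[OF bounded_box[of l r]] by (intro emeasure_eq_ennreal_measure[symmetric]) auto
  finally show "emeasure ?M (box l r) = ennreal (\<Prod>b\<in>Basis. (r - l) \<bullet> b)" using lr by simp
 qed simp
 then have "density lborel (%_. 1) = ?M" by (simp add: density_1)
 then have "AE x in lborel. (1::ennreal) = ennreal (1 + h x / K')"
  by (intro sigma_finite_measure.density_unique[OF sigma_finite_lborel]) auto
 then show ?thesis
 proof eventually_elim
  case (elim x)
  then have "ennreal (1 + h x / K') = 1" by simp
  then have "1 + h x / K' = 1" by (simp only: ennreal_eq_1)
  then show ?case using K'(1) by simp
 qed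
qed

text \<open>The difference quotients satisfy
 \<open>q\<^sub>t(v + w) x = q\<^sub>t v x + q\<^sub>t w (x + t v)\<close>, and the shift by \<open>t v\<close> disappears in the limit
 of the integrals over a box.\<close>

lemma dir_deriv_add_ae:
 fixes u :: "'a::euclidean_space => real"
 assumes L: "L-lipschitz_on UNIV u"
 shows "AE x in lborel. dir_deriv u (v + w) x = dir_deriv u v x + dir_deriv u w x"
proof -
 have u: "continuous_on UNIV u" using L by (rule lipschitz_on_continuous_on)
 define h where "h x = dir_deriv u (v + w) x - dir_deriv u v x - dir_deriv u w x" for x
 have [measurable]: "dir_deriv u v \<in> borel_measurable borel" for v by (rule dir_deriv_borel[OF u])
 have [measurable]: "dq u v t \<in> borel_measurable borel" for v t by (rule dq_borel[OF u])
 have "AE x in lborel. h x = 0"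
 proof (rule ae_zero_if_box_integrals_zero)
  show "h \<in> borel_measurable borel" unfolding h_def by measurable
  show "\<bar>h x\<bar> <= L * norm (v + w) + L * norm v + L * norm w" for x
   unfolding h_def using dir_deriv_bound[OF L, of "v + w" x] dir_deriv_bound[OF L, of v x] dir_deriv_bound[OF L, of w x]
   by linarith
  fix l r :: 'a
  let ?Q = "box l r"
  define t where "t n = 1 / real (Suc n)" for n
  have t: "filterlim t (at 0) sequentially" "!!n. t n ~= 0" "!!n. \<bar>t n\<bar> <= 1" "t \<longlonglongrightarrow> 0"
   unfolding filterlim_at t_def using LIMSEQ_inverse_real_of_nat by (auto simp: inverse_eq_divide)
  note lims = integral_dq_tendsto[OF L _ bounded_box[of l r] t(1)]
  have "(%n. (LINT x|lborel. indicator ?Q x * dq u (v + w) (t n) x) -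
     (LINT x|lborel. indicator ?Q x * dq u v (t n) x) -
     (LINT x|lborel. indicator ?Q x * dq u w (t n) x)) \<longlonglongrightarrow>
    (LINT x|lborel. indicator ?Q x * dir_deriv u (v + w) x) -
     (LINT x|lborel. indicator ?Q x * dir_deriv u v x) - (LINT x|lborel. indicator ?Q x * dir_deriv u w x)"
   by (intro tendsto_diff lims) auto
  moreover have "(LINT x|lborel. indicator ?Q x * dir_deriv u (v + w) x) -
     (LINT x|lborel. indicator ?Q x * dir_deriv u v x) - (LINT x|lborel. indicator ?Q x * dir_deriv u w x) =
    (LINT x|lborel. indicator ?Q x * h x)"
   using dir_deriv_integrable[OF L _ bounded_box[of l r]] unfolding h_def by (simp add: right_diff_distrib)
  ultimately have lim1: "(%n. (LINT x|lborel. indicator ?Q x * dq u (v + w) (t n) x) -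
     (LINT x|lborel. indicator ?Q x * dq u v (t n) x) -
     (LINT x|lborel. indicator ?Q x * dq u w (t n) x)) \<longlonglongrightarrow> (LINT x|lborel. indicator ?Q x * h x)"
   by simp
  have eq: "(LINT x|lborel. indicator ?Q x * dq u (v + w) (t n) x) -
     (LINT x|lborel. indicator ?Q x * dq u v (t n) x) -
     (LINT x|lborel. indicator ?Q x * dq u w (t n) x) =
    (LINT x|lborel. (indicator ?Q (x - t n *\<^sub>R v) - indicator ?Q x) * dq u w (t n) x)" for n
  proof -
   define s where "s = t n *\<^sub>R v"
   have i: "integrable lborel (%x. indicator ?Q x * dq u v (t n) x)" for v
    by (rule dq_integrable[OF L]) auto
   have img: "indicator ?Q (x - s) = (indicator ((+) s ` ?Q) x :: real)" for x
    by (force simp: indicator_def)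
   have i': "integrable lborel (%x. indicator ?Q (x - s) * dq u w (t n) x)"
    unfolding img by (rule dq_integrable[OF L])
     (auto intro!: borel_open open_translation bounded_translation)
   have "dq u (v + w) (t n) x - dq u v (t n) x = dq u w (t n) (s + x)" for x
    unfolding dq_def s_def by (simp add: diff_divide_distrib[symmetric] algebra_simps)
   then have "(LINT x|lborel. indicator ?Q x * dq u (v + w) (t n) x) -
     (LINT x|lborel. indicator ?Q x * dq u v (t n) x) =
     (LINT x|lborel. indicator ?Q x * dq u w (t n) (s + x))"
    using i by (simp add: Bochner_Integration.integral_diff[symmetric] right_diff_distrib[symmetric])
   also have "... = (LINT x|lborel. (%y. indicator ?Q (y - s) * dq u w (t n) y) (s + x))" by simp
   also have "... = (LINT x|distr lborel borel ((+) s). indicator ?Q (x - s) * dq u w (t n) x)"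
    by (rule integral_distr[symmetric]) auto
   also have "... = (LINT x|lborel. indicator ?Q (x - s) * dq u w (t n) x)"
    unfolding lborel_distr_plus ..
   finally show ?thesis using i[of w] i' unfolding s_def by (simp add: left_diff_distrib)
  qed
  obtain R where R: "!!x. x \<in> ?Q ==> norm x <= R" using bounded_box[of l r] unfolding bounded_iff by blast
  have lim2: "(%n. LINT x|lborel. (indicator ?Q (x - t n *\<^sub>R v) - indicator ?Q x) * dq u w (t n) x)
   \<longlonglongrightarrow> (LINT x|(lborel :: 'a measure). (0::real))"
  proof (rule integral_dominated_convergence)
   show "integrable lborel (%x::'a. (L * norm w) * indicator (cball 0 (R + norm v)) x :: real)"
    using emeasure_bounded_finite[of "cball (0::'a) (R + norm v)"]
    by (intro integrable_mult_right) (simp add: integrable_indicator_iff)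
   show "(%x. (indicator ?Q (x - t n *\<^sub>R v) - indicator ?Q x) * dq u w (t n) x) \<in> borel_measurable lborel" for n
    by measurable
   show "AE x in lborel. norm ((indicator ?Q (x - t n *\<^sub>R v) - indicator ?Q x) * dq u w (t n) x)
     <= L * norm w * indicator (cball 0 (R + norm v)) x" for n
   proof (rule AE_I2)
    fix x :: 'a
    show "norm ((indicator ?Q (x - t n *\<^sub>R v) - indicator ?Q x) * dq u w (t n) x)
     <= L * norm w * indicator (cball 0 (R + norm v)) x"
    proof (cases "x \<in> ?Q \<or> x - t n *\<^sub>R v \<in> ?Q")
     case True
     have "norm x <= R + norm v"
     proof (cases "x \<in> ?Q")
      case True
      then show ?thesis using R[of x] by (simp add: add_increasing2)
     next
      case False
      then have "norm (x - t n *\<^sub>R v) <= R" using True R by auto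
      moreover have "norm (t n *\<^sub>R v) <= norm v" using t(3)[of n] by (simp add: mult_left_le_one_le)
      ultimately show ?thesis using norm_triangle_sub[of x "t n *\<^sub>R v"] by linarith
     qed
     moreover have i1: "\<bar>indicator ?Q (x - t n *\<^sub>R v) - indicator ?Q x\<bar> <= (1::real)" by (auto simp: indicator_def)
     ultimately show ?thesis
      using mult_mono[OF i1 dq_bound[OF L, of w "t n" x]] by (simp add: abs_mult)
    next
     case False
     then show ?thesis using lipschitz_on_nonneg[OF L] by (simp add: indicator_def)
    qed
   qed
   \<comment> \<open>Convergence of the shifted indicators can fail only on the boundary of the box,
     which is null because the box is convex.\<close>
   have "negligible (frontier ?Q)" by (rule negligible_convex_frontier) (rule convex_box)
   then have "AE x in lebesgue. x ~: frontier ?Q"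
    by (auto simp: negligible_iff_null_sets dest: AE_not_in)
   then have "AE x in lborel. x ~: frontier ?Q" by (simp add: AE_completion_iff)
   then show "AE x in lborel. (%n. (indicator ?Q (x - t n *\<^sub>R v) - indicator ?Q x) * dq u w (t n) x) \<longlonglongrightarrow> 0"
   proof eventually_elim
    case (elim x)
    have xt: "(%n. x - t n *\<^sub>R v) \<longlonglongrightarrow> x" by (auto intro!: tendsto_eq_intros t(4))
    have "\<forall>\<^sub>F n in sequentially. indicator ?Q (x - t n *\<^sub>R v) = (indicator ?Q x :: real)"
    proof (cases "x \<in> ?Q")
     case True
     then show ?thesis using topological_tendstoD[OF xt open_box True] by (auto elim: eventually_mono)
    next
     case False
     then have "x \<in> - closure ?Q" using elim unfolding frontier_def interior_open[OF open_box] by simp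
     then have "\<forall>\<^sub>F n in sequentially. x - t n *\<^sub>R v \<in> - closure ?Q"
      using topological_tendstoD[OF xt, of "- closure ?Q"] by auto
     then show ?thesis
      by eventually_elim (use False closure_subset[of ?Q] in "auto simp: indicator_def")
    qed
    then show ?case by (intro tendsto_eventually) (auto elim: eventually_mono)
   qed
  qed simp
  show "(LINT x|lborel. indicator ?Q x * h x) = 0"
   using LIMSEQ_unique[OF lim1] lim2 unfolding eq by simp
 qed
 then show ?thesis by eventually_elim (simp add: h_def)
qed

lemma dir_deriv_linear_ae:
 fixes u :: "'a::euclidean_space => real"
 assumes L: "L-lipschitz_on UNIV u"
 shows "AE x in lborel. dir_deriv u v x = (\<Sum>b\<in>Basis. (v \<bullet> b) * dir_deriv u b x)"
proof -
 have "AE x in lborel. dir_deriv u (\<Sum>b\<in>B. (v \<bullet> b) *\<^sub>R b) x = (\<Sum>b\<in>B. (v \<bullet> b) * dir_deriv u b x)"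
  if "finite B" for B
  using that
 proof induction
  case empty
  have "((%t. dq u 0 t x) \<longlongrightarrow> 0) (at 0)" for x by (simp add: dq_def)
  from dir_deriv_eqI(2)[OF this] show ?case by simp
 next
  case (insert b B)
  show ?case
   using insert.IH dir_deriv_add_ae[OF L, of "(v \<bullet> b) *\<^sub>R b" "\<Sum>b\<in>B. (v \<bullet> b) *\<^sub>R b"] dir_regular_ae[OF L, of b]
   by eventually_elim (use insert.hyps in "simp add: dir_deriv_scale")
 qed
 from this[OF finite_Basis] show ?thesis by (simp add: euclidean_representation)
qed

text \<open>Finitely many of the given directions come within \<open>ep\<close> of every unit
  vector, by compactness of the sphere, and over these the limits are uniform. Replacing a direction
  by a nearby one costs at most \<open>L * ep\<close> in the difference quotient and
  \<open>ep * norm p\<close> in the linear form.\<close>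

lemma has_derivative_if_dense_directions:
 fixes u :: "'a::euclidean_space => real"
 assumes L: "L-lipschitz_on UNIV u"
  and V: "!!X. open X ==> X ~= {} ==> \<exists>v\<in>V. v \<in> X"
  and lim: "!!v. v \<in> V ==> ((%t. dq u v t x) \<longlongrightarrow> v \<bullet> p) (at 0)"
 shows "(u has_derivative (%h. h \<bullet> p)) (at x)"
 unfolding has_derivative_at_alt
proof (intro conjI allI impI)
 show "bounded_linear (%h. h \<bullet> p)" by (rule bounded_linear_inner_left)
 fix e :: real assume e: "e > 0"
 have L0: "L \<ge> 0" by (rule lipschitz_on_nonneg[OF L])
 \<comment> \<open>Half of \<open>e\<close> is spent on the limits in the finitely many directions;
   the other half has to cover \<open>ep * (L + norm p)\<close>, the cost of changing the
   direction.\<close>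
 define ep where "ep = e / (2 * (L + norm p + 1))"
 have ep: "ep > 0" "ep * (L + norm p) <= e / 2"
 proof -
  have pos: "L + norm p + 1 > 0" using L0 by (simp add: add_nonneg_pos)
  then show "ep > 0" unfolding ep_def using e by simp
  then have "ep * (L + norm p) <= ep * (L + norm p + 1)" by (intro mult_left_mono) auto
  also have "... = e / 2" unfolding ep_def using pos by (simp add: field_simps)
  finally show "ep * (L + norm p) <= e / 2" .
 qed
 have "sphere 0 1 \<subseteq> (\<Union>v\<in>V. ball v ep)"
 proof
  fix w :: 'a
  obtain v where "v \<in> V" "v \<in> ball w ep" using V[of "ball w ep"] ep by auto
  then show "w \<in> (\<Union>v\<in>V. ball v ep)" by (auto simp: dist_commute)
 qed
 then obtain V0 where V0: "V0 \<subseteq> V" "finite V0" "sphere 0 1 \<subseteq> (\<Union>v\<in>V0. ball v ep)"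
  using compactE_image[OF compact_sphere, of V "%v. ball v ep"] by (metis open_ball)
 have "\<forall>\<^sub>F t in at 0. \<forall>v\<in>V0. dist (dq u v t x) (v \<bullet> p) < e / 2"
 proof (intro eventually_ball_finite[OF V0(2)] ballI)
  fix v assume "v \<in> V0"
  then have "v \<in> V" using V0(1) by blast
  moreover have "e / 2 > 0" using e by simp
  ultimately show "\<forall>\<^sub>F t in at 0. dist (dq u v t x) (v \<bullet> p) < e / 2"
   using tendstoD[OF lim] by blast
 qed
 then obtain d where d: "d > 0"
  "!!t v. t ~= 0 ==> \<bar>t\<bar> < d ==> v \<in> V0 ==> \<bar>dq u v t x - v \<bullet> p\<bar> < e / 2"
  unfolding eventually_at by (auto simp: dist_real_def)
 have "norm (u y - u x - (y - x) \<bullet> p) <= e * norm (y - x)" if y: "norm (y - x) < d" for y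
 proof (cases "y = x")
  case False
  define t where "t = norm (y - x)"
  define w where "w = (y - x) /\<^sub>R t"
  have t: "t > 0" "t < d" using False y by (auto simp: t_def)
  have w: "y = x + t *\<^sub>R w" "norm w = 1" using t unfolding w_def by (auto simp: t_def)
  then obtain v where v: "v \<in> V0" "norm (v - w) < ep" using V0(3) by (auto simp: dist_norm)
  have "\<bar>dq u v t x - v \<bullet> p\<bar> * t < e / 2 * t" using d(2)[of t v] t v by (intro mult_strict_right_mono) auto
  moreover have "\<bar>dq u v t x - v \<bullet> p\<bar> * t = \<bar>u (x + t *\<^sub>R v) - u x - t * (v \<bullet> p)\<bar>"
  proof -
   have "(dq u v t x - v \<bullet> p) * t = u (x + t *\<^sub>R v) - u x - t * (v \<bullet> p)"
    unfolding dq_def using t by (simp add: field_simps)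
   then show ?thesis using t by (metis abs_mult abs_of_pos)
  qed
  ultimately have 1: "\<bar>u (x + t *\<^sub>R v) - u x - t * (v \<bullet> p)\<bar> <= e / 2 * t" by linarith
  have n: "norm (t *\<^sub>R w - t *\<^sub>R v) <= t * ep"
   unfolding scaleR_diff_right[symmetric] using v t by (simp add: norm_minus_commute)
  have "\<bar>u y - u (x + t *\<^sub>R v)\<bar> <= L * norm (t *\<^sub>R w - t *\<^sub>R v)"
   using lipschitz_on_normD[OF L, of y "x + t *\<^sub>R v"] w by simp
  also have "... <= L * (t * ep)" by (rule mult_left_mono[OF n L0])
  finally have 2: "\<bar>u y - u (x + t *\<^sub>R v)\<bar> <= L * (t * ep)" .
  have "\<bar>(t *\<^sub>R w - t *\<^sub>R v) \<bullet> p\<bar> <= (t * ep) * norm p"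
   using Cauchy_Schwarz_ineq2[of "t *\<^sub>R w - t *\<^sub>R v" p] mult_right_mono[OF n, of "norm p"] by simp
  then have 3: "\<bar>(y - x) \<bullet> p - t * (v \<bullet> p)\<bar> <= (t * ep) * norm p" using w by (simp add: inner_diff_left)
  have "\<bar>u y - u x - (y - x) \<bullet> p\<bar> <= e / 2 * t + L * (t * ep) + (t * ep) * norm p" using 1 2 3 by linarith
  also have "... = t * (e / 2 + ep * (L + norm p))" by (simp add: algebra_simps)
  also have "... <= t * e" using t ep by (intro mult_left_mono) auto
  finally show ?thesis by (simp add: t_def mult.commute)
 qed simp
 then show "\<exists>d>0. ALL y. norm (y - x) < d --> norm (u y - u x - (y - x) \<bullet> p) <= e * norm (y - x)"
  using d(1) by blast
qed

text \<open>Regularity and linearity in the direction \<open>v\<close> hold off a null set that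
  depends on \<open>v\<close>. For a countable dense set of directions the union of these sets is
  still null, and the Lipschitz bound takes care of all other directions.\<close>

lemma Rademacher_real:
 fixes u :: "'a::euclidean_space => real"
 assumes L: "L-lipschitz_on UNIV u"
 shows "AE x in lborel. u differentiable at x"
proof -
 obtain V :: "'a set" where V: "countable V" "!!X. open X ==> X ~= {} ==> \<exists>v\<in>V. v \<in> X"
  using countable_dense_exists by metis
 have "AE x in lborel. \<forall>v\<in>V. x \<in> dir_regular u v & dir_deriv u v x = (\<Sum>b\<in>Basis. (v \<bullet> b) * dir_deriv u b x)"
  unfolding AE_ball_countable[OF V(1)] using dir_regular_ae[OF L] dir_deriv_linear_ae[OF L] by simp
 then show ?thesis
 proof eventually_elim
  case (elim x)
  define p where "p = (\<Sum>b\<in>Basis. dir_deriv u b x *\<^sub>R b)"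
  have "(u has_derivative (%h. h \<bullet> p)) (at x)"
  proof (rule has_derivative_if_dense_directions[OF L V(2)])
   fix v assume "v \<in> V"
   then show "((%t. dq u v t x) \<longlongrightarrow> v \<bullet> p) (at 0)"
    using elim dir_deriv_tendsto[of x u v] by (simp add: p_def inner_sum_right mult.commute)
  qed
  then show ?case unfolding differentiable_def by blast
 qed
qed

theorem Rademacher:
 fixes f :: "'a::euclidean_space => 'b::euclidean_space"
 assumes L: "L-lipschitz_on UNIV f"
 shows "AE x in lborel. f differentiable at x"
proof -
 have "AE x in lborel. \<forall>i\<in>Basis. (%x. f x \<bullet> i) differentiable at x"
 proof (rule AE_finite_allI[OF finite_Basis])
   fix i :: 'b assume i: "i \<in> Basis"
   have "L-lipschitz_on UNIV (%x. f x \<bullet> i)"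
   proof (rule lipschitz_onI)
    fix x y
    have "\<bar>(f x - f y) \<bullet> i\<bar> <= norm (f x - f y)" by (rule Basis_le_norm[OF i])
    then show "dist (f x \<bullet> i) (f y \<bullet> i) <= L * dist x y"
     using lipschitz_onD[OF L, of x y] by (simp add: dist_norm inner_diff_left)
   qed (rule lipschitz_on_nonneg[OF L])
   then show "AE x in lborel. (%x. f x \<bullet> i) differentiable at x" by (rule Rademacher_real)
 qed
 then show ?thesis by eventually_elim (subst differentiable_componentwise_within, simp)
qed

text \<open>Composition with the nearest point map of a closed ball extends the restriction of
  \<open>f\<close> to a Lipschitz function on the whole space without changing it inside the ball.
  Countably many balls suffice by the Lindelof property.\<close>

lemma Rademacher_local:
 fixes f :: "'a::euclidean_space => 'b::euclidean_space"
 assumes W: "!!x. x \<in> W ==> \<exists>r>0. EX L. L-lipschitz_on (ball x r) f"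
 shows "negligible {x\<in>W. ~ f differentiable at x}"
proof -
 obtain r L where r: "!!x. x \<in> W ==> r x > 0" "!!x. x \<in> W ==> (L x)-lipschitz_on (ball x (r x)) f"
  using W by metis
 have loc: "negligible {y\<in>ball x (r x / 2). ~ f differentiable at y}" if x: "x \<in> W" for x
 proof -
  let ?C = "cball x (r x / 2)"
  have rx: "r x > 0" using r x by auto
  have C: "?C \<subseteq> ball x (r x)" "convex ?C" "closed ?C" "?C ~= {}" using rx by auto
  have "(L x)-lipschitz_on UNIV (f o closest_point ?C)"
  proof (rule lipschitz_onI)
   fix y z
   have "dist ((f o closest_point ?C) y) ((f o closest_point ?C) z) <= L x * dist (closest_point ?C y) (closest_point ?C z)"
    using closest_point_in_set[OF C(3,4)] C(1) by (auto intro!: lipschitz_onD[OF r(2)[OF x]])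
   also have "... <= L x * dist y z"
    by (intro mult_left_mono closest_point_lipschitz C lipschitz_on_nonneg[OF r(2)[OF x]])
   finally show "dist ((f o closest_point ?C) y) ((f o closest_point ?C) z) <= L x * dist y z" .
  qed (rule lipschitz_on_nonneg[OF r(2)[OF x]])
  from Rademacher[OF this] have "AE y in lebesgue. (f o closest_point ?C) differentiable at y"
   by (rule AE_completion)
  then have "AE y in lebesgue. y ~: {y\<in>ball x (r x / 2). ~ f differentiable at y}"
  proof eventually_elim
   case (elim y)
   have "f differentiable at y" if y: "y \<in> ball x (r x / 2)"
   proof -
    obtain D where "((f o closest_point ?C) has_derivative D) (at y)" using elim unfolding differentiable_def by blast
    then have "(f has_derivative D) (at y)"
    proof (rule has_derivative_transform_within_open[OF _ open_ball y])
     fix z assume "z \<in> ball x (r x / 2)"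
     then have "closest_point ?C z = z" by (intro closest_point_self) auto
     then show "(f o closest_point ?C) z = f z" by simp
    qed
    then show ?thesis unfolding differentiable_def by blast
   qed
   then show ?case by auto
  qed
  then show ?thesis unfolding eventually_ae_filter_negligible by (auto intro: negligible_subset)
 qed
 obtain F where F: "F \<subseteq> (%x. ball x (r x / 2)) ` W" "countable F" "\<Union>F = (\<Union>x\<in>W. ball x (r x / 2))"
  using Lindelof[of "(%x. ball x (r x / 2)) ` W"] by auto
 have "negligible (\<Union>B\<in>F. {y\<in>B. ~ f differentiable at y})"
  using F(1,2) loc by (intro negligible_countable_Union) auto
 then show ?thesis
 proof (rule negligible_subset, intro subsetI)
  fix y assume y: "y \<in> {x\<in>W. ~ f differentiable at x}"
  then have "y \<in> \<Union>F" unfolding F(3) using r(1) by (auto intro!: bexI[of _ y])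
  then show "y \<in> (\<Union>B\<in>F. {y\<in>B. ~ f differentiable at y})" using y by auto
 qed
qed

section \<open>The area formula for injective differentiable maps\<close>

text \<open>The library has the change of variables formula only for coordinate index types that are
 well-ordered. The type \<open>'n wo\<close> is a well-ordered copy of the finite type \<open>'n\<close>.\<close>

typedef 'n wo = "UNIV :: 'n set" ..

lemma bij_Rep_wo: "bij Rep_wo"
 by (rule bij_betw_byWitness[where f'=Abs_wo]) (auto simp: Abs_wo_inverse Rep_wo_inverse)

instance wo :: (finite) finite
proof
 have "finite (range (Rep_wo :: 'a wo => 'a))" by (rule finite)
 then show "finite (UNIV :: 'a wo set)" by (rule finite_imageD) (rule bij_is_inj[OF bij_Rep_wo])
qed

text \<open>Any injection into the naturals will do: only the existence of some well-order on the
  copy matters, and the measure and the determinant are insensitive to the order of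
  coordinates.\<close>

definition wo_index :: "'n::finite wo => nat" where
 "wo_index x = (SOME f :: 'n => nat. inj f) (Rep_wo x)"

lemma inj_wo_index: "inj (wo_index :: 'n::finite wo => nat)"
proof (rule injI)
 fix x y :: "'n wo" assume xy: "wo_index x = wo_index y"
 have "\<exists>f :: 'n => nat. inj f" using finite_imp_inj_to_nat_seg[of "UNIV :: 'n set"] by auto
 then have "inj (SOME f :: 'n => nat. inj f)" by (rule someI_ex)
 then have "Rep_wo x = Rep_wo y" using xy unfolding wo_index_def by (rule injD)
 then show "x = y" by (simp add: Rep_wo_inject)
qed

instantiation wo :: (finite) wellorder
begin

definition "x <= y \<longleftrightarrow> wo_index x <= wo_index (y :: 'a wo)"
definition "x < y \<longleftrightarrow> wo_index x < wo_index (y :: 'a wo)"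

instance
proof
 fix P :: "'a wo => bool" and a
 assume "!!x. (!!y. y < x ==> P y) ==> P x"
 then show "P a" unfolding less_wo_def by (induction a rule: measure_induct_rule[of wo_index]) blast
qed (use inj_wo_index in "auto simp: less_eq_wo_def less_wo_def inj_def")

end

definition to_wo :: "real^'n => real^'n wo" where "to_wo x = (\<chi> i. x $ Rep_wo i)"
definition of_wo :: "real^'n wo => real^'n" where "of_wo x = (\<chi> i. x $ Abs_wo i)"

lemma to_of_wo [simp]: "to_wo (of_wo x) = x" and of_to_wo [simp]: "of_wo (to_wo y) = y"
 by (simp_all add: to_wo_def of_wo_def vec_eq_iff Rep_wo_inverse Abs_wo_inverse)

lemma linear_to_wo: "linear (to_wo :: real^'n::finite => _)"
 by (rule linearI) (simp_all add: to_wo_def vec_eq_iff)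

lemma linear_of_wo: "linear (of_wo :: real^'n::finite wo => _)"
 by (rule linearI) (simp_all add: of_wo_def vec_eq_iff)

lemma to_wo_image: "to_wo ` S = of_wo -` S"
 by (auto simp: image_iff) (metis to_of_wo)

lemma CARD_wo: "CARD('n::finite wo) = CARD('n)"
 using bij_Rep_wo by (rule bij_betw_same_card)

lemma DIM_wo: "DIM(real^'n::finite wo) = DIM(real^'n)"
 by (simp add: CARD_wo)

lemma prod_Basis_cart:
 fixes x :: "real^'n::finite"
 shows "(\<Prod>b\<in>Basis. x \<bullet> b) = (\<Prod>i\<in>UNIV. x $ i)"
proof -
 have B: "(Basis :: (real^'n) set) = (%i. axis i 1) ` UNIV" by (auto simp: Basis_vec_def)
 have "inj (%i::'n. axis i (1::real))" by (auto simp: inj_def axis_eq_axis)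
 then show ?thesis unfolding B by (simp add: prod.reindex inner_axis)
qed

lemma distr_lborel_of_wo: "distr lborel borel (of_wo :: _ => real^'n::finite) = lborel"
proof (rule lborel_eqI[symmetric])
 have m: "(of_wo :: _ => real^'n) \<in> borel_measurable borel"
  by (intro borel_measurable_continuous_onI linear_continuous_on linear_conv_bounded_linear[THEN iffD1] linear_of_wo)
 fix l u :: "real^'n" assume lu: "!!b. b \<in> Basis ==> l \<bullet> b <= u \<bullet> b"
 then have le: "l $ i <= u $ i" for i using lu[of "axis i 1"] by (simp add: inner_axis)
 have "emeasure (distr lborel borel of_wo) (box l u) = emeasure lborel (of_wo -` box l u)"
  using m by (subst emeasure_distr) auto
 also have "of_wo -` box l u = box (to_wo l) (to_wo u)"
  by (auto simp: mem_box_cart to_wo_def of_wo_def) (metis Rep_wo_inverse Abs_wo_inverse UNIV_I)+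
 also have "emeasure lborel (box (to_wo l) (to_wo u)) = ennreal (\<Prod>b\<in>Basis. (to_wo u - to_wo l) \<bullet> b)"
 proof (rule emeasure_lborel_box)
  fix b :: "real^'n wo" assume "b \<in> Basis"
  then obtain i where "b = axis i 1" by (auto simp: Basis_vec_def)
  then show "to_wo l \<bullet> b <= to_wo u \<bullet> b" using le by (simp add: inner_axis to_wo_def)
 qed
 also have "(\<Prod>b\<in>Basis. (to_wo u - to_wo l) \<bullet> b) = (\<Prod>i\<in>UNIV. (u - l) $ Rep_wo i)"
  unfolding prod_Basis_cart by (simp add: to_wo_def)
 also have "... = (\<Prod>i\<in>UNIV. (u - l) $ i)"
  using prod.reindex_bij_betw[OF bij_Rep_wo, of "%i. (u - l) $ i"] by simp
 finally show "emeasure (distr lborel borel of_wo) (box l u) = ennreal (\<Prod>b\<in>Basis. (u - l) \<bullet> b)"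
  unfolding prod_Basis_cart .
qed simp

lemma to_wo_lebesgue:
 fixes S :: "(real^'n::finite) set"
 assumes "S \<in> sets lebesgue"
 shows "to_wo ` S \<in> sets lebesgue"
 by (rule differentiable_image_in_sets_lebesgue[OF assms])
  (auto simp: CARD_wo intro!: linear_imp_differentiable_on linear_to_wo)

lemma emeasure_to_wo:
 fixes S :: "(real^'n::finite) set"
 assumes S: "S \<in> sets lebesgue"
 shows "emeasure lebesgue (to_wo ` S) = emeasure lebesgue S"
proof -
 obtain B N where BN: "B \<in> sets borel" "negligible N" "B Un N = S" by (rule sets_lebesgue_almost_borel[OF S])
 have m: "(of_wo :: _ => real^'n) \<in> borel_measurable borel"
  by (intro borel_measurable_continuous_onI linear_continuous_on linear_conv_bounded_linear[THEN iffD1] linear_of_wo)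
 have tB: "to_wo ` B \<in> sets borel" unfolding to_wo_image using measurable_sets[OF m BN(1)] by simp
 have tN: "negligible (to_wo ` N)"
  by (rule negligible_differentiable_image_negligible[OF _ BN(2)])
   (auto simp: CARD_wo intro!: linear_imp_differentiable_on linear_to_wo)
 have "emeasure lebesgue (to_wo ` S) = emeasure lebesgue (to_wo ` B Un to_wo ` N)"
  unfolding BN(3)[symmetric] image_Un ..
 also have "... = emeasure lborel (to_wo ` B)"
  using tB tN by (simp add: emeasure_Un_null_set negligible_iff_null_sets)
 also have "... = emeasure (distr lborel borel of_wo) B" unfolding to_wo_image using m BN by (subst emeasure_distr) auto
 also have "... = emeasure lebesgue B" unfolding distr_lborel_of_wo using BN by simp
 also have "... = emeasure lebesgue (B Un N)"
  using BN(1,2) by (intro emeasure_Un_null_set[symmetric]) (auto simp: negligible_iff_null_sets)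
 finally show ?thesis unfolding BN(3) .
qed

lemma nn_integral_of_wo:
 fixes h :: "real^'n::finite => ennreal"
 assumes h: "h \<in> borel_measurable lebesgue"
 shows "(\<integral>\<^sup>+y. h (of_wo y) \<partial>lebesgue) = (\<integral>\<^sup>+x. h x \<partial>lebesgue)"
proof -
 have m: "(of_wo :: _ => real^'n) \<in> lebesgue \<rightarrow>\<^sub>M lebesgue"
  by (rule measurableI) (use to_wo_lebesgue in "auto simp: to_wo_image[symmetric]")
 have "distr lebesgue lebesgue (of_wo :: _ => real^'n) = lebesgue"
 proof (rule measure_eqI)
  fix A :: "(real^'n) set" assume "A \<in> sets (distr lebesgue lebesgue of_wo)"
  then have A: "A \<in> sets lebesgue" by simp
  show "emeasure (distr lebesgue lebesgue of_wo) A = emeasure lebesgue A"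
   using emeasure_distr[OF m A] emeasure_to_wo[OF A] by (simp only: to_wo_image space_completion space_lborel space_borel Int_UNIV_right)
 qed simp
 then show ?thesis using nn_integral_distr[OF m, of h] h by simp
qed

text \<open>Relabelling rows and columns by one bijection conjugates every permutation in the
  Leibniz formula, which leaves its sign unchanged.\<close>

lemma det_wo:
 fixes A :: "real^'n::finite^'n"
 shows "det (\<chi> i j. A $ Rep_wo i $ Rep_wo j) = det A"
proof -
 let ?f = "map_permutation (UNIV :: 'n wo set) Rep_wo"
 have inj: "inj_on Rep_wo (UNIV :: 'n wo set)" by (rule bij_is_inj[OF bij_Rep_wo])
 have bij: "bij_betw Rep_wo (UNIV :: 'n wo set) UNIV" by (rule bij_Rep_wo)
 have bij': "bij_betw Abs_wo (UNIV :: 'n set) UNIV"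
  by (rule bij_betw_byWitness[where f'=Rep_wo]) (auto simp: Abs_wo_inverse Rep_wo_inverse)
 have "det A = (\<Sum>p\<in>{p. p permutes UNIV}. of_int (sign p) * (\<Prod>i\<in>UNIV. A $ i $ p i))" by (simp add: det_def)
 also have "... = (\<Sum>p\<in>{p. p permutes (UNIV :: 'n wo set)}. of_int (sign (?f p)) * (\<Prod>i\<in>UNIV. A $ i $ ?f p i))"
 proof (rule sum.reindex_bij_witness[of _ ?f "map_permutation UNIV Abs_wo"])
  fix p :: "'n => 'n" assume "p \<in> {p. p permutes UNIV}"
  then show "?f (map_permutation UNIV Abs_wo p) = p" "map_permutation UNIV Abs_wo p \<in> {p. p permutes UNIV}"
   using map_permutation_compose_inv[OF bij', of p Rep_wo] map_permutation_permutes[OF bij', of p]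
   by (auto simp: Abs_wo_inverse)
 next
  fix p :: "'n wo => 'n wo" assume "p \<in> {p. p permutes UNIV}"
  then show "map_permutation UNIV Abs_wo (?f p) = p" "?f p \<in> {p. p permutes UNIV}"
   using map_permutation_compose_inv[OF bij, of p Abs_wo] map_permutation_permutes[OF bij, of p]
   by (auto simp: Rep_wo_inverse)
 next
  fix p :: "'n => 'n" assume "p \<in> {p. p permutes UNIV}"
  then have "?f (map_permutation UNIV Abs_wo p) = p"
   using map_permutation_compose_inv[OF bij', of p Rep_wo] by (auto simp: Abs_wo_inverse)
  then show "of_int (sign (?f (map_permutation UNIV Abs_wo p))) * (\<Prod>i\<in>UNIV. A $ i $ ?f (map_permutation UNIV Abs_wo p) i)
   = of_int (sign p) * (\<Prod>i\<in>UNIV. A $ i $ p i)" by simp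
 qed
 also have "... = (\<Sum>p\<in>{p. p permutes (UNIV :: 'n wo set)}. of_int (sign p) * (\<Prod>i\<in>UNIV. A $ Rep_wo i $ Rep_wo (p i)))"
 proof (rule sum.cong[OF refl])
  fix p :: "'n wo => 'n wo" assume p: "p \<in> {p. p permutes UNIV}"
  have "(\<Prod>i\<in>UNIV. A $ i $ ?f p i) = (\<Prod>i\<in>UNIV. A $ Rep_wo i $ ?f p (Rep_wo i))"
   using prod.reindex_bij_betw[OF bij, of "%i. A $ i $ ?f p i"] by simp
  also have "... = (\<Prod>i\<in>UNIV. A $ Rep_wo i $ Rep_wo (p i))" by (simp add: map_permutation_apply[OF inj])
  finally show "of_int (sign (?f p)) * (\<Prod>i\<in>UNIV. A $ i $ ?f p i) = of_int (sign p) * (\<Prod>i\<in>UNIV. A $ Rep_wo i $ Rep_wo (p i))"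
   using sign_map_permutation[OF inj, of p] p by simp
 qed
 also have "... = det (\<chi> i j. A $ Rep_wo i $ Rep_wo j)" by (simp add: det_def)
 finally show ?thesis ..
qed

text \<open>The formula for finite measures is an equivalence: the image has measure
  \<open>m\<close> exactly if the density has integral \<open>m\<close>. This covers a finite
  integral directly, and it also shows that an infinite integral excludes an image of finite
  measure.\<close>

lemma emeasure_differentiable_image_wellorder:
 fixes f :: "real^'n::{finite,wellorder} => real^'n::_"
 assumes S: "S \<in> sets lebesgue"
  and der: "!!x. x \<in> S ==> (f has_derivative f' x) (at x within S)"
  and inj: "inj_on f S"
 shows "emeasure lebesgue (f ` S) = (\<integral>\<^sup>+x\<in>S. ennreal \<bar>det (matrix (f' x))\<bar> \<partial>lebesgue)"
proof -
 define h where "h x = (if x \<in> S then \<bar>det (matrix (f' x))\<bar> else 0)" for x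
 have "(%x. det (matrix (f' x))) \<in> borel_measurable (lebesgue_on S)"
  by (rule borel_measurable_det_Jacobian[OF S der])
 then have hm: "h \<in> borel_measurable lebesgue" unfolding h_def[abs_def]
  using borel_measurable_if[OF S, of "%x. \<bar>det (matrix (f' x))\<bar>"] by simp
 have h0: "h x \<ge> 0" for x by (simp add: h_def)
 have eq: "(\<integral>\<^sup>+x\<in>S. ennreal \<bar>det (matrix (f' x))\<bar> \<partial>lebesgue) = (\<integral>\<^sup>+x. ennreal (h x) \<partial>lebesgue)"
  by (intro nn_integral_cong) (auto simp: h_def)
 have int_iff: "((%x. \<bar>det (matrix (f' x))\<bar>) has_integral m) S \<longleftrightarrow> (\<integral>\<^sup>+x. ennreal (h x) \<partial>lebesgue) = ennreal m & 0 <= m" for m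
 proof -
  have "(h has_integral m) UNIV \<longleftrightarrow> (h \<in> lebesgue \<rightarrow>\<^sub>M borel & integral\<^sup>N lebesgue h = m & 0 <= m)"
   by (rule has_integral_iff_nn_integral_lebesgue) (rule h0)
  moreover have "(h has_integral m) UNIV \<longleftrightarrow> ((%x. \<bar>det (matrix (f' x))\<bar>) has_integral m) S"
   unfolding h_def[abs_def] by (rule has_integral_restrict_UNIV)
  ultimately show ?thesis using hm by simp
 qed
 have fS: "f ` S \<in> sets lebesgue"
  using der by (intro differentiable_image_in_sets_lebesgue[OF S]) (auto simp: differentiable_on_def differentiable_def)
 show ?thesis
 proof (cases "(\<integral>\<^sup>+x. ennreal (h x) \<partial>lebesgue) = \<infinity>")
  case False
  then obtain m where m: "(\<integral>\<^sup>+x. ennreal (h x) \<partial>lebesgue) = ennreal m" "0 <= m"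
   by (metis ennreal_cases infinity_ennreal_def)
  then have "f ` S \<in> lmeasurable & measure lebesgue (f ` S) = m"
   using has_measure_differentiable_image[OF S der inj, where m=m] int_iff by blast
  then show ?thesis unfolding eq m(1) by (metis emeasure_eq_measure2)
 next
  case True
  have "f ` S ~: lmeasurable"
   using has_measure_differentiable_image[OF S der inj, where m="measure lebesgue (f ` S)"] int_iff True by auto
  then have "emeasure lebesgue (f ` S) = \<infinity>" using fS
   by (metis fmeasurableI infinity_ennreal_def top.not_eq_extremum)
  then show ?thesis unfolding eq True .
 qed
qed

theorem emeasure_differentiable_image:
 fixes f :: "real^'n::finite => real^'n"
 assumes S: "S \<in> sets lebesgue"
  and der: "!!x. x \<in> S ==> (f has_derivative f' x) (at x within S)"
  and inj: "inj_on f S"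
  and meas: "(%x. indicator S x * ennreal \<bar>det (matrix (f' x))\<bar>) \<in> borel_measurable lebesgue"
 shows "emeasure lebesgue (f ` S) = (\<integral>\<^sup>+x\<in>S. ennreal \<bar>det (matrix (f' x))\<bar> \<partial>lebesgue)"
proof -
 let ?S = "to_wo ` S" and ?f = "to_wo o f o of_wo" and ?f' = "%y. to_wo o f' (of_wo y) o of_wo"
 have fS: "f ` S \<in> sets lebesgue"
  using der by (intro differentiable_image_in_sets_lebesgue[OF S]) (auto simp: differentiable_on_def differentiable_def)
 have det: "det (matrix (?f' y)) = det (matrix (f' (of_wo y)))" for y
 proof -
  have ax: "of_wo (axis j 1) = axis (Rep_wo j) (1::real)" for j :: "'n wo"
   by (auto simp: of_wo_def axis_def vec_eq_iff Abs_wo_inverse Rep_wo_inverse)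
  have "matrix (?f' y) $ i $ j = matrix (f' (of_wo y)) $ Rep_wo i $ Rep_wo j" for i j
   by (simp add: matrix_def to_wo_def ax)
  then have "matrix (?f' y) = (\<chi> i j. matrix (f' (of_wo y)) $ Rep_wo i $ Rep_wo j)"
   by (simp add: vec_eq_iff)
  then show ?thesis by (simp add: det_wo)
 qed
 have "emeasure lebesgue (?f ` ?S) = (\<integral>\<^sup>+y\<in>?S. ennreal \<bar>det (matrix (?f' y))\<bar> \<partial>lebesgue)"
 proof (rule emeasure_differentiable_image_wellorder[OF to_wo_lebesgue[OF S]])
  fix y assume "y \<in> ?S"
  then have y: "of_wo y \<in> S" "of_wo ` ?S = S" by (auto simp: image_image)
  have "(f has_derivative f' (of_wo y)) (at (of_wo y) within of_wo ` ?S)" unfolding y(2) by (rule der[OF y(1)])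
  then show "(?f has_derivative ?f' y) (at y within ?S)"
   unfolding comp_assoc
   by (intro diff_chain_within linear_imp_has_derivative linear_of_wo linear_to_wo) auto
 next
  show "inj_on ?f ?S"
  proof (rule inj_onI)
   fix y z assume *: "y \<in> ?S" "z \<in> ?S" "?f y = ?f z"
   then have "f (of_wo y) = f (of_wo z)" by (metis comp_apply of_to_wo)
   moreover have "of_wo y \<in> S" "of_wo z \<in> S" using * by auto
   ultimately have "of_wo y = of_wo z" using inj by (meson inj_onD)
   then show "y = z" by (metis to_of_wo)
  qed
 qed
 also have "?f ` ?S = to_wo ` (f ` S)" by (simp add: image_image comp_def)
 also have "(\<integral>\<^sup>+y\<in>?S. ennreal \<bar>det (matrix (?f' y))\<bar> \<partial>lebesgue) =
  (\<integral>\<^sup>+y. indicator S (of_wo y) * ennreal \<bar>det (matrix (f' (of_wo y)))\<bar> \<partial>lebesgue)"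
  unfolding det to_wo_image by (intro nn_integral_cong) (auto simp: indicator_def)
 also have "... = (\<integral>\<^sup>+x. indicator S x * ennreal \<bar>det (matrix (f' x))\<bar> \<partial>lebesgue)"
  by (rule nn_integral_of_wo[OF meas])
 finally show ?thesis using emeasure_to_wo[OF fS] by (simp add: mult.commute)
qed

lemma borel_measurable_vec_nth:
 fixes f :: "_ => ('b::{second_countable_topology, real_normed_vector})^'n::finite"
 assumes "f \<in> borel_measurable M"
 shows "(%x. f x $ i) \<in> borel_measurable M"
 by (rule measurable_compose[OF assms borel_measurable_continuous_onI]) (intro continuous_intros)

section \<open>Locally Lipschitz maps between open sets\<close>

definition loc_lip_on :: "'a::metric_space set => ('a => 'b::metric_space) => bool" where
 "loc_lip_on W f \<longleftrightarrow> (\<forall>x\<in>W. \<exists>r>0. EX L. ball x r \<subseteq> W & L-lipschitz_on (ball x r) f)"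

lemma loc_lip_onE:
 assumes "loc_lip_on W f" "x \<in> W"
 obtains r L where "r > 0" "ball x r \<subseteq> W" "L-lipschitz_on (ball x r) f"
 using assms unfolding loc_lip_on_def by blast

lemma loc_lip_on_open: "loc_lip_on W f ==> open W"
 unfolding loc_lip_on_def open_contains_ball by blast

lemma loc_lip_on_continuous:
 assumes "loc_lip_on W f"
 shows "continuous_on W f"
proof (subst continuous_on_eq_continuous_at[OF loc_lip_on_open[OF assms]], rule ballI)
 fix x assume "x \<in> W"
 then obtain r L where "r > 0" "ball x r \<subseteq> W" "L-lipschitz_on (ball x r) f" by (rule loc_lip_onE[OF assms])
 then show "isCont f x"
  using lipschitz_on_continuous_on continuous_on_eq_continuous_at[OF open_ball] by (metis centre_in_ball)
qed

lemma loc_lip_on_subset: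
 assumes "loc_lip_on W f" "open V" "V \<subseteq> W"
 shows "loc_lip_on V f"
 unfolding loc_lip_on_def
proof
 fix x assume x: "x \<in> V"
 then obtain r L where r: "r > 0" "ball x r \<subseteq> W" "L-lipschitz_on (ball x r) f"
  using loc_lip_onE[OF assms(1)] assms(3) by blast
 obtain s where s: "s > 0" "ball x s \<subseteq> V" using assms(2) x open_contains_ball by blast
 show "\<exists>r>0. EX L. ball x r \<subseteq> V & L-lipschitz_on (ball x r) f"
  using r s by (intro exI[of _ "min r s"] conjI exI[of _ L] lipschitz_on_subset[OF r(3)]) auto
qed

lemma loc_lip_on_cong:
 assumes "loc_lip_on W f" "!!x. x \<in> W ==> f x = g x"
 shows "loc_lip_on W g"
 unfolding loc_lip_on_def
proof
 fix x assume "x \<in> W"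
 then obtain r L where r: "r > 0" "ball x r \<subseteq> W" "L-lipschitz_on (ball x r) f" by (rule loc_lip_onE[OF assms(1)])
 then have "L-lipschitz_on (ball x r) g" using assms(2) by (intro lipschitz_on_transform[OF r(3)]) auto
 then show "\<exists>r>0. EX L. ball x r \<subseteq> W & L-lipschitz_on (ball x r) g" using r by blast
qed

lemma loc_lip_on_compose:
 assumes f: "loc_lip_on W f" and g: "loc_lip_on V g" and sub: "f ` W \<subseteq> V"
 shows "loc_lip_on W (g o f)"
 unfolding loc_lip_on_def
proof
 fix x assume x: "x \<in> W"
 then obtain r L where r: "r > 0" "ball x r \<subseteq> W" "L-lipschitz_on (ball x r) f" by (rule loc_lip_onE[OF f])
 obtain s M where s: "s > 0" "ball (f x) s \<subseteq> V" "M-lipschitz_on (ball (f x) s) g" using loc_lip_onE[OF g] sub x by blast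
 have "isCont f x" using loc_lip_on_continuous[OF f] continuous_on_eq_continuous_at[OF loc_lip_on_open[OF f]] x by blast
 then obtain d where d: "d > 0" "!!y. dist y x < d ==> dist (f y) (f x) < s" using s(1) unfolding continuous_at_eps_delta by blast
 have "(M * L)-lipschitz_on (ball x (min r d)) (g o f)"
 proof (rule lipschitz_on_compose)
  show "L-lipschitz_on (ball x (min r d)) f" by (rule lipschitz_on_subset[OF r(3)]) auto
  show "M-lipschitz_on (f ` ball x (min r d)) g" using d(2) by (intro lipschitz_on_subset[OF s(3)]) (auto simp: dist_commute)
 qed
 then show "\<exists>r>0. EX L. ball x r \<subseteq> W & L-lipschitz_on (ball x r) (g o f)"
  using r d by (intro exI[of _ "min r d"]) auto
qed

lemma loc_lip_on_negligible:
 fixes f :: "'a::euclidean_space => 'b::euclidean_space"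
 assumes f: "loc_lip_on W f" and N: "negligible N" "N \<subseteq> W" and D: "DIM('a) <= DIM('b)"
 shows "negligible (f ` N)"
proof (rule negligible_locally_Lipschitz_image[OF D N(1)])
 fix x assume "x \<in> N"
 then obtain r L where r: "r > 0" "ball x r \<subseteq> W" "L-lipschitz_on (ball x r) f" using loc_lip_onE[OF f] N(2) by blast
 then show "EX T B. open T & x \<in> T & (\<forall>y\<in>N Int T. norm (f y - f x) <= B * norm (y - x))"
  using lipschitz_on_normD[OF r(3)] by (intro exI[of _ "ball x r"] exI[of _ L]) auto
qed

lemma loc_lip_on_image_lebesgue:
 fixes f :: "'a::euclidean_space => 'b::euclidean_space"
 assumes f: "loc_lip_on W f" and E: "E \<in> sets lebesgue" "E \<subseteq> W" and D: "DIM('a) <= DIM('b)"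
 shows "f ` E \<in> sets lebesgue"
 by (rule sets_lebesgue_continuous_image[OF E(1)])
  (use E(2) in "auto intro: continuous_on_subset[OF loc_lip_on_continuous[OF f]] loc_lip_on_negligible[OF f _ _ D]")

lemma loc_lip_on_differentiable_ae:
 fixes f :: "'a::euclidean_space => 'b::euclidean_space"
 assumes "loc_lip_on W f"
 shows "negligible {x\<in>W. ~ f differentiable at x}"
 using assms unfolding loc_lip_on_def by (intro Rademacher_local) blast

lemma lebesgue_on_measurable_AE_cong:
 fixes f g :: "'a::euclidean_space => 'b::euclidean_space"
 assumes f: "f \<in> borel_measurable (lebesgue_on W)" and W: "W \<in> sets lebesgue"
  and N: "negligible {x\<in>W. f x ~= g x}"
 shows "g \<in> borel_measurable (lebesgue_on W)"
proof -
 have "(%x. if x \<in> W then f x else 0) \<in> borel_measurable lebesgue"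
  using f W by (simp add: borel_measurable_if)
 moreover have "AE x in lebesgue. (if x \<in> W then f x else 0) = (if x \<in> W then g x else 0)"
  unfolding eventually_ae_filter_negligible using N by (intro exI[of _ "{x\<in>W. f x ~= g x}"]) auto
 ultimately have "(%x. if x \<in> W then g x else 0) \<in> borel_measurable lebesgue" by (rule borel_measurable_AE)
 then show ?thesis using W by (simp add: borel_measurable_if)
qed

lemma has_derivative_directional_limit:
 fixes f :: "'a::real_normed_vector => 'b::real_normed_vector"
 assumes "(f has_derivative D) (at x)"
 shows "((%s. (f (x + s *\<^sub>R v) - f x) /\<^sub>R s) \<longlongrightarrow> D v) (at 0)"
proof -
 have lin: "linear D" using assms has_derivative_linear by blast
 have "((%s. x + s *\<^sub>R v) has_derivative (%s. s *\<^sub>R v)) (at 0)" by (auto intro!: derivative_eq_intros)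
 moreover have "(f has_derivative D) (at (x + 0 *\<^sub>R v))" using assms by simp
 ultimately have "((%s. f (x + s *\<^sub>R v)) has_derivative (%s. D (s *\<^sub>R v))) (at 0)"
  using diff_chain_at[of "%s. x + s *\<^sub>R v" "%s. s *\<^sub>R v" 0 f D] by (simp add: comp_def)
 then have "((%h. norm (f (x + h *\<^sub>R v) - f x - D (h *\<^sub>R v)) / norm h) \<longlongrightarrow> 0) (at 0)"
  by (simp add: has_derivative_at)
 moreover have "\<forall>\<^sub>F h in at 0. norm (f (x + h *\<^sub>R v) - f x - D (h *\<^sub>R v)) / norm h = norm ((f (x + h *\<^sub>R v) - f x) /\<^sub>R h - D v)"
 proof (rule eventually_at_topological[THEN iffD2], intro exI[of _ UNIV] conjI ballI impI)
  fix h :: real assume "h ~= 0"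
  then have "(f (x + h *\<^sub>R v) - f x) /\<^sub>R h - D v = (f (x + h *\<^sub>R v) - f x - D (h *\<^sub>R v)) /\<^sub>R h"
   by (simp add: linear_cmul[OF lin] scaleR_diff_right)
  then show "norm (f (x + h *\<^sub>R v) - f x - D (h *\<^sub>R v)) / norm h = norm ((f (x + h *\<^sub>R v) - f x) /\<^sub>R h - D v)"
   by (simp add: divide_inverse mult.commute)
 qed auto
 ultimately have "((%h. norm ((f (x + h *\<^sub>R v) - f x) /\<^sub>R h - D v)) \<longlongrightarrow> 0) (at 0)"
  by (rule Lim_transform_eventually)
 then show ?thesis by (rule LIM_zero_cancel[OF tendsto_norm_zero_cancel])
qed

text \<open>At points where \<open>f\<close> is not differentiable the value of
  \<open>frechet_derivative\<close> is arbitrary. These points are null by Rademacher's theorem;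
  elsewhere the derivative is a limit of difference quotients, which become Borel functions on the
  whole space after extending \<open>f\<close> by 0.\<close>

lemma frechet_derivative_measurable:
 fixes f :: "'a::euclidean_space => 'b::euclidean_space"
 assumes f: "loc_lip_on W f"
 shows "(%x. frechet_derivative f (at x) v) \<in> borel_measurable (lebesgue_on W)"
proof -
 have oW: "open W" by (rule loc_lip_on_open[OF f])
 have W: "W \<in> sets lebesgue" using oW by auto
 define t where "t n = 1 / real (Suc n)" for n
 have t: "filterlim t (at 0) sequentially"
  unfolding filterlim_at t_def using LIMSEQ_inverse_real_of_nat by (auto simp: inverse_eq_divide)
 define F where "F x = (if x \<in> W then f x else 0)" for x
 have "f \<in> borel_measurable (restrict_space borel W)"
  by (rule borel_measurable_continuous_on_restrict[OF loc_lip_on_continuous[OF f]])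
 then have "(%x. indicator W x *\<^sub>R f x) \<in> borel_measurable borel"
  using oW by (subst (asm) borel_measurable_restrict_space_iff) auto
 moreover have "F = (%x. indicator W x *\<^sub>R f x)" by (auto simp: F_def fun_eq_iff)
 ultimately have Fm[measurable]: "F \<in> borel_measurable borel" by simp
 define q where "q n x = (F (x + t n *\<^sub>R v) - F x) /\<^sub>R t n" for n x
 have qm: "q n \<in> borel_measurable borel" for n unfolding q_def[abs_def] by measurable
 have "(%x. lim (%n. q n x)) \<in> borel_measurable borel"
  using qm by (rule borel_measurable_lim_metric)
 then have m: "(%x. lim (%n. q n x)) \<in> borel_measurable (lebesgue_on W)"
  by (intro measurable_restrict_space1 measurable_completion) simp
 show ?thesis
 proof (rule lebesgue_on_measurable_AE_cong[OF m W])
  show "negligible {x\<in>W. lim (%n. q n x) ~= frechet_derivative f (at x) v}"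
  proof (rule negligible_subset[OF loc_lip_on_differentiable_ae[OF f]], clarify)
   fix x assume x: "x \<in> W" "f differentiable at x" and ne: "lim (%n. q n x) ~= frechet_derivative f (at x) v"
   let ?D = "frechet_derivative f (at x)"
   have "(f has_derivative ?D) (at x)" using x(2) by (simp add: frechet_derivative_works)
   from filterlim_compose[OF has_derivative_directional_limit[OF this] t]
   have *: "(%n. (f (x + t n *\<^sub>R v) - f x) /\<^sub>R t n) \<longlonglongrightarrow> ?D v" .
   have "(%n. x + t n *\<^sub>R v) \<longlonglongrightarrow> x"
    using t unfolding filterlim_at by (auto intro!: tendsto_eq_intros)
   then have "\<forall>\<^sub>F n in sequentially. x + t n *\<^sub>R v \<in> W" using oW x(1) by (rule topological_tendstoD)
   then have "\<forall>\<^sub>F n in sequentially. (f (x + t n *\<^sub>R v) - f x) /\<^sub>R t n = q n x"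
    by eventually_elim (use x(1) in "simp add: q_def F_def")
   with * have "(%n. q n x) \<longlonglongrightarrow> ?D v" by (rule Lim_transform_eventually)
   then show False using ne by (simp add: limI)
  qed
 qed
qed

text \<open>The points of non-differentiability are null, and so is their image because
  \<open>f\<close> is locally Lipschitz; on the remaining set the area formula for differentiable
  injective maps applies.\<close>

lemma emeasure_loc_lip_image:
 fixes f :: "real^'n::finite => real^'n"
 assumes f: "loc_lip_on W f" and inj: "inj_on f W" and E: "E \<in> sets lebesgue" "E \<subseteq> W"
 shows "emeasure lebesgue (f ` E) = (\<integral>\<^sup>+x\<in>E. ennreal \<bar>det (jacobian f (at x))\<bar> \<partial>lebesgue)"
proof -
 have oW: "open W" by (rule loc_lip_on_open[OF f])
 define N where "N = {x\<in>W. ~ f differentiable at x}"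
 have N: "negligible N" "N \<subseteq> W" unfolding N_def using loc_lip_on_differentiable_ae[OF f] by auto
 have Nl: "N \<in> sets lebesgue" using N(1) by (rule negligible_imp_sets)
 have fN: "negligible (f ` (E Int N))"
  using N negligible_subset[of N "E Int N"] by (intro loc_lip_on_negligible[OF f]) auto
 have m: "(%x. det (jacobian f (at x))) \<in> borel_measurable (lebesgue_on W)"
  unfolding jacobian_def matrix_def det_def using frechet_derivative_measurable[OF f]
  by (auto intro!: borel_measurable_sum borel_measurable_times borel_measurable_prod borel_measurable_vec_nth)
 then have "(%x. if x \<in> W then det (jacobian f (at x)) else 0) \<in> borel_measurable lebesgue"
  using oW by (simp add: borel_measurable_if)
 then have "(%x. indicator (E - N) x * ennreal \<bar>(if x \<in> W then det (jacobian f (at x)) else 0)\<bar>) \<in> borel_measurable lebesgue"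
  using E(1) Nl by (intro borel_measurable_times_ennreal borel_measurable_indicator measurable_compose[OF _ measurable_ennreal] borel_measurable_abs) auto
 moreover have "(%x. indicator (E - N) x * ennreal \<bar>(if x \<in> W then det (jacobian f (at x)) else 0)\<bar>) =
   (%x. indicator (E - N) x * ennreal \<bar>det (matrix (frechet_derivative f (at x)))\<bar>)"
  using E(2) by (auto simp: fun_eq_iff indicator_def jacobian_def)
 ultimately have mm: "(%x. indicator (E - N) x * ennreal \<bar>det (matrix (frechet_derivative f (at x)))\<bar>) \<in> borel_measurable lebesgue"
  by simp
 have "f ` E = f ` (E - N) Un f ` (E Int N)" by auto
 then have "emeasure lebesgue (f ` E) = emeasure lebesgue (f ` (E - N) Un f ` (E Int N))" by simp
 also have "... = emeasure lebesgue (f ` (E - N))"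
  using E Nl fN by (intro emeasure_Un_null_set loc_lip_on_image_lebesgue[OF f]) (auto simp: negligible_iff_null_sets)
 also have "... = (\<integral>\<^sup>+x\<in>E - N. ennreal \<bar>det (matrix (frechet_derivative f (at x)))\<bar> \<partial>lebesgue)"
 proof (rule emeasure_differentiable_image)
  show "E - N \<in> sets lebesgue" using E(1) Nl by auto
  show "(f has_derivative frechet_derivative f (at x)) (at x within E - N)" if "x \<in> E - N" for x
  proof -
   have "f differentiable at x" using that E(2) unfolding N_def by auto
   then show ?thesis using frechet_derivative_works has_derivative_at_withinI by blast
  qed
  show "inj_on f (E - N)" using inj E(2) by (blast intro: inj_on_subset)
 qed (rule mm)
 also have "... = (\<integral>\<^sup>+x\<in>E. ennreal \<bar>det (jacobian f (at x))\<bar> \<partial>lebesgue)"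
 proof (rule nn_integral_cong_AE)
  have "AE x in lebesgue. x ~: N" using N(1) by (auto simp: negligible_iff_null_sets dest: AE_not_in)
  then show "AE x in lebesgue. ennreal \<bar>det (matrix (frechet_derivative f (at x)))\<bar> * indicator (E - N) x =
    ennreal \<bar>det (jacobian f (at x))\<bar> * indicator E x"
   by eventually_elim (auto simp: jacobian_def indicator_def)
 qed
 finally show ?thesis .
qed

text \<open>Both directions being locally Lipschitz, preimages of negligible sets are negligible, which makes
 \<open>h o f\<close> Lebesgue measurable.\<close>

theorem nn_integral_loc_lip_image:
 fixes f f' :: "real^'n::finite => real^'n"
 assumes f: "loc_lip_on W f" and f': "loc_lip_on (f ` W) f'" and inv: "!!x. x \<in> W ==> f' (f x) = x"
  and E: "E \<in> sets lebesgue" "E \<subseteq> W"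
  and h: "h \<in> borel_measurable (lebesgue_on (f ` W))"
 shows "(\<integral>\<^sup>+y\<in>f ` E. ennreal (h y) \<partial>lebesgue) = (\<integral>\<^sup>+x\<in>E. ennreal (h (f x)) * ennreal \<bar>det (jacobian f (at x))\<bar> \<partial>lebesgue)"
proof -
 let ?V = "f ` W" and ?J = "%x. ennreal \<bar>det (jacobian f (at x))\<bar>"
 have oW: "open W" and oV: "open ?V" using loc_lip_on_open f f' by auto
 have Wl: "W \<in> sets lebesgue" and Vl: "?V \<in> sets lebesgue" using oW oV by auto
 have inj: "inj_on f W" using inv by (metis inj_onI)
 have J: "?J \<in> borel_measurable (lebesgue_on W)"
  unfolding jacobian_def matrix_def det_def using frechet_derivative_measurable[OF f]
  by (auto intro!: borel_measurable_sum borel_measurable_times borel_measurable_prod borel_measurable_vec_nth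
    measurable_compose[OF _ measurable_ennreal] borel_measurable_abs)
 have pre: "f -` B Int W = f' ` B" if "B \<subseteq> ?V" for B using that inv by force
 have fm: "f \<in> lebesgue_on W \<rightarrow>\<^sub>M lebesgue_on ?V"
 proof (rule measurableI)
  fix B assume "B \<in> sets (lebesgue_on ?V)"
  then have B: "B \<in> sets lebesgue" "B \<subseteq> ?V" using Vl by (auto simp: sets_restrict_space_iff)
  have "f' ` B \<in> sets lebesgue" by (rule loc_lip_on_image_lebesgue[OF f' B]) simp
  moreover have "f' ` B \<subseteq> W" using B(2) inv by auto
  ultimately show "f -` B Int space (lebesgue_on W) \<in> sets (lebesgue_on W)"
   using pre[OF B(2)] Wl by (simp add: sets_restrict_space_iff)
 qed auto
 define D where "D = density (lebesgue_on W) ?J"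
 have fD: "f \<in> D \<rightarrow>\<^sub>M lebesgue_on ?V" unfolding D_def using fm by simp
 \<comment> \<open>The formula for sets says that \<open>f\<close> carries the measure with density
   \<open>?J\<close> to Lebesgue measure. The formula for functions is then the transformation rule
   for image measures.\<close>
 have eq: "distr D (lebesgue_on ?V) f = lebesgue_on ?V"
 proof (rule measure_eqI)
  fix B assume "B \<in> sets (distr D (lebesgue_on ?V) f)"
  then have B': "B \<in> sets (lebesgue_on ?V)" by simp
  then have B: "B \<in> sets lebesgue" "B \<subseteq> ?V" using Vl by (auto simp: sets_restrict_space_iff)
  let ?P = "f' ` B"
  have P: "?P \<in> sets lebesgue" "?P \<subseteq> W" "f ` ?P = B"
   using loc_lip_on_image_lebesgue[OF f' B] B(2) inv by (auto simp: image_image) force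
  have "emeasure (distr D (lebesgue_on ?V) f) B = emeasure D (f -` B Int W)"
   using emeasure_distr[OF fD B'] by (simp add: D_def)
  also have "... = emeasure D ?P" by (simp add: pre[OF B(2)])
  also have "... = (\<integral>\<^sup>+x. ?J x * indicator ?P x \<partial>lebesgue_on W)"
   unfolding D_def using J P Wl by (intro emeasure_density) (auto simp: sets_restrict_space_iff)
  also have "... = (\<integral>\<^sup>+x. ?J x * indicator ?P x * indicator W x \<partial>lebesgue)"
   using Wl by (simp add: nn_integral_restrict_space)
  also have "... = (\<integral>\<^sup>+x\<in>?P. ?J x \<partial>lebesgue)" using P(2) by (intro nn_integral_cong) (auto simp: indicator_def)
  also have "... = emeasure lebesgue (f ` ?P)" by (rule emeasure_loc_lip_image[OF f inj P(1,2), symmetric])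
  also have "... = emeasure (lebesgue_on ?V) B" unfolding P(3) using B Vl by (simp add: emeasure_restrict_space)
  finally show "emeasure (distr D (lebesgue_on ?V) f) B = emeasure (lebesgue_on ?V) B" .
 qed simp
 have fE: "f ` E \<in> sets lebesgue" "f ` E \<subseteq> ?V" using loc_lip_on_image_lebesgue[OF f E] E(2) by auto
 let ?h = "%y. ennreal (h y) * indicator (f ` E) y"
 have hm: "?h \<in> borel_measurable (lebesgue_on ?V)"
  using h fE Vl by (intro borel_measurable_times_ennreal measurable_compose[OF _ measurable_ennreal] borel_measurable_indicator)
   (auto simp: sets_restrict_space_iff)
 have "(\<integral>\<^sup>+y\<in>f ` E. ennreal (h y) \<partial>lebesgue) = (\<integral>\<^sup>+y. ?h y * indicator ?V y \<partial>lebesgue)"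
  using fE(2) by (intro nn_integral_cong) (auto simp: indicator_def)
 also have "... = (\<integral>\<^sup>+y. ?h y \<partial>lebesgue_on ?V)" using Vl by (simp add: nn_integral_restrict_space)
 also have "... = (\<integral>\<^sup>+y. ?h y \<partial>distr D (lebesgue_on ?V) f)" unfolding eq ..
 also have "... = (\<integral>\<^sup>+x. ?h (f x) \<partial>D)" by (rule nn_integral_distr[OF fD]) (use hm in simp)
 also have "... = (\<integral>\<^sup>+x. ?J x * ?h (f x) \<partial>lebesgue_on W)"
  unfolding D_def using J measurable_compose[OF fm hm] by (intro nn_integral_density) auto
 also have "... = (\<integral>\<^sup>+x. ?J x * ?h (f x) * indicator W x \<partial>lebesgue)"
  using Wl by (simp add: nn_integral_restrict_space)
 also have "... = (\<integral>\<^sup>+x\<in>E. ennreal (h (f x)) * ?J x \<partial>lebesgue)"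
 proof (rule nn_integral_cong)
  fix x
  show "?J x * ?h (f x) * indicator W x = ennreal (h (f x)) * ?J x * indicator E x"
   using E(2) inj_on_image_mem_iff[OF inj _ E(2), of x] by (auto simp: indicator_def mult.commute)
 qed
 finally show ?thesis .
qed

section \<open>Smooth functions\<close>

lemma frechet_derivative_cong_open:
 assumes "open S" "x \<in> S" "!!y. y \<in> S ==> f y = g y"
 shows "frechet_derivative f (at x) = frechet_derivative g (at x)"
proof -
 have "(f has_derivative D) (at x) \<longleftrightarrow> (g has_derivative D) (at x)" for D
  using assms has_derivative_transform_within_open[of f D x UNIV S g] has_derivative_transform_within_open[of g D x UNIV S f]
  by auto
 then show ?thesis unfolding frechet_derivative_def by simp
qed

lemma differentiable_on_openD: "f differentiable_on S ==> open S ==> x \<in> S ==> f differentiable at x"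
 by (metis at_within_open differentiable_on_def)

lemma differentiable_on_openI: "(!!x. x \<in> S ==> f differentiable at x) ==> f differentiable_on S"
 by (simp add: differentiable_on_def differentiable_at_withinI)

lemma Ck_on_cong:
 fixes f g :: "real^'a::finite => 'b::real_normed_vector"
 assumes "open S" "!!x. x \<in> S ==> f x = g x"
 shows "Ck_on k S f \<longleftrightarrow> Ck_on k S g"
 using assms(2)
proof (induction k arbitrary: f g)
 case 0
 then show ?case by (auto intro: continuous_on_cong[THEN iffD1])
next
 case (Suc k)
 have "f differentiable_on S \<longleftrightarrow> g differentiable_on S"
 proof -
  have "g differentiable_on S" if f: "f differentiable_on S" and eq: "!!x. x \<in> S ==> f x = g x" for f g :: "real^'a => 'b"
  proof (rule differentiable_on_openI)
   fix x assume x: "x \<in> S"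
   then obtain D where "(f has_derivative D) (at x)"
    using differentiable_on_openD[OF f assms(1)] unfolding differentiable_def by blast
   then have "(g has_derivative D) (at x)"
    by (rule has_derivative_transform_within_open[OF _ assms(1) x]) (rule eq)
   then show "g differentiable at x" unfolding differentiable_def by blast
  qed
  from this[of f g] this[of g f] show ?thesis using Suc.prems by metis
 qed
 moreover have "Ck_on k S (%x. frechet_derivative f (at x) v) \<longleftrightarrow> Ck_on k S (%x. frechet_derivative g (at x) v)" for v
  using frechet_derivative_cong_open[OF assms(1), of _ f g] Suc.prems by (intro Suc.IH) auto
 ultimately show ?case by simp
qed

lemma Ck_on_subset: "Ck_on k S f ==> T \<subseteq> S ==> Ck_on k T f"
 by (induction k arbitrary: f) (auto intro: continuous_on_subset differentiable_on_subset)

lemma Ck_on_local: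
 assumes "!!x. x \<in> S ==> EX T. open T & x \<in> T & Ck_on k T f"
 shows "Ck_on k S f"
 using assms
proof (induction k arbitrary: f)
 case 0
 have "isCont f x" if "x \<in> S" for x
  using 0[OF that] continuous_on_eq_continuous_at by auto
 then show ?case by (simp add: continuous_at_imp_continuous_on)
next
 case (Suc k)
 have "f differentiable at x" if "x \<in> S" for x
  using Suc.prems[OF that] differentiable_on_openD by auto
 moreover have "Ck_on k S (%x. frechet_derivative f (at x) v)" for v
  by (rule Suc.IH) (use Suc.prems in force)
 ultimately show ?case by (auto intro: differentiable_on_openI)
qed

lemma Ck_on_SucI:
 assumes "open S" "!!x. x \<in> S ==> (f has_derivative f' x) (at x)" "!!v. Ck_on k S (%x. f' x v)"
 shows "Ck_on (Suc k) S f"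
proof -
 have "frechet_derivative f (at x) = f' x" if "x \<in> S" for x
  using frechet_derivative_at[OF assms(2)[OF that]] by simp
 then have "Ck_on k S (%x. frechet_derivative f (at x) v)" for v
  using assms(3)[of v] Ck_on_cong[OF assms(1), of "%x. frechet_derivative f (at x) v" "%x. f' x v"] by simp
 moreover have "f differentiable_on S"
  by (rule differentiable_on_openI) (use assms(2) in "unfold differentiable_def, blast")
 ultimately show ?thesis by simp
qed

lemma Ck_on_SucD:
 assumes "Ck_on (Suc k) S f" "open S" "x \<in> S"
 shows "(f has_derivative frechet_derivative f (at x)) (at x)"
 using assms differentiable_on_openD[of f S x] by (simp add: frechet_derivative_works)

lemma Ck_on_Suc_imp: "Ck_on (Suc k) S f ==> Ck_on k S f"
 by (induction k arbitrary: f) (auto intro: differentiable_imp_continuous_on)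

lemma Ck_on_const: "open S ==> Ck_on k S (%x. c)"
proof (induction k arbitrary: c)
 case (Suc k)
 show ?case by (rule Ck_on_SucI[where f'="%x v. 0"]) (auto intro!: Suc derivative_eq_intros)
qed simp

lemma Ck_on_linear:
 assumes "bounded_linear h" "open S"
 shows "Ck_on k S h"
proof (cases k)
 case 0
 then show ?thesis using linear_continuous_on[OF assms(1)] by simp
next
 case (Suc k)
 show ?thesis unfolding Suc
  by (rule Ck_on_SucI[where f'="%x. h"])
   (use assms in "auto intro: bounded_linear_imp_has_derivative Ck_on_const")
qed

lemma Ck_on_compose_linear:
 assumes h: "bounded_linear h" and S: "open S"
 shows "Ck_on k S f ==> Ck_on k S (%x. h (f x))"
proof (induction k arbitrary: f)
 case 0
 then show ?case using bounded_linear.continuous_on[OF h] by simp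
next
 case (Suc k)
 show ?case
 proof (rule Ck_on_SucI[OF S])
  show "((%x. h (f x)) has_derivative (%v. h (frechet_derivative f (at x) v))) (at x)" if "x \<in> S" for x
   by (rule bounded_linear.has_derivative[OF h Ck_on_SucD[OF Suc.prems S that]])
  show "Ck_on k S (%x. h (frechet_derivative f (at x) v))" for v
   using Suc.prems by (intro Suc.IH) simp
 qed
qed

lemma Ck_on_add:
 assumes S: "open S"
 shows "Ck_on k S f ==> Ck_on k S g ==> Ck_on k S (%x. f x + g x)"
proof (induction k arbitrary: f g)
 case 0
 then show ?case by (auto intro: continuous_intros)
next
 case (Suc k)
 show ?case
 proof (rule Ck_on_SucI[OF S])
  show "((%x. f x + g x) has_derivative (%v. frechet_derivative f (at x) v + frechet_derivative g (at x) v)) (at x)"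
   if "x \<in> S" for x
   by (rule has_derivative_add[OF Ck_on_SucD[OF Suc.prems(1) S that] Ck_on_SucD[OF Suc.prems(2) S that]])
  show "Ck_on k S (%x. frechet_derivative f (at x) v + frechet_derivative g (at x) v)" for v
   using Suc.prems by (intro Suc.IH) simp_all
 qed
qed

lemma Ck_on_sum:
 assumes S: "open S" and "finite I" "!!i. i \<in> I ==> Ck_on k S (f i)"
 shows "Ck_on k S (%x. \<Sum>i\<in>I. f i x)"
 using assms(2,3) by (induction I) (auto intro: Ck_on_const[OF S] Ck_on_add[OF S])

lemma Ck_on_scaleR:
 fixes f :: "real^'n::finite => real" and g :: "real^'n => 'b::real_normed_vector"
 assumes S: "open S"
 shows "Ck_on k S f ==> Ck_on k S g ==> Ck_on k S (%x. f x *\<^sub>R g x)"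
proof (induction k arbitrary: f g)
 case 0
 then show ?case by (auto intro: continuous_intros)
next
 case (Suc k)
 show ?case
 proof (rule Ck_on_SucI[OF S])
  show "((%x. f x *\<^sub>R g x) has_derivative
    (%v. f x *\<^sub>R frechet_derivative g (at x) v + frechet_derivative f (at x) v *\<^sub>R g x)) (at x)"
   if "x \<in> S" for x
   by (rule has_derivative_scaleR[OF Ck_on_SucD[OF Suc.prems(1) S that] Ck_on_SucD[OF Suc.prems(2) S that]])
  show "Ck_on k S (%x. f x *\<^sub>R frechet_derivative g (at x) v + frechet_derivative f (at x) v *\<^sub>R g x)" for v
   using Suc.prems Ck_on_Suc_imp[OF Suc.prems(1)] Ck_on_Suc_imp[OF Suc.prems(2)]
   by (intro Ck_on_add[OF S] Suc.IH) simp_all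
 qed
qed

text \<open>\<open>Ck_on\<close> speaks of derivatives in fixed directions, but in the chain rule
  the direction in which \<open>f\<close> is differentiated varies with the point. Expanding it
  along the coordinate axes turns the derivative into a sum of products to which the induction
  hypothesis applies.\<close>

lemma Ck_on_compose:
 fixes ph :: "real^'n::finite => real^'m::finite" and f :: "real^'m => 'b::real_normed_vector"
 assumes S: "open S" and T: "open T" and sub: "ph ` S \<subseteq> T"
 shows "Ck_on k S ph ==> Ck_on k T f ==> Ck_on k S (%x. f (ph x))"
proof (induction k arbitrary: f)
 case 0
 then show ?case using sub by (auto intro: continuous_on_compose2)
next
 case (Suc k)
 let ?Dph = "%x. frechet_derivative ph (at x)" and ?Df = "%y. frechet_derivative f (at y)"
 have lin: "?Df y w = (\<Sum>i\<in>UNIV. w $ i *\<^sub>R ?Df y (axis i 1))" if "y \<in> T" for y w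
 proof -
  have l: "linear (?Df y)" using Ck_on_SucD[OF Suc.prems(2) T that] by (rule has_derivative_linear)
  have "?Df y w = ?Df y (\<Sum>i\<in>UNIV. w $ i *\<^sub>R axis i 1)" by (simp add: basis_expansion flip: scalar_mult_eq_scaleR)
  also have "... = (\<Sum>i\<in>UNIV. w $ i *\<^sub>R ?Df y (axis i 1))" by (simp add: linear_sum[OF l] linear_cmul[OF l])
  finally show ?thesis .
 qed
 show ?case
 proof (rule Ck_on_SucI[OF S])
  fix x assume x: "x \<in> S"
  then have y: "ph x \<in> T" using sub by auto
  have "((%x. f (ph x)) has_derivative (%v. ?Df (ph x) (?Dph x v))) (at x)"
   using diff_chain_at[OF Ck_on_SucD[OF Suc.prems(1) S x] Ck_on_SucD[OF Suc.prems(2) T y]] by (simp add: comp_def)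
  then show "((%x. f (ph x)) has_derivative (%v. \<Sum>i\<in>UNIV. (?Dph x v) $ i *\<^sub>R ?Df (ph x) (axis i 1))) (at x)"
   by (rule has_derivative_eq_rhs) (rule ext, rule lin[OF y])
 next
  fix v
  show "Ck_on k S (%x. \<Sum>i\<in>UNIV. (?Dph x v) $ i *\<^sub>R ?Df (ph x) (axis i 1))"
  proof (intro Ck_on_sum[OF S] Ck_on_scaleR[OF S])
   fix i
   show "Ck_on k S (%x. (?Dph x v) $ i)"
    using Suc.prems(1) by (intro Ck_on_compose_linear[OF bounded_linear_vec_nth S]) simp
   show "Ck_on k S (%x. ?Df (ph x) (axis i 1))"
    using Suc.prems(2) Ck_on_Suc_imp[OF Suc.prems(1)] by (intro Suc.IH) simp_all
  qed simp
 qed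
qed

section \<open>Mollification of Lipschitz functions\<close>

text \<open>The function \<open>exp (- 1 / t)\<close> with a pole of order \<open>m\<close> as a
  factor. The derivative of a member of this family is a combination of two others, so smoothness of
  the bump function follows by an induction in which \<open>m\<close> varies.\<close>

definition flat :: "nat => real => real" where
 "flat m t = (if t <= 0 then 0 else exp (- (1 / t)) / t ^ m)"

lemma power_le_fact_exp: "x \<ge> 0 ==> x ^ n <= fact n * exp (x::real)"
proof (induction n arbitrary: x)
 case (Suc n)
 define h where "h x = fact (Suc n) * exp x - x ^ Suc n" for x :: real
 have "h 0 <= h x"
 proof (rule DERIV_nonneg_imp_nondecreasing[OF Suc.prems])
  fix y :: real assume "0 <= y" "y <= x"
  have "(h has_real_derivative fact (Suc n) * exp y - real (Suc n) * y ^ n) (at y)"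
  proof -
   have "((%x. x ^ Suc n) has_real_derivative real (Suc n) * y ^ n) (at y)"
    using DERIV_pow[of "Suc n" y UNIV] by simp
   from DERIV_diff[OF DERIV_cmult[OF DERIV_exp] this] show ?thesis unfolding h_def[abs_def] .
  qed
  moreover have "fact (Suc n) * exp y - real (Suc n) * y ^ n = real (Suc n) * (fact n * exp y - y ^ n)"
   by (simp add: algebra_simps)
  moreover have "... \<ge> 0" using Suc.IH[OF \<open>0 <= y\<close>] by (intro mult_nonneg_nonneg) auto
  ultimately show "EX d. (h has_real_derivative d) (at y) & d \<ge> 0" by metis
 qed
 moreover have "0 <= h 0" by (simp add: h_def)
 ultimately have "0 <= h x" by linarith
 then show ?case unfolding h_def by linarith
qed simp

text \<open>Any exponent above 1 would give derivative 0 at the origin; the constant comes from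
  \<open>power_le_fact_exp\<close> with exponent \<open>m + 2\<close> and argument
  \<open>1 / t\<close>.\<close>

lemma flat_bound: "\<bar>flat m t\<bar> <= fact (m + 2) * t\<^sup>2"
proof (cases "t <= 0")
 case False
 then have t: "t > 0" by simp
 have "(1 / t) ^ (m + 2) <= fact (m + 2) * exp (1 / t)" using t by (intro power_le_fact_exp) simp
 then have "1 <= fact (m + 2) * exp (1 / t) * t ^ (m + 2)" using t by (simp add: power_divide pos_divide_le_eq)
 then have "1 <= (fact (m + 2) * t\<^sup>2 * t ^ m) * exp (1 / t)" by (simp only: power_add mult_ac)
 then have "exp (- (1 / t)) <= fact (m + 2) * t\<^sup>2 * t ^ m"
  unfolding exp_minus inverse_eq_divide by (subst pos_divide_le_eq) (simp_all only: exp_gt_zero)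
 then show ?thesis using t unfolding flat_def by (simp add: pos_divide_le_eq)
qed (simp add: flat_def)

lemma flat_derivative: "(flat m has_real_derivative flat (m + 2) t - real m * flat (m + 1) t) (at t)"
proof -
 consider "t < 0" | "t > 0" | "t = 0" by linarith
 then show ?thesis
 proof cases
  case 1
  have "((%t. 0) has_real_derivative flat (m + 2) t - real m * flat (m + 1) t) (at t)"
   using 1 by (simp add: flat_def)
  then show ?thesis
   by (rule has_field_derivative_transform_within_open[where S="{..<0}"]) (use 1 in "auto simp: flat_def")
 next
  case 2
  have "((%t. exp (- (1 / t)) * inverse (t ^ m)) has_real_derivative flat (m + 2) t - real m * flat (m + 1) t) (at t)"
  proof -
   let ?E = "exp (- (1 / t)) * (1 / t\<^sup>2) * inverse (t ^ m) + exp (- (1 / t)) * (- (real m * t ^ (m - 1)) * (inverse (t ^ m))\<^sup>2)"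
   have d: "((%t. exp (- (1 / t)) * inverse (t ^ m)) has_real_derivative ?E) (at t)"
    using 2 by (auto intro!: derivative_eq_intros simp: power2_eq_square divide_inverse)
   have e1: "?E = exp (- (1 / t)) * inverse (t ^ (m + 2)) - exp (- (1 / t)) * (real m * t ^ (m - 1) * (inverse (t ^ m))\<^sup>2)"
    using 2 by (simp add: power_add divide_inverse power2_eq_square algebra_simps)
   have e2: "real m * t ^ (m - 1) * (inverse (t ^ m))\<^sup>2 = real m * inverse (t ^ (m + 1))"
    using 2 by (cases m) (simp_all add: field_simps power2_eq_square)
   have e3: "flat (m + 2) t - real m * flat (m + 1) t =
     exp (- (1 / t)) * inverse (t ^ (m + 2)) - real m * (exp (- (1 / t)) * inverse (t ^ (m + 1)))"
    using 2 by (simp only: flat_def divide_inverse) simp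
   show ?thesis by (rule DERIV_cong[OF d]) (simp only: e1 e2 e3 mult.left_commute)
  qed
  then show ?thesis
   by (rule has_field_derivative_transform_within_open[where S="{0<..}"]) (use 2 in "simp_all add: flat_def divide_inverse")
 next
  case 3
  have "((%y. (flat m y - flat m 0) / (y - 0)) \<longlongrightarrow> 0) (at 0)"
  proof (rule Lim_null_comparison)
   show "\<forall>\<^sub>F y in at 0. norm ((flat m y - flat m 0) / (y - 0)) <= fact (m + 2) * \<bar>y\<bar>"
   proof (rule eventually_at_topological[THEN iffD2], intro exI[of _ UNIV] conjI ballI impI)
    fix y :: real assume "y ~= 0"
    show "norm ((flat m y - flat m 0) / (y - 0)) <= fact (m + 2) * \<bar>y\<bar>"
    proof -
     have "flat m 0 = 0" by (simp add: flat_def)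
     moreover have "\<bar>flat m y\<bar> <= (fact (m + 2) * \<bar>y\<bar>) * \<bar>y\<bar>"
      using flat_bound[of m y] by (simp only: power2_abs[of y, symmetric] power2_eq_square mult.assoc)
     moreover have "\<bar>flat m y\<bar> / \<bar>y\<bar> <= c * \<bar>y\<bar>" if "\<bar>flat m y\<bar> <= (c * \<bar>y\<bar>) * \<bar>y\<bar>" for c
      using that `y ~= 0` by (simp add: pos_divide_le_eq)
     ultimately show ?thesis by (simp only: diff_zero real_norm_def abs_divide)
    qed
   qed auto
   show "((%y. fact (m + 2) * \<bar>y\<bar>) \<longlongrightarrow> (0::real)) (at 0)"
    by (rule tendsto_mult_right_zero[OF tendsto_rabs_zero[OF tendsto_ident_at]])
  qed
  then show ?thesis unfolding 3 by (simp add: has_field_derivative_iff flat_def)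
 qed
qed

lemma flat_Ck: "Ck_on k UNIV (%z :: real^'n::finite. flat m (1 - z \<bullet> z))"
proof (induction k arbitrary: m)
 case 0
 have "continuous_on UNIV (flat m)"
  using flat_derivative by (intro continuous_at_imp_continuous_on ballI) (rule DERIV_isCont)
 then show ?case by (auto intro!: continuous_on_compose2[of UNIV "flat m"] continuous_intros)
next
 case (Suc k)
 show ?case
 proof (rule Ck_on_SucI)
  fix z :: "real^'n"
  have "((%z. 1 - z \<bullet> z) has_derivative (%v. - 2 * (z \<bullet> v))) (at z)"
   by (auto intro!: derivative_eq_intros simp: inner_commute)
  from has_derivative_compose[OF this flat_derivative[unfolded has_field_derivative_def]]
  show "((%z. flat m (1 - z \<bullet> z)) has_derivative
   (%v. (- 2 * (z \<bullet> v)) *\<^sub>R (flat (m + 2) (1 - z \<bullet> z) + (- real m) *\<^sub>R flat (m + 1) (1 - z \<bullet> z)))) (at z)"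
   by (simp add: mult.commute)
 next
  fix v :: "real^'n"
  have "bounded_linear (%z. - 2 * (z \<bullet> v))"
   by (intro bounded_linear_const_mult bounded_linear_inner_left)
  moreover have "bounded_linear (%x::real. (- real m) *\<^sub>R x)" by (rule bounded_linear_scaleR_right)
  ultimately show "Ck_on k UNIV (%z. (- 2 * (z \<bullet> v)) *\<^sub>R (flat (m + 2) (1 - z \<bullet> z) + (- real m) *\<^sub>R flat (m + 1) (1 - z \<bullet> z)))"
   by (intro Ck_on_scaleR Ck_on_add Ck_on_compose_linear[where h="%x. (- real m) *\<^sub>R x"] Suc.IH Ck_on_linear) auto
 qed simp
qed

definition bump :: "real^'n::finite => real" where
 "bump z = flat 0 (1 - z \<bullet> z) / (LINT z|lborel. flat 0 (1 - (z :: real^'n) \<bullet> z))"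

lemma integrable_supported_cball:
 fixes g :: "'a::euclidean_space => 'b::{banach, second_countable_topology}"
 assumes "continuous_on UNIV g" "!!z. z ~: cball c r ==> g z = 0"
 shows "integrable lborel g"
proof -
 have "integrable lborel (%x. indicator (cball c r) x *\<^sub>R g x)"
  using continuous_on_subset[OF assms(1)] by (intro borel_integrable_compact) auto
 moreover have "(%x. indicator (cball c r) x *\<^sub>R g x) = g" using assms(2) by (auto simp: fun_eq_iff indicator_def)
 ultimately show ?thesis by simp
qed

lemma flat_zero_outside: "z ~: cball 0 1 ==> flat 0 (1 - z \<bullet> z) = 0"
proof -
 assume "z ~: cball 0 1"
 then have "norm z * norm z \<ge> 1 * 1" by (intro mult_mono) auto
 then have "z \<bullet> z \<ge> 1" by (simp add: power2_norm_eq_inner[symmetric] power2_eq_square)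
 then show ?thesis by (simp add: flat_def)
qed

lemma flat_integral_pos: "(LINT z|lborel. flat 0 (1 - (z :: real^'n::finite) \<bullet> z)) > 0"
proof -
 let ?f = "%z :: real^'n. flat 0 (1 - z \<bullet> z)"
 have c: "continuous_on UNIV ?f" using flat_Ck[of 0 0] by simp
 have i: "integrable lborel ?f" using c flat_zero_outside by (rule integrable_supported_cball)
 have nn: "?f z \<ge> 0" for z by (simp add: flat_def)
 have "(LINT z|lborel. ?f z) ~= 0"
 proof
  assume "(LINT z|lborel. ?f z) = 0"
  then have "AE z in lborel. ?f z = 0" using integral_nonneg_eq_0_iff_AE[OF i] nn by auto
  then have "AE z in lborel. z ~: ball (0::real^'n) 1"
  proof eventually_elim
   case (elim z)
   show ?case
   proof
    assume "z \<in> ball 0 1"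
    then have "norm z * norm z < 1 * 1" by (intro mult_strict_mono') auto
    then have "z \<bullet> z < 1" by (simp add: power2_norm_eq_inner[symmetric] power2_eq_square)
    then show False using elim by (simp add: flat_def)
   qed
  qed
  then have "AE z in lebesgue. z ~: ball (0::real^'n) 1" by (rule AE_completion)
  then obtain N :: "(real^'n) set" where "negligible N" "{x. ~ x ~: ball 0 1} \<subseteq> N"
   unfolding eventually_ae_filter_negligible by blast
  then have "negligible N" "ball 0 1 \<subseteq> N" by auto
  then have "negligible (ball (0::real^'n) 1)" by (rule negligible_subset)
  then show False using open_not_negligible[of "ball (0::real^'n) 1"] by simp
 qed
 moreover have "(LINT z|lborel. ?f z) \<ge> 0" using nn by (intro integral_nonneg_AE) auto
 ultimately show ?thesis by simp
qed

lemma bump_Ck: "Ck_on k UNIV (bump :: real^'n::finite => real)"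
 unfolding bump_def[abs_def] by (rule Ck_on_compose_linear[OF bounded_linear_divide open_UNIV flat_Ck])

lemma bump_nonneg: "bump z \<ge> 0"
 unfolding bump_def using flat_integral_pos by (intro divide_nonneg_nonneg) (auto simp: flat_def less_imp_le)

lemma bump_zero: "z ~: cball 0 1 ==> bump z = 0"
 unfolding bump_def using flat_zero_outside[of z] by simp

lemma bump_continuous: "continuous_on S bump"
 using bump_Ck[of 0] by (auto intro: continuous_on_subset)

lemma bump_integrable_mult:
 fixes u :: "real^'n::finite => 'b::{banach, second_countable_topology}"
 assumes "continuous_on UNIV u"
 shows "integrable lborel (%z. bump z *\<^sub>R u z)"
 by (rule integrable_supported_cball[of _ 0 1]) (auto intro!: continuous_intros bump_continuous assms simp: bump_zero)

lemma integral_bump: "(LINT z|lborel. bump (z :: real^'n::finite)) = 1"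
 unfolding bump_def using flat_integral_pos[where 'n='n] by simp

abbreviation dbump :: "real^'n::finite => real^'n => real" where
 "dbump z v \<equiv> frechet_derivative bump (at z) v"

lemma dbump_continuous: "continuous_on UNIV (%z :: real^'n::finite. dbump z v)"
 using bump_Ck[where 'n='n and k="Suc 0"] by simp

lemma bump_has_derivative: "(bump has_derivative dbump z) (at z)"
 using Ck_on_SucD[OF bump_Ck[of "Suc 0"]] by simp

lemma dbump_zero:
 assumes "z ~: cball 0 1"
 shows "dbump z v = 0"
proof -
 have "frechet_derivative bump (at z) = frechet_derivative (%_. 0) (at z)"
  by (rule frechet_derivative_cong_open[of "- cball 0 1"]) (use assms bump_zero in auto)
 then show ?thesis by simp
qed

lemma dbump_integrable_mult:
 fixes u :: "real^'n::finite => 'b::{banach, second_countable_topology}"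
 assumes "continuous_on UNIV u"
 shows "integrable lborel (%z. dbump z v *\<^sub>R u z)"
 by (rule integrable_supported_cball[of _ 0 1]) (auto intro!: continuous_intros dbump_continuous assms simp: dbump_zero)

definition mollify :: "real => (real^'n::finite => 'b::euclidean_space) => real^'n => 'b" where
 "mollify ep u x = (LINT z|lborel. bump z *\<^sub>R u (x - ep *\<^sub>R z))"

text \<open>All derivatives fall on the kernel \<open>K\<close>, so \<open>u\<close> need only be
  continuous. The derivatives are packed into a family of bounded linear maps because
  differentiation under the integral sign needs it to be continuous in that sense; in finite
  dimension this may be checked vector by vector.\<close>

lemma leibniz_convolution:
 fixes K :: "real^'n::finite => real" and u :: "real^'n => 'b::euclidean_space"
 assumes K: "Ck_on (Suc 0) UNIV K" and u: "continuous_on UNIV u"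
 shows "((%x. integral (cbox a b) (%y. K (x - y) *\<^sub>R u y)) has_derivative
  (%v. integral (cbox a b) (%y. frechet_derivative K (at (x - y)) v *\<^sub>R u y))) (at x)"
proof -
 let ?D = "%z. frechet_derivative K (at z)"
 have D: "(K has_derivative ?D z) (at z)" for z by (rule Ck_on_SucD[OF K]) auto
 have bl: "bounded_linear (%v. ?D z v *\<^sub>R w)" for z and w :: 'b
  by (rule bounded_linear_scaleR_const[OF has_derivative_bounded_linear[OF D]])
 define F where "F x y = Blinfun (%v. ?D (x - y) v *\<^sub>R u y)" for x y
 have F: "blinfun_apply (F x y) v = ?D (x - y) v *\<^sub>R u y" for x y v
  unfolding F_def by (simp add: bounded_linear_Blinfun_apply[OF bl])
 have Dc: "continuous_on UNIV (%z. ?D z v)" for v using K by simp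
 have cF: "continuous_on (UNIV \<times> cbox a b) (%(x, y). F x y)"
 proof (rule continuous_on_blinfun_componentwise)
  fix i :: "real^'n"
  show "continuous_on (UNIV \<times> cbox a b) (%p. blinfun_apply (case p of (x, y) => F x y) i)"
   unfolding split_def F
   by (intro continuous_intros continuous_on_compose2[OF Dc] continuous_on_compose2[OF u]) auto
 qed
 have Kc: "continuous_on UNIV K" using Ck_on_Suc_imp[OF K] by simp
 have ci: "continuous_on (cbox a b) (%y. K (x - y) *\<^sub>R u y)" for x
  by (intro continuous_intros continuous_on_compose2[OF Kc] continuous_on_subset[OF u]) auto
 have h1: "((%x. integral (cbox a b) (%y. K (x - y) *\<^sub>R u y)) has_derivative
   blinfun_apply (integral (cbox a b) (F x))) (at x within UNIV)"
 proof (rule leibniz_rule)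
  fix x y
  have "((%x. K (x - y)) has_derivative ?D (x - y)) (at x)"
   by (rule has_derivative_compose[of "%x. x - y" "%v. v" x UNIV K "?D (x - y)"]) (auto intro!: derivative_eq_intros D)
  then have "((%x. K (x - y) *\<^sub>R u y) has_derivative (%v. ?D (x - y) v *\<^sub>R u y)) (at x)"
   by (rule has_derivative_scaleR_left)
  moreover have "blinfun_apply (F x y) = (%v. ?D (x - y) v *\<^sub>R u y)" by (rule ext) (rule F)
  ultimately show "((%x. K (x - y) *\<^sub>R u y) has_derivative blinfun_apply (F x y)) (at x within UNIV)" by simp
 qed (use ci cF in "auto intro: integrable_continuous")
 have h2: "blinfun_apply (integral (cbox a b) (F x)) v = integral (cbox a b) (%y. ?D (x - y) v *\<^sub>R u y)" for v
 proof -
  have "continuous_on (cbox a b) (%y. case (x, y) of (x, y) => F x y)"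
   by (rule continuous_on_compose2[OF cF]) (auto intro!: continuous_intros)
  then have "continuous_on (cbox a b) (F x)" by simp
  then have "F x integrable_on cbox a b" by (rule integrable_continuous)
  from integral_linear[OF this blinfun.bounded_linear_left[of v]]
  show ?thesis by (simp add: comp_def F)
 qed
 show ?thesis using has_derivative_eq_rhs[OF h1, OF ext, OF h2] by simp
qed

lemma Ck_convolution:
 fixes K :: "real^'n::finite => real" and u :: "real^'n => 'b::euclidean_space"
 assumes u: "continuous_on UNIV u"
 shows "Ck_on k UNIV K ==> Ck_on k UNIV (%x. integral (cbox a b) (%y. K (x - y) *\<^sub>R u y))"
proof (induction k arbitrary: K)
 case 0
 then have Kc: "continuous_on UNIV K" by simp
 have "continuous_on (UNIV \<times> cbox a b) (%(x, y). K (x - y) *\<^sub>R u y)"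
  unfolding split_def by (intro continuous_intros continuous_on_compose2[OF Kc] continuous_on_compose2[OF u]) auto
 then show ?case using integral_continuous_on_param by auto
next
 case (Suc k)
 have K1: "Ck_on (Suc 0) UNIV K"
  using Suc.prems
 proof (induction k)
  case (Suc k)
  then show ?case using Ck_on_Suc_imp by blast
 qed simp
 show ?case
 proof (rule Ck_on_SucI[OF open_UNIV leibniz_convolution[OF K1 u]])
  fix v
  show "Ck_on k UNIV (%x. integral (cbox a b) (%y. frechet_derivative K (at (x - y)) v *\<^sub>R u y))"
   using Suc.IH[of "%z. frechet_derivative K (at z) v"] Suc.prems by simp
 qed
qed


lemma integral_lborel_scale:
 fixes F :: "'a::euclidean_space => 'b::{banach, second_countable_topology}"
 assumes F: "F \<in> borel_measurable borel" and c: "c ~= 0"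
 shows "(LINT y|lborel. F y) = \<bar>c\<bar> ^ DIM('a) *\<^sub>R (LINT z|lborel. F (x + c *\<^sub>R z))"
proof -
 have "(LINT y|lborel. F y) = (LINT y|density (distr lborel borel (%z. x + c *\<^sub>R z)) (%_. ennreal (\<bar>c\<bar> ^ DIM('a))). F y)"
  by (subst lborel_affine[OF c, of x]) simp
 also have "... = (LINT y|distr lborel borel (%z. x + c *\<^sub>R z). \<bar>c\<bar> ^ DIM('a) *\<^sub>R F y)"
  using F by (intro integral_density) auto
 also have "... = (LINT z|lborel. \<bar>c\<bar> ^ DIM('a) *\<^sub>R F (x + c *\<^sub>R z))"
  using F by (intro integral_distr) auto
 finally show ?thesis by simp
qed

text \<open>Substitution of \<open>x - ep *\<^sub>R z\<close> for \<open>y\<close>: its Jacobian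
  cancels the normalising factor of the kernel, and any box that contains the support of the scaled
  kernel may replace the whole space.\<close>

lemma scaled_convolution:
 fixes u :: "real^'n::finite => 'b::euclidean_space"
 assumes u: "continuous_on UNIV u" and g: "continuous_on UNIV g" "!!z. z ~: cball 0 1 ==> g z = (0::real)"
  and ep: "ep > 0" and ab: "cball x ep \<subseteq> cbox a b"
 shows "integral (cbox a b) (%y. (inverse (ep ^ CARD('n)) * g ((x - y) /\<^sub>R ep)) *\<^sub>R u y) =
  (LINT z|lborel. g z *\<^sub>R u (x - ep *\<^sub>R z))"
proof -
 let ?F = "%y. (inverse (ep ^ CARD('n)) * g ((x - y) /\<^sub>R ep)) *\<^sub>R u y"
 have cF: "continuous_on UNIV ?F"
  by (intro continuous_intros continuous_on_compose2[OF g(1)] u) auto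
 have z: "?F y = 0" if "y ~: cball x ep" for y
 proof -
  have "norm ((x - y) /\<^sub>R ep) > 1" using that ep by (simp add: dist_norm pos_less_divide_eq divide_inverse[symmetric] mult.commute[of "inverse _"])
  then show ?thesis using g(2)[of "(x - y) /\<^sub>R ep"] by simp
 qed
 have i: "integrable lborel ?F" using cF z by (rule integrable_supported_cball)
 have "(LINT y|lborel. ?F y) = integral UNIV ?F"
  using has_integral_integral_lborel[OF i] by (simp add: integral_unique)
 also have "... = integral (cbox a b) ?F"
 proof -
  have e: "{y \<in> UNIV - cbox a b. ?F y ~= 0} = {}" "{y \<in> cbox a b - UNIV. ?F y ~= 0} = {}" using z ab by blast+
  show ?thesis by (rule integral_spike_set) (simp_all only: e negligible_empty)
 qed
 finally have "integral (cbox a b) ?F = (LINT y|lborel. ?F y)" ..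
 also have "... = \<bar>- ep\<bar> ^ DIM(real^'n) *\<^sub>R (LINT z|lborel. ?F (x + (- ep) *\<^sub>R z))"
  using ep by (intro integral_lborel_scale borel_measurable_continuous_onI[OF cF]) simp
 also have "... = ep ^ CARD('n) *\<^sub>R (LINT z|lborel. inverse (ep ^ CARD('n)) *\<^sub>R (g z *\<^sub>R u (x - ep *\<^sub>R z)))"
  using ep by simp
 also have "... = (LINT z|lborel. g z *\<^sub>R u (x - ep *\<^sub>R z))"
  unfolding integral_scaleR_right using ep by simp
 finally show ?thesis .
qed

text \<open>The support of the kernel moves with \<open>x\<close>. One box large enough for all
  \<open>x\<close> in a unit ball provides a fixed compact domain of integration, over which
  differentiation under the integral is possible.\<close>

lemma mollify_local:
 fixes u :: "real^'n::finite => 'b::euclidean_space"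
 assumes u: "continuous_on UNIV u" and ep: "ep > 0"
 obtains a b where
  "!!x. x \<in> ball c 1 ==> mollify ep u x = integral (cbox a b) (%y. (inverse (ep ^ CARD('n)) * bump ((x - y) /\<^sub>R ep)) *\<^sub>R u y)"
  "cball c ep \<subseteq> cbox a b"
proof -
 obtain a where a: "cball c (1 + ep) \<subseteq> cbox (- a) a" using bounded_subset_cbox_symmetric[OF bounded_cball] by blast
 show ?thesis
 proof (rule that[of "- a" a])
  fix x assume "x \<in> ball c 1"
  then have "dist c x < 1" by simp
  have "cball x ep \<subseteq> cball c (1 + ep)"
  proof
   fix y assume "y \<in> cball x ep"
   then show "y \<in> cball c (1 + ep)" using dist_triangle[of c y x] `dist c x < 1` by simp
  qed
  then have "cball x ep \<subseteq> cbox (- a) a" using a by blast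
  from scaled_convolution[OF u bump_continuous bump_zero ep this]
  show "mollify ep u x = integral (cbox (- a) a) (%y. (inverse (ep ^ CARD('n)) * bump ((x - y) /\<^sub>R ep)) *\<^sub>R u y)"
   unfolding mollify_def by simp
 next
  show "cball c ep \<subseteq> cbox (- a) a" using a by (auto simp: subset_eq)
 qed
qed

lemma scaled_bump_Ck: "Ck_on k UNIV (%z :: real^'n::finite. c * bump (z /\<^sub>R ep))"
proof (rule Ck_on_compose_linear[OF bounded_linear_mult_right open_UNIV])
 show "Ck_on k UNIV (%z :: real^'n. bump (z /\<^sub>R ep))"
  by (rule Ck_on_compose[OF open_UNIV open_UNIV _ Ck_on_linear[OF bounded_linear_scaleR_right open_UNIV] bump_Ck]) simp
qed

lemma mollify_smooth:
 fixes u :: "real^'n::finite => 'b::euclidean_space"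
 assumes u: "continuous_on UNIV u" and ep: "ep > 0"
 shows "smooth_on UNIV (mollify ep u)"
 unfolding smooth_on_def
proof (intro allI Ck_on_local)
 fix k and x :: "real^'n"
 obtain a b where
  ab: "!!y. y \<in> ball x 1 ==> mollify ep u y = integral (cbox a b) (%z. (inverse (ep ^ CARD('n)) * bump ((y - z) /\<^sub>R ep)) *\<^sub>R u z)"
  by (rule mollify_local[OF assms, where c=x]) blast
 have "Ck_on k (ball x 1) (%y. integral (cbox a b) (%z. (inverse (ep ^ CARD('n)) * bump ((y - z) /\<^sub>R ep)) *\<^sub>R u z))"
  by (rule Ck_on_subset[OF Ck_convolution[OF u scaled_bump_Ck]]) simp
 then have "Ck_on k (ball x 1) (mollify ep u)" using Ck_on_cong[OF open_ball, of x 1 "mollify ep u"] ab by simp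
 then show "EX T. open T & x \<in> T & Ck_on k T (mollify ep u)" by (intro exI[of _ "ball x 1"]) auto
qed

lemma mollify_has_derivative:
 fixes u :: "real^'n::finite => 'b::euclidean_space"
 assumes u: "continuous_on UNIV u" and ep: "ep > 0"
 shows "(mollify ep u has_derivative (%v. LINT z|lborel. (dbump z v / ep) *\<^sub>R u (x - ep *\<^sub>R z))) (at x)"
proof -
 obtain a b where
  ab: "!!y. y \<in> ball x 1 ==> mollify ep u y = integral (cbox a b) (%z. (inverse (ep ^ CARD('n)) * bump ((y - z) /\<^sub>R ep)) *\<^sub>R u z)"
  "cball x ep \<subseteq> cbox a b"
  by (rule mollify_local[OF assms, where c=x]) blast
 let ?K = "%z :: real^'n. inverse (ep ^ CARD('n)) * bump (z /\<^sub>R ep)"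
 have DK: "frechet_derivative ?K (at z) v = inverse (ep ^ CARD('n)) * (dbump (z /\<^sub>R ep) v / ep)" for z v
 proof -
  have lin: "linear (dbump (z /\<^sub>R ep))" using bump_has_derivative by (rule has_derivative_linear)
  have "((%z. z /\<^sub>R ep) has_derivative (%v. v /\<^sub>R ep)) (at z)" by (auto intro!: derivative_eq_intros)
  from has_derivative_mult_right[OF has_derivative_compose[OF this bump_has_derivative], of "inverse (ep ^ CARD('n))"]
  have "(?K has_derivative (%v. inverse (ep ^ CARD('n)) * dbump (z /\<^sub>R ep) (v /\<^sub>R ep))) (at z)" .
  from frechet_derivative_at[OF this, symmetric] show ?thesis by (simp add: linear_cmul[OF lin] divide_inverse)
 qed
 have "((%y. integral (cbox a b) (%z. ?K (y - z) *\<^sub>R u z)) has_derivative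
   (%v. integral (cbox a b) (%y. frechet_derivative ?K (at (x - y)) v *\<^sub>R u y))) (at x)"
  by (rule leibniz_convolution[OF scaled_bump_Ck u])
 then have "(mollify ep u has_derivative (%v. integral (cbox a b) (%y. frechet_derivative ?K (at (x - y)) v *\<^sub>R u y))) (at x)"
  by (rule has_derivative_transform_within_open[OF _ open_ball[of x 1]]) (use ab(1) in auto)
 moreover have "integral (cbox a b) (%y. frechet_derivative ?K (at (x - y)) v *\<^sub>R u y) =
   (LINT z|lborel. (dbump z v / ep) *\<^sub>R u (x - ep *\<^sub>R z))" for v
  unfolding DK
  by (rule scaled_convolution[OF u _ _ ep ab(2), of "%z. dbump z v / ep"])
   (use ep in "auto intro!: continuous_intros dbump_continuous simp: dbump_zero")
 ultimately show ?thesis by simp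
qed

lemma mollify_lipschitz:
 fixes u :: "real^'n::finite => 'b::euclidean_space"
 assumes L: "L-lipschitz_on UNIV u"
 shows "L-lipschitz_on UNIV (mollify ep u)"
proof (rule lipschitz_onI)
 have u: "continuous_on UNIV u" using L by (rule lipschitz_on_continuous_on)
 fix x y :: "real^'n"
 have i: "integrable lborel (%z. bump z *\<^sub>R u (x - ep *\<^sub>R z))" for x
  by (intro bump_integrable_mult continuous_on_compose2[OF u] continuous_intros) auto
 have ib: "integrable lborel (%z::real^'n. bump z * (L * dist x y))"
  using bump_integrable_mult[of "%_. L * dist x y"] by simp
 have "dist (mollify ep u x) (mollify ep u y) = norm (LINT z|lborel. bump z *\<^sub>R (u (x - ep *\<^sub>R z) - u (y - ep *\<^sub>R z)))"
  unfolding mollify_def dist_norm using i by (simp add: scaleR_diff_right)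
 also have "... <= (LINT z|lborel. norm (bump z *\<^sub>R (u (x - ep *\<^sub>R z) - u (y - ep *\<^sub>R z))))"
  by (rule Bochner_Integration.integral_norm_bound)
 also have "... <= (LINT z|lborel. bump (z::real^'n) * (L * dist x y))"
 proof (rule Bochner_Integration.integral_mono)
  show "integrable lborel (%z. norm (bump z *\<^sub>R (u (x - ep *\<^sub>R z) - u (y - ep *\<^sub>R z))))"
   using i by (intro integrable_norm) (simp add: scaleR_diff_right)
  fix z
  have "norm (u (x - ep *\<^sub>R z) - u (y - ep *\<^sub>R z)) <= L * dist x y"
   using lipschitz_on_normD[OF L, of "x - ep *\<^sub>R z" "y - ep *\<^sub>R z"] by (simp add: dist_norm)
  then show "norm (bump z *\<^sub>R (u (x - ep *\<^sub>R z) - u (y - ep *\<^sub>R z))) <= bump z * (L * dist x y)"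
   by (simp add: abs_of_nonneg[OF bump_nonneg] mult_left_mono bump_nonneg)
 qed (rule ib)
 also have "... = L * dist x y" using integral_bump[where 'n='n] by simp
 finally show "dist (mollify ep u x) (mollify ep u y) <= L * dist x y" .
qed (rule lipschitz_on_nonneg[OF L])

lemma mollify_close:
 fixes u :: "real^'n::finite => 'b::euclidean_space"
 assumes L: "L-lipschitz_on UNIV u" and ep: "ep \<ge> 0"
 shows "norm (mollify ep u x - u x) <= L * ep"
proof -
 have u: "continuous_on UNIV u" using L by (rule lipschitz_on_continuous_on)
 have L0: "L \<ge> 0" by (rule lipschitz_on_nonneg[OF L])
 have i: "integrable lborel (%z. bump z *\<^sub>R u (x - ep *\<^sub>R z))"
  by (intro bump_integrable_mult continuous_on_compose2[OF u] continuous_intros) auto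
 have ib: "integrable lborel (%z::real^'n. bump z *\<^sub>R c)" for c :: "'c::euclidean_space"
  by (intro bump_integrable_mult continuous_intros)
 have "u x = (LINT z|lborel. bump (z::real^'n) *\<^sub>R u x)"
 proof -
  have "(LINT z|lborel. bump (z::real^'n) *\<^sub>R u x) = (LINT z|lborel. bump (z::real^'n)) *\<^sub>R u x"
   by (rule integral_scaleR_left) (use ib[of "1::real"] in simp)
  then show ?thesis by (simp add: integral_bump)
 qed
 then have "mollify ep u x - u x = (LINT z|lborel. bump z *\<^sub>R (u (x - ep *\<^sub>R z) - u x))"
  unfolding mollify_def using i ib[of "u x"] by (simp add: scaleR_diff_right)
 also have "norm ... <= (LINT z|lborel. norm (bump z *\<^sub>R (u (x - ep *\<^sub>R z) - u x)))"
  by (rule Bochner_Integration.integral_norm_bound)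
 also have "... <= (LINT z|lborel. bump (z::real^'n) * (L * ep))"
 proof (rule Bochner_Integration.integral_mono)
  show "integrable lborel (%z. norm (bump z *\<^sub>R (u (x - ep *\<^sub>R z) - u x)))"
   using i ib[of "u x"] by (intro integrable_norm) (simp add: scaleR_diff_right)
  show "integrable lborel (%z::real^'n. bump z * (L * ep))" using ib[of "L * ep"] by simp
  fix z :: "real^'n"
  show "norm (bump z *\<^sub>R (u (x - ep *\<^sub>R z) - u x)) <= bump z * (L * ep)"
  proof (cases "z \<in> cball 0 1")
   case True
   have "norm (u (x - ep *\<^sub>R z) - u x) <= L * (ep * norm z)"
    using lipschitz_on_normD[OF L, of "x - ep *\<^sub>R z" x] ep by simp
   also have "... <= L * (ep * 1)" using True ep L0 by (intro mult_left_mono) auto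
   finally show ?thesis by (simp add: abs_of_nonneg[OF bump_nonneg] mult_left_mono bump_nonneg)
  qed (simp add: bump_zero)
 qed
 also have "... = L * ep" using integral_bump[where 'n='n] by simp
 finally show ?thesis .
qed

text \<open>The moments of the derivative of the bump are read off from the mollification of affine functions.\<close>

lemma dbump_moments:
 fixes v :: "real^'n::finite"
 shows "(LINT z|lborel. dbump z v) = 0" "(LINT z|lborel. dbump z v * (z $ i)) = - (v $ i)"
proof -
 have lin: "linear (dbump z)" for z :: "real^'n" using bump_has_derivative by (rule has_derivative_linear)
 have "(mollify 1 (%_::real^'n. 1::real) has_derivative (%v. LINT z|lborel. (dbump z v / 1) *\<^sub>R 1)) (at 0)"
  by (intro mollify_has_derivative) auto
 moreover have "mollify 1 (%_::real^'n. 1::real) = (%_. 1)" by (simp add: fun_eq_iff mollify_def integral_bump)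
 ultimately have "((%_::real^'n. 1::real) has_derivative (%v. LINT z|lborel. dbump z v)) (at 0)" by simp
 from has_derivative_unique[OF this has_derivative_const]
 show "(LINT z|lborel. dbump z v) = 0" by meson
 have "(mollify 1 (%z::real^'n. z $ i) has_derivative (%v. LINT z|lborel. (dbump z v / 1) *\<^sub>R (0 - 1 *\<^sub>R z) $ i)) (at 0)"
  by (intro mollify_has_derivative continuous_intros) auto
 moreover have "mollify 1 (%z::real^'n. z $ i) = (%x. x $ i - (LINT z|lborel. bump (z::real^'n) * z $ i))"
 proof
  fix x :: "real^'n"
  have "integrable lborel (%z::real^'n. bump z *\<^sub>R (x $ i))" "integrable lborel (%z::real^'n. bump z *\<^sub>R (z $ i))"
   by (intro bump_integrable_mult continuous_intros)+
  then show "mollify 1 (%z. z $ i) x = x $ i - (LINT z|lborel. bump (z::real^'n) * z $ i)"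
   unfolding mollify_def using integral_bump[where 'n='n] by (simp add: right_diff_distrib)
 qed
 ultimately have "((%x. x $ i - (LINT z|lborel. bump (z::real^'n) * z $ i)) has_derivative
   (%v. LINT z|lborel. dbump z v * - (z $ i))) (at (0::real^'n))" by simp
 moreover have "((%x. x $ i - (LINT z|lborel. bump (z::real^'n) * z $ i)) has_derivative (%v. v $ i)) (at (0::real^'n))"
  by (auto intro!: derivative_eq_intros bounded_linear_imp_has_derivative bounded_linear_vec_nth)
 ultimately have "(%v. LINT z|lborel. dbump z v * - (z $ i)) = (%v. v $ i)" by (rule has_derivative_unique)
 then have "(LINT z|lborel. dbump z v * - (z $ i)) = v $ i" by meson
 then show "(LINT z|lborel. dbump z v * (z $ i)) = - (v $ i)" by simp
qed

lemma linear_axis_sum: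
 fixes D :: "real^'n::finite => 'b::real_vector"
 assumes "linear D"
 shows "D w = (\<Sum>i\<in>UNIV. w $ i *\<^sub>R D (axis i 1))"
proof -
 have "D w = D (\<Sum>i\<in>UNIV. w $ i *\<^sub>R axis i 1)" by (simp add: basis_expansion flip: scalar_mult_eq_scaleR)
 also have "... = (\<Sum>i\<in>UNIV. w $ i *\<^sub>R D (axis i 1))" by (simp add: linear_sum[OF assms] linear_cmul[OF assms])
 finally show ?thesis .
qed

lemma derivative_lipschitz_bound:
 fixes u :: "'a::real_normed_vector => 'b::real_normed_vector"
 assumes L: "L-lipschitz_on S u" "open S" "x \<in> S" and D: "(u has_derivative D) (at x)"
 shows "norm (D v) <= L * norm v"
proof -
 have lin: "linear D" using D by (rule has_derivative_linear)
 have "((%s. x + s *\<^sub>R v) has_derivative (%s. s *\<^sub>R v)) (at 0)" by (auto intro!: derivative_eq_intros)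
 moreover have "(u has_derivative D) (at (x + 0 *\<^sub>R v))" using D by simp
 ultimately have "((%s. u (x + s *\<^sub>R v)) has_derivative (%s. D (s *\<^sub>R v))) (at 0)"
  using diff_chain_at[of "%s. x + s *\<^sub>R v" "%s. s *\<^sub>R v" 0 u D] by (simp add: comp_def)
 then have lim: "((%h. norm (u (x + h *\<^sub>R v) - u x - D (h *\<^sub>R v)) / norm h) \<longlongrightarrow> 0) (at 0)"
  by (simp add: has_derivative_at)
 have "isCont (%s::real. x + s *\<^sub>R v) 0" by (intro continuous_intros)
 then have "\<forall>\<^sub>F h in at 0. x + h *\<^sub>R v \<in> S"
  using assms(2,3) unfolding isCont_def by (intro topological_tendstoD) auto
 then have "\<forall>\<^sub>F h in at 0. norm (D v) - L * norm v <= norm (u (x + h *\<^sub>R v) - u x - D (h *\<^sub>R v)) / norm h"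
  using eventually_neq_at_within[of 0 0 UNIV]
 proof eventually_elim
  case (elim h)
  then have h: "h ~= 0" by simp
  show ?case
  proof -
   have "norm (D (h *\<^sub>R v)) <= norm (u (x + h *\<^sub>R v) - u x) + norm (u (x + h *\<^sub>R v) - u x - D (h *\<^sub>R v))"
    by (metis add_diff_cancel_left' diff_add_cancel norm_minus_commute norm_triangle_sub)
   also have "norm (u (x + h *\<^sub>R v) - u x) <= L * (\<bar>h\<bar> * norm v)"
    using lipschitz_on_normD[OF L(1), of "x + h *\<^sub>R v" x] elim h assms(3) by simp
   finally have "(norm (D v) - L * norm v) * \<bar>h\<bar> <= norm (u (x + h *\<^sub>R v) - u x - D (h *\<^sub>R v))"
    by (simp add: linear_cmul[OF lin] algebra_simps)
   then show "norm (D v) - L * norm v <= norm (u (x + h *\<^sub>R v) - u x - D (h *\<^sub>R v)) / norm h"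
    using h by (simp add: pos_le_divide_eq)
  qed
 qed
 from tendsto_lowerbound[OF lim this] show ?thesis by simp
qed

text \<open>By the moments of \<open>dbump\<close> the difference to \<open>D v\<close> is an
  integral of the first order Taylor remainder of \<open>u\<close> at \<open>x\<close>, divided by
  \<open>ep j\<close>. Differentiability at the single point \<open>x\<close> makes the integrand
  tend to 0, so the derivatives converge wherever \<open>u\<close> is differentiable.\<close>

lemma mollify_derivative_tendsto:
 fixes u :: "real^'n::finite => 'b::euclidean_space"
 assumes L: "L-lipschitz_on UNIV u" and D: "(u has_derivative D) (at x)"
  and ep: "!!j. ep j > 0" "ep \<longlonglongrightarrow> 0"
 shows "(%j. frechet_derivative (mollify (ep j) u) (at x) v) \<longlonglongrightarrow> D v"
proof -
 have u: "continuous_on UNIV u" using L by (rule lipschitz_on_continuous_on)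
 have lin: "linear D" using D by (rule has_derivative_linear)
 have Dc: "continuous_on UNIV D" using has_derivative_bounded_linear[OF D] by (rule linear_continuous_on)
 let ?s = "%j z. dbump z v *\<^sub>R ((u (x - ep j *\<^sub>R z) - u x) /\<^sub>R ep j + D z)"
 have id: "integrable lborel (%z::real^'n. dbump z v *\<^sub>R c)" for c :: "'c::euclidean_space"
  by (intro dbump_integrable_mult continuous_intros)
 have DD: "(LINT z|lborel. dbump z v *\<^sub>R D z) = - D v"
 proof -
  have "(LINT z|lborel. dbump z v *\<^sub>R D z) = (LINT z|lborel. (\<Sum>i\<in>UNIV. (dbump z v * z $ i) *\<^sub>R D (axis i 1)))"
  proof (rule Bochner_Integration.integral_cong[OF refl])
   fix z
   show "dbump z v *\<^sub>R D z = (\<Sum>i\<in>UNIV. (dbump z v * z $ i) *\<^sub>R D (axis i 1))"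
    unfolding linear_axis_sum[OF lin, of z] by (simp only: scaleR_sum_right scaleR_scaleR)
  qed
  also have "... = (\<Sum>i\<in>UNIV. (LINT z|lborel. dbump z v * z $ i) *\<^sub>R D (axis i 1))"
  proof (subst Bochner_Integration.integral_sum)
   show i: "integrable lborel (%z::real^'n. (dbump z v * z $ i) *\<^sub>R D (axis i 1))" for i
   proof -
    have "integrable lborel (%z::real^'n. dbump z v *\<^sub>R (z $ i *\<^sub>R D (axis i 1)))"
     by (intro dbump_integrable_mult continuous_intros)
    then show ?thesis by simp
   qed
   have "integrable lborel (%z::real^'n. dbump z v * z $ i)" for i
   proof -
    have "integrable lborel (%z::real^'n. dbump z v *\<^sub>R (z $ i))"
     by (intro dbump_integrable_mult continuous_intros)
    then show ?thesis by simp
   qed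
   then show "(\<Sum>i\<in>UNIV. LINT z|lborel. (dbump z v * z $ i) *\<^sub>R D (axis i 1)) =
    (\<Sum>i\<in>UNIV. (LINT z|lborel. dbump z v * z $ i) *\<^sub>R D (axis i 1))"
    by (intro sum.cong refl integral_scaleR_left) auto
  qed
  also have "... = - (\<Sum>i\<in>UNIV. v $ i *\<^sub>R D (axis i 1))" by (simp add: dbump_moments(2) sum_negf)
  finally show ?thesis using linear_axis_sum[OF lin, of v] by simp
 qed
 have eq: "frechet_derivative (mollify (ep j) u) (at x) v - D v = (LINT z|lborel. ?s j z)" for j
 proof -
  have i1: "integrable lborel (%z::real^'n. dbump z v *\<^sub>R (u (x - ep j *\<^sub>R z) /\<^sub>R ep j))"
   by (intro dbump_integrable_mult continuous_intros continuous_on_compose2[OF u]) auto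
  have i2: "integrable lborel (%z::real^'n. dbump z v *\<^sub>R D z)" by (rule dbump_integrable_mult[OF Dc])
  have "?s j = (%z. dbump z v *\<^sub>R (u (x - ep j *\<^sub>R z) /\<^sub>R ep j) - dbump z v *\<^sub>R (u x /\<^sub>R ep j) + dbump z v *\<^sub>R D z)"
   by (auto simp: fun_eq_iff scaleR_add_right scaleR_diff_right)
  then have "(LINT z|lborel. ?s j z) = (LINT z|lborel. dbump z v *\<^sub>R (u (x - ep j *\<^sub>R z) /\<^sub>R ep j))
    - (LINT z|lborel. dbump (z::real^'n) v *\<^sub>R (u x /\<^sub>R ep j)) + (LINT z|lborel. dbump z v *\<^sub>R D z)"
   using i1 i2 id[of "u x /\<^sub>R ep j"] by simp
  also have "(LINT z|lborel. dbump (z::real^'n) v *\<^sub>R (u x /\<^sub>R ep j)) = 0"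
   using id[of "1::real"] dbump_moments(1)[of v] by simp
  also have "(LINT z|lborel. dbump z v *\<^sub>R (u (x - ep j *\<^sub>R z) /\<^sub>R ep j)) = frechet_derivative (mollify (ep j) u) (at x) v"
   unfolding frechet_derivative_at[OF mollify_has_derivative[OF u ep(1)], symmetric] by (simp add: divide_inverse)
  finally show ?thesis unfolding DD by simp
 qed
 \<comment> \<open>The factor \<open>dbump z v\<close> vanishes off the unit ball; on it the
   difference quotient of \<open>u\<close> and the value of \<open>D\<close> are bounded by
   \<open>L\<close> each, whence the dominating constant \<open>2 * L\<close>.\<close>
 have "(%j. LINT z|lborel. ?s j z) \<longlonglongrightarrow> (LINT z|(lborel :: (real^'n) measure). (0::'b))"
 proof (rule integral_dominated_convergence)
  have L0: "L \<ge> 0" by (rule lipschitz_on_nonneg[OF L])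
  show "integrable lborel (%z::real^'n. \<bar>dbump z v\<bar> * (2 * L))"
   using integrable_norm[OF id[of "2 * L"]] L0 by (simp add: abs_mult)
  show "(%z. ?s j z) \<in> borel_measurable lborel" for j
  proof -
   have "continuous_on UNIV (?s j)"
    by (intro continuous_intros dbump_continuous continuous_on_compose2[OF u] Dc) auto
   then show ?thesis using borel_measurable_continuous_onI by simp
  qed
  show "AE z in lborel. norm (?s j z) <= \<bar>dbump z v\<bar> * (2 * L)" for j
  proof (rule AE_I2)
   fix z :: "real^'n"
   show "norm (?s j z) <= \<bar>dbump z v\<bar> * (2 * L)"
   proof (cases "z \<in> cball 0 1")
    case True
    have "norm (u (x - ep j *\<^sub>R z) - u x) <= L * (ep j * norm z)"
     using lipschitz_on_normD[OF L, of "x - ep j *\<^sub>R z" x] ep(1)[of j] by simp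
    also have "... <= L * (ep j * 1)" using True ep(1)[of j] L0 by (intro mult_left_mono) auto
    finally have "norm ((u (x - ep j *\<^sub>R z) - u x) /\<^sub>R ep j) <= L"
     using ep(1)[of j] by (simp add: divide_inverse[symmetric] pos_divide_le_eq mult.commute[of "inverse _"])
    moreover have "norm (D z) <= L"
     using derivative_lipschitz_bound[OF L open_UNIV UNIV_I D, of z] True L0 mult_left_mono[of "norm z" 1 L] by simp
    ultimately have "norm ((u (x - ep j *\<^sub>R z) - u x) /\<^sub>R ep j + D z) <= 2 * L"
     using norm_triangle_ineq[of "(u (x - ep j *\<^sub>R z) - u x) /\<^sub>R ep j" "D z"] by linarith
    then show ?thesis by (simp add: mult_left_mono)
   qed (simp add: dbump_zero)
  qed
  show "AE z in lborel. (%j. ?s j z) \<longlonglongrightarrow> 0"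
  proof (rule AE_I2)
   fix z :: "real^'n"
   have f: "filterlim ep (at 0) sequentially"
    unfolding filterlim_at using ep by (auto simp: less_imp_neq[symmetric])
   have "((%s. norm (u (x + s *\<^sub>R - z) - u x - D (s *\<^sub>R - z)) / norm s) \<longlongrightarrow> 0) (at 0)"
   proof -
    have "((%s. x + s *\<^sub>R - z) has_derivative (%s. s *\<^sub>R - z)) (at 0)" by (auto intro!: derivative_eq_intros)
    moreover have "(u has_derivative D) (at (x + 0 *\<^sub>R - z))" using D by simp
    ultimately have "((%s. u (x + s *\<^sub>R - z)) has_derivative (%s. D (s *\<^sub>R - z))) (at 0)"
     using diff_chain_at[of "%s. x + s *\<^sub>R - z" "%s. s *\<^sub>R - z" 0 u D] by (simp add: comp_def)
    then show ?thesis by (simp add: has_derivative_at)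
   qed
   from filterlim_compose[OF this f]
   have "(%j. norm (u (x + ep j *\<^sub>R - z) - u x - D (ep j *\<^sub>R - z)) / norm (ep j)) \<longlonglongrightarrow> 0" .
   moreover have "norm (u (x + ep j *\<^sub>R - z) - u x - D (ep j *\<^sub>R - z)) / norm (ep j) =
     norm ((u (x - ep j *\<^sub>R z) - u x) /\<^sub>R ep j + D z)" for j
   proof -
    have "(u (x - ep j *\<^sub>R z) - u x) /\<^sub>R ep j + D z = (u (x + ep j *\<^sub>R - z) - u x - D (ep j *\<^sub>R - z)) /\<^sub>R ep j"
     using ep(1)[of j] by (simp add: linear_cmul[OF lin] linear_neg[OF lin] scaleR_add_right)
    then show ?thesis by (simp add: divide_inverse mult.commute)
   qed
   ultimately have "(%j. (u (x - ep j *\<^sub>R z) - u x) /\<^sub>R ep j + D z) \<longlonglongrightarrow> 0"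
    using tendsto_norm_zero_cancel by simp
   from tendsto_scaleR[OF tendsto_const this] show "(%j. ?s j z) \<longlonglongrightarrow> 0" by simp
  qed
 qed simp
 then have "(%j. frechet_derivative (mollify (ep j) u) (at x) v - D v) \<longlonglongrightarrow> 0" unfolding eq by simp
 then show ?thesis by (rule LIM_zero_cancel)
qed

text \<open>The support, the Lipschitz constant and the distance to \<open>u\<close> are all bounded
  independently of \<open>j\<close>. On the manifold these bounds become the dominating functions
  under which the functions and their gradients converge in the mean.\<close>

theorem lipschitz_smooth_approximation:
 fixes u :: "real^'n::finite => 'b::euclidean_space"
 assumes L: "L-lipschitz_on UNIV u" and K: "compact K" "K \<subseteq> W" "open W" and supp: "!!x. x ~: K ==> u x = 0"
 obtains U K' where "!!j::nat. smooth_on UNIV (U j)" "compact K'" "K' \<subseteq> W" "K \<subseteq> K'"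
  "!!j x. x ~: K' ==> U j x = 0" "!!j. L-lipschitz_on UNIV (U j)"
  "!!x. (%j. U j x) \<longlonglongrightarrow> u x" "!!j x. norm (U j x - u x) <= L"
  "!!x D v. (u has_derivative D) (at x) ==> (%j. frechet_derivative (U j) (at x) v) \<longlonglongrightarrow> D v"
proof -
 have u: "continuous_on UNIV u" using L by (rule lipschitz_on_continuous_on)
 have L0: "L \<ge> 0" by (rule lipschitz_on_nonneg[OF L])
 obtain e where e: "e > 0" "(\<Union>x\<in>K. cball x e) \<subseteq> W"
  using compact_subset_open_imp_cball_epsilon_subset[OF K(1,3,2)] by blast
 \<comment> \<open>The number \<open>e\<close> keeps the enlarged support inside \<open>W\<close>,
   and a radius of at most 1 turns the error bound \<open>L * ep j\<close> into
   \<open>L\<close>.\<close>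
 define r where "r = min e 1"
 have r: "r > 0" "r <= e" "r <= 1" unfolding r_def using e by auto
 define ep where "ep j = r / real (Suc j)" for j
 have ep: "ep j > 0" "ep j <= r" for j unfolding ep_def using r by (auto simp: divide_le_eq)
 have ep0: "ep \<longlonglongrightarrow> 0"
  using tendsto_mult[OF tendsto_const LIMSEQ_inverse_real_of_nat, of r] unfolding ep_def by (simp add: divide_inverse)
 define K' where "K' = {x + y |x y. x \<in> K & y \<in> cball 0 r}"
 show ?thesis
 proof (rule that[of "%j. mollify (ep j) u" K'])
  show "smooth_on UNIV (mollify (ep j) u)" for j by (rule mollify_smooth[OF u ep(1)])
  show "compact K'" unfolding K'_def by (intro compact_sums K compact_cball)
  show "K' \<subseteq> W"
  proof
   fix p assume "p \<in> K'"
   then obtain x y where "p = x + y" "x \<in> K" "norm y <= r" unfolding K'_def by auto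
   then have "p \<in> cball x e" using r by (simp add: dist_norm)
   then show "p \<in> W" using e `x \<in> K` by blast
  qed
  show "K \<subseteq> K'" unfolding K'_def using r by force
  show "mollify (ep j) u x = 0" if x: "x ~: K'" for j x
  proof -
   have "bump z *\<^sub>R u (x - ep j *\<^sub>R z) = 0" for z
   proof (cases "z \<in> cball 0 1")
    case True
    have "x - ep j *\<^sub>R z ~: K"
    proof
     assume k: "x - ep j *\<^sub>R z \<in> K"
     have "ep j * norm z <= r * 1" using True ep[of j] r by (intro mult_mono) auto
     then have "ep j *\<^sub>R z \<in> cball 0 r" using ep(1)[of j] by simp
     moreover have "x = (x - ep j *\<^sub>R z) + ep j *\<^sub>R z" by simp
     ultimately show False using x k unfolding K'_def by blast
    qed
    then show ?thesis using supp by simp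
   qed (simp add: bump_zero)
   then have "(%z. bump z *\<^sub>R u (x - ep j *\<^sub>R z)) = (%z. 0)" by (rule ext)
   then show ?thesis unfolding mollify_def by simp
  qed
  show "L-lipschitz_on UNIV (mollify (ep j) u)" for j by (rule mollify_lipschitz[OF L])
  have cl: "norm (mollify (ep j) u x - u x) <= L * ep j" for j x using ep(1)[of j] by (intro mollify_close[OF L]) simp
  show "(%j. mollify (ep j) u x) \<longlonglongrightarrow> u x" for x
  proof (rule LIM_zero_cancel, rule Lim_null_comparison)
   show "\<forall>\<^sub>F j in sequentially. norm (mollify (ep j) u x - u x) <= L * ep j" using cl by simp
   show "(%j. L * ep j) \<longlonglongrightarrow> 0" using tendsto_mult[OF tendsto_const ep0, of L] by simp
  qed
  show "norm (mollify (ep j) u x - u x) <= L" for j x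
   using cl[of j x] mult_left_mono[of "ep j" 1 L] ep(2)[of j] r L0 by linarith
  show "(%j. frechet_derivative (mollify (ep j) u) (at x) v) \<longlonglongrightarrow> D v" if "(u has_derivative D) (at x)" for x D v
   by (rule mollify_derivative_tendsto[OF L that ep(1) ep0])
 qed
qed

section \<open>Maps in charts\<close>

lemma Ck_on_1_loc_lip:
 fixes f :: "real^'n::finite => 'b::euclidean_space"
 assumes S: "open S" and f: "Ck_on (Suc 0) S f"
 shows "loc_lip_on S f"
 unfolding loc_lip_on_def
proof
 fix x assume "x \<in> S"
 then obtain r where r: "r > 0" "cball x r \<subseteq> S" using S open_contains_cball by blast
 let ?D = "%y. frechet_derivative f (at y)"
 have D: "(f has_derivative ?D y) (at y)" if "y \<in> S" for y by (rule Ck_on_SucD[OF f S that])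
 have "EX B. \<forall>y\<in>cball x r. norm (?D y (axis i 1)) <= B" for i
 proof -
  have "continuous_on (cball x r) (%y. ?D y (axis i 1))"
   using f by (auto intro: continuous_on_subset[OF _ r(2)])
  then have "bounded ((%y. ?D y (axis i 1)) ` cball x r)"
   by (intro compact_imp_bounded compact_continuous_image compact_cball)
  then show ?thesis unfolding bounded_iff by auto
 qed
 then obtain B where B: "!!i y. y \<in> cball x r ==> norm (?D y (axis i 1)) <= B i" by metis
 define L where "L = (\<Sum>i\<in>UNIV. \<bar>B i\<bar>)"
 have "L-lipschitz_on (ball x r) f"
 proof (rule bounded_derivative_imp_lipschitz)
  fix y assume y: "y \<in> ball x r"
  then show "(f has_derivative ?D y) (at y within ball x r)"
   using r(2) by (intro has_derivative_at_withinI[OF D]) auto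
  have "y \<in> S" using y r(2) by auto
  from has_derivative_linear[OF D[OF this]] have lin: "linear (?D y)" .
  show "onorm (?D y) <= L"
  proof (rule onorm_le)
   fix v
   have "norm (?D y v) <= (\<Sum>i\<in>UNIV. norm (v $ i *\<^sub>R ?D y (axis i 1)))"
    unfolding linear_axis_sum[OF lin, of v] by (rule norm_sum)
   also have "... <= (\<Sum>i\<in>UNIV. norm v * \<bar>B i\<bar>)"
   proof (rule sum_mono)
    fix i
    have "norm (?D y (axis i 1)) <= \<bar>B i\<bar>" using B[of y i] y by auto
    then show "norm (v $ i *\<^sub>R ?D y (axis i 1)) <= norm v * \<bar>B i\<bar>"
     using component_le_norm_cart[of v i] by (auto intro: mult_mono)
   qed
   also have "... = L * norm v" by (simp add: L_def sum_distrib_left mult.commute)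
   finally show "norm (?D y v) <= L * norm v" .
  qed
 qed (auto simp: L_def intro: sum_nonneg)
 then show "\<exists>r>0. EX L. ball x r \<subseteq> S & L-lipschitz_on (ball x r) f"
  using r by (meson ball_subset_cball order_trans)
qed

lemma jacobianI:
 fixes f :: "real^'n::finite => real^'m::finite"
 assumes "(f has_derivative (%h. M *v h)) (at x)"
 shows "jacobian f (at x) = M"
 unfolding jacobian_def using frechet_derivative_at[OF assms] by (metis matrix_of_matrix_vector_mul)

lemma has_derivative_jacobian:
 fixes f :: "real^'n::finite => real^'m::finite"
 shows "f differentiable at x ==> (f has_derivative (%h. jacobian f (at x) *v h)) (at x)"
 by (simp add: jacobian_works)

abbreviation cdom :: "('m, 'n) chart => 'm set" where "cdom \<equiv> fst"
abbreviation cmap :: "('m, 'n) chart => 'm => real^'n" where "cmap \<equiv> snd"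
abbreviation cinv :: "('m, 'n) chart => real^'n => 'm" where "cinv \<equiv> chart_inv"

definition lrep :: "('m => 'm) => ('m, 'n) chart => ('m, 'n) chart => real^'n => real^'n" where
 "lrep F c d = cmap d o F o cinv c"

definition ldom :: "('m => 'm) => ('m, 'n) chart => ('m, 'n) chart => (real^'n) set" where
 "ldom F c d = cmap c ` (cdom c Int F -` cdom d)"

definition jac :: "('m => 'm) => ('m, 'n::finite) chart => ('m, 'n) chart => 'm => real^'n^'n" where
 "jac F c d p = jacobian (lrep F c d) (at (cmap c p))"

abbreviation cod :: "('m, 'n) chart => (real^'n) set" where
 "cod c \<equiv> cmap c ` cdom c"

abbreviation mfun :: "(real^'n) set => (real^'n => 'b::topological_space) set" where
 "mfun W \<equiv> borel_measurable (lebesgue_on W)"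

locale manifold =
 fixes At :: "('m::{t2_space, second_countable_topology}, 'n::finite) chart set"
 assumes smooth_manifold: "smooth_manifold At"
begin

abbreviation "dd \<equiv> ext_deriv At"
abbreviation "cic \<equiv> covector_in_chart At"
abbreviation "mic \<equiv> metric_in_chart At"
abbreviation "LS \<equiv> lebesgue_sets At"
abbreviation "pbc \<equiv> pullback_covector At"
abbreviation "pbm \<equiv> pullback_metric At"
abbreviation "L2f \<equiv> L2_fun At"
abbreviation "L2c \<equiv> L2_cov At"
abbreviation "gc \<equiv> grad_c At"
abbreviation "Df \<equiv> differential At"

lemma is_chart: "c \<in> At ==> is_chart c"
 using smooth_manifold unfolding smooth_manifold_def by blast

lemma open_dom: "c \<in> At ==> open (cdom c)"
 and open_cod: "c \<in> At ==> open (cod c)"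
 and chart_homeo: "c \<in> At ==> homeomorphism (cdom c) (cod c) (cmap c) (cinv c)"
 using is_chart unfolding is_chart_def by blast+

lemma chart_inv_map [simp]: "c \<in> At ==> p \<in> cdom c ==> cinv c (cmap c p) = p"
 using chart_homeo by (metis homeomorphism_apply1)

lemma chart_map_inv [simp]: "c \<in> At ==> x \<in> cod c ==> cmap c (cinv c x) = x"
 using chart_homeo by (metis homeomorphism_apply2)

lemma chart_inv_in [simp]: "c \<in> At ==> x \<in> cod c ==> cinv c x \<in> cdom c"
 using chart_homeo by (auto dest: homeomorphism_image2)

lemma cont_map: "c \<in> At ==> continuous_on (cdom c) (cmap c)"
 and cont_inv: "c \<in> At ==> continuous_on (cod c) (cinv c)"
 using chart_homeo homeomorphism_cont1 homeomorphism_cont2 by blast+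

lemma chart_inj: "c \<in> At ==> inj_on (cmap c) (cdom c)"
 by (metis chart_inv_map inj_onI)

lemma open_image: "c \<in> At ==> open V ==> V \<subseteq> cdom c ==> open (cmap c ` V)"
 using homeomorphism_imp_open_map[OF chart_homeo] open_cod open_dom
 by (metis open_openin_trans open_subset openin_open_eq)

lemma open_inv_image: "c \<in> At ==> open V ==> V \<subseteq> cod c ==> open (cinv c ` V)"
 using homeomorphism_imp_open_map[OF homeomorphism_symD[OF chart_homeo]] open_cod open_dom
 by (metis open_openin_trans open_subset openin_open_eq)

lemma chart_at: "chart_at At p \<in> At" "p \<in> cdom (chart_at At p)"
proof -
 have "EX c. c \<in> At & p \<in> cdom c" using smooth_manifold unfolding smooth_manifold_def by blast
 from someI_ex[OF this] show "chart_at At p \<in> At" "p \<in> cdom (chart_at At p)"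
  unfolding chart_at_def by auto
qed

text \<open>A consequence of second countability. It is what allows null sets and measurable pieces
  found chart by chart to be united over all charts.\<close>

lemma countable_atlas: obtains C where "countable C" "C \<subseteq> At" "!!p. \<exists>c\<in>C. p \<in> cdom c"
proof -
 have op: "!!S. S \<in> cdom ` At ==> open S" using open_dom by blast
 obtain F where F: "F \<subseteq> cdom ` At" "countable F" "\<Union>F = \<Union>(cdom ` At)"
  by (rule Lindelof[OF op])
 then obtain C where C: "C \<subseteq> At" "countable C" "F = cdom ` C"
  by (metis countable_subset_image)
 have "(\<Union>c\<in>C. cdom c) = UNIV" using F(3) C(3) smooth_manifold unfolding smooth_manifold_def by simp
 then show ?thesis using that[of C] C by blast
qed

lemma transition_Ck:
 assumes "c \<in> At" "d \<in> At"
 shows "Ck_on k (cmap c ` (cdom c Int cdom d)) (cmap d o cinv c)"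
 using smooth_manifold assms unfolding smooth_manifold_def smooth_on_def by blast

lemma mem_ldom: "c \<in> At ==> x \<in> ldom F c d \<longleftrightarrow> x \<in> cod c & F (cinv c x) \<in> cdom d"
 unfolding ldom_def by force

lemma ldom_mem: "p \<in> cdom c ==> F p \<in> cdom d ==> cmap c p \<in> ldom F c d"
 unfolding ldom_def by auto

lemma lrep_map [simp]: "c \<in> At ==> p \<in> cdom c ==> lrep F c d (cmap c p) = cmap d (F p)"
 by (simp add: lrep_def)

lemma lrep_compose:
 assumes "c \<in> At" "d \<in> At" "x \<in> ldom F c d"
 shows "lrep (G o F) c e x = lrep G d e (lrep F c d x)"
 using assms by (simp add: lrep_def mem_ldom)

text \<open>In particular the domains \<open>ldom F c d\<close> are open, which makes \<open>F\<close> continuous.\<close>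

definition lip_map :: "('m => 'm) => bool" where
 "lip_map F \<longleftrightarrow> (\<forall>c\<in>At. \<forall>d\<in>At. loc_lip_on (ldom F c d) (lrep F c d))"

lemma lip_mapD: "lip_map F ==> c \<in> At ==> d \<in> At ==> loc_lip_on (ldom F c d) (lrep F c d)"
 unfolding lip_map_def by blast

lemma open_ldom: "lip_map F ==> c \<in> At ==> d \<in> At ==> open (ldom F c d)"
 using lip_mapD loc_lip_on_open by blast

text \<open>Transition maps are the local representatives of \<open>id\<close>. Changes of charts,
  for null sets, measurable sets, densities and gradients alike, thus become special cases of
  statements about maps.\<close>

lemma lip_map_id: "lip_map id"
 unfolding lip_map_def
proof (intro ballI)
 fix c d assume c: "c \<in> At" "d \<in> At"
 have "open (cmap c ` (cdom c Int cdom d))"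
  using c by (intro open_image open_Int open_dom) auto
 then show "loc_lip_on (ldom id c d) (lrep id c d)"
  using Ck_on_1_loc_lip[OF _ transition_Ck[OF c]] by (simp add: ldom_def lrep_def)
qed

lemma transition_differentiable:
 assumes "c \<in> At" "d \<in> At" "p \<in> cdom c" "p \<in> cdom d"
 shows "lrep id c d differentiable at (cmap c p)"
proof -
 have "open (cmap c ` (cdom c Int cdom d))"
  using assms by (intro open_image open_Int open_dom) auto
 from Ck_on_SucD[OF transition_Ck[OF assms(1,2), of "Suc 0"] this, of "cmap c p"]
 have "(lrep id c d has_derivative frechet_derivative (lrep id c d) (at (cmap c p))) (at (cmap c p))"
  using assms by (simp add: lrep_def)
 then show ?thesis unfolding differentiable_def by blast
qed

lemma lrep_differentiable_compose:
 assumes c: "c \<in> At" "d \<in> At" and op: "open (ldom F c d)" and p: "p \<in> cdom c" "F p \<in> cdom d"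
  and F: "lrep F c d differentiable at (cmap c p)"
  and G: "lrep G d e differentiable at (cmap d (F p))"
 shows "lrep (G o F) c e differentiable at (cmap c p)"
  "jac (G o F) c e p = jac G d e (F p) ** jac F c d p"
proof -
 have "(lrep G d e has_derivative (%h. jac G d e (F p) *v h)) (at (lrep F c d (cmap c p)))"
  using has_derivative_jacobian[OF G] c p by (simp add: jac_def)
 from diff_chain_at[OF has_derivative_jacobian[OF F] this]
 have "(lrep G d e o lrep F c d has_derivative (%h. (jac G d e (F p) ** jac F c d p) *v h)) (at (cmap c p))"
  by (simp add: comp_def jac_def matrix_vector_mul_assoc)
 then have "(lrep (G o F) c e has_derivative (%h. (jac G d e (F p) ** jac F c d p) *v h)) (at (cmap c p))"
  by (rule has_derivative_transform_within_open[OF _ op ldom_mem[where F=F, OF p]]) (use lrep_compose[OF c] in simp)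
 then show "lrep (G o F) c e differentiable at (cmap c p)"
  "jac (G o F) c e p = jac G d e (F p) ** jac F c d p"
  unfolding differentiable_def jac_def[of "G o F"] using jacobianI by blast+
qed

definition mdiff :: "('m => 'm) => 'm => bool" where
 "mdiff F p \<longleftrightarrow> lrep F (chart_at At p) (chart_at At (F p)) differentiable at (cmap (chart_at At p) p)"

lemma lrep_differentiable_change:
 assumes F: "lip_map F" and c: "c \<in> At" "d \<in> At" "c' \<in> At" "d' \<in> At"
  and p: "p \<in> cdom c" "F p \<in> cdom d" "p \<in> cdom c'" "F p \<in> cdom d'"
  and D: "lrep F c d differentiable at (cmap c p)"
 shows "lrep F c' d' differentiable at (cmap c' p)"
  "jac F c' d' p = jac id d d' (F p) ** jac F c d p ** jac id c' c p"
proof -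
 have op: "open (ldom id c' c)" by (rule open_ldom[OF lip_map_id c(3,1)])
 have 1: "lrep F c' d differentiable at (cmap c' p)" "jac F c' d p = jac F c d p ** jac id c' c p"
  using lrep_differentiable_compose[OF c(3,1) op, of p F d] p D transition_differentiable[OF c(3,1) p(3,1)] by simp_all
 show "lrep F c' d' differentiable at (cmap c' p)"
  "jac F c' d' p = jac id d d' (F p) ** jac F c d p ** jac id c' c p"
  using lrep_differentiable_compose[OF c(3,2) open_ldom[OF F c(3,2)] p(3,2) 1(1), of id d']
   transition_differentiable[OF c(2,4) p(2,4)] 1(2) by (simp_all add: matrix_mul_assoc)
qed

lemma mdiff_iff:
 assumes "lip_map F" "c \<in> At" "d \<in> At" "p \<in> cdom c" "F p \<in> cdom d"
 shows "mdiff F p \<longleftrightarrow> lrep F c d differentiable at (cmap c p)"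
 unfolding mdiff_def using lrep_differentiable_change(1)[OF assms(1)] assms chart_at by blast

lemma frame_jac: "frame At c p = jac id c (chart_at At p) p"
 by (simp add: frame_def jac_def lrep_def)

lemma differential_jac: "Df F p = jac F (chart_at At p) (chart_at At (F p)) p"
 by (simp add: differential_def jac_def lrep_def)

lemma jac_id_same: "c \<in> At ==> p \<in> cdom c ==> jac id c c p = mat 1"
proof -
 assume c: "c \<in> At" "p \<in> cdom c"
 have "((%x. x) has_derivative (%h. mat 1 *v h)) (at (cmap c p))" by simp
 then have "(lrep id c c has_derivative (%h. mat 1 *v h)) (at (cmap c p))"
  by (rule has_derivative_transform_within_open[OF _ open_cod[OF c(1)]]) (use c in "auto simp: lrep_def")
 then show ?thesis unfolding jac_def by (rule jacobianI)
qed

lemma jac_id_compose: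
 assumes c: "c \<in> At" "d \<in> At" "e \<in> At" "p \<in> cdom c" "p \<in> cdom d" "p \<in> cdom e"
 shows "jac id d e p ** jac id c d p = jac id c e p"
 using lrep_differentiable_compose(2)[OF c(1,2) open_ldom[OF lip_map_id c(1,2)], of p id e] c
  transition_differentiable[of c d p] transition_differentiable[of d e p] by simp

lemma jac_id_inverse:
 assumes "c \<in> At" "d \<in> At" "p \<in> cdom c" "p \<in> cdom d"
 shows "jac id d c p ** jac id c d p = mat 1"
 using jac_id_compose[of c d c p] jac_id_same[of c p] assms by simp

lemma frame_inverse:
 assumes "c \<in> At" "p \<in> cdom c"
 shows "jac id (chart_at At p) c p ** frame At c p = mat 1" "frame At c p ** jac id (chart_at At p) c p = mat 1"
 unfolding frame_jac using assms chart_at jac_id_inverse by auto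

lemma frame_invertible: "c \<in> At ==> p \<in> cdom c ==> invertible (frame At c p)"
 unfolding invertible_def using frame_inverse by blast

text \<open>Both products describe the images of the coordinate vectors of \<open>c\<close> under
  the differential, expressed in the chart that is selected at \<open>F p\<close>. The identity
  converts the pullback formulas between arbitrary and selected charts.\<close>

lemma frame_differential:
 assumes F: "lip_map F" and c: "c \<in> At" "d \<in> At" "p \<in> cdom c" "F p \<in> cdom d" and D: "mdiff F p"
 shows "frame At d (F p) ** jac F c d p = Df F p ** frame At c p"
proof -
 let ?a = "chart_at At p" and ?b = "chart_at At (F p)"
 have d: "lrep F ?a ?b differentiable at (cmap ?a p)" using D by (simp add: mdiff_def)
 from lrep_differentiable_change(2)[OF F chart_at(1) chart_at(1) c(1,2) chart_at(2) chart_at(2) c(3,4) d]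
 have "jac F c d p = jac id ?b d (F p) ** Df F p ** frame At c p"
  by (simp add: differential_jac frame_jac)
 then have "frame At d (F p) ** jac F c d p =
   (frame At d (F p) ** jac id ?b d (F p)) ** Df F p ** frame At c p"
  by (simp add: matrix_mul_assoc)
 then show ?thesis using frame_inverse(2)[OF c(2,4)] by (simp add: matrix_mul_lid)
qed

lemma differential_id: "Df id p = mat 1"
 unfolding differential_jac using jac_id_same[OF chart_at] by simp

lemma differential_compose:
 assumes F: "lip_map F" and D: "mdiff F p" "mdiff G (F p)"
 shows "mdiff (G o F) p" "Df (G o F) p = Df G (F p) ** Df F p"
 using lrep_differentiable_compose[OF chart_at(1) chart_at(1) open_ldom[OF F chart_at(1) chart_at(1)] chart_at(2) chart_at(2), where G=G and e="chart_at At (G (F p))"]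
  D unfolding mdiff_def differential_jac by simp_all

section \<open>Null sets\<close>

text \<open>No measure occurs, so the notion is the same for all metrics on \<open>M\<close>. By
  \<open>vol_null_iff\<close> these are the null sets of the volume of every \<open>rough\<close>
  metric.\<close>

definition nullM :: "'m set => bool" where
 "nullM N \<longleftrightarrow> (\<forall>c\<in>At. negligible (cmap c ` (N Int cdom c)))"

lemma nullM_subset: "nullM N ==> N' \<subseteq> N ==> nullM N'"
 unfolding nullM_def by (meson Int_mono image_mono negligible_subset order_refl)

lemma nullM_UN: "countable I ==> (!!i. i \<in> I ==> nullM (N i)) ==> nullM (\<Union>i\<in>I. N i)"
 unfolding nullM_def
proof
 fix c assume I: "countable I" "!!i. i \<in> I ==> \<forall>c\<in>At. negligible (cmap c ` (N i Int cdom c))" and c: "c \<in> At"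
 have "cmap c ` ((\<Union>i\<in>I. N i) Int cdom c) = (\<Union>i\<in>I. cmap c ` (N i Int cdom c))" by auto
 moreover have "negligible (\<Union>i\<in>I. cmap c ` (N i Int cdom c))"
  using I c by (intro negligible_countable_Union) auto
 ultimately show "negligible (cmap c ` ((\<Union>i\<in>I. N i) Int cdom c))" by simp
qed

lemma nullM_Un: "nullM N ==> nullM N' ==> nullM (N Un N')"
 using nullM_UN[of "{False, True}" "%b. if b then N else N'"] by (simp add: Un_commute)

lemma nullM_empty [simp]: "nullM {}"
 unfolding nullM_def by simp

lemma nullM_image:
 assumes F: "lip_map F" and N: "nullM N"
 shows "nullM (F ` N)"
 unfolding nullM_def
proof
 fix d assume d: "d \<in> At"
 obtain C where C: "countable C" "C \<subseteq> At" "!!p. \<exists>c\<in>C. p \<in> cdom c" by (rule countable_atlas) blast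
 have "negligible (lrep F c d ` (cmap c ` (N Int cdom c) Int ldom F c d))" if "c \<in> C" for c
 proof (rule loc_lip_on_negligible)
  show "loc_lip_on (ldom F c d) (lrep F c d)" using lip_mapD[OF F _ d] C that by blast
  show "negligible (cmap c ` (N Int cdom c) Int ldom F c d)"
   using N C that unfolding nullM_def by (meson Int_lower1 negligible_subset subsetD)
 qed auto
 then have "negligible (\<Union>c\<in>C. lrep F c d ` (cmap c ` (N Int cdom c) Int ldom F c d))"
  using C(1) by (intro negligible_countable_Union) auto
 then show "negligible (cmap d ` (F ` N Int cdom d))"
 proof (rule negligible_subset, intro subsetI)
  fix y assume "y \<in> cmap d ` (F ` N Int cdom d)"
  then obtain p where p: "p \<in> N" "F p \<in> cdom d" "y = cmap d (F p)" by auto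
  obtain c where c: "c \<in> C" "p \<in> cdom c" using C(3) by blast
  then have "y = lrep F c d (cmap c p)" using C(2) p by auto
  moreover have "cmap c p \<in> cmap c ` (N Int cdom c) Int ldom F c d"
   using p c ldom_mem[of p c F d] by blast
  ultimately show "y \<in> (\<Union>c\<in>C. lrep F c d ` (cmap c ` (N Int cdom c) Int ldom F c d))" using c by blast
 qed
qed

lemma nullM_not_mdiff:
 assumes F: "lip_map F"
 shows "nullM {p. ~ mdiff F p}"
 unfolding nullM_def
proof
 fix c assume c: "c \<in> At"
 obtain C where C: "countable C" "C \<subseteq> At" "!!p. \<exists>c\<in>C. p \<in> cdom c" by (rule countable_atlas) blast
 have "negligible (\<Union>d\<in>C. {x\<in>ldom F c d. ~ lrep F c d differentiable at x})"
  using C c lip_mapD[OF F c] by (intro negligible_countable_Union) (auto intro!: loc_lip_on_differentiable_ae)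
 then show "negligible (cmap c ` ({p. ~ mdiff F p} Int cdom c))"
 proof (rule negligible_subset, intro subsetI)
  fix x assume "x \<in> cmap c ` ({p. ~ mdiff F p} Int cdom c)"
  then obtain p where p: "x = cmap c p" "p \<in> cdom c" "~ mdiff F p" by auto
  obtain d where d: "d \<in> C" "F p \<in> cdom d" using C(3) by blast
  then show "x \<in> (\<Union>d\<in>C. {x\<in>ldom F c d. ~ lrep F c d differentiable at x})"
   using p mdiff_iff[OF F c _ p(2) d(2)] C(2) ldom_mem[where F=F, OF p(2) d(2)] by blast
 qed
qed

section \<open>Lebesgue measurable sets and functions\<close>

lemma lebesgue_setsD: "E \<in> LS ==> c \<in> At ==> cmap c ` (E Int cdom c) \<in> sets lebesgue"
 unfolding lebesgue_sets_def by blast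

lemma lebesgue_sets_algebra: "sigma_algebra UNIV (LS)"
 unfolding sigma_algebra_iff2
proof (intro conjI ballI allI impI)
 show "LS \<subseteq> Pow UNIV" by simp
 show "{} \<in> LS" by (simp add: lebesgue_sets_def)
 fix E assume E: "E \<in> LS"
 show "UNIV - E \<in> LS"
  unfolding lebesgue_sets_def
 proof (intro CollectI ballI)
  fix c assume c: "c \<in> At"
  have "cmap c ` ((UNIV - E) Int cdom c) = cod c - cmap c ` (E Int cdom c)"
   using chart_inj[OF c] by (auto simp: inj_on_def)
  moreover have "cod c \<in> sets lebesgue" using open_cod[OF c] by auto
  ultimately show "cmap c ` ((UNIV - E) Int cdom c) \<in> sets lebesgue"
   using lebesgue_setsD[OF E c] by auto
 qed
next
 fix E :: "nat => 'm set" assume E: "range E \<subseteq> LS"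
 show "\<Union> (range E) \<in> LS"
  unfolding lebesgue_sets_def
 proof (intro CollectI ballI)
  fix c assume c: "c \<in> At"
  have "cmap c ` (\<Union> (range E) Int cdom c) = (\<Union>i. cmap c ` (E i Int cdom c))" by auto
  moreover have "... \<in> sets lebesgue" using E lebesgue_setsD[OF _ c] by (intro sets.countable_UN) auto
  ultimately show "cmap c ` (\<Union> (range E) Int cdom c) \<in> sets lebesgue" by simp
 qed
qed

lemma open_lebesgue: "open V ==> V \<in> LS"
 unfolding lebesgue_sets_def
proof (intro CollectI ballI)
 fix c assume V: "open V" and c: "c \<in> At"
 have "open (cmap c ` (V Int cdom c))" using V open_dom[OF c] by (intro open_image[OF c]) auto
 then show "cmap c ` (V Int cdom c) \<in> sets lebesgue" by auto
qed

lemma nullM_lebesgue: "nullM N ==> N \<in> LS"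
 unfolding nullM_def lebesgue_sets_def using negligible_imp_sets by blast

text \<open>The preimage under \<open>F\<close> is the image under \<open>G\<close>, and locally
  Lipschitz maps take Lebesgue sets to Lebesgue sets. Continuity of \<open>F\<close> alone would
  settle the matter for Borel sets only.\<close>

lemma lebesgue_sets_vimage:
 assumes F: "lip_map F" "lip_map G" and inv: "!!p. G (F p) = p" "!!p. F (G p) = p" and E: "E \<in> LS"
 shows "F -` E \<in> LS"
 unfolding lebesgue_sets_def
proof (intro CollectI ballI)
 fix c assume c: "c \<in> At"
 obtain C where C: "countable C" "C \<subseteq> At" "!!p. \<exists>c\<in>C. p \<in> cdom c" by (rule countable_atlas) blast
 have "cmap c ` (F -` E Int cdom c) = (\<Union>d\<in>C. lrep G d c ` (cmap d ` (E Int cdom d) Int ldom G d c))"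
 proof (intro equalityI subsetI)
  fix x assume "x \<in> cmap c ` (F -` E Int cdom c)"
  then obtain p where p: "x = cmap c p" "F p \<in> E" "p \<in> cdom c" by auto
  obtain d where d: "d \<in> C" "F p \<in> cdom d" using C(3) by blast
  have "x = lrep G d c (cmap d (F p))" using p d C(2) inv by auto
  moreover have "cmap d (F p) \<in> cmap d ` (E Int cdom d) Int ldom G d c"
   using p d ldom_mem[of "F p" d G c] inv by auto
  ultimately show "x \<in> (\<Union>d\<in>C. lrep G d c ` (cmap d ` (E Int cdom d) Int ldom G d c))" using d by blast
 next
  fix x assume "x \<in> (\<Union>d\<in>C. lrep G d c ` (cmap d ` (E Int cdom d) Int ldom G d c))"
  then obtain d q where d: "d \<in> C" "q \<in> E" "q \<in> cdom d" "cmap d q \<in> ldom G d c" "x = lrep G d c (cmap d q)"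
   by auto
  moreover have "d \<in> At" using d(1) C(2) by blast
  ultimately have "G q \<in> cdom c" "x = cmap c (G q)" using mem_ldom[of d "cmap d q" G c] by simp_all
  then show "x \<in> cmap c ` (F -` E Int cdom c)" using d inv by auto
 qed
 also have "... \<in> sets lebesgue"
 proof (intro sets.countable_UN'' C(1))
  fix d assume "d \<in> C"
  then have d: "d \<in> At" using C by auto
  show "lrep G d c ` (cmap d ` (E Int cdom d) Int ldom G d c) \<in> sets lebesgue"
   using lebesgue_setsD[OF E d] open_ldom[OF F(2) d c]
   by (intro loc_lip_on_image_lebesgue[OF lip_mapD[OF F(2) d c]]) auto
 qed
 finally show "cmap c ` (F -` E Int cdom c) \<in> sets lebesgue" .
qed

definition lmeas :: "('m => 'b::topological_space) => bool" where
 "lmeas f \<longleftrightarrow> (\<forall>B\<in>sets borel. f -` B \<in> LS)"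

lemma lmeas_iff: "lmeas f \<longleftrightarrow> (\<forall>c\<in>At. (%x. f (cinv c x)) \<in> mfun (cod c))"
proof -
 have eq: "(%x. f (cinv c x)) -` B Int space (lebesgue_on (cod c)) = cmap c ` (f -` B Int cdom c)" if "c \<in> At" for c B
  using that by force
 have s: "cmap c ` (f -` B Int cdom c) \<in> sets (lebesgue_on (cod c)) \<longleftrightarrow> cmap c ` (f -` B Int cdom c) \<in> sets lebesgue"
  if "c \<in> At" for c B
  using open_cod[OF that] by (subst sets_restrict_space_iff) auto
 have "(%x. f (cinv c x)) \<in> mfun (cod c) \<longleftrightarrow>
   (\<forall>B\<in>sets borel. cmap c ` (f -` B Int cdom c) \<in> sets lebesgue)" if "c \<in> At" for c
  unfolding measurable_def using eq[OF that] s[OF that] by auto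
 then show ?thesis unfolding lmeas_def lebesgue_sets_def by auto
qed

lemma lmeas_compose:
 assumes "lip_map F" "lip_map G" "!!p. G (F p) = p" "!!p. F (G p) = p" "lmeas f"
 shows "lmeas (%p. f (F p))"
 unfolding lmeas_def
proof
 fix B :: "'a set" assume "B \<in> sets borel"
 then have "f -` B \<in> LS" using assms(5) unfolding lmeas_def by blast
 from lebesgue_sets_vimage[OF assms(1-4) this] show "(%p. f (F p)) -` B \<in> LS"
  by (simp add: vimage_def)
qed

end

section \<open>Measurable metrics and their volume\<close>

text \<open>Ellipticity with a lower bound for the form and an upper bound for the entries; the
  latter is the shape in which the bound enters the Leibniz formula of the determinant.\<close>

definition ell :: "real => real => real^'n::finite^'n => bool" where
 "ell l u G \<longleftrightarrow> transpose G = G & (ALL i j. \<bar>G $ i $ j\<bar> <= u) & (ALL v. l * (v \<bullet> v) <= v \<bullet> (G *v v))"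

definition posdef :: "real^'n::finite^'n => bool" where
 "posdef G \<longleftrightarrow> transpose G = G & (ALL v. v ~= 0 --> v \<bullet> (G *v v) > 0)"

lemma ell_posdef: "l > 0 ==> ell l u (G :: real^'n::finite^'n) ==> posdef G"
 unfolding ell_def posdef_def
proof (intro conjI allI impI; elim conjE)
 fix v :: "real^'n" assume "l > 0" "ALL v. l * (v \<bullet> v) <= v \<bullet> (G *v v)" "v ~= 0"
 then have "0 < l * (v \<bullet> v)" "l * (v \<bullet> v) <= v \<bullet> (G *v v)" by auto
 then show "v \<bullet> (G *v v) > 0" by (rule less_le_trans)
qed

lemma inner_transpose: "(x :: real^'n::finite) \<bullet> (transpose B *v y) = (B *v x) \<bullet> y"
 by (metis dot_lmul_matrix vector_transpose_matrix transpose_transpose)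

lemma posdef_invertible:
 assumes "posdef G"
 shows "invertible G"
proof -
 have "x = 0" if "G *v x = 0" for x
 proof (rule ccontr)
  assume "x ~= 0"
  then have "x \<bullet> (G *v x) > 0" using assms by (simp add: posdef_def)
  then show False using that by simp
 qed
 then show ?thesis by (simp add: invertible_left_inverse matrix_left_invertible_ker)
qed

lemma continuous_on_det:
 fixes M :: "'a::topological_space => real^'n::finite^'n"
 assumes "!!i j. continuous_on S (%x. M x $ i $ j)"
 shows "continuous_on S (%x. det (M x))"
 unfolding det_def
 by (intro continuous_on_sum continuous_on_mult continuous_on_const continuous_on_prod assms)

text \<open>All matrices on the segment from the identity to \<open>G\<close> are positive definite,
  hence invertible. The determinant does not vanish along the segment and equals 1 at its
  beginning.\<close>

lemma posdef_det_pos: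
 fixes G :: "real^'n::finite^'n"
 assumes G: "posdef G"
 shows "det G > 0"
proof -
 define H where "H t = (1 - t) *\<^sub>R mat 1 + t *\<^sub>R G" for t :: real
 have c: "continuous_on {0..1} (%t. det (H t))"
  unfolding H_def by (rule continuous_on_det) (auto intro!: continuous_intros)
 have nz: "det (H t) ~= 0" if t: "0 <= t" "t <= 1" for t
 proof -
  have "posdef (H t)" unfolding posdef_def
  proof (intro conjI allI impI)
   show "transpose (H t) = H t" using G unfolding H_def posdef_def
    by (simp add: transpose_def vec_eq_iff mat_def)
   fix v :: "real^'n" assume v: "v ~= 0"
   have "H t *v v = (1 - t) *\<^sub>R v + t *\<^sub>R (G *v v)"
    unfolding H_def by (simp add: matrix_vector_mult_add_rdistrib scaleR_matrix_vector_assoc[symmetric])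
   then have "v \<bullet> (H t *v v) = (1 - t) * (v \<bullet> v) + t * (v \<bullet> (G *v v))" by (simp add: inner_add_right)
   moreover have "v \<bullet> v > 0" "v \<bullet> (G *v v) > 0" using v G by (auto simp: posdef_def)
   ultimately show "v \<bullet> (H t *v v) > 0"
    using t by (cases "t = 0") (auto intro!: add_nonneg_pos)
  qed
  then show ?thesis using posdef_invertible invertible_det_nz by blast
 qed
 have H01: "det (H 0) = 1" "H 1 = G" unfolding H_def by simp_all
 show ?thesis
 proof (rule ccontr)
  assume "~ det G > 0"
  then have "det (H 1) <= 0" "0 <= det (H 0)" using H01 by auto
  then obtain t where "0 <= t" "t <= 1" "det (H t) = 0"
   using IVT2'[of "%t. det (H t)" 1 0 0] c by auto
  then show False using nz by blast
 qed
qed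

lemma ell_det_bound:
 fixes G :: "real^'n::finite^'n"
 assumes "ell l u G"
 shows "\<bar>det G\<bar> <= (\<Sum>p\<in>{p. p permutes (UNIV :: 'n set)}. u ^ CARD('n))"
proof -
 have "\<bar>det G\<bar> <= (\<Sum>p\<in>{p. p permutes (UNIV :: 'n set)}. \<bar>of_int (sign p) * (\<Prod>i\<in>UNIV. G $ i $ p i)\<bar>)"
  unfolding det_def by (rule sum_abs)
 also have "... <= (\<Sum>p\<in>{p. p permutes (UNIV :: 'n set)}. u ^ CARD('n))"
 proof (rule sum_mono)
  fix p :: "'n => 'n"
  have "\<bar>of_int (sign p) * (\<Prod>i\<in>UNIV. G $ i $ p i)\<bar> = (\<Prod>i\<in>UNIV. \<bar>G $ i $ p i\<bar>)"
   by (simp add: abs_mult abs_prod sign_def)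
  also have "... <= (\<Prod>i\<in>(UNIV :: 'n set). u)" using assms by (intro prod_mono) (auto simp: ell_def)
  finally show "\<bar>of_int (sign p) * (\<Prod>i\<in>UNIV. G $ i $ p i)\<bar> <= u ^ CARD('n)" by simp
 qed
 finally show ?thesis .
qed

lemma det_congruence: "det (transpose J ** G ** J) = (det J)\<^sup>2 * det (G :: real^'n::finite^'n)"
 by (simp add: det_mul power2_eq_square mult_ac)

lemma posdef_congruence:
 fixes G J :: "real^'n::finite^'n"
 assumes G: "posdef G" and J: "invertible J"
 shows "posdef (transpose J ** G ** J)"
 unfolding posdef_def
proof (intro conjI allI impI)
 show "transpose (transpose J ** G ** J) = transpose J ** G ** J"
  using G by (simp add: matrix_transpose_mul matrix_mul_assoc posdef_def)
 fix v :: "real^'n" assume "v ~= 0"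
 then have "J *v v ~= 0" using J by (metis invertible_left_inverse matrix_left_invertible_ker)
 moreover have "v \<bullet> ((transpose J ** G ** J) *v v) = (J *v v) \<bullet> (G *v (J *v v))"
  by (simp only: matrix_vector_mul_assoc[symmetric] inner_transpose)
 ultimately show "v \<bullet> ((transpose J ** G ** J) *v v) > 0" using G by (simp add: posdef_def)
qed

context manifold
begin

lemma lebesgue_sets_in_chart:
 assumes c: "c \<in> At" and E: "E \<subseteq> cdom c" "cmap c ` E \<in> sets lebesgue"
 shows "E \<in> LS"
 unfolding lebesgue_sets_def
proof (intro CollectI ballI)
 fix d assume d: "d \<in> At"
 have "cmap d ` (E Int cdom d) = lrep id c d ` (cmap c ` E Int ldom id c d)"
 proof (intro equalityI subsetI)
  fix y assume "y \<in> cmap d ` (E Int cdom d)"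
  then obtain p where p: "p \<in> E" "p \<in> cdom d" "y = cmap d p" by blast
  then have "y = lrep id c d (cmap c p)" "cmap c p \<in> ldom id c d"
   using E(1) c ldom_mem[of p c id d] by auto
  then show "y \<in> lrep id c d ` (cmap c ` E Int ldom id c d)" using p by blast
 next
  fix y assume "y \<in> lrep id c d ` (cmap c ` E Int ldom id c d)"
  then obtain p where p: "p \<in> E" "cmap c p \<in> ldom id c d" "y = lrep id c d (cmap c p)" by blast
  then have "p \<in> cdom c" using E by blast
  then have "p \<in> cdom d" "y = cmap d p" using p c by (auto simp: mem_ldom)
  then show "y \<in> cmap d ` (E Int cdom d)" using p by blast
 qed
 moreover have "lrep id c d ` (cmap c ` E Int ldom id c d) \<in> sets lebesgue"
  using E open_ldom[OF lip_map_id c d] by (intro loc_lip_on_image_lebesgue[OF lip_mapD[OF lip_map_id c d]]) auto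
 ultimately show "cmap d ` (E Int cdom d) \<in> sets lebesgue" by simp
qed

text \<open>A class that contains the continuous metrics and is stable under pullback by locally
  bi-Lipschitz maps (\<open>rough_pullback\<close>). Near every point the ellipticity constants are
  uniform, but they bind only almost everywhere, as a pullback metric has no meaning on a null
  set.\<close>

definition rough :: "('m => real^'n^'n) => bool" where
 "rough k \<longleftrightarrow> (\<forall>c\<in>At.
  (ALL i j. (%x. mic k c (cinv c x) $ i $ j) \<in> mfun (cod c)) &
  (\<forall>x\<in>cod c. \<exists>r>0. \<exists>l>0. EX u. ball x r \<subseteq> cod c &
    negligible {y\<in>ball x r. ~ ell l u (mic k c (cinv c y))}))"

lemma rough_measurable:
 "rough k ==> c \<in> At ==> (%x. mic k c (cinv c x) $ i $ j) \<in> mfun (cod c)"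
 unfolding rough_def by blast

lemma rough_ell:
 assumes "rough k" "c \<in> At" "x \<in> cod c"
 obtains r l u where "r > 0" "l > 0" "ball x r \<subseteq> cod c"
  "negligible {y\<in>ball x r. ~ ell l u (mic k c (cinv c y))}"
 using assms unfolding rough_def by blast

lemma rough_posdef_chart:
 assumes k: "rough k" and c: "c \<in> At"
 shows "negligible {x\<in>cod c. ~ posdef (mic k c (cinv c x))}" (is "negligible ?N")
proof -
 have "\<exists>r>0. negligible (?N Int ball x r)" if xc: "x \<in> cod c" for x
 proof -
  obtain r l u where r: "r > 0" "l > 0" "ball x r \<subseteq> cod c" "negligible {y\<in>ball x r. ~ ell l u (mic k c (cinv c y))}"
   by (rule rough_ell[OF k c xc])
  then have "negligible (?N Int ball x r)"
   by (rule_tac negligible_subset[OF r(4)]) (use ell_posdef[OF r(2)] in blast)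
  then show ?thesis using r(1) by blast
 qed
 then have "\<forall>x\<in>cod c. EX r. r > 0 & negligible (?N Int ball x r)" by blast
 from bchoice[OF this] obtain r where r: "!!x. x \<in> cod c ==> r x > 0 & negligible (?N Int ball x (r x))" by blast
 obtain X where X: "X \<subseteq> (%x. ball x (r x)) ` cod c" "countable X" "\<Union>X = (\<Union>x\<in>cod c. ball x (r x))"
  using Lindelof[of "(%x. ball x (r x)) ` cod c"] by auto
 have "negligible (\<Union>B\<in>X. ?N Int B)" using X(1,2) r by (intro negligible_countable_Union) auto
 then show ?thesis
 proof (rule negligible_subset, intro subsetI)
  fix x assume x: "x \<in> ?N"
  then have "x \<in> \<Union>X" unfolding X(3) using r by force
  then show "x \<in> (\<Union>B\<in>X. ?N Int B)" using x by blast
 qed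
qed

lemma metric_in_chart_posdef:
 assumes "c \<in> At" "p \<in> cdom c"
 shows "posdef (mic k c p) \<longleftrightarrow> posdef (k p)"
proof
 let ?B = "frame At c p" and ?B' = "jac id (chart_at At p) c p"
 have inv: "?B ** ?B' = mat 1" "?B' ** ?B = mat 1" using frame_inverse[OF assms] by auto
 show "posdef (mic k c p)" if "posdef (k p)"
  unfolding metric_in_chart_def using posdef_congruence[OF that frame_invertible[OF assms]] .
 assume pd: "posdef (mic k c p)"
 have "k p = transpose (?B ** ?B') ** k p ** (?B ** ?B')" unfolding inv by (simp add: transpose_mat)
 also have "... = transpose ?B' ** mic k c p ** ?B'"
  unfolding metric_in_chart_def by (simp add: matrix_transpose_mul matrix_mul_assoc)
 moreover have "invertible ?B'" unfolding invertible_def using inv by blast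
 ultimately show "posdef (k p)" using posdef_congruence[OF pd] by metis
qed

lemma rough_posdef:
 assumes k: "rough k"
 shows "nullM {p. ~ posdef (k p)}"
 unfolding nullM_def
proof
 fix c assume c: "c \<in> At"
 show "negligible (cmap c ` ({p. ~ posdef (k p)} Int cdom c))"
  by (rule negligible_subset[OF rough_posdef_chart[OF k c]])
   (use c metric_in_chart_posdef[OF c] in force)
qed

lemma metric_in_chart_pullback:
 assumes F: "lip_map F" and c: "c \<in> At" "d \<in> At" "p \<in> cdom c" "F p \<in> cdom d" and D: "mdiff F p"
 shows "mic (pbm F k) c p =
  transpose (jac F c d p) ** mic k d (F p) ** jac F c d p"
proof -
 have "mic (pbm F k) c p =
  transpose (Df F p ** frame At c p) ** k (F p) ** (Df F p ** frame At c p)"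
  by (simp add: metric_in_chart_def pullback_metric_def matrix_transpose_mul matrix_mul_assoc)
 also have "... = transpose (frame At d (F p) ** jac F c d p) ** k (F p) ** (frame At d (F p) ** jac F c d p)"
  unfolding frame_differential[OF F c D] ..
 also have "... = transpose (jac F c d p) ** mic k d (F p) ** jac F c d p"
  by (simp add: metric_in_chart_def matrix_transpose_mul matrix_mul_assoc)
 finally show ?thesis .
qed

lemma pullback_metric_id: "pbm id k = k"
 by (simp add: pullback_metric_def fun_eq_iff differential_id transpose_mat)

lemma continuous_metric_in_chart:
 assumes g: "continuous_metric At g" and c: "c \<in> At"
 shows "continuous_on (cod c) (%x. mic g c (cinv c x) $ i $ j)"
proof -
 have "continuous_on (cdom c) (mic g c)" using g c unfolding continuous_metric_def by blast
 then have "continuous_on (cod c) (%x. mic g c (cinv c x))"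
  by (rule continuous_on_compose2[OF _ cont_inv[OF c]]) (use c in auto)
 then show ?thesis by (intro continuous_intros)
qed

text \<open>The lower constant is the minimum of the quadratic form over the compact product of a
  closed ball and the unit sphere. Here the bounds hold at every point of the ball; this stronger
  form is required where lengths of curves are compared, since a curve is a null set in higher
  dimension.\<close>

lemma continuous_metric_ell:
 assumes g: "continuous_metric At g" and c: "c \<in> At" and x: "x \<in> cod c"
 obtains r l u where "r > 0" "l > 0" "ball x r \<subseteq> cod c" "\<forall>y\<in>ball x r. ell l u (mic g c (cinv c y))"
proof -
 let ?G = "%x. mic g c (cinv c x)"
 note Gij = continuous_metric_in_chart[OF g c]
 obtain r where r: "r > 0" "cball x r \<subseteq> cod c" using x open_cod[OF c] open_contains_cball by blast
 have pd: "posdef (?G y)" if "y \<in> cod c" for y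
  using metric_in_chart_posdef[OF c, of "cinv c y" g] g that c unfolding continuous_metric_def posdef_def by auto
 have "continuous_on (cball x r \<times> sphere 0 1) (%(y, v). v \<bullet> (?G y *v v))"
 proof -
  have "(%(y, v). v \<bullet> (?G y *v v)) = (%p. \<Sum>i\<in>UNIV. snd p $ i * (\<Sum>j\<in>UNIV. ?G (fst p) $ i $ j * snd p $ j))"
   by (auto simp: inner_vec_def matrix_vector_mult_def fun_eq_iff)
  moreover have "continuous_on (cball x r \<times> sphere 0 1) (%p. ?G (fst p) $ i $ j)" for i j
   by (rule continuous_on_compose2[OF Gij continuous_on_fst[OF continuous_on_id]]) (use r(2) in auto)
  moreover have "continuous_on (cball x r \<times> sphere 0 1) (%p. snd p $ i)" for i
   by (intro continuous_on_component continuous_on_snd continuous_on_id)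
  ultimately show ?thesis by (simp only:) (intro continuous_on_sum continuous_on_mult)
 qed
 moreover have "compact (cball x r \<times> sphere (0::real^'n) 1)" by (intro compact_Times compact_cball compact_sphere)
 moreover have "cball x r \<times> sphere (0::real^'n) 1 ~= {}" using r(1) by simp
 ultimately obtain y0 v0 where yv: "y0 \<in> cball x r" "norm v0 = 1"
  "!!y v. y \<in> cball x r ==> norm v = 1 ==> v0 \<bullet> (?G y0 *v v0) <= v \<bullet> (?G y *v v)"
  using continuous_attains_inf[of "cball x r \<times> sphere (0::real^'n) 1" "%(y, v). v \<bullet> (?G y *v v)"] by fastforce
 define l where "l = v0 \<bullet> (?G y0 *v v0)"
 have "y0 \<in> cod c" "v0 ~= 0" using yv(1,2) r(2) by auto
 then have l: "l > 0" using pd[of y0] unfolding l_def posdef_def by blast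
 have "EX u. \<forall>y\<in>cball x r. \<bar>?G y $ i $ j\<bar> <= u" for i j
 proof -
  have "bounded ((%y. ?G y $ i $ j) ` cball x r)"
   using r(2) by (intro compact_imp_bounded compact_continuous_image continuous_on_subset[OF Gij]) auto
  then show ?thesis unfolding bounded_iff by auto
 qed
 then obtain u where u: "!!i j y. y \<in> cball x r ==> \<bar>?G y $ i $ j\<bar> <= u i j" by metis
 define U where "U = (\<Sum>i\<in>UNIV. \<Sum>j\<in>UNIV. \<bar>u i j\<bar>)"
 have uU: "u i j <= U" for i j
 proof -
  have "u i j <= \<bar>u i j\<bar>" by simp
  also have "... <= (\<Sum>j\<in>UNIV. \<bar>u i j\<bar>)" by (rule member_le_sum) auto
  also have "... <= U" unfolding U_def by (rule member_le_sum) (auto intro: sum_nonneg)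
  finally show ?thesis .
 qed
 have "ell l U (?G y)" if y: "y \<in> ball x r" for y
  unfolding ell_def
 proof (intro conjI allI)
  show "transpose (?G y) = ?G y" using pd[of y] y subsetD[OF r(2), of y] unfolding posdef_def by auto
  show "\<bar>?G y $ i $ j\<bar> <= U" for i j using order_trans[OF u uU] y by simp
  fix v :: "real^'n"
  show "l * (v \<bullet> v) <= v \<bullet> (?G y *v v)"
  proof (cases "v = 0")
   case False
   define w where "w = v /\<^sub>R norm v"
   have "norm w = 1" using False by (simp add: w_def)
   have v: "v = norm v *\<^sub>R w" using False by (simp add: w_def)
   have "l <= w \<bullet> (?G y *v w)" unfolding l_def using yv(3)[of y w] y `norm w = 1` by auto
   then have "(norm v)\<^sup>2 * l <= (norm v)\<^sup>2 * (w \<bullet> (?G y *v w))" by (intro mult_left_mono) auto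
   also have "... = v \<bullet> (?G y *v v)"
    using arg_cong[OF v, of "%v. v \<bullet> (?G y *v v)"] by (simp add: matrix_vector_mult_scaleR power2_eq_square)
   finally show ?thesis by (simp add: power2_norm_eq_inner mult.commute)
  qed simp
 qed
 moreover have "ball x r \<subseteq> cod c" using r(2) ball_subset_cball by blast
 ultimately show thesis using r(1) l by (intro that[of r l U]) auto
qed

lemma continuous_metric_rough:
 assumes g: "continuous_metric At g"
 shows "rough g"
 unfolding rough_def
proof (intro ballI conjI allI)
 fix c assume c: "c \<in> At"
 let ?G = "%x. mic g c (cinv c x)"
 show "(%x. ?G x $ i $ j) \<in> mfun (cod c)" for i j
  using continuous_imp_measurable_on_sets_lebesgue[OF continuous_metric_in_chart[OF g c]] open_cod[OF c] by auto
 fix x assume x: "x \<in> cod c"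
 obtain r l u where r: "r > 0" "l > 0" "ball x r \<subseteq> cod c" "\<forall>y\<in>ball x r. ell l u (?G y)"
  by (rule continuous_metric_ell[OF g c x])
 have "{y\<in>ball x r. ~ ell l u (?G y)} = {}" using r(4) by blast
 then have "negligible {y\<in>ball x r. ~ ell l u (?G y)}" by (simp only: negligible_empty)
 then show "\<exists>r>0. \<exists>l>0. EX u. ball x r \<subseteq> cod c & negligible {y\<in>ball x r. ~ ell l u (?G y)}"
  using r(1-3) by blast
qed

definition dens :: "('m => real^'n^'n) => ('m, 'n) chart => real^'n => ennreal" where
 "dens k c x = ennreal (sqrt (det (mic k c (cinv c x))))"

lemma sqrt_det_measurable:
 assumes "rough k" "c \<in> At"
 shows "(%x. sqrt (det (mic k c (cinv c x)))) \<in> mfun (cod c)"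
 unfolding det_def using rough_measurable[OF assms]
 by (intro measurable_compose[OF _ borel_measurable_sqrt] borel_measurable_sum borel_measurable_times borel_measurable_const borel_measurable_prod)

lemma dens_measurable:
 assumes "rough k" "c \<in> At"
 shows "(%x. dens k c x * indicator (cod c) x) \<in> borel_measurable lebesgue"
proof -
 have "dens k c \<in> mfun (cod c)"
  unfolding dens_def[abs_def] using sqrt_det_measurable[OF assms] by measurable
 then show ?thesis
  using open_cod[OF assms(2)] by (subst (asm) borel_measurable_restrict_space_iff_ennreal) auto
qed

text \<open>The Jacobian in the area formula is absorbed by the density, since a congruence by
  \<open>J\<close> multiplies the determinant by the square of \<open>det J\<close>. The case in
  which \<open>F\<close> is the identity shows that the density defines the same measure in every
  chart.\<close>

lemma vol_change:
 assumes F: "lip_map F" "lip_map G" and inv: "!!p. G (F p) = p" "!!p. F (G p) = p"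
  and k: "rough k" and c: "c \<in> At" "d \<in> At"
  and eq: "nullM {p. k' p ~= pbm F k p}"
  and E: "E \<in> LS" "E \<subseteq> cdom c" "F ` E \<subseteq> cdom d"
 shows "(\<integral>\<^sup>+y\<in>cmap d ` F ` E. dens k d y \<partial>lebesgue) = (\<integral>\<^sup>+x\<in>cmap c ` E. dens k' c x \<partial>lebesgue)"
proof -
 let ?f = "lrep F c d" and ?W = "ldom F c d" and ?f' = "lrep G d c"
 have fW: "?f ` ?W = ldom G d c"
 proof (intro equalityI subsetI)
  fix y assume "y \<in> ?f ` ?W"
  then obtain p where "p \<in> cdom c" "F p \<in> cdom d" "y = cmap d (F p)"
   using c unfolding ldom_def by auto
  then show "y \<in> ldom G d c" using ldom_mem[of "F p" d G c] inv by auto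
 next
  fix y assume "y \<in> ldom G d c"
  then obtain q where q: "q \<in> cdom d" "G q \<in> cdom c" "y = cmap d q" unfolding ldom_def by auto
  then have "y = ?f (cmap c (G q))" "cmap c (G q) \<in> ?W"
   using c inv ldom_mem[of "G q" c F d] by auto
  then show "y \<in> ?f ` ?W" by blast
 qed
 have f'f: "?f' (?f x) = x" if "x \<in> ?W" for x
  using that c inv by (auto simp: mem_ldom lrep_def)
 have E': "cmap c ` E \<in> sets lebesgue" "cmap c ` E \<subseteq> ?W"
  using lebesgue_setsD[OF E(1) c(1)] E(2,3) ldom_mem[where F=F and c=c and d=d]
  by (simp add: Int_absorb2, blast)
 have img: "?f ` cmap c ` E = cmap d ` F ` E"
  using E(2) c(1) by (force simp: image_image)
 let ?h = "%y. sqrt (det (mic k d (cinv d y)))"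
 have h: "?h \<in> borel_measurable (lebesgue_on (?f ` ?W))"
  unfolding fW by (rule measurable_restrict_mono[OF sqrt_det_measurable[OF k c(2)]]) (auto simp: ldom_def)
 have "(\<integral>\<^sup>+y\<in>?f ` cmap c ` E. ennreal (?h y) \<partial>lebesgue) =
   (\<integral>\<^sup>+x\<in>cmap c ` E. ennreal (?h (?f x)) * ennreal \<bar>det (jacobian ?f (at x))\<bar> \<partial>lebesgue)"
  by (rule nn_integral_loc_lip_image[OF lip_mapD[OF F(1) c] _ f'f E' h])
   (unfold fW, rule lip_mapD[OF F(2) c(2,1)])
 also have "... = (\<integral>\<^sup>+x\<in>cmap c ` E. dens k' c x \<partial>lebesgue)"
 proof (rule nn_integral_cong_AE)
  have "nullM ({p. ~ mdiff F p} Un {p. k' p ~= pbm F k p})" (is "nullM ?N")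
   by (intro nullM_Un nullM_not_mdiff F eq)
  then have "negligible (cmap c ` (?N Int cdom c))" using c unfolding nullM_def by blast
  then have "AE x in lebesgue. x ~: cmap c ` (?N Int cdom c)"
   by (auto simp: negligible_iff_null_sets dest: AE_not_in)
  then show "AE x in lebesgue. ennreal (?h (?f x)) * ennreal \<bar>det (jacobian ?f (at x))\<bar> * indicator (cmap c ` E) x =
    dens k' c x * indicator (cmap c ` E) x"
  proof eventually_elim
   case (elim x)
   show ?case
   proof (cases "x \<in> cmap c ` E")
    case True
    then obtain p where p: "p \<in> E" "x = cmap c p" by blast
    have pc: "p \<in> cdom c" "F p \<in> cdom d" using E p by auto
    then have "mdiff F p" "k' p = pbm F k p" using elim p by auto
    then have "mic k' c p = transpose (jac F c d p) ** mic k d (F p) ** jac F c d p"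
     using metric_in_chart_pullback[OF F(1) c pc, of k] by (simp add: metric_in_chart_def)
    then have "sqrt (det (mic k' c p)) = \<bar>det (jac F c d p)\<bar> * sqrt (det (mic k d (F p)))"
     by (simp add: det_congruence real_sqrt_mult)
    then have "dens k' c x = ennreal (\<bar>det (jac F c d p)\<bar> * sqrt (det (mic k d (F p))))"
     using p pc c by (simp add: dens_def)
    also have "... = ennreal \<bar>det (jac F c d p)\<bar> * ennreal (sqrt (det (mic k d (F p))))"
     by (rule ennreal_mult') simp
    finally show ?thesis using p pc c by (simp add: jac_def mult.commute)
   qed simp
  qed
 qed
 finally show ?thesis unfolding img dens_def .
qed

lemma bilip_jac_inverse:
 assumes F: "lip_map F" and inv: "!!p. G (F p) = p"
  and c: "c \<in> At" "d \<in> At" "p \<in> cdom c" "F p \<in> cdom d"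
  and D: "lrep F c d differentiable at (cmap c p)" "lrep G d c differentiable at (cmap d (F p))"
 shows "jac G d c (F p) ** jac F c d p = mat 1"
proof -
 have "G o F = id" using inv by auto
 then show ?thesis
  using lrep_differentiable_compose(2)[OF c(1,2) open_ldom[OF F c(1,2)] c(3,4) D] jac_id_same[OF c(1,3)] by simp
qed

text \<open>The bound on \<open>J\<close> yields the bound on the entries, the bound on its inverse
  \<open>J'\<close> yields the lower bound for the form. The summand 1 keeps the denominator
  positive.\<close>

lemma ell_congruence:
 fixes J J' K :: "real^'n^'n"
 assumes K: "ell l u K" "l > 0" and J: "!!v. norm (J *v v) <= L * norm v" and J': "!!v. norm (J' *v v) <= L' * norm v"
  and inv: "J' ** J = mat 1"
 shows "ell (l / (L'\<^sup>2 + 1)) (\<Sum>i\<in>(UNIV::'n set). \<Sum>j\<in>(UNIV::'n set). L * u * L) (transpose J ** K ** J)"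
proof -
 have q: "a \<bullet> ((transpose J ** K ** J) *v b) = (J *v a) \<bullet> (K *v (J *v b))" for a b
  by (simp only: matrix_vector_mul_assoc[symmetric] inner_transpose)
 show ?thesis unfolding ell_def
 proof (intro conjI allI)
  show "transpose (transpose J ** K ** J) = transpose J ** K ** J"
   using K by (simp add: matrix_transpose_mul matrix_mul_assoc ell_def)
  fix i j :: 'n
  let ?a = "J *v axis i 1" and ?b = "J *v axis j 1"
  have ab: "\<bar>?a $ k\<bar> <= L" "\<bar>?b $ k\<bar> <= L" for k
   using J[of "axis i 1"] J[of "axis j 1"] component_le_norm_cart[of ?a k] component_le_norm_cart[of ?b k] by simp_all
  have L: "0 <= L" using ab[of undefined] by linarith
  have "(transpose J ** K ** J) $ i $ j = axis i 1 \<bullet> ((transpose J ** K ** J) *v axis j 1)"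
   by (simp add: inner_axis' matrix_vector_mult_basis column_def)
  also have "... = (\<Sum>k\<in>UNIV. \<Sum>m\<in>UNIV. ?a $ k * (K $ k $ m * ?b $ m))"
   unfolding q by (simp add: inner_vec_def matrix_vector_mult_def[of K] sum_distrib_left)
  finally have "\<bar>(transpose J ** K ** J) $ i $ j\<bar> <= (\<Sum>k\<in>UNIV. \<Sum>m\<in>UNIV. \<bar>?a $ k * (K $ k $ m * ?b $ m)\<bar>)"
   by (simp only:) (rule order_trans[OF sum_abs], rule sum_mono, rule sum_abs)
  also have "... <= (\<Sum>k\<in>(UNIV::'n set). \<Sum>m\<in>(UNIV::'n set). L * u * L)"
  proof (intro sum_mono)
   fix k m
   have "\<bar>K $ k $ m\<bar> <= u" using K by (auto simp: ell_def)
   then have "\<bar>?a $ k\<bar> * (\<bar>K $ k $ m\<bar> * \<bar>?b $ m\<bar>) <= L * (u * L)"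
    using ab L by (intro mult_mono) auto
   then show "\<bar>?a $ k * (K $ k $ m * ?b $ m)\<bar> <= L * u * L" by (simp add: abs_mult mult.assoc)
  qed
  finally show "\<bar>(transpose J ** K ** J) $ i $ j\<bar> <= (\<Sum>i\<in>(UNIV::'n set). \<Sum>j\<in>(UNIV::'n set). L * u * L)" .
 next
  fix v :: "real^'n"
  have "v = J' *v (J *v v)" by (simp add: matrix_vector_mul_assoc inv)
  then have "norm v <= L' * norm (J *v v)" using J'[of "J *v v"] by simp
  then have "(norm v)\<^sup>2 <= L'\<^sup>2 * (norm (J *v v))\<^sup>2"
   using power_mono[of "norm v" "L' * norm (J *v v)" 2] by (simp add: power_mult_distrib)
  also have "... <= (L'\<^sup>2 + 1) * (norm (J *v v))\<^sup>2" by (simp add: algebra_simps)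
  finally have "l * (norm v)\<^sup>2 <= l * ((L'\<^sup>2 + 1) * (norm (J *v v))\<^sup>2)" using K(2) by (intro mult_left_mono) auto
  then have "l / (L'\<^sup>2 + 1) * (norm v)\<^sup>2 <= l * (norm (J *v v))\<^sup>2"
   by (simp add: pos_divide_le_eq add_nonneg_pos mult_ac)
  also have "... <= (J *v v) \<bullet> (K *v (J *v v))" using K(1) by (simp add: ell_def power2_norm_eq_inner)
  finally show "l / (L'\<^sup>2 + 1) * (v \<bullet> v) <= v \<bullet> ((transpose J ** K ** J) *v v)"
   unfolding q by (simp add: power2_norm_eq_inner)
 qed
qed

lemma lmeas_extend:
 assumes d: "d \<in> At" and h: "(%x. h (cinv d x)) \<in> mfun (cod d)"
 shows "lmeas (%q. if q \<in> cdom d then h q else (0::'b::real_normed_vector))"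
 unfolding lmeas_def
proof
 interpret sigma_algebra UNIV "LS" by (rule lebesgue_sets_algebra)
 fix B :: "'b set" assume B: "B \<in> sets borel"
 have "cmap d ` (h -` B Int cdom d) = (%x. h (cinv d x)) -` B Int space (lebesgue_on (cod d))"
  using d by force
 also have "... \<in> sets (lebesgue_on (cod d))" by (rule measurable_sets[OF h B])
 finally have "h -` B Int cdom d \<in> LS"
  using open_cod[OF d] by (intro lebesgue_sets_in_chart[OF d]) (auto simp: sets_restrict_space_iff)
 moreover have "(if 0 \<in> B then UNIV - cdom d else {}) \<in> LS"
  using open_lebesgue[OF open_dom[OF d]] by auto
 moreover have "(%q. if q \<in> cdom d then h q else 0) -` B =
   (h -` B Int cdom d) Un (if 0 \<in> B then UNIV - cdom d else {})"
  by (intro set_eqI) (simp add: if_distrib[of "%x. x \<in> B"])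
 ultimately show "(%q. if q \<in> cdom d then h q else 0) -` B \<in> LS" by auto
qed

text \<open>Formulas for pullbacks involve a chart around the image point. The sets on which one
  target chart can be used are open, and countably many of them cover the source chart.\<close>

lemma measurable_pieces:
 assumes F: "lip_map F" and c: "c \<in> At"
  and f: "!!d. d \<in> At ==> f \<in> mfun (ldom F c d)"
 shows "f \<in> mfun (cod c)"
proof -
 obtain C where C: "countable C" "C \<subseteq> At" "!!p. \<exists>c\<in>C. p \<in> cdom c" by (rule countable_atlas) blast
 show ?thesis
 proof (rule measurable_piecewise_restrict[of "ldom F c ` C"])
  show "countable (ldom F c ` C)" using C by auto
  show "space (lebesgue_on (cod c)) \<subseteq> \<Union> (ldom F c ` C)" using C(3) by (force simp: ldom_def)
  fix W assume "W \<in> ldom F c ` C"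
  then obtain d where d: "d \<in> At" "W = ldom F c d" using C by auto
  have W: "W \<subseteq> cod c" "open W" using d open_ldom[OF F c d(1)] by (auto simp: ldom_def)
  then show "W Int space (lebesgue_on (cod c)) \<in> sets (lebesgue_on (cod c))"
   using open_cod[OF c] by (auto simp: sets_restrict_space_iff)
  show "f \<in> borel_measurable (restrict_space (lebesgue_on (cod c)) W)"
   using f[OF d(1)] W open_cod[OF c] d(2) by (simp add: restrict_restrict_space Int_absorb1)
 qed
qed

lemma jac_measurable:
 assumes F: "lip_map F" and c: "c \<in> At" "d \<in> At"
 shows "(%x. jac F c d (cinv c x) $ i $ j) \<in> mfun (ldom F c d)"
proof -
 have "(%x. frechet_derivative (lrep F c d) (at x) (axis j 1)) \<in> mfun (ldom F c d)"
  by (rule frechet_derivative_measurable[OF lip_mapD[OF F c]])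
 then have "(%x. frechet_derivative (lrep F c d) (at x) (axis j 1) $ i) \<in> mfun (ldom F c d)"
  by (rule borel_measurable_vec_nth)
 then show ?thesis
  by (rule measurable_cong[THEN iffD1, rotated]) (use c in "auto simp: ldom_def jac_def jacobian_def matrix_def")
qed

lemma nullM_lebesgue_AE:
 assumes N: "nullM N" and c: "c \<in> At"
 shows "AE x in lebesgue. x \<in> cod c --> cinv c x ~: N"
proof -
 have "negligible (cmap c ` (N Int cdom c))" using N c unfolding nullM_def by blast
 then have "AE x in lebesgue. x ~: cmap c ` (N Int cdom c)"
  by (auto simp: negligible_iff_null_sets dest: AE_not_in)
 then show ?thesis by eventually_elim (use c in force)
qed

text \<open>Lipschitz constants of the representatives of \<open>F\<close> and \<open>G\<close>
  bound the Jacobian and its inverse, which \<open>ell_congruence\<close> turns into ellipticity of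
  the pullback. The points at which \<open>k\<close> fails to be elliptic are carried back by
  \<open>G\<close> and remain null.\<close>

lemma rough_pullback:
 assumes F: "lip_map F" "lip_map G" and inv: "!!p. G (F p) = p" "!!p. F (G p) = p" and k: "rough k"
 shows "rough (pbm F k)"
 unfolding rough_def
proof (intro ballI conjI allI)
 fix c assume c: "c \<in> At"
 let ?K = "%x. mic (pbm F k) c (cinv c x)"
 \<comment> \<open>Differentiability of \<open>G\<close> at the image point is required too: only
   then the two Jacobians are inverse to each other.\<close>
 define N where "N = {p. ~ mdiff F p} Un {p. ~ mdiff G (F p)}"
 have "{p. ~ mdiff G (F p)} = G ` {q. ~ mdiff G q}"
 proof (intro equalityI subsetI)
  fix p assume "p \<in> {p. ~ mdiff G (F p)}"
  then show "p \<in> G ` {q. ~ mdiff G q}" using inv(1)[of p] by (intro image_eqI[of _ _ "F p"]) auto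
 qed (use inv in auto)
 then have N: "nullM N" unfolding N_def using F by (auto intro!: nullM_Un nullM_not_mdiff nullM_image)
 have K: "?K x = transpose (jac F c d (cinv c x)) ** mic k d (F (cinv c x)) ** jac F c d (cinv c x)"
  if "d \<in> At" "x \<in> ldom F c d" "cinv c x ~: N" for d x
  using that c by (intro metric_in_chart_pullback F) (auto simp: mem_ldom N_def)
 show "(%x. ?K x $ i $ j) \<in> mfun (cod c)" for i j
 proof (rule measurable_pieces[OF F(1) c])
  fix d assume d: "d \<in> At"
  let ?J = "%x. jac F c d (cinv c x)" and ?M = "%x. mic k d (F (cinv c x))"
  have "(%x. ?M x $ a $ b) \<in> mfun (ldom F c d)" for a b
  proof -
   have "lmeas (%q. if F q \<in> cdom d then mic k d (F q) $ a $ b else 0)"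
    using lmeas_compose[OF F inv lmeas_extend[OF d rough_measurable[OF k d, of a b]]] .
   then have "(%x. if F (cinv c x) \<in> cdom d then ?M x $ a $ b else 0) \<in> mfun (cod c)"
    using c unfolding lmeas_iff by blast
   then have "(%x. if F (cinv c x) \<in> cdom d then ?M x $ a $ b else 0) \<in> mfun (ldom F c d)"
    by (rule measurable_restrict_mono) (auto simp: ldom_def)
   then show ?thesis by (rule measurable_cong[THEN iffD1, rotated]) (use c in "auto simp: ldom_def")
  qed
  then have m: "(%x. (transpose (?J x) ** ?M x ** ?J x) $ i $ j) \<in> mfun (ldom F c d)"
   unfolding matrix_matrix_mult_def transpose_def using jac_measurable[OF F(1) c d] by simp
  have "negligible {x\<in>ldom F c d. (transpose (?J x) ** ?M x ** ?J x) $ i $ j ~= ?K x $ i $ j}"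
  proof (rule negligible_subset)
   show "negligible (cmap c ` (N Int cdom c))" using N c unfolding nullM_def by blast
   show "{x\<in>ldom F c d. (transpose (?J x) ** ?M x ** ?J x) $ i $ j ~= ?K x $ i $ j} \<subseteq> cmap c ` (N Int cdom c)"
    using K[OF d] c by (force simp: mem_ldom)
  qed
  moreover have "ldom F c d \<in> sets lebesgue" using open_ldom[OF F(1) c d] by simp
  ultimately show "(%x. ?K x $ i $ j) \<in> mfun (ldom F c d)"
   using m by (intro lebesgue_on_measurable_AE_cong[OF m])
 qed
 fix x assume x: "x \<in> cod c"
 define d where "d = chart_at At (F (cinv c x))"
 have d: "d \<in> At" "F (cinv c x) \<in> cdom d" unfolding d_def by (rule chart_at)+
 let ?f = "lrep F c d" and ?f' = "lrep G d c"
 have x': "x \<in> ldom F c d" using c x d by (auto simp: mem_ldom)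
 obtain r1 L where r1: "r1 > 0" "ball x r1 \<subseteq> ldom F c d" "L-lipschitz_on (ball x r1) ?f"
  by (rule loc_lip_onE[OF lip_mapD[OF F(1) c d(1)] x'])
 have fx: "?f x = cmap d (F (cinv c x))" by (simp add: lrep_def)
 then have y': "?f x \<in> ldom G d c" using d c x inv ldom_mem[of "F (cinv c x)" d G c] by simp
 obtain r2 L' where r2: "r2 > 0" "ball (?f x) r2 \<subseteq> ldom G d c" "L'-lipschitz_on (ball (?f x) r2) ?f'"
  by (rule loc_lip_onE[OF lip_mapD[OF F(2) d(1) c] y'])
 have "?f x \<in> cod d" unfolding fx using d by auto
 then obtain r3 l u where r3: "r3 > 0" "l > 0" "ball (?f x) r3 \<subseteq> cod d"
  "negligible {y\<in>ball (?f x) r3. ~ ell l u (mic k d (cinv d y))}" (is "negligible ?Y")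
  by (rule rough_ell[OF k d(1)])
 have L: "L \<ge> 0" by (rule lipschitz_on_nonneg[OF r1(3)])
 define r where "r = min r1 (min r2 r3 / (L + 1))"
 have r: "r > 0" "r <= r1" "L * r < min r2 r3"
 proof -
  show "r > 0" "r <= r1" using r1 r2 r3 L by (auto simp: r_def)
  have "r <= min r2 r3 / (L + 1)" by (simp add: r_def)
  then have "r * (L + 1) <= min r2 r3" using L by (simp add: pos_le_divide_eq)
  then show "L * r < min r2 r3" using `r > 0` by (simp add: algebra_simps)
 qed
 have fb: "?f z \<in> ball (?f x) (min r2 r3)" if "z \<in> ball x r" for z
 proof -
  have "dist (?f x) (?f z) <= L * dist x z" using that r r1(1) by (intro lipschitz_onD[OF r1(3)]) auto
  also have "... <= L * r" using that L by (intro mult_left_mono) auto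
  finally show ?thesis using r(3) by (simp only: mem_ball)
 qed
 have nY: "negligible (?f' ` (?Y Int ball (?f x) r2))"
  by (rule loc_lip_on_negligible[OF loc_lip_on_subset[OF lip_mapD[OF F(2) d(1) c] open_ball r2(2)]])
   (auto intro: negligible_subset[OF r3(4)])
 have neg: "negligible (?f' ` (?Y Int ball (?f x) r2) Un cmap c ` (N Int cdom c))"
  using nY N c unfolding nullM_def by (intro negligible_Un) auto
 let ?u = "\<Sum>i\<in>(UNIV::'n set). \<Sum>j\<in>(UNIV::'n set). L * u * L"
 have "ell (l / (L'\<^sup>2 + 1)) ?u (?K z)"
  if z: "z \<in> ball x r" "z ~: ?f' ` (?Y Int ball (?f x) r2) Un cmap c ` (N Int cdom c)" for z
 proof -
  have z': "z \<in> ldom F c d" using z r r1 by auto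
  let ?p = "cinv c z"
  have p: "?p \<in> cdom c" "F ?p \<in> cdom d" "cmap c ?p = z" using z' c by (auto simp: mem_ldom)
  have fz: "?f z = cmap d (F ?p)" by (simp add: lrep_def)
  have pN: "?p ~: N" using z(2) p by force
  have ff: "?f' (?f z) = z" using p d inv unfolding fz by simp
  have "?f z ~: ?Y Int ball (?f x) r2"
  proof
   assume "?f z \<in> ?Y Int ball (?f x) r2"
   from imageI[OF this, of ?f'] have "z \<in> ?f' ` (?Y Int ball (?f x) r2)" unfolding ff .
   then show False using z(2) by blast
  qed
  then have e: "ell l u (mic k d (F ?p))" using fb[OF z(1)] p d unfolding fz by simp
  have D: "?f differentiable at z" "?f' differentiable at (?f z)"
   using pN mdiff_iff[OF F(1) c d(1) p(1,2)] mdiff_iff[OF F(2) d(1) c p(2)] inv p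
   unfolding N_def fz by auto
  have J: "norm (jac F c d ?p *v v) <= L * norm v" for v
   by (rule derivative_lipschitz_bound[OF r1(3) open_ball _ _])
    (use has_derivative_jacobian[OF D(1)] z r p in "auto simp: jac_def")
  have J': "norm (jac G d c (F ?p) *v v) <= L' * norm v" for v
   by (rule derivative_lipschitz_bound[OF r2(3) open_ball, of "?f z"])
    (use has_derivative_jacobian[OF D(2)] fb[OF z(1)] fz in "auto simp: jac_def")
  have "jac G d c (F ?p) ** jac F c d ?p = mat 1"
   using D unfolding fz by (intro bilip_jac_inverse F inv c d p) (auto simp: p)
  from ell_congruence[OF e r3(2) J J' this] show ?thesis using K[OF d(1) z' pN] by simp
 qed
 then have "negligible {z\<in>ball x r. ~ ell (l / (L'\<^sup>2 + 1)) ?u (?K z)}"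
  by (rule_tac negligible_subset[OF neg]) blast
 moreover have "l / (L'\<^sup>2 + 1) > 0" using r3 by (simp add: add_nonneg_pos)
 moreover have "ball x r \<subseteq> cod c"
  using r1(2) subset_ball[OF r(2), of x] mem_ldom[OF c, of _ F d] by blast
 ultimately show "\<exists>r>0. \<exists>l>0. EX u. ball x r \<subseteq> cod c & negligible {y\<in>ball x r. ~ ell l u (?K y)}"
  using r(1) by blast
qed

end

section \<open>Existence, uniqueness and transformation of the volume measure\<close>

context manifold
begin

text \<open>The property by which the definite description in \<open>vol\<close> selects the
  measure.\<close>

definition is_vol :: "('m => real^'n^'n) => 'm measure => bool" where
 "is_vol k \<mu> \<longleftrightarrow> space \<mu> = UNIV & sets \<mu> = LS &
  (\<forall>c\<in>At. \<forall>E\<in>LS. E \<subseteq> cdom c --> emeasure \<mu> E = (\<integral>\<^sup>+x\<in>cmap c ` E. dens k c x \<partial>lebesgue))"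

text \<open>Once the countable cover is made disjoint, both measures are sums over its pieces;
  finiteness does not enter.\<close>

lemma measure_eq_locally:
 assumes s: "sets \<mu> = LS" "sets \<nu> = LS" and I: "countable I"
  and W: "!!i. i \<in> I ==> W i \<in> LS" "(\<Union>i\<in>I. W i) = UNIV"
  and eq: "!!i E. i \<in> I ==> E \<in> LS ==> E \<subseteq> W i ==> emeasure \<mu> E = emeasure \<nu> E"
 shows "\<mu> = \<nu>"
proof (rule measure_eqI)
 show "sets \<mu> = sets \<nu>" using s by simp
 fix E assume E: "E \<in> sets \<mu>"
 have ne: "I ~= {}" using W(2) by auto
 define V where "V n = W (from_nat_into I n)" for n :: nat
 have V: "range V \<subseteq> sets \<mu>" "range V \<subseteq> sets \<nu>"
  using W(1) from_nat_into[OF ne] s by (auto simp: V_def)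
 then have dV: "range (disjointed V) \<subseteq> sets \<mu>" "range (disjointed V) \<subseteq> sets \<nu>"
  by (auto intro: sets.range_disjointed_sets[THEN subsetD] simp: image_subset_iff)
 have "(\<Union>n. V n) = UNIV" using W(2) range_from_nat_into[OF ne I] unfolding V_def by (metis image_image)
 then have u: "(\<Union>n. E Int disjointed V n) = E" by (simp add: UN_disjointed_eq flip: Int_UN_distrib)
 have dj: "disjoint_family (%n. E Int disjointed V n)"
  using disjoint_family_disjointed[of V] by (auto simp: disjoint_family_on_def)
 have m: "range (%n. E Int disjointed V n) \<subseteq> sets \<mu>" "range (%n. E Int disjointed V n) \<subseteq> sets \<nu>"
  using sets.Int[OF E, of "disjointed V _"] dV s by (auto simp: image_subset_iff)
 have "emeasure \<mu> E = (\<Sum>n. emeasure \<mu> (E Int disjointed V n))"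
  using suminf_emeasure[OF m(1) dj] u by simp
 also have "... = (\<Sum>n. emeasure \<nu> (E Int disjointed V n))"
 proof (rule suminf_cong)
  fix n
  have "disjointed V n \<subseteq> W (from_nat_into I n)" using disjointed_subset[of V n] by (simp add: V_def)
  then show "emeasure \<mu> (E Int disjointed V n) = emeasure \<nu> (E Int disjointed V n)"
   using m(1) s(1) by (intro eq[OF from_nat_into[OF ne]]) auto
 qed
 also have "... = emeasure \<nu> E" using suminf_emeasure[OF m(2) dj] u by simp
 finally show "emeasure \<mu> E = emeasure \<nu> E" .
qed

lemma is_vol_unique:
 assumes "is_vol k \<mu>" "is_vol k \<nu>"
 shows "\<mu> = \<nu>"
proof -
 obtain C where C: "countable C" "C \<subseteq> At" "!!p. \<exists>c\<in>C. p \<in> cdom c" by (rule countable_atlas) blast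
 show ?thesis
 proof (rule measure_eq_locally[of _ _ C cdom])
  show "(\<Union>c\<in>C. cdom c) = UNIV" using C(3) by blast
  show "cdom c \<in> LS" if "c \<in> C" for c using that C(2) open_dom open_lebesgue by blast
  show "emeasure \<mu> E = emeasure \<nu> E" if "c \<in> C" "E \<in> LS" "E \<subseteq> cdom c" for c E
  proof -
   have "c \<in> At" using that C by blast
   then show ?thesis using assms that(2,3) unfolding is_vol_def by simp
  qed
 qed (use assms C in "auto simp: is_vol_def")
qed

text \<open>The measures of countably many charts are glued along a disjoint refinement of the chart
  domains. A set inside one chart gets the right mass, since by \<open>vol_change\<close> for the
  identity its pieces may be measured in that chart as well.\<close>

lemma is_vol_exists:
 assumes k: "rough k"
 shows "EX \<mu>. is_vol k \<mu>"
proof -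
 interpret sigma_algebra UNIV "LS" by (rule lebesgue_sets_algebra)
 obtain C where C: "countable C" "C \<subseteq> At" "!!p. \<exists>c\<in>C. p \<in> cdom c" by (rule countable_atlas) blast
 have ne: "C ~= {}" using C(3) by blast
 define e where "e = from_nat_into C"
 have eA: "e n \<in> At" for n using from_nat_into[OF ne] C(2) unfolding e_def by blast
 define D where "D = disjointed (%n. cdom (e n))"
 have "range D \<subseteq> LS"
  unfolding D_def using open_lebesgue[OF open_dom[OF eA]] by (intro range_disjointed_sets) auto
 then have D: "D n \<in> LS" for n by auto
 have Ddom: "D n \<subseteq> cdom (e n)" for n unfolding D_def by (rule disjointed_subset)
 have DU: "(\<Union>n. D n) = UNIV" "disjoint_family D"
 proof -
  have re: "range e = C" unfolding e_def by (rule range_from_nat_into[OF ne C(1)])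
  have "(\<Union>n. cdom (e n)) = (\<Union>c\<in>range e. cdom c)" by simp
  also have "... = UNIV" unfolding re using C(3) by blast
  finally have "(\<Union>n. cdom (e n)) = UNIV" .
  then show "(\<Union>n. D n) = UNIV" unfolding D_def UN_disjointed_eq .
 qed (simp add: D_def disjoint_family_disjointed)
 define m where "m c = density lebesgue (%x. dens k c x * indicator (cod c) x)" for c
 have m: "emeasure (m c) (cmap c ` E) = (\<integral>\<^sup>+x\<in>cmap c ` E. dens k c x \<partial>lebesgue)" "cmap c ` E \<in> sets (m c)"
  if "c \<in> At" "E \<in> LS" "E \<subseteq> cdom c" for c E
 proof -
  have s: "cmap c ` E \<in> sets lebesgue" using lebesgue_setsD[OF that(2,1)] that(3) by (simp add: Int_absorb2)
  then show "cmap c ` E \<in> sets (m c)" by (simp add: m_def)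
  have "emeasure (m c) (cmap c ` E) = (\<integral>\<^sup>+x. dens k c x * indicator (cod c) x * indicator (cmap c ` E) x \<partial>lebesgue)"
   unfolding m_def using dens_measurable[OF k that(1)] s by (simp add: emeasure_density)
  also have "... = (\<integral>\<^sup>+x\<in>cmap c ` E. dens k c x \<partial>lebesgue)"
   using that(3) by (intro nn_integral_cong) (auto simp: indicator_def)
  finally show "emeasure (m c) (cmap c ` E) = (\<integral>\<^sup>+x\<in>cmap c ` E. dens k c x \<partial>lebesgue)" .
 qed
 have add: "(\<Sum>i. emeasure (m c) (cmap c ` E i)) = emeasure (m c) (cmap c ` (\<Union>i. E i))"
  if c: "c \<in> At" and E: "!!i. E i \<in> LS" "!!i. E i \<subseteq> cdom c" "disjoint_family E" for c and E :: "nat => 'm set"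
 proof -
  have "disjoint_family (%i. cmap c ` E i)"
   unfolding disjoint_family_on_def
  proof (intro ballI impI)
   fix i j :: nat assume "i ~= j"
   then have "E i Int E j = {}" using E(3) by (auto simp: disjoint_family_on_def)
   then show "cmap c ` E i Int cmap c ` E j = {}"
    using inj_on_image_Int[OF chart_inj[OF c] E(2) E(2), of i j] by simp
  qed
  then show ?thesis using m(2)[OF c E(1,2)] by (simp add: suminf_emeasure image_subset_iff image_UN)
 qed
 \<comment> \<open>With the sum over the pieces written as an integral over counting measure,
   countable additivity becomes the interchange of an integral with a sum.\<close>
 define \<mu>0 where "\<mu>0 E = (\<integral>\<^sup>+n. emeasure (m (e n)) (cmap (e n) ` (E Int D n)) \<partial>count_space (UNIV::nat set))" for E
 define \<mu> where "\<mu> = measure_of UNIV (LS) \<mu>0"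
 have sp: "space \<mu> = UNIV" "sets \<mu> = LS" by (simp_all add: \<mu>_def sets_measure_of_eq)
 have em: "emeasure \<mu> E = \<mu>0 E" if E: "E \<in> LS" for E
  unfolding \<mu>_def
 proof (rule emeasure_measure_of_sigma[OF lebesgue_sets_algebra _ _ E])
  show "positive (LS) \<mu>0" by (simp add: positive_def \<mu>0_def)
  show "countably_additive (LS) \<mu>0"
   unfolding countably_additive_def
  proof (intro allI impI)
   fix E :: "nat => 'm set" assume E: "range E \<subseteq> LS" "disjoint_family E"
   have "(\<Sum>i. \<mu>0 (E i)) = (\<integral>\<^sup>+n. (\<Sum>i. emeasure (m (e n)) (cmap (e n) ` (E i Int D n))) \<partial>count_space (UNIV::nat set))"
    unfolding \<mu>0_def by (rule nn_integral_suminf[symmetric]) simp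
   also have "... = (\<integral>\<^sup>+n. emeasure (m (e n)) (cmap (e n) ` (\<Union>i. E i Int D n)) \<partial>count_space (UNIV::nat set))"
   proof (rule nn_integral_cong)
    fix n
    show "(\<Sum>i. emeasure (m (e n)) (cmap (e n) ` (E i Int D n))) = emeasure (m (e n)) (cmap (e n) ` (\<Union>i. E i Int D n))"
     using E D[of n] Ddom[of n] by (intro add eA) (auto simp: disjoint_family_on_def intro!: Int)
   qed
   also have "... = \<mu>0 (\<Union>i. E i)" by (simp add: \<mu>0_def)
   finally show "(\<Sum>i. \<mu>0 (E i)) = \<mu>0 (\<Union>i. E i)" .
  qed
 qed
 have "is_vol k \<mu>" unfolding is_vol_def
 proof (intro conjI sp ballI impI)
  fix c E assume c: "c \<in> At" and E: "E \<in> LS" "E \<subseteq> cdom c"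
  have ED: "E Int D n \<in> LS" for n using E D by auto
  have "emeasure (m (e n)) (cmap (e n) ` (E Int D n)) = emeasure (m c) (cmap c ` (E Int D n))" for n
  proof -
   have "nullM {p. k p ~= pbm id k p}" by (simp add: pullback_metric_id)
   then have "(\<integral>\<^sup>+y\<in>cmap (e n) ` id ` (E Int D n). dens k (e n) y \<partial>lebesgue) = (\<integral>\<^sup>+x\<in>cmap c ` (E Int D n). dens k c x \<partial>lebesgue)"
    using E Ddom[of n] ED by (intro vol_change[OF lip_map_id lip_map_id _ _ k c eA]) auto
   moreover have "E Int D n \<subseteq> cdom (e n)" "E Int D n \<subseteq> cdom c" using E Ddom[of n] by auto
   ultimately show ?thesis using m(1)[OF eA ED] m(1)[OF c ED] by simp
  qed
  then have "emeasure \<mu> E = (\<Sum>n. emeasure (m c) (cmap c ` (E Int D n)))"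
   by (simp add: em[OF E(1)] \<mu>0_def nn_integral_count_space_nat)
  also have "... = emeasure (m c) (cmap c ` (\<Union>n. E Int D n))"
   using E DU(2) ED by (intro add c) (auto simp: disjoint_family_on_def)
  also have "(\<Union>n. E Int D n) = E" using DU(1) by blast
  also have "emeasure (m c) (cmap c ` E) = (\<integral>\<^sup>+x\<in>cmap c ` E. dens k c x \<partial>lebesgue)" by (rule m(1)[OF c E])
  finally show "emeasure \<mu> E = (\<integral>\<^sup>+x\<in>cmap c ` E. dens k c x \<partial>lebesgue)" .
 qed
 then show ?thesis ..
qed

lemma is_vol_vol:
 assumes k: "rough k"
 shows "is_vol k (vol At k)"
proof -
 have "vol At k = (THE \<mu>. is_vol k \<mu>)" by (simp add: vol_def is_vol_def dens_def)
 moreover obtain \<mu> where "is_vol k \<mu>" using is_vol_exists[OF k] by blast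
 ultimately show ?thesis using is_vol_unique by (metis the_equality)
qed

lemma space_vol [simp]: "rough k ==> space (vol At k) = UNIV"
 and sets_vol [simp]: "rough k ==> sets (vol At k) = LS"
 and emeasure_vol: "rough k ==> c \<in> At ==> E \<in> LS ==> E \<subseteq> cdom c ==>
  emeasure (vol At k) E = (\<integral>\<^sup>+x\<in>cmap c ` E. dens k c x \<partial>lebesgue)"
 using is_vol_vol unfolding is_vol_def by blast+

lemma vol_measurable_iff: "rough k ==> f \<in> borel_measurable (vol At k) \<longleftrightarrow> lmeas f"
 unfolding measurable_def lmeas_def by simp

text \<open>The density in a chart is positive almost everywhere because the metric is positive
  definite almost everywhere. Null sets therefore do not depend on the metric.\<close>

lemma vol_null_iff:
 assumes k: "rough k"
 shows "N \<in> null_sets (vol At k) \<longleftrightarrow> nullM N"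
proof
 assume N: "N \<in> null_sets (vol At k)"
 show "nullM N" unfolding nullM_def
 proof
  fix c assume c: "c \<in> At"
  interpret sigma_algebra UNIV "LS" by (rule lebesgue_sets_algebra)
  let ?E = "N Int cdom c"
  have "N \<in> LS" using null_setsD2[OF N] is_vol_vol[OF k] by (simp add: is_vol_def)
  then have E: "?E \<in> LS" using open_lebesgue[OF open_dom[OF c]] by (rule Int)
  have "?E \<in> null_sets (vol At k)" using N k open_lebesgue[OF open_dom[OF c]] by (intro null_set_Int2) auto
  then have "emeasure (vol At k) ?E = 0" by blast
  then have i0: "(\<integral>\<^sup>+x\<in>cmap c ` ?E. dens k c x \<partial>lebesgue) = 0" using emeasure_vol[OF k c E] by simp
  have L: "cmap c ` ?E \<in> sets lebesgue" using lebesgue_setsD[OF E c] by (simp add: Int_assoc)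
  have "(%x. dens k c x * indicator (cod c) x * indicator (cmap c ` ?E) x) \<in> borel_measurable lebesgue"
   using dens_measurable[OF k c] L by simp
  moreover have "dens k c x * indicator (cod c) x * indicator (cmap c ` ?E) x = dens k c x * indicator (cmap c ` ?E) x" for x
   by (auto simp: indicator_def)
  ultimately have "AE x in lebesgue. dens k c x * indicator (cmap c ` ?E) x = 0"
   using i0 by (simp add: nn_integral_0_iff_AE)
  then have "AE x in lebesgue. x ~: cmap c ` ?E"
   using nullM_lebesgue_AE[OF rough_posdef[OF k] c]
  proof eventually_elim
   case (elim x)
   show ?case
   proof
    assume x: "x \<in> cmap c ` ?E"
    then have "x \<in> cod c" by auto
    then have "posdef (k (cinv c x))" using elim by blast
    then have "posdef (mic k c (cinv c x))" using metric_in_chart_posdef[OF c] c `x \<in> cod c` by simp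
    then have "dens k c x > 0" unfolding dens_def using posdef_det_pos by simp
    then show False using elim x by simp
   qed
  qed
  then have "cmap c ` ?E \<in> null_sets lebesgue" using L by (simp add: AE_iff_null_sets)
  then show "negligible (cmap c ` ?E)" by (simp add: negligible_iff_null_sets)
 qed
next
 assume N: "nullM N"
 interpret sigma_algebra UNIV "LS" by (rule lebesgue_sets_algebra)
 obtain C where C: "countable C" "C \<subseteq> At" "!!p. \<exists>c\<in>C. p \<in> cdom c" by (rule countable_atlas) blast
 have "N Int cdom c \<in> null_sets (vol At k)" if "c \<in> C" for c
 proof (rule null_setsI)
  have c: "c \<in> At" using that C by blast
  have E: "N Int cdom c \<in> LS" using nullM_lebesgue[OF N] open_lebesgue[OF open_dom[OF c]] by auto
  then show "N Int cdom c \<in> sets (vol At k)" using k by simp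
  have "emeasure (vol At k) (N Int cdom c) = (\<integral>\<^sup>+x\<in>cmap c ` (N Int cdom c). dens k c x \<partial>lebesgue)"
   by (rule emeasure_vol[OF k c E]) simp
  also have "... = 0"
  proof -
   have "AE x in lebesgue. x ~: cmap c ` (N Int cdom c)"
    using N c unfolding nullM_def by (auto simp: negligible_iff_null_sets dest: AE_not_in)
   then have "AE x in lebesgue. dens k c x * indicator (cmap c ` (N Int cdom c)) x = 0"
    by eventually_elim simp
   then have "(\<integral>\<^sup>+x\<in>cmap c ` (N Int cdom c). dens k c x \<partial>lebesgue) = (\<integral>\<^sup>+x. 0 \<partial>(lebesgue :: (real^'n) measure))"
    by (rule nn_integral_cong_AE)
   then show ?thesis by simp
  qed
  finally show "emeasure (vol At k) (N Int cdom c) = 0" .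
 qed
 then have "(\<Union>c\<in>C. N Int cdom c) \<in> null_sets (vol At k)" by (rule null_sets_UN'[OF C(1)])
 moreover have "(\<Union>c\<in>C. N Int cdom c) = N" using C(3) by blast
 ultimately show "N \<in> null_sets (vol At k)" by simp
qed

lemma AE_vol_iff:
 assumes k: "rough k"
 shows "(AE p in vol At k. P p) \<longleftrightarrow> nullM {p. ~ P p}"
proof
 assume "AE p in vol At k. P p"
 then obtain N where "{p \<in> space (vol At k). ~ P p} \<subseteq> N" "N \<in> null_sets (vol At k)" by (auto elim!: AE_E intro: null_setsI)
 then show "nullM {p. ~ P p}" using vol_null_iff[OF k] nullM_subset k by auto
next
 assume "nullM {p. ~ P p}"
 then show "AE p in vol At k. P p" using vol_null_iff[OF k] by (intro AE_I'[of "{p. ~ P p}"]) auto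
qed

text \<open>The two measures are compared on sets that lie in one chart and whose images lie in one
  chart. Countably many such sets cover \<open>M\<close>, and on each of them
  \<open>vol_change\<close> applies.\<close>

lemma vol_distr:
 assumes F: "lip_map F" "lip_map G" and inv: "!!p. G (F p) = p" "!!p. F (G p) = p"
  and k: "rough k1" "rough k2" and eq: "nullM {p. k1 p ~= pbm F k2 p}"
 shows "G \<in> measurable (vol At k2) (vol At k1)" "vol At k1 = distr (vol At k2) (vol At k1) G"
proof -
 interpret sigma_algebra UNIV "LS" by (rule lebesgue_sets_algebra)
 show G: "G \<in> measurable (vol At k2) (vol At k1)"
  unfolding measurable_def using k lebesgue_sets_vimage[OF F(2,1) inv(2,1)] by auto
 obtain C where C: "countable C" "C \<subseteq> At" "!!p. \<exists>c\<in>C. p \<in> cdom c" by (rule countable_atlas) blast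
 have fE: "F ` E = G -` E" for E
 proof (intro equalityI subsetI)
  fix q assume "q \<in> G -` E"
  then show "q \<in> F ` E" using inv(2)[of q] by (intro image_eqI[of _ _ "G q"]) auto
 qed (use inv in auto)
 show "vol At k1 = distr (vol At k2) (vol At k1) G"
 proof (rule measure_eq_locally[of _ _ "C \<times> C" "%(c, d). cdom c Int F -` cdom d"])
  show "(\<Union>i\<in>C \<times> C. case i of (c, d) => cdom c Int F -` cdom d) = UNIV" using C(3) by (auto simp del: split_paired_Ex) 
  fix i assume "i \<in> C \<times> C"
  then obtain c d where i: "i = (c, d)" "c \<in> At" "d \<in> At" using C(2) by blast
  have "F -` cdom d \<in> LS"
   using lebesgue_sets_vimage[OF F inv open_lebesgue[OF open_dom[OF i(3)]]] .
  then show "(case i of (c, d) => cdom c Int F -` cdom d) \<in> LS"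
   using open_lebesgue[OF open_dom[OF i(2)]] i(1) by auto
  fix E assume E: "E \<in> LS" "E \<subseteq> (case i of (c, d) => cdom c Int F -` cdom d)"
  have E': "E \<subseteq> cdom c" "F ` E \<subseteq> cdom d" using E(2) unfolding i(1) by auto
  have FE: "F ` E \<in> LS" unfolding fE by (rule lebesgue_sets_vimage[OF F(2,1) inv(2,1) E(1)])
  have "emeasure (distr (vol At k2) (vol At k1) G) E = emeasure (vol At k2) (F ` E)"
   using E(1) k by (simp add: emeasure_distr[OF G] fE)
  also have "... = (\<integral>\<^sup>+x\<in>cmap d ` F ` E. dens k2 d x \<partial>lebesgue)" by (rule emeasure_vol[OF k(2) i(3) FE E'(2)])
  also have "... = (\<integral>\<^sup>+x\<in>cmap c ` E. dens k1 c x \<partial>lebesgue)" by (rule vol_change[OF F inv k(2) i(2,3) eq E(1) E'])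
  also have "... = emeasure (vol At k1) E" by (rule emeasure_vol[OF k(1) i(2) E(1) E'(1), symmetric])
  finally show "emeasure (vol At k1) E = emeasure (distr (vol At k2) (vol At k1) G) E" ..
 qed (use C k in auto)
qed

end

section \<open>The dual inner product\<close>

lemma matrix_inv_works:
 assumes "invertible (M :: 'a::semiring_1^'n^'n)"
 shows "M ** matrix_inv M = mat 1" "matrix_inv M ** M = mat 1"
 using someI_ex[OF assms[unfolded invertible_def]] unfolding matrix_inv_def by auto

lemma matrix_inv_eqI:
 assumes "M ** X = mat 1" "X ** M = mat 1"
 shows "matrix_inv (M :: 'a::semiring_1^'n^'n) = X"
proof -
 have "invertible M" using assms unfolding invertible_def by blast
 from matrix_inv_works[OF this] assms show ?thesis by (metis matrix_mul_assoc matrix_mul_lid matrix_mul_rid)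
qed

text \<open>By Cramer's rule the entries of the inverse are rational functions of the entries; this
  is the source of measurability for the dual metric.\<close>

lemma matrix_inv_entry:
 fixes M :: "real^'n::finite^'n"
 assumes "invertible M"
 shows "matrix_inv M $ k $ m = det (\<chi> i j. if j = k then axis m 1 $ i else M $ i $ j) / det M"
proof -
 have "M *v (matrix_inv M *v axis m 1) = axis m 1"
  by (simp add: matrix_vector_mul_assoc matrix_inv_works(1)[OF assms])
 then have "matrix_inv M *v axis m 1 = (\<chi> k. det (\<chi> i j. if j = k then axis m 1 $ i else M $ i $ j) / det M)"
  using cramer[of M "matrix_inv M *v axis m 1" "axis m 1"] assms invertible_det_nz by blast
 then have "(matrix_inv M *v axis m 1) $ k = det (\<chi> i j. if j = k then axis m 1 $ i else M $ i $ j) / det M" by simp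
 then show ?thesis by (simp add: matrix_vector_mult_basis column_def)
qed

definition cdot :: "complex^'n => complex^'n => complex" where
 "cdot w v = (\<Sum>i\<in>UNIV. w $ i * v $ i)"

definition vcnj :: "complex^'n => complex^'n" where
 "vcnj v = (\<chi> i. cnj (v $ i))"

lemma cov_inner_cdot: "cov_inner G w z = cdot w (cmatrix (matrix_inv G) *v vcnj z)"
 by (simp add: cov_inner_def cdot_def matrix_vector_mult_def vcnj_def cmatrix_def sum_distrib_left mult_ac)

lemma cdot_transpose: "cdot (transpose M *v w) v = cdot w (M *v v)"
 unfolding cdot_def matrix_vector_mult_def transpose_def
 by (simp add: sum_distrib_left sum_distrib_right mult_ac) (rule sum.swap)

lemma cmatrix_mult: "cmatrix (A ** B) = cmatrix A ** cmatrix B"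
 by (simp add: cmatrix_def matrix_matrix_mult_def vec_eq_iff)

lemma cmatrix_mat_1 [simp]: "cmatrix (mat 1) = mat 1"
 by (simp add: cmatrix_def mat_def vec_eq_iff)

lemma cmatrix_transpose: "cmatrix (transpose A) = transpose (cmatrix A)"
 by (simp add: cmatrix_def transpose_def vec_eq_iff)

lemma vcnj_cmatrix: "vcnj (cmatrix A *v z) = cmatrix A *v vcnj z"
 by (simp add: vcnj_def cmatrix_def matrix_vector_mult_def vec_eq_iff)

text \<open>The inverse of the congruent matrix is
  \<open>matrix_inv J ** matrix_inv K ** transpose (matrix_inv J)\<close>, and its outer factors
  cancel against the transposed \<open>J\<close> by which covectors are pulled back. Pullback of
  covectors is thus an isometry at every single point.\<close>

lemma cov_inner_congruence:
 fixes J K :: "real^'n::finite^'n"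
 assumes J: "invertible J" and K: "invertible K"
 shows "cov_inner (transpose J ** K ** J) (transpose (cmatrix J) *v w) (transpose (cmatrix J) *v z) = cov_inner K w z"
proof -
 let ?M = "transpose J ** K ** J" and ?J = "matrix_inv J" and ?K = "matrix_inv K"
 note j = matrix_inv_works[OF J] and k = matrix_inv_works[OF K]
 have jt: "transpose J ** transpose ?J = mat 1" "transpose ?J ** transpose J = mat 1"
  using j by (simp_all only: matrix_transpose_mul[symmetric] transpose_mat)
 have "?M ** (?J ** ?K ** transpose ?J) = transpose J ** (K ** ((J ** ?J) ** ?K)) ** transpose ?J"
  by (simp only: matrix_mul_assoc)
 moreover have "(?J ** ?K ** transpose ?J) ** ?M = ?J ** (?K ** ((transpose ?J ** transpose J) ** K)) ** J"
  by (simp only: matrix_mul_assoc)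
 ultimately have "matrix_inv ?M = ?J ** ?K ** transpose ?J"
  using j k jt by (intro matrix_inv_eqI) simp_all
 then have "J ** matrix_inv ?M ** transpose J = (J ** ?J) ** ?K ** (transpose ?J ** transpose J)"
  by (simp only: matrix_mul_assoc)
 then have *: "J ** matrix_inv ?M ** transpose J = ?K" using j jt by simp
 have "cov_inner ?M (transpose (cmatrix J) *v w) (transpose (cmatrix J) *v z) =
   cdot w (cmatrix (J ** matrix_inv ?M ** transpose J) *v vcnj z)"
  by (simp only: cov_inner_cdot cdot_transpose)
   (simp only: cmatrix_transpose[symmetric] vcnj_cmatrix matrix_vector_mul_assoc cmatrix_mult matrix_mul_assoc)
 then show ?thesis unfolding * by (simp add: cov_inner_cdot)
qed

lemma cov_inner_add_left: "cov_inner G (w + w') z = cov_inner G w z + cov_inner G w' z"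
 and cov_inner_add_right: "cov_inner G w (z + z') = cov_inner G w z + cov_inner G w z'"
 and cov_inner_diff_left: "cov_inner G (w - w') z = cov_inner G w z - cov_inner G w' z"
 and cov_inner_diff_right: "cov_inner G w (z - z') = cov_inner G w z - cov_inner G w z'"
 by (simp_all add: cov_inner_def algebra_simps sum.distrib sum_subtractf)

lemma cov_inner_zero [simp]: "cov_inner G 0 z = 0" "cov_inner G w 0 = 0"
 by (simp_all add: cov_inner_def)

lemma Re_cov_inner_self:
 "Re (cov_inner G w w) = (\<chi> i. Re (w $ i)) \<bullet> (matrix_inv G *v (\<chi> i. Re (w $ i))) + (\<chi> i. Im (w $ i)) \<bullet> (matrix_inv G *v (\<chi> i. Im (w $ i)))"
 by (simp add: cov_inner_def inner_vec_def matrix_vector_mult_def sum_distrib_left algebra_simps sum.distrib)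

lemma Im_cov_inner_self:
 assumes "posdef G"
 shows "Im (cov_inner G w w) = 0"
proof -
 have inv: "invertible G" by (rule posdef_invertible[OF assms])
 have t: "transpose (matrix_inv G) = matrix_inv G"
 proof (rule matrix_inv_eqI[symmetric])
  have G: "transpose G = G" using assms by (simp add: posdef_def)
  show "G ** transpose (matrix_inv G) = mat 1" "transpose (matrix_inv G) ** G = mat 1"
   using arg_cong[OF matrix_inv_works(2)[OF inv], of transpose] arg_cong[OF matrix_inv_works(1)[OF inv], of transpose]
   by (simp_all add: matrix_transpose_mul G transpose_mat)
 qed
 have s: "matrix_inv G $ i $ j = matrix_inv G $ j $ i" for i j
  by (subst t[symmetric]) (simp add: transpose_def)
 have "Im (cov_inner G w w) = (\<Sum>i\<in>UNIV. \<Sum>j\<in>UNIV. matrix_inv G $ i $ j * (Im (w $ i) * Re (w $ j) - Re (w $ i) * Im (w $ j)))"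
  unfolding cov_inner_def Im_sum by (intro sum.cong refl) (simp add: algebra_simps)
 also have "... = (\<Sum>i\<in>UNIV. \<Sum>j\<in>UNIV. matrix_inv G $ i $ j * (Im (w $ i) * Re (w $ j))) -
  (\<Sum>i\<in>UNIV. \<Sum>j\<in>UNIV. matrix_inv G $ i $ j * (Re (w $ i) * Im (w $ j)))"
  by (simp add: algebra_simps sum_subtractf)
 also have "(\<Sum>i\<in>UNIV. \<Sum>j\<in>UNIV. matrix_inv G $ i $ j * (Re (w $ i) * Im (w $ j))) =
  (\<Sum>i\<in>UNIV. \<Sum>j\<in>UNIV. matrix_inv G $ i $ j * (Im (w $ i) * Re (w $ j)))"
  by (subst sum.swap) (simp add: s mult_ac)
 finally show ?thesis by simp
qed

text \<open>For \<open>?y\<close> with \<open>G *v ?y = a\<close> the dual form at \<open>a\<close>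
  is the form of \<open>G\<close> at \<open>?y\<close>. Ellipticity and the Cauchy-Schwarz
  inequality bound \<open>l\<close> times the square of \<open>norm ?y\<close> by
  \<open>norm a * norm ?y\<close>, hence \<open>norm ?y\<close> by
  \<open>norm a / l\<close>.\<close>

lemma posdef_inverse_form:
 fixes a :: "real^'n::finite"
 assumes G: "posdef G"
 shows "0 <= a \<bullet> (matrix_inv G *v a)"
  "l > 0 ==> ell l u G ==> a \<bullet> (matrix_inv G *v a) <= (norm a)\<^sup>2 / l"
proof -
 let ?y = "matrix_inv G *v a"
 have y: "G *v ?y = a" by (simp add: matrix_vector_mul_assoc matrix_inv_works(1)[OF posdef_invertible[OF G]])
 have q: "a \<bullet> ?y = ?y \<bullet> (G *v ?y)" unfolding y by (rule inner_commute)
 show "0 <= a \<bullet> ?y" unfolding q using G by (cases "?y = 0") (auto simp: posdef_def intro: less_imp_le)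
 assume l: "l > 0" "ell l u G"
 have "l * (norm ?y)\<^sup>2 <= a \<bullet> ?y" unfolding q using l by (simp add: ell_def power2_norm_eq_inner)
 also have "... <= norm a * norm ?y" by (rule norm_cauchy_schwarz)
 finally have "norm ?y * (l * norm ?y) <= norm ?y * norm a" by (simp add: power2_eq_square mult_ac)
 then have "l * norm ?y <= norm a" by (cases "?y = 0") (auto simp: mult_le_cancel_left)
 then have "norm ?y <= norm a / l" using l by (simp add: pos_le_divide_eq mult.commute)
 then have "norm a * norm ?y <= norm a * (norm a / l)" by (intro mult_left_mono) auto
 then show "a \<bullet> ?y <= (norm a)\<^sup>2 / l" using norm_cauchy_schwarz[of a ?y] by (simp add: power2_eq_square)
qed

lemma Re_cov_inner_nonneg: "posdef G ==> 0 <= Re (cov_inner G w w)"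
 unfolding Re_cov_inner_self using posdef_inverse_form(1) by (meson add_nonneg_nonneg)

lemma Re_cov_inner_le:
 fixes w :: "complex^'n::finite"
 assumes "l > 0" "ell l u G"
 shows "Re (cov_inner G w w) <= (norm w)\<^sup>2 / l"
proof -
 have "(norm w)\<^sup>2 = (norm (\<chi> i. Re (w $ i)))\<^sup>2 + (norm (\<chi> i. Im (w $ i)))\<^sup>2"
  unfolding power2_norm_eq_inner by (simp add: inner_vec_def inner_complex_def sum.distrib power2_eq_square)
 then have "(norm w)\<^sup>2 / l = (norm (\<chi> i. Re (w $ i)))\<^sup>2 / l + (norm (\<chi> i. Im (w $ i)))\<^sup>2 / l"
  by (simp add: add_divide_distrib)
 then show ?thesis
  using posdef_inverse_form(2)[OF ell_posdef[OF assms] assms] unfolding Re_cov_inner_self by (simp add: add_mono)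
qed

text \<open>Expansion of the nonnegative form at \<open>w - z\<close>, as in the parallelogram law.
  It takes the place of the triangle inequality and applies to squared norms pointwise.\<close>

lemma Re_cov_inner_add_le:
 assumes "posdef G"
 shows "Re (cov_inner G (w + z) (w + z)) <= 2 * Re (cov_inner G w w) + 2 * Re (cov_inner G z z)"
 using Re_cov_inner_nonneg[OF assms, of "w - z"]
 by (simp add: cov_inner_add_left cov_inner_add_right cov_inner_diff_left cov_inner_diff_right)

lemma borel_measurable_vecI:
 fixes f :: "_ => 'b::euclidean_space^'n::finite"
 assumes "!!i. (%x. f x $ i) \<in> borel_measurable M"
 shows "f \<in> borel_measurable M"
 unfolding borel_measurable_euclidean_space[of f]
proof
 fix b :: "'b^'n" assume "b \<in> Basis"
 then obtain i u where "b = axis i u" unfolding Basis_vec_def by auto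
 then show "(%x. f x \<bullet> b) \<in> borel_measurable M" using assms[of i] by (simp add: inner_axis)
qed

section \<open>Covector fields\<close>

context manifold
begin

abbreviation mcf :: "('m => complex^'n) => bool" where
 "mcf \<equiv> measurable_covector_field At"

lemma mcfD:
 "mcf w ==> c \<in> At ==>
  (%x. cic c (cinv c x) (w (cinv c x)) $ i) \<in> mfun (cod c)"
 unfolding measurable_covector_field_def by (rule borel_measurable_vec_nth) blast

lemma mcfI:
 "(!!c i. c \<in> At ==> (%x. cic c (cinv c x) (w (cinv c x)) $ i)
   \<in> mfun (cod c)) ==> mcf w"
 unfolding measurable_covector_field_def by (intro ballI borel_measurable_vecI)

lemma covector_in_chart_add: "cic c p (w + z) = cic c p w + cic c p z"
 and covector_in_chart_diff: "cic c p (w - z) = cic c p w - cic c p z"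
 by (simp_all add: covector_in_chart_def matrix_vector_right_distrib matrix_vector_mult_diff_distrib)

lemma mcf_add: "mcf w ==> mcf z ==> mcf (%p. w p + z p)"
 unfolding measurable_covector_field_def covector_in_chart_add by (intro ballI borel_measurable_add) (erule (1) bspec)+

lemma mcf_diff: "mcf w ==> mcf z ==> mcf (%p. w p - z p)"
 unfolding measurable_covector_field_def covector_in_chart_diff by (intro ballI borel_measurable_diff) (erule (1) bspec)+

lemma chart_AE_measurable:
 fixes f g :: "'m => 'b::euclidean_space"
 assumes c: "c \<in> At" and W: "W \<in> sets lebesgue" "W \<subseteq> cod c"
  and f: "(%x. f (cinv c x)) \<in> mfun W"
  and N: "nullM N" "!!x. x \<in> W ==> cinv c x ~: N ==> f (cinv c x) = g (cinv c x)"
 shows "(%x. g (cinv c x)) \<in> mfun W"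
proof (rule lebesgue_on_measurable_AE_cong[OF f W(1)], rule negligible_subset)
 show "negligible (cmap c ` (N Int cdom c))" using N(1) c unfolding nullM_def by blast
 show "{x \<in> W. f (cinv c x) ~= g (cinv c x)} \<subseteq> cmap c ` (N Int cdom c)"
 proof
  fix x assume x: "x \<in> {x \<in> W. f (cinv c x) ~= g (cinv c x)}"
  then have "x \<in> cod c" "cinv c x \<in> N" using W(2) N(2) by auto
  then show "x \<in> cmap c ` (N Int cdom c)" using c by (intro image_eqI[of _ _ "cinv c x"]) auto
 qed
qed

lemma cod_lebesgue: "c \<in> At ==> cod c \<in> sets lebesgue"
 using open_cod by auto

lemma lmeas_AE:
 fixes f g :: "'m => 'b::euclidean_space"
 assumes "lmeas f" "nullM {p. f p ~= g p}"
 shows "lmeas g"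
 unfolding lmeas_iff
proof
 fix c assume c: "c \<in> At"
 show "(%x. g (cinv c x)) \<in> mfun (cod c)"
  by (rule chart_AE_measurable[OF c cod_lebesgue[OF c] order_refl _ assms(2), where f=f])
   (use assms(1) c in "auto simp: lmeas_iff")
qed

lemma mcf_AE:
 assumes w: "mcf w" and N: "nullM {p. w p ~= w' p}"
 shows "mcf w'"
 unfolding measurable_covector_field_def
proof
 fix c assume c: "c \<in> At"
 show "(%x. cic c (cinv c x) (w' (cinv c x))) \<in> mfun (cod c)"
  by (rule chart_AE_measurable[OF c cod_lebesgue[OF c] order_refl _ N, where f="%p. cic c p (w p)"])
   (use w c in "auto simp: measurable_covector_field_def")
qed

lemma cov_inner_in_chart:
 assumes "c \<in> At" "p \<in> cdom c" "posdef (k p)"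
 shows "cov_inner (mic k c p) (cic c p w) (cic c p z) = cov_inner (k p) w z"
 unfolding metric_in_chart_def covector_in_chart_def
 by (intro cov_inner_congruence frame_invertible posdef_invertible assms)

text \<open>In a chart, Cramer's rule gives an expression in the components that is visibly
  measurable. It may differ from the inner product only where the metric is not positive definite,
  that is, on a null set.\<close>

lemma cov_inner_lmeas:
 assumes k: "rough k" and w: "mcf w" and z: "mcf z"
 shows "lmeas (%p. cov_inner (k p) (w p) (z p))"
 unfolding lmeas_iff
proof
 fix c assume c: "c \<in> At"
 define e where "e p i j = det (\<chi> a b. if b = i then axis j 1 $ a else mic k c p $ a $ b) / det (mic k c p)" for p i j
 define f where "f p = (\<Sum>i\<in>UNIV. \<Sum>j\<in>UNIV. complex_of_real (e p i j) *
   cic c p (w p) $ i * cnj (cic c p (z p) $ j))" for p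
 have m: "(%x. mic k c (cinv c x) $ i $ j) \<in> mfun (cod c)" for i j
  by (rule rough_measurable[OF k c])
 have b: "(%x. if P then h x else g x) \<in> mfun (cod c)"
  if "h \<in> mfun (cod c)" "g \<in> mfun (cod c)"
  for P and h g :: "real^'n => real" using that by simp
 have "(%x. e (cinv c x) i j) \<in> mfun (cod c)" for i j
  unfolding e_def det_def vec_lambda_beta
  by (intro borel_measurable_divide borel_measurable_sum borel_measurable_times borel_measurable_const borel_measurable_prod b m)
 then have "(%x. complex_of_real (e (cinv c x) i j)) \<in> mfun (cod c)" for i j
  by (rule measurable_compose[OF _ borel_measurable_continuous_onI]) (intro continuous_intros)
 moreover have "(%x. cnj (cic c (cinv c x) (z (cinv c x)) $ j)) \<in> mfun (cod c)" for j
  by (rule measurable_compose[OF mcfD[OF z c] borel_measurable_continuous_onI]) (intro continuous_intros)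
 ultimately have f: "(%x. f (cinv c x)) \<in> mfun (cod c)"
  unfolding f_def by (intro borel_measurable_sum borel_measurable_times mcfD[OF w c])
 show "(%x. cov_inner (k (cinv c x)) (w (cinv c x)) (z (cinv c x))) \<in> mfun (cod c)"
 proof (rule chart_AE_measurable[OF c cod_lebesgue[OF c] order_refl f rough_posdef[OF k]])
  fix x assume x: "x \<in> cod c" "cinv c x ~: {p. ~ posdef (k p)}"
  let ?p = "cinv c x"
  have p: "?p \<in> cdom c" "posdef (k ?p)" using x c by auto
  then have "posdef (mic k c ?p)" using metric_in_chart_posdef[OF c] by blast
  then have "f ?p = cov_inner (mic k c ?p) (cic c ?p (w ?p)) (cic c ?p (z ?p))"
   unfolding f_def cov_inner_def e_def by (simp add: matrix_inv_entry posdef_invertible)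
  then show "f ?p = cov_inner (k ?p) (w ?p) (z ?p)" using cov_inner_in_chart[where k=k, OF c p] by simp
 qed
qed

end

section \<open>Pullback by a locally bi-Lipschitz map\<close>

text \<open>Both metrics are merely \<open>rough\<close>, and \<open>k1\<close> is the pullback of
  \<open>k2\<close> only up to a null set. In this form the assumptions are symmetric under exchange
  of \<open>F\<close> with \<open>G\<close> and of \<open>k1\<close> with \<open>k2\<close>, which a
  continuous \<open>k2\<close> or an exact equality would spoil.\<close>

locale lip_pull = manifold At for At :: "('m::{t2_space, second_countable_topology}, 'n::finite) chart set" +
 fixes F G :: "'m => 'm" and k1 k2 :: "'m => real^'n^'n"
 assumes lip_F: "lip_map F" and lip_G: "lip_map G" and GF: "!!p. G (F p) = p" and FG: "!!p. F (G p) = p"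
  and rough1: "rough k1" and rough2: "rough k2" and pullback_ae: "nullM {p. k1 p ~= pbm F k2 p}"
begin

lemma nullM_pull: "nullM {p. P (F p)} \<longleftrightarrow> nullM {q. P q}"
proof -
 have "p \<in> G ` {q. P q}" if "P (F p)" for p using that GF[of p] by (intro image_eqI[of _ _ "F p"]) auto
 then have 1: "{p. P (F p)} = G ` {q. P q}" using FG by auto
 have "q \<in> F ` {p. P (F p)}" if "P q" for q using that FG[of q] by (intro image_eqI[of _ _ "G q"]) auto
 then have 2: "{q. P q} = F ` {p. P (F p)}" by auto
 show ?thesis
 proof
  show "nullM {q. P q}" if "nullM {p. P (F p)}" unfolding 2 by (rule nullM_image[OF lip_F that])
  show "nullM {p. P (F p)}" if "nullM {q. P q}" unfolding 1 by (rule nullM_image[OF lip_G that])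
 qed
qed

lemma lmeas_pull: "lmeas f ==> lmeas (%p. f (F p))"
 by (rule lmeas_compose[OF lip_F lip_G GF FG])

lemma integral_pull:
 fixes f :: "'m => 'b::{banach, second_countable_topology}"
 assumes "lmeas f"
 shows "(LINT p|vol At k1. f (F p)) = (LINT q|vol At k2. f q)"
  "integrable (vol At k1) (%p. f (F p)) \<longleftrightarrow> integrable (vol At k2) f"
proof -
 note d = vol_distr[OF lip_F lip_G GF FG rough1 rough2 pullback_ae]
 have m: "(%p. f (F p)) \<in> borel_measurable (vol At k1)"
  unfolding vol_measurable_iff[OF rough1] by (rule lmeas_pull[OF assms])
 show "(LINT p|vol At k1. f (F p)) = (LINT q|vol At k2. f q)"
  by (subst d(2), subst integral_distr[OF d(1) m]) (simp add: FG)
 show "integrable (vol At k1) (%p. f (F p)) \<longleftrightarrow> integrable (vol At k2) f"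
  by (subst d(2), subst integrable_distr_eq[OF d(1) m]) (simp add: FG)
qed

text \<open>The points at which the identities of the pullback hold as statements of linear algebra;
  by \<open>nullM_bad\<close> they are almost all points.\<close>

definition good :: "'m => bool" where
 "good p \<longleftrightarrow> mdiff F p & mdiff G (F p) & k1 p = pbm F k2 p & posdef (k2 (F p))"

lemma nullM_bad: "nullM {p. ~ good p}"
proof -
 have "nullM ({p. ~ mdiff F p} Un ({p. ~ mdiff G (F p)} Un ({p. k1 p ~= pbm F k2 p} Un {p. ~ posdef (k2 (F p))})))"
  using nullM_not_mdiff lip_F lip_G pullback_ae rough_posdef[OF rough2] nullM_pull[of "%q. ~ mdiff G q"] nullM_pull[of "%q. ~ posdef (k2 q)"]
  by (intro nullM_Un) auto
 then show ?thesis by (rule nullM_subset) (auto simp: good_def)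
qed

lemma differential_inverse:
 assumes "mdiff F p" "mdiff G (F p)"
 shows "Df G (F p) ** Df F p = mat 1"
proof -
 have "G o F = id" using GF by auto
 then show ?thesis using differential_compose(2)[OF lip_F assms] differential_id by simp
qed

lemma differential_invertible: "good p ==> invertible (Df F p)"
 unfolding good_def using differential_inverse invertible_left_inverse by blast

lemma cov_inner_pull:
 assumes "good p"
 shows "cov_inner (k1 p) (pbc F w p) (pbc F z p) = cov_inner (k2 (F p)) (w (F p)) (z (F p))"
 using assms cov_inner_congruence[OF differential_invertible[OF assms] posdef_invertible, of "k2 (F p)"]
 unfolding good_def pullback_covector_def by (simp add: pullback_metric_def)

lemma covector_in_chart_pull:
 assumes c: "c \<in> At" "d \<in> At" "p \<in> cdom c" "F p \<in> cdom d" and D: "mdiff F p"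
 shows "cic c p (pbc F w p) =
  transpose (cmatrix (jac F c d p)) *v cic d (F p) (w (F p))"
 unfolding covector_in_chart_def pullback_covector_def
 by (simp only: matrix_vector_mul_assoc matrix_transpose_mul[symmetric] cmatrix_mult[symmetric]
   frame_differential[OF lip_F c D])

text \<open>In a pair of charts the components of the pullback are obtained from those of
  \<open>w\<close> by the transposed Jacobian, and both factors are measurable. The formula holds at
  good points, which is enough for a complete measure.\<close>

lemma mcf_pull:
 assumes w: "mcf w"
 shows "mcf (pbc F w)"
proof (rule mcfI, rule measurable_pieces[OF lip_F])
 fix c d i assume c: "c \<in> At" and d: "d \<in> At"
 let ?V = "%p j. cic d (F p) (w (F p)) $ j"
 have W: "ldom F c d \<in> sets lebesgue" "ldom F c d \<subseteq> cod c"
  using open_ldom[OF lip_F c d] by (auto simp: ldom_def)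
 have V: "(%x. ?V (cinv c x) j) \<in> mfun (ldom F c d)" for j
 proof -
  have "lmeas (%p. if F p \<in> cdom d then ?V p j else 0)"
   using lmeas_pull[OF lmeas_extend[OF d mcfD[OF w d, of j]]] .
  then have "(%x. if F (cinv c x) \<in> cdom d then ?V (cinv c x) j else 0) \<in> mfun (cod c)"
   using c unfolding lmeas_iff by blast
  then have "(%x. if F (cinv c x) \<in> cdom d then ?V (cinv c x) j else 0) \<in> mfun (ldom F c d)"
   by (rule measurable_restrict_mono) (auto simp: ldom_def)
  then show ?thesis by (rule measurable_cong[THEN iffD1, rotated]) (use c in "auto simp: ldom_def")
 qed
 let ?f = "%p. \<Sum>j\<in>UNIV. complex_of_real (jac F c d p $ j $ i) * ?V p j"
 have J: "(%x. complex_of_real (jac F c d (cinv c x) $ j $ i)) \<in> mfun (ldom F c d)" for j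
  by (rule measurable_compose[OF jac_measurable[OF lip_F c d] borel_measurable_continuous_onI]) (intro continuous_intros)
 have f: "(%x. ?f (cinv c x)) \<in> mfun (ldom F c d)"
  by (intro borel_measurable_sum borel_measurable_times J V)
 show "(%x. cic c (cinv c x) (pbc F w (cinv c x)) $ i)
   \<in> mfun (ldom F c d)"
 proof (rule chart_AE_measurable[OF c W f nullM_bad])
  fix x assume x: "x \<in> ldom F c d" "cinv c x ~: {p. ~ good p}"
  then have "cinv c x \<in> cdom c" "F (cinv c x) \<in> cdom d" "mdiff F (cinv c x)"
   using c by (auto simp: mem_ldom good_def)
  from covector_in_chart_pull[OF c d this, of w]
  show "?f (cinv c x) = cic c (cinv c x) (pbc F w (cinv c x)) $ i"
   by (simp add: matrix_vector_mult_def transpose_def cmatrix_def)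
 qed
qed

lemma pullback_pullback:
 assumes "mdiff F p" "mdiff G (F p)"
 shows "pbc F (pbc G w) p = w p"
 unfolding pullback_covector_def
 by (simp only: matrix_vector_mul_assoc GF matrix_transpose_mul[symmetric] cmatrix_mult[symmetric]
   differential_inverse[OF assms] transpose_mat cmatrix_mat_1 matrix_vector_mul_lid)

end

text \<open>At almost every point the differentials of \<open>F\<close> and \<open>G\<close> are
  inverse to each other, so pulling \<open>k1\<close> back by \<open>G\<close> cancels the pullback
  by \<open>F\<close> and gives \<open>k2\<close>. Each one-sided statement of the locale thereby
  yields its converse.\<close>

lemma (in lip_pull) lip_pull_swap: "lip_pull At G F k2 k1"
proof
 show "lip_map G" "lip_map F" "rough k2" "rough k1" by (fact lip_G lip_F rough2 rough1)+
 show "F (G p) = p" "G (F p) = p" for p by (fact FG GF)+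
 have "nullM {q. ~ good (G q)}"
  using nullM_pull[of "%q. ~ good (G q)"] nullM_bad by (simp add: GF)
 then show "nullM {p. k2 p ~= pbm G k1 p}"
 proof (rule nullM_subset, intro subsetI CollectI notI)
  fix q assume "q \<in> {p. k2 p ~= pbm G k1 p}" "good (G q)"
  then have q: "k2 q ~= pbm G k1 q" "mdiff F (G q)" "mdiff G q" "k1 (G q) = pbm F k2 (G q)"
   by (auto simp: good_def FG)
  let ?D = "Df F (G q)" and ?E = "Df G q"
  have "F o G = id" using FG by auto
  then have "?D ** ?E = mat 1" using differential_compose(2)[OF lip_G q(3,2)] differential_id by simp
  moreover have "pbm G k1 q = transpose (?D ** ?E) ** k2 q ** (?D ** ?E)"
   by (simp add: pullback_metric_def q(4) FG matrix_transpose_mul matrix_mul_assoc)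
  ultimately show False using q(1) by (simp add: transpose_mat)
 qed
qed

section \<open>Square integrable functions and covector fields\<close>

context manifold
begin

lemma lmeas_continuous:
 assumes "lmeas f" "continuous_on UNIV g"
 shows "lmeas (%p. g (f p))"
 unfolding lmeas_def
proof
 fix B :: "'b set" assume "B \<in> sets borel"
 then have "g -` B \<in> sets borel" using borel_measurable_continuous_onI[OF assms(2)] by (simp add: measurable_def)
 then have "f -` (g -` B) \<in> LS" using assms(1) unfolding lmeas_def by blast
 then show "(%p. g (f p)) -` B \<in> LS" by (simp add: vimage_def)
qed

lemma lmeas_lebesgue_measurable: "lmeas f \<longleftrightarrow> f \<in> borel_measurable (measure_of UNIV (LS) (%_. 0))"
 using sigma_algebra.sets_measure_of_eq[OF lebesgue_sets_algebra]
 unfolding measurable_def lmeas_def by (simp add: space_measure_of_conv)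

lemma lmeas_add: "lmeas f ==> lmeas g ==> lmeas (%p. f p + g p :: 'b::euclidean_space)"
 and lmeas_diff: "lmeas f ==> lmeas g ==> lmeas (%p. f p - g p :: 'b::euclidean_space)"
 and lmeas_mult: "lmeas f' ==> lmeas g' ==> lmeas (%p. f' p * g' p :: complex)"
 unfolding lmeas_lebesgue_measurable by simp_all

lemma lmeas_cmod_square: "lmeas u ==> lmeas (%p. (cmod (u p))\<^sup>2)"
 by (rule lmeas_continuous[of u "%z. (cmod z)\<^sup>2"], assumption) (intro continuous_intros)

lemma Re_cov_inner_lmeas: "rough k ==> mcf w ==> lmeas (%p. Re (cov_inner (k p) (w p) (w p)))"
 by (rule lmeas_continuous[OF cov_inner_lmeas, of _ _ _ Re]) (auto intro: continuous_intros)

lemma L2_fun_iff: "rough k ==> u \<in> L2f k \<longleftrightarrow> lmeas u & integrable (vol At k) (%p. (cmod (u p))\<^sup>2)"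
 unfolding L2_fun_def by (simp add: vol_measurable_iff)

lemma L2_cov_iff: "w \<in> L2c k \<longleftrightarrow> mcf w & integrable (vol At k) (%p. Re (cov_inner (k p) (w p) (w p)))"
 unfolding L2_cov_def by simp

text \<open>The squared norm is used throughout: it is a plain integral, is preserved by pullbacks
  as such, and obeys a triangle inequality with factors 2 that follows from a pointwise bound. This
  is sufficient for taking closures.\<close>

definition N0 :: "('m => real^'n^'n) => ('m => complex) => real" where
 "N0 k u = (LINT p|vol At k. (cmod (u p))\<^sup>2)"

definition N1 :: "('m => real^'n^'n) => ('m => complex^'n) => real" where
 "N1 k w = (LINT p|vol At k. Re (cov_inner (k p) (w p) (w p)))"

lemma AE_posdef: "rough k ==> AE p in vol At k. posdef (k p)"
 using AE_vol_iff rough_posdef by blast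

lemma N0_nonneg: "0 <= N0 k u"
 unfolding N0_def by simp

lemma N1_nonneg: "rough k ==> 0 <= N1 k w"
 unfolding N1_def by (intro integral_nonneg_AE) (use AE_posdef Re_cov_inner_nonneg in fastforce)

lemma L2_fun_norm_N0: "L2_fun_norm At k u = sqrt (N0 k u)"
proof -
 have "u p * cnj (u p) = complex_of_real ((cmod (u p))\<^sup>2)" for p using complex_norm_square[of "u p"] by simp
 then show ?thesis by (simp add: L2_fun_norm_def L2_fun_inner_def N0_def del: of_real_power)
qed

lemma L2_cov_norm_N1:
 assumes k: "rough k" and w: "mcf w"
 shows "L2_cov_norm At k w = sqrt (N1 k w)"
proof -
 have "(LINT p|vol At k. cov_inner (k p) (w p) (w p)) = (LINT p|vol At k. complex_of_real (Re (cov_inner (k p) (w p) (w p))))"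
 proof (rule integral_cong_AE)
  show "(%p. cov_inner (k p) (w p) (w p)) \<in> borel_measurable (vol At k)"
   unfolding vol_measurable_iff[OF k] by (rule cov_inner_lmeas[OF k w w])
  show "(%p. complex_of_real (Re (cov_inner (k p) (w p) (w p)))) \<in> borel_measurable (vol At k)"
   unfolding vol_measurable_iff[OF k]
   by (rule lmeas_continuous[OF cov_inner_lmeas[OF k w w], of "%z. complex_of_real (Re z)"]) (intro continuous_intros)
  show "AE p in vol At k. cov_inner (k p) (w p) (w p) = complex_of_real (Re (cov_inner (k p) (w p) (w p)))"
   using AE_posdef[OF k] by eventually_elim (simp add: complex_eq_iff Im_cov_inner_self)
 qed
 then show ?thesis by (simp add: L2_cov_norm_def L2_cov_inner_def N1_def)
qed

lemma integrable_two_bound: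
 fixes f g h :: "'m => real"
 assumes "integrable (vol At k) f" "integrable (vol At k) g" "rough k" "lmeas h"
  and b: "AE p in vol At k. 0 <= h p & h p <= 2 * f p + 2 * g p"
 shows "integrable (vol At k) h" "integral\<^sup>L (vol At k) h <= 2 * integral\<^sup>L (vol At k) f + 2 * integral\<^sup>L (vol At k) g"
proof -
 have i: "integrable (vol At k) (%p. 2 * f p + 2 * g p)" using assms by auto
 have "AE p in vol At k. norm (h p) <= norm (2 * f p + 2 * g p)" using b by eventually_elim auto
 then show h: "integrable (vol At k) h"
  by (rule Bochner_Integration.integrable_bound[OF i, rotated]) (use assms in "simp add: vol_measurable_iff")
 have "integral\<^sup>L (vol At k) h <= (LINT p|vol At k. 2 * f p + 2 * g p)"
  by (rule integral_mono_AE[OF h i]) (use b in auto)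
 then show "integral\<^sup>L (vol At k) h <= 2 * integral\<^sup>L (vol At k) f + 2 * integral\<^sup>L (vol At k) g" using assms by simp
qed

lemma cmod_add_square_le: "(cmod (a + b))\<^sup>2 <= 2 * (cmod a)\<^sup>2 + 2 * (cmod b)\<^sup>2"
proof -
 have "(cmod (a + b))\<^sup>2 <= (cmod a + cmod b)\<^sup>2" by (intro power_mono norm_triangle_ineq) auto
 also have "... <= 2 * (cmod a)\<^sup>2 + 2 * (cmod b)\<^sup>2"
  using zero_le_power2[of "cmod a - cmod b"] by (simp add: power2_eq_square algebra_simps)
 finally show ?thesis .
qed

lemma L2_fun_add:
 assumes k: "rough k" and u: "u \<in> L2f k" "v \<in> L2f k"
 shows "(%p. u p + v p) \<in> L2f k" "N0 k (%p. u p + v p) <= 2 * N0 k u + 2 * N0 k v"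
proof -
 have m: "lmeas (%p. u p + v p)" using u unfolding L2_fun_iff[OF k] by (intro lmeas_add) auto
 note * = integrable_two_bound[OF _ _ k lmeas_cmod_square[OF m], of "%p. (cmod (u p))\<^sup>2" "%p. (cmod (v p))\<^sup>2"]
 show "(%p. u p + v p) \<in> L2f k" "N0 k (%p. u p + v p) <= 2 * N0 k u + 2 * N0 k v"
  using * u m cmod_add_square_le unfolding L2_fun_iff[OF k] N0_def by auto
qed

lemma L2_cov_add:
 assumes k: "rough k" and w: "w \<in> L2c k" "z \<in> L2c k"
 shows "(%p. w p + z p) \<in> L2c k" "N1 k (%p. w p + z p) <= 2 * N1 k w + 2 * N1 k z"
proof -
 have m: "mcf (%p. w p + z p)" using w unfolding L2_cov_iff by (intro mcf_add) auto
 have b: "AE p in vol At k. 0 <= Re (cov_inner (k p) (w p + z p) (w p + z p)) &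
   Re (cov_inner (k p) (w p + z p) (w p + z p)) <= 2 * Re (cov_inner (k p) (w p) (w p)) + 2 * Re (cov_inner (k p) (z p) (z p))"
  using AE_posdef[OF k] by eventually_elim (auto intro: Re_cov_inner_nonneg Re_cov_inner_add_le)
 note * = integrable_two_bound[OF _ _ k Re_cov_inner_lmeas[OF k m] b]
 show "(%p. w p + z p) \<in> L2c k" "N1 k (%p. w p + z p) <= 2 * N1 k w + 2 * N1 k z"
  using * w m unfolding L2_cov_iff N1_def by auto
qed

lemma L2_fun_uminus: "rough k ==> u \<in> L2f k ==> (%p. - u p) \<in> L2f k"
 using lmeas_continuous[of u uminus] continuous_on_minus[OF continuous_on_id, of "UNIV :: complex set"]
 by (auto simp: L2_fun_iff)

lemma L2_cov_uminus: "w \<in> L2c k ==> (%p. - w p) \<in> L2c k"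
proof -
 assume w: "w \<in> L2c k"
 have "mcf (%p. (w p - w p) - w p)" using w unfolding L2_cov_iff by (intro mcf_diff) auto
 moreover have "cov_inner (k p) (- w p) (- w p) = cov_inner (k p) (w p) (w p)" for p by (simp add: cov_inner_def)
 ultimately show ?thesis using w by (simp add: L2_cov_iff)
qed

lemma L2_fun_diff: "rough k ==> u \<in> L2f k ==> v \<in> L2f k ==> (%p. u p - v p) \<in> L2f k"
 using L2_fun_add(1)[OF _ _ L2_fun_uminus, of k u v] by simp

lemma L2_cov_diff: "rough k ==> w \<in> L2c k ==> z \<in> L2c k ==> (%p. w p - z p) \<in> L2c k"
 using L2_cov_add(1)[OF _ _ L2_cov_uminus, of k w z] by simp

lemma N0_triangle:
 assumes "rough k" "u \<in> L2f k" "v \<in> L2f k" "x \<in> L2f k"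
 shows "N0 k (%p. u p - x p) <= 2 * N0 k (%p. u p - v p) + 2 * N0 k (%p. v p - x p)"
 using L2_fun_add(2)[OF assms(1) L2_fun_diff[OF assms(1-3)] L2_fun_diff[OF assms(1,3,4)]] by simp

lemma N1_triangle:
 assumes "rough k" "u \<in> L2c k" "v \<in> L2c k" "x \<in> L2c k"
 shows "N1 k (%p. u p - x p) <= 2 * N1 k (%p. u p - v p) + 2 * N1 k (%p. v p - x p)"
 using L2_cov_add(2)[OF assms(1) L2_cov_diff[OF assms(1-3)] L2_cov_diff[OF assms(1,3,4)]] by simp

lemma L2_fun_AE:
 assumes k: "rough k" and u: "u \<in> L2f k" and eq: "nullM {p. u p ~= v p}"
 shows "v \<in> L2f k"
proof -
 have v: "lmeas v" using u lmeas_AE[OF _ eq] by (simp add: L2_fun_iff[OF k])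
 have "integrable (vol At k) (%p. (cmod (u p))\<^sup>2) \<longleftrightarrow> integrable (vol At k) (%p. (cmod (v p))\<^sup>2)"
 proof (rule integrable_cong_AE)
  have "AE p in vol At k. u p = v p" using AE_vol_iff[OF k] eq by blast
  then show "AE p in vol At k. (cmod (u p))\<^sup>2 = (cmod (v p))\<^sup>2" by eventually_elim simp
 qed (use u v lmeas_cmod_square in "auto simp: vol_measurable_iff[OF k] L2_fun_iff[OF k]")
 then show ?thesis using u v by (simp add: L2_fun_iff[OF k])
qed

lemma L2_cov_AE:
 assumes k: "rough k" and w: "w \<in> L2c k" and eq: "nullM {p. w p ~= z p}"
 shows "z \<in> L2c k"
proof -
 have z: "mcf z" using w mcf_AE[OF _ eq] by (simp add: L2_cov_iff)
 have "integrable (vol At k) (%p. Re (cov_inner (k p) (w p) (w p))) \<longleftrightarrow> integrable (vol At k) (%p. Re (cov_inner (k p) (z p) (z p)))"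
 proof (rule integrable_cong_AE)
  have "AE p in vol At k. w p = z p" using AE_vol_iff[OF k] eq by blast
  then show "AE p in vol At k. Re (cov_inner (k p) (w p) (w p)) = Re (cov_inner (k p) (z p) (z p))" by eventually_elim simp
 qed (use w z Re_cov_inner_lmeas[OF k] in "auto simp: vol_measurable_iff[OF k] L2_cov_iff")
 then show ?thesis using w z by (simp add: L2_cov_iff)
qed

end

context lip_pull
begin

lemma integral_pull_AE:
 fixes f :: "'m => 'b::euclidean_space"
 assumes f: "lmeas f" and eq: "nullM {p. f' p ~= f (F p)}"
 shows "(LINT p|vol At k1. f' p) = (LINT q|vol At k2. f q)"
  "integrable (vol At k1) f' \<longleftrightarrow> integrable (vol At k2) f"
proof -
 have n: "nullM {p. f (F p) ~= f' p}" using eq by (simp add: eq_commute)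
 have m: "(%p. f (F p)) \<in> borel_measurable (vol At k1)" "f' \<in> borel_measurable (vol At k1)"
  unfolding vol_measurable_iff[OF rough1] using lmeas_pull[OF f] lmeas_AE[OF lmeas_pull[OF f] n] by auto
 have a: "AE p in vol At k1. f' p = f (F p)" using eq AE_vol_iff[OF rough1] by blast
 show "(LINT p|vol At k1. f' p) = (LINT q|vol At k2. f q)"
  using integral_cong_AE[OF m(2,1) a] integral_pull(1)[OF f] by simp
 show "integrable (vol At k1) f' \<longleftrightarrow> integrable (vol At k2) f"
  using integrable_cong_AE[OF m(2,1) a] integral_pull(2)[OF f] by simp
qed

lemma L2_fun_pull:
 assumes u: "lmeas u" and eq: "nullM {p. u' p ~= u (F p)}"
 shows "u' \<in> L2f k1 \<longleftrightarrow> u \<in> L2f k2" "N0 k1 u' = N0 k2 u"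
proof -
 have n: "nullM {p. u (F p) ~= u' p}" using eq by (simp add: eq_commute)
 have e: "nullM {p. (cmod (u' p))\<^sup>2 ~= (cmod (u (F p)))\<^sup>2}" by (rule nullM_subset[OF eq]) auto
 note * = integral_pull_AE[OF lmeas_cmod_square[OF u] e]
 show "u' \<in> L2f k1 \<longleftrightarrow> u \<in> L2f k2" "N0 k1 u' = N0 k2 u"
  using * u lmeas_AE[OF lmeas_pull[OF u] n] by (auto simp: L2_fun_iff rough1 rough2 N0_def)
qed

lemma nullM_cov_inner_pull:
 assumes "nullM {p. w' p ~= pbc F w p}" "nullM {p. z' p ~= pbc F z p}"
 shows "nullM {p. cov_inner (k1 p) (w' p) (z' p) ~= cov_inner (k2 (F p)) (w (F p)) (z (F p))}"
 by (rule nullM_subset[OF nullM_Un[OF nullM_bad nullM_Un[OF assms]]]) (auto simp: cov_inner_pull)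

lemma L2_cov_pull:
 assumes w: "mcf w" and eq: "nullM {p. w' p ~= pbc F w p}"
 shows "w' \<in> L2c k1 \<longleftrightarrow> w \<in> L2c k2" "N1 k1 w' = N1 k2 w"
proof -
 have n: "nullM {p. pbc F w p ~= w' p}" using eq by (simp add: eq_commute)
 have e: "nullM {p. Re (cov_inner (k1 p) (w' p) (w' p)) ~= Re (cov_inner (k2 (F p)) (w (F p)) (w (F p)))}"
  by (rule nullM_subset[OF nullM_cov_inner_pull[OF eq eq]]) auto
 note * = integral_pull_AE[OF Re_cov_inner_lmeas[OF rough2 w] e]
 show "w' \<in> L2c k1 \<longleftrightarrow> w \<in> L2c k2" "N1 k1 w' = N1 k2 w"
  using * w mcf_AE[OF mcf_pull[OF w] n] by (auto simp: L2_cov_iff N1_def)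
qed

end

section \<open>Locally Lipschitz functions on the manifold\<close>

lemma loc_lip_on_local:
 assumes "!!x. x \<in> W ==> EX V. open V & x \<in> V & V \<subseteq> W & loc_lip_on V f"
 shows "loc_lip_on W f"
 unfolding loc_lip_on_def
proof
 fix x assume "x \<in> W"
 then obtain V where V: "x \<in> V" "V \<subseteq> W" "loc_lip_on V f" using assms by blast
 obtain r L where "r > 0" "ball x r \<subseteq> V" "L-lipschitz_on (ball x r) f" by (rule loc_lip_onE[OF V(3,1)])
 then show "\<exists>r>0. EX L. ball x r \<subseteq> W & L-lipschitz_on (ball x r) f" using V(2) by blast
qed

lemma lipschitz_loc_lip_on: "open W ==> L-lipschitz_on W f ==> loc_lip_on W f"
 unfolding loc_lip_on_def using lipschitz_on_subset open_contains_ball by metis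

lemma loc_lip_on_mult:
 fixes f g :: "'a::metric_space => complex"
 assumes f: "loc_lip_on W f" and g: "loc_lip_on W g"
 shows "loc_lip_on W (%x. f x * g x)"
 unfolding loc_lip_on_def
proof
 fix x assume x: "x \<in> W"
 obtain r L where r: "r > 0" "ball x r \<subseteq> W" "L-lipschitz_on (ball x r) f" by (rule loc_lip_onE[OF f x])
 obtain s M where s: "s > 0" "ball x s \<subseteq> W" "M-lipschitz_on (ball x s) g" by (rule loc_lip_onE[OF g x])
 \<comment> \<open>A radius of at most 1 turns the Lipschitz constants into bounds on the factors,
   as needed for a product.\<close>
 define t where "t = min 1 (min r s)"
 have sub: "ball x t \<subseteq> ball x r" "ball x t \<subseteq> ball x s" by (auto simp: t_def)
 have LM: "0 <= L" "0 <= M" using lipschitz_on_nonneg r(3) s(3) by blast+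
 have fb: "cmod (f y) <= cmod (f x) + L" and gb: "cmod (g y) <= cmod (g x) + M" if "y \<in> ball x t" for y
 proof -
  have y: "dist y x <= 1" "x \<in> ball x r" "x \<in> ball x s" "y \<in> ball x r" "y \<in> ball x s"
   using that r s sub by (auto simp: t_def dist_commute)
  from mult_left_mono[OF y(1) LM(1)] mult_left_mono[OF y(1) LM(2)]
  have "dist (f y) (f x) <= L" "dist (g y) (g x) <= M"
   using lipschitz_onD[OF r(3) y(4,2)] lipschitz_onD[OF s(3) y(5,3)] by linarith+
  then show "cmod (f y) <= cmod (f x) + L" "cmod (g y) <= cmod (g x) + M"
   using norm_triangle_sub[of "f y" "f x"] norm_triangle_sub[of "g y" "g x"] by (auto simp: dist_norm)
 qed
 have "((cmod (f x) + L) * M + L * (cmod (g x) + M))-lipschitz_on (ball x t) (%x. f x * g x)"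
 proof (rule lipschitz_onI)
  fix y z assume yz: "y \<in> ball x t" "z \<in> ball x t"
  have d: "cmod (f y - f z) <= L * dist y z" "cmod (g y - g z) <= M * dist y z"
   using lipschitz_onD[OF r(3) subsetD[OF sub(1) yz(1)] subsetD[OF sub(1) yz(2)]]
    lipschitz_onD[OF s(3) subsetD[OF sub(2) yz(1)] subsetD[OF sub(2) yz(2)]] by (auto simp: dist_norm)
  have "f y * g y - f z * g z = f y * (g y - g z) + (f y - f z) * g z" by (simp add: algebra_simps)
  then have "dist (f y * g y) (f z * g z) <= cmod (f y * (g y - g z)) + cmod ((f y - f z) * g z)"
   unfolding dist_norm by (metis norm_triangle_ineq)
  also have "... = cmod (f y) * cmod (g y - g z) + cmod (f y - f z) * cmod (g z)" by (simp add: norm_mult)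
  also have "... <= (cmod (f x) + L) * (M * dist y z) + (L * dist y z) * (cmod (g x) + M)"
   by (intro add_mono mult_mono fb gb yz d) (use LM in auto)
  finally show "dist (f y * g y) (f z * g z) <= ((cmod (f x) + L) * M + L * (cmod (g x) + M)) * dist y z"
   by (simp add: algebra_simps)
 qed (use LM in auto)
 moreover have "t > 0" "ball x t \<subseteq> W" using r s sub by (auto simp: t_def)
 ultimately show "\<exists>r>0. EX L. ball x r \<subseteq> W & L-lipschitz_on (ball x r) (%x. f x * g x)" by blast
qed

lemma loc_lip_on_const_diff: "loc_lip_on W f ==> loc_lip_on W (%x. (c::'b::real_normed_vector) - f x)"
 unfolding loc_lip_on_def lipschitz_on_def by (simp add: dist_norm norm_minus_commute)

text \<open>On the ball enlarged by 1, compactness makes the local constants uniform. A point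
  outside of it has distance at least 1 from the support, so there the bound \<open>b\<close> on
  \<open>f\<close> can serve as a Lipschitz constant.\<close>

lemma loc_lip_compact_support_lipschitz:
 fixes f :: "real^'n::finite => complex"
 assumes f: "loc_lip_on UNIV f" and s: "!!y. y ~: cball x rh ==> f y = 0"
 obtains L where "L-lipschitz_on UNIV f"
proof -
 define B where "B = cball x (rh + 1)"
 have B: "compact B" unfolding B_def by simp
 have "local_lipschitz {0::real} B (%_. f)"
 proof (rule local_lipschitzI)
  fix t :: real and y assume "y \<in> B"
  obtain r L where r: "r > 0" "L-lipschitz_on (ball y r) f" using loc_lip_onE[OF f, of y] by blast
  have "L-lipschitz_on (cball y (r/2) Int B) f" by (rule lipschitz_on_subset[OF r(2)]) (use r(1) in auto)
  then show "\<exists>u>0. EX L. \<forall>t\<in>cball t u Int {0}. L-lipschitz_on (cball y u Int B) f"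
   using r(1) by (intro exI[of _ "r/2"]) auto
 qed
 from local_lipschitz_compact_implies_lipschitz[OF this B compact_sing[of "0::real"]]
 obtain L where L: "L-lipschitz_on B f" by auto
 have "bounded (f ` B)"
  using loc_lip_on_continuous[OF f] by (intro compact_imp_bounded compact_continuous_image B) (auto intro: continuous_on_subset)
 then obtain b where b: "!!y. y \<in> B ==> cmod (f y) <= b" "b \<ge> 0" unfolding bounded_pos by (force intro: less_imp_le)
 have L0: "L \<ge> 0" by (rule lipschitz_on_nonneg[OF L])
 have far: "dist (f y) (f z) <= (L + b) * dist y z" if "z ~: B" for y z
 proof -
  have fz: "f z = 0" using that by (intro s) (auto simp: B_def)
  show ?thesis
  proof (cases "y \<in> cball x rh")
   case True
   have "dist x z <= dist x y + dist y z" by (rule dist_triangle)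
   then have "1 <= dist y z" using that True by (auto simp: B_def)
   then have "b * 1 <= (L + b) * dist y z" using b(2) L0 by (intro mult_mono) auto
   then show ?thesis using b(1)[of y] True fz by (auto simp: B_def)
  next
   case False
   then show ?thesis using s[of y] fz b(2) L0 by simp
  qed
 qed
 have "(L + b)-lipschitz_on UNIV f"
 proof (rule lipschitz_onI)
  fix y z :: "real^'n"
  consider "z ~: B" | "y ~: B" | "y \<in> B" "z \<in> B" by blast
  then show "dist (f y) (f z) <= (L + b) * dist y z"
  proof cases
   case 1 then show ?thesis by (rule far)
  next
   case 2 then show ?thesis using far[of y z] by (simp add: dist_commute)
  next
   case 3
   then have "dist (f y) (f z) <= L * dist y z" by (rule lipschitz_onD[OF L])
   also have "... <= (L + b) * dist y z" using b(2) by (intro mult_right_mono) auto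
   finally show ?thesis .
  qed
 qed (use L0 b in auto)
 then show ?thesis by (rule that)
qed

context manifold
begin

definition lip_fun :: "('m => complex) => bool" where
 "lip_fun v \<longleftrightarrow> (\<forall>c\<in>At. loc_lip_on (cod c) (v o cinv c))"

definition vdiff :: "('m => complex) => 'm => bool" where
 "vdiff v p \<longleftrightarrow> v o cinv (chart_at At p) differentiable at (cmap (chart_at At p) p)"

definition cgrad :: "('m, 'n) chart => ('m => complex) => 'm => complex^'n" where
 "cgrad c v p = (\<chi> i. frechet_derivative (v o cinv c) (at (cmap c p)) (axis i 1))"

lemma ext_deriv_cgrad: "dd v p = cgrad (chart_at At p) v p"
 by (simp add: ext_deriv_def cgrad_def)

text \<open>The chain rule in the shape in which covectors transform. When \<open>F\<close> is the
  identity it is the change of chart for differentials; in general it says that the exterior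
  derivative commutes with pullback at points of differentiability.\<close>

lemma cgrad_compose:
 assumes F: "lip_map F" and c: "c \<in> At" "d \<in> At" and p: "p \<in> cdom c" "F p \<in> cdom d"
  and D: "lrep F c d differentiable at (cmap c p)"
  and v: "v o cinv d differentiable at (cmap d (F p))"
 shows "(v o F) o cinv c differentiable at (cmap c p)"
  "cgrad c (v o F) p = transpose (cmatrix (jac F c d p)) *v cgrad d v (F p)"
proof -
 let ?D = "frechet_derivative (v o cinv d) (at (cmap d (F p)))"
 have vD: "(v o cinv d has_derivative ?D) (at (lrep F c d (cmap c p)))"
  using v c p by (simp add: frechet_derivative_works)
 from diff_chain_at[OF has_derivative_jacobian[OF D] this]
 have "((v o cinv d) o lrep F c d has_derivative (%h. ?D (jac F c d p *v h))) (at (cmap c p))"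
  by (simp add: comp_def jac_def)
 then have *: "((v o F) o cinv c has_derivative (%h. ?D (jac F c d p *v h))) (at (cmap c p))"
  by (rule has_derivative_transform_within_open[OF _ open_ldom[OF F c] ldom_mem[where F=F, OF p]])
   (use c in "auto simp: mem_ldom lrep_def")
 then show "(v o F) o cinv c differentiable at (cmap c p)" unfolding differentiable_def by blast
 have lin: "linear ?D" by (rule has_derivative_linear[OF vD])
 have "cgrad c (v o F) p $ i = (transpose (cmatrix (jac F c d p)) *v cgrad d v (F p)) $ i" for i
 proof -
  have "cgrad c (v o F) p $ i = ?D (jac F c d p *v axis i 1)"
   using frechet_derivative_at[OF *] by (simp add: cgrad_def) metis
  also have "... = (\<Sum>j\<in>UNIV. (jac F c d p *v axis i 1) $ j *\<^sub>R ?D (axis j 1))" by (rule linear_axis_sum[OF lin])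
  also have "... = (\<Sum>j\<in>UNIV. cmatrix (jac F c d p) $ j $ i * cgrad d v (F p) $ j)"
   by (simp add: cgrad_def cmatrix_def matrix_vector_mult_basis column_def scaleR_conv_of_real[where 'a=complex])
  finally show ?thesis by (simp add: matrix_vector_mult_def transpose_def)
 qed
 then show "cgrad c (v o F) p = transpose (cmatrix (jac F c d p)) *v cgrad d v (F p)" by (simp add: vec_eq_iff)
qed

lemma vdiff_chart:
 assumes c: "c \<in> At" "p \<in> cdom c"
 shows "vdiff v p \<longleftrightarrow> v o cinv c differentiable at (cmap c p)"
  "vdiff v p ==> cic c p (dd v p) = cgrad c v p"
proof -
 let ?a = "chart_at At p"
 note a = chart_at[of p]
 show "vdiff v p \<longleftrightarrow> v o cinv c differentiable at (cmap c p)"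
  unfolding vdiff_def
  using cgrad_compose(1)[OF lip_map_id c(1) a(1) c(2), of v] cgrad_compose(1)[OF lip_map_id a(1) c(1) a(2), of v]
   transition_differentiable[OF c(1) a(1) c(2) a(2)] transition_differentiable[OF a(1) c(1) a(2) c(2)] a c by auto
 show "cic c p (dd v p) = cgrad c v p" if "vdiff v p"
  using that cgrad_compose(2)[OF lip_map_id c(1) a(1) c(2), of v] transition_differentiable[OF c(1) a(1) c(2) a(2)] a
  by (simp add: vdiff_def covector_in_chart_def frame_jac ext_deriv_cgrad)
qed

lemma lip_fun_nullM:
 assumes "lip_fun v"
 shows "nullM {p. ~ vdiff v p}"
 unfolding nullM_def
proof
 fix c assume c: "c \<in> At"
 have "negligible {x\<in>cod c. ~ v o cinv c differentiable at x}"
  using assms c unfolding lip_fun_def by (intro loc_lip_on_differentiable_ae) blast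
 then show "negligible (cmap c ` ({p. ~ vdiff v p} Int cdom c))"
  by (rule negligible_subset) (use vdiff_chart(1)[OF c] in blast)
qed

lemma lip_fun_lmeas:
 assumes "lip_fun v"
 shows "lmeas v"
 unfolding lmeas_iff
proof
 fix c assume c: "c \<in> At"
 have "continuous_on (cod c) (v o cinv c)"
  using assms c unfolding lip_fun_def by (intro loc_lip_on_continuous) blast
 then show "(%x. v (cinv c x)) \<in> mfun (cod c)"
  using continuous_imp_measurable_on_sets_lebesgue[OF _ cod_lebesgue[OF c]] by (simp add: comp_def)
qed

lemma lip_fun_mcf:
 assumes v: "lip_fun v"
 shows "mcf (dd v)"
proof (rule mcfI)
 fix c i assume c: "c \<in> At"
 have "(%x. frechet_derivative (v o cinv c) (at x) (axis i 1)) \<in> mfun (cod c)"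
  using v c unfolding lip_fun_def by (intro frechet_derivative_measurable) blast
 then have "(%x. cgrad c v (cinv c x) $ i) \<in> mfun (cod c)"
  by (rule measurable_cong[THEN iffD1, rotated]) (use c in "simp add: cgrad_def")
 then show "(%x. cic c (cinv c x) (dd v (cinv c x)) $ i) \<in> mfun (cod c)"
  by (rule chart_AE_measurable[OF c cod_lebesgue[OF c] order_refl _ lip_fun_nullM[OF v]])
   (use c vdiff_chart(2)[OF c] in auto)
qed

lemma lip_fun_mult: "lip_fun v ==> lip_fun u ==> lip_fun (%p. v p * u p)"
 unfolding lip_fun_def comp_def by (intro ballI loc_lip_on_mult) (erule (1) bspec)+

lemma lip_fun_const_diff: "lip_fun v ==> lip_fun (%p. z - v p)"
 unfolding lip_fun_def comp_def by (intro ballI loc_lip_on_const_diff) (erule (1) bspec)+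

lemma lip_fun_compose:
 assumes F: "lip_map F" and v: "lip_fun v"
 shows "lip_fun (v o F)"
 unfolding lip_fun_def
proof (intro ballI loc_lip_on_local)
 fix c x assume c: "c \<in> At" and x: "x \<in> cod c"
 define d where "d = chart_at At (F (cinv c x))"
 have d: "d \<in> At" "F (cinv c x) \<in> cdom d" unfolding d_def by (rule chart_at)+
 have "loc_lip_on (ldom F c d) ((v o cinv d) o lrep F c d)"
 proof (rule loc_lip_on_compose[OF lip_mapD[OF F c d(1)], where V="cod d"])
  show "loc_lip_on (cod d) (v o cinv d)" using v d(1) unfolding lip_fun_def by blast
  show "lrep F c d ` ldom F c d \<subseteq> cod d" using c by (auto simp: mem_ldom lrep_def)
 qed
 then have "loc_lip_on (ldom F c d) (v o F o cinv c)"
  by (rule loc_lip_on_cong) (use c d in "simp add: mem_ldom lrep_def")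
 moreover have "x \<in> ldom F c d" "ldom F c d \<subseteq> cod c" using x c d by (auto simp: mem_ldom)
 ultimately show "EX V. open V & x \<in> V & V \<subseteq> cod c & loc_lip_on V (v o F o cinv c)"
  using open_ldom[OF F c d(1)] by blast
qed

lemma smooth_lip_fun:
 assumes "smooth_fun At v"
 shows "lip_fun v"
 unfolding lip_fun_def
proof
 fix c assume c: "c \<in> At"
 then have "Ck_on (Suc 0) (cod c) (v o cinv c)" using assms unfolding smooth_fun_def smooth_on_def by blast
 then show "loc_lip_on (cod c) (v o cinv c)" by (rule Ck_on_1_loc_lip[OF open_cod[OF c]])
qed

lemma smooth_vdiff:
 assumes "smooth_fun At v"
 shows "vdiff v p"
proof -
 let ?c = "chart_at At p"
 have "Ck_on (Suc 0) (cod ?c) (v o cinv ?c)"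
  using assms chart_at(1) unfolding smooth_fun_def smooth_on_def by blast
 from Ck_on_SucD[OF this open_cod[OF chart_at(1)], of "cmap ?c p"] show ?thesis
  unfolding vdiff_def differentiable_def using chart_at(2) by blast
qed

section \<open>Functions supported in one chart\<close>

definition chart_ext :: "('m, 'n) chart => (real^'n => complex) => 'm => complex" where
 "chart_ext c U p = (if p \<in> cdom c then U (cmap c p) else 0)"

lemma compact_chart_image: "c \<in> At ==> compact K ==> K \<subseteq> cod c ==> compact (cinv c ` K)"
 by (rule compact_continuous_image[OF continuous_on_subset[OF cont_inv]])

lemma chart_ext_support:
 assumes c: "c \<in> At" and s: "!!y. y ~: K ==> U y = 0" and "chart_ext c U p ~= 0"
 shows "p \<in> cinv c ` K"
proof -
 have "p \<in> cdom c" "cmap c p \<in> K" using assms by (auto simp: chart_ext_def split: if_splits)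
 then show ?thesis using c by (intro image_eqI[of _ _ "cmap c p"]) auto
qed

lemma chart_ext_local:
 assumes c: "c \<in> At" "d \<in> At" and K: "compact K" "K \<subseteq> cod c" and s: "!!y. y ~: K ==> U y = 0" and y: "y \<in> cod d"
 obtains V where "open V" "y \<in> V" "V \<subseteq> ldom id d c" "!!z. z \<in> V ==> (chart_ext c U o cinv d) z = U (lrep id d c z)"
 | V where "open V" "y \<in> V" "V \<subseteq> cod d" "!!z. z \<in> V ==> (chart_ext c U o cinv d) z = 0"
proof (cases "cinv d y \<in> cdom c")
 case True
 show ?thesis
 proof (rule that(1)[of "ldom id d c"])
  show "open (ldom id d c)" by (rule open_ldom[OF lip_map_id c(2,1)])
  show "y \<in> ldom id d c" using True y c by (simp add: mem_ldom)
 qed (use c in "auto simp: mem_ldom chart_ext_def lrep_def")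
next
 case False
 have cl: "closed (cinv c ` K)" using compact_chart_image[OF c(1) K] by (rule compact_imp_closed)
 define V where "V = cod d Int cinv d -` (- (cinv c ` K))"
 show ?thesis
 proof (rule that(2)[of V])
  show "open V" unfolding V_def
   by (rule continuous_open_preimage[OF cont_inv[OF c(2)] open_cod[OF c(2)]]) (use cl in auto)
  have "cinv c ` K \<subseteq> cdom c" using K(2) c by auto
  then show "y \<in> V" using False y by (auto simp: V_def)
  show "(chart_ext c U o cinv d) z = 0" if "z \<in> V" for z
   using chart_ext_support[where U=U and K=K and p="cinv d z", OF c(1) s] that unfolding V_def comp_def by blast
 qed (simp add: V_def)
qed

lemma chart_ext_lip_fun:
 assumes c: "c \<in> At" and K: "compact K" "K \<subseteq> cod c" and s: "!!y. y ~: K ==> U y = 0" and U: "loc_lip_on UNIV U"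
 shows "lip_fun (chart_ext c U)"
 unfolding lip_fun_def
proof (intro ballI loc_lip_on_local)
 fix d y assume d: "d \<in> At" and y: "y \<in> cod d"
 show "EX V. open V & y \<in> V & V \<subseteq> cod d & loc_lip_on V (chart_ext c U o cinv d)"
 proof (rule chart_ext_local[where U=U, OF c d K s y])
  fix V assume V: "open V" "y \<in> V" "V \<subseteq> ldom id d c" "!!z. z \<in> V ==> (chart_ext c U o cinv d) z = U (lrep id d c z)"
  have "loc_lip_on V (U o lrep id d c)"
   by (rule loc_lip_on_compose[OF loc_lip_on_subset[OF lip_mapD[OF lip_map_id d c] V(1,3)] U]) simp
  then have "loc_lip_on V (chart_ext c U o cinv d)" by (rule loc_lip_on_cong) (use V(4) in simp)
  moreover have "V \<subseteq> cod d" using V(3) by (auto simp: ldom_def)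
  ultimately show ?thesis using V by blast
 next
  fix V assume V: "open V" "y \<in> V" "V \<subseteq> cod d" "!!z. z \<in> V ==> (chart_ext c U o cinv d) z = 0"
  have "loc_lip_on V (%_. 0 :: complex)" by (rule lipschitz_loc_lip_on[OF V(1), of 0]) (simp add: lipschitz_on_def)
  then have "loc_lip_on V (chart_ext c U o cinv d)" by (rule loc_lip_on_cong) (use V(4) in simp)
  then show ?thesis using V by blast
 qed
qed

lemma chart_ext_smooth:
 assumes c: "c \<in> At" and K: "compact K" "K \<subseteq> cod c" and s: "!!y. y ~: K ==> U y = 0" and U: "smooth_on UNIV U"
 shows "smooth_fun At (chart_ext c U)"
 unfolding smooth_fun_def smooth_on_def
proof (intro ballI allI Ck_on_local)
 fix d k y assume d: "d \<in> At" and y: "y \<in> cod d"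
 show "EX T. open T & y \<in> T & Ck_on k T (chart_ext c U o cinv d)"
 proof (rule chart_ext_local[where U=U, OF c d K s y])
  fix V assume V: "open V" "y \<in> V" "V \<subseteq> ldom id d c" "!!z. z \<in> V ==> (chart_ext c U o cinv d) z = U (lrep id d c z)"
  have "Ck_on k (ldom id d c) (lrep id d c)" using transition_Ck[OF d c, of k] by (simp add: ldom_def lrep_def)
  from Ck_on_compose[OF V(1) open_UNIV subset_UNIV Ck_on_subset[OF this V(3)]] U
  have "Ck_on k V (%x. U (lrep id d c x))" unfolding smooth_on_def by blast
  then show ?thesis using V Ck_on_cong[of V "chart_ext c U o cinv d" "%x. U (lrep id d c x)" k] by blast
 next
  fix V assume V: "open V" "y \<in> V" "V \<subseteq> cod d" "!!z. z \<in> V ==> (chart_ext c U o cinv d) z = 0"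
  then show ?thesis
   using Ck_on_const[OF V(1), of k 0] Ck_on_cong[of V "chart_ext c U o cinv d" "%x. 0" k] by blast
 qed
qed

lemma chart_ext_compact_support:
 assumes c: "c \<in> At" and K: "compact K" "K \<subseteq> cod c" and s: "!!y. y ~: K ==> U y = 0"
 shows "compact (closure {p. chart_ext c U p ~= 0})" "closure {p. chart_ext c U p ~= 0} \<subseteq> cinv c ` K"
proof -
 have cK: "compact (cinv c ` K)" by (rule compact_chart_image[OF c K])
 show sub: "closure {p. chart_ext c U p ~= 0} \<subseteq> cinv c ` K"
  by (rule closure_minimal[OF _ compact_imp_closed[OF cK]]) (use chart_ext_support[where U=U and K=K, OF c s] in blast)
 show "compact (closure {p. chart_ext c U p ~= 0})"
  using compact_Int_closed[OF cK closed_closure, of "{p. chart_ext c U p ~= 0}"] sub by (simp add: Int_absorb1)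
qed

end

section \<open>The gradient of Lipschitz functions\<close>

context manifold
begin

abbreviation "near k u w e \<equiv> EX ph. smooth_fun At ph & compact (closure {p. ph p ~= 0}) & ph \<in> L2f k & dd ph \<in> L2c k &
 N0 k (%p. ph p - u p) < e & N1 k (%p. dd ph p - w p) < e"

text \<open>A description by single approximants in place of sequences: closures can then be
  iterated without choosing diagonal sequences, and square roots disappear.\<close>

lemma grad_c_iff:
 assumes k: "rough k"
 shows "(u, w) \<in> gc k \<longleftrightarrow> u \<in> L2f k & w \<in> L2c k &
  (\<forall>e>0. near k u w e)" (is "_ \<longleftrightarrow> _ & _ & ?A")
proof
 assume uw: "(u, w) \<in> gc k"
 then obtain us ws where u: "u \<in> L2f k" and w: "w \<in> L2c k"
  and T: "!!j::nat. (us j, ws j) \<in> {(u, dd u) | u. smooth_fun At u & compact (closure {p. u p ~= 0})} Int L2f k \<times> L2c k"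
  and l: "(%j. L2_fun_norm At k (%p. us j p - u p)) \<longlonglongrightarrow> 0" "(%j. L2_cov_norm At k (%p. ws j p - w p)) \<longlonglongrightarrow> 0"
  unfolding grad_c_def L2_closure_def by blast
 have s: "smooth_fun At (us j)" "compact (closure {p. us j p ~= 0})" "us j \<in> L2f k" "ws j = dd (us j)" "dd (us j) \<in> L2c k" for j
  using T[of j] by auto
 have m: "mcf (%p. dd (us j) p - w p)" for j using s(5) w unfolding L2_cov_iff by (intro mcf_diff) auto
 have ?A
 proof (intro allI impI)
  fix e :: real assume "e > 0"
  then have e: "0 < sqrt e" by simp
  from eventually_conj[OF order_tendstoD(2)[OF l(1) e] order_tendstoD(2)[OF l(2) e]]
  obtain j where "L2_fun_norm At k (%p. us j p - u p) < sqrt e" "L2_cov_norm At k (%p. ws j p - w p) < sqrt e"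
   using eventually_happens'[OF sequentially_bot] by blast
  then show "near k u w e"
   using s[of j] L2_cov_norm_N1[OF k m[of j]] by (intro exI[of _ "us j"]) (simp add: L2_fun_norm_N0)
 qed
 with u w show "u \<in> L2f k & w \<in> L2c k & ?A" by blast
next
 assume a: "u \<in> L2f k & w \<in> L2c k & ?A"
 then have "\<forall>j::nat. near k u w (inverse (real (Suc j)))"
  by simp
 from choice[OF this] obtain ph where ph: "!!j. smooth_fun At (ph j)" "!!j. compact (closure {p. ph j p ~= 0})"
  "!!j. ph j \<in> L2f k" "!!j. dd (ph j) \<in> L2c k"
  "!!j. N0 k (%p. ph j p - u p) < inverse (real (Suc j))" "!!j. N1 k (%p. dd (ph j) p - w p) < inverse (real (Suc j))"
  by blast
 have m: "mcf (%p. dd (ph j) p - w p)" for j using ph(4)[of j] a unfolding L2_cov_iff by (intro mcf_diff) auto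
 have z: "(%j. sqrt (inverse (real (Suc j)))) \<longlonglongrightarrow> 0"
  using tendsto_real_sqrt[OF LIMSEQ_inverse_real_of_nat] by simp
 have "(%j. L2_fun_norm At k (%p. ph j p - u p)) \<longlonglongrightarrow> 0"
  by (rule real_tendsto_sandwich[OF _ _ tendsto_const z])
   (use ph(5) in "auto simp: L2_fun_norm_N0 N0_nonneg intro!: always_eventually less_imp_le")
 moreover have "(%j. L2_cov_norm At k (%p. dd (ph j) p - w p)) \<longlonglongrightarrow> 0"
  by (rule real_tendsto_sandwich[OF _ _ tendsto_const z])
   (use ph(6) in "auto simp: L2_cov_norm_N1[OF k m] N1_nonneg[OF k] intro!: always_eventually less_imp_le")
 ultimately show "(u, w) \<in> gc k"
  using a ph(1-4) unfolding grad_c_def L2_closure_def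
  by (intro CollectI case_prodI conjI exI[of _ ph] exI[of _ "%j. dd (ph j)"]) auto
qed

lemma grad_cD: "rough k ==> (u, w) \<in> gc k ==> u \<in> L2f k & w \<in> L2c k"
 by (simp add: grad_c_iff)

text \<open>Closedness of the gradient. Each of the two steps of the approximation gets
  \<open>e / 4\<close>, which the factors 2 in the triangle inequality for squared norms raise to
  \<open>e / 2\<close>.\<close>

lemma grad_c_limit:
 assumes k: "rough k" and u: "u \<in> L2f k" and w: "w \<in> L2c k"
  and ap: "!!e. e > 0 ==> EX v x. (v, x) \<in> gc k & N0 k (%p. v p - u p) < e & N1 k (%p. x p - w p) < e"
 shows "(u, w) \<in> gc k"
 unfolding grad_c_iff[OF k]
proof (intro conjI u w allI impI)
 fix e :: real assume e: "e > 0"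
 then obtain v x where v: "(v, x) \<in> gc k" "N0 k (%p. v p - u p) < e / 4" "N1 k (%p. x p - w p) < e / 4"
  using ap[of "e / 4"] by auto
 have "e / 4 > 0" using e by simp
 then obtain ph where ph: "smooth_fun At ph" "compact (closure {p. ph p ~= 0})" "ph \<in> L2f k" "dd ph \<in> L2c k"
  "N0 k (%p. ph p - v p) < e / 4" "N1 k (%p. dd ph p - x p) < e / 4"
  using v(1) unfolding grad_c_iff[OF k] by blast
 note vx = grad_cD[OF k v(1)]
 have "N0 k (%p. ph p - u p) < e" "N1 k (%p. dd ph p - w p) < e"
  using N0_triangle[OF k ph(3) _ u, of v] N1_triangle[OF k ph(4) _ w, of x] vx v ph by auto
 then show "near k u w e"
  using ph by blast
qed

lemma grad_c_AE:
 assumes k: "rough k" and uw: "(u, w) \<in> gc k" and eq: "nullM {p. u p ~= u' p}" "nullM {p. w p ~= w' p}"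
 shows "(u', w') \<in> gc k"
proof (rule grad_c_limit[OF k])
 show "u' \<in> L2f k" "w' \<in> L2c k"
  using L2_fun_AE[OF k _ eq(1)] L2_cov_AE[OF k _ eq(2)] grad_cD[OF k uw] by auto
 have "AE p in vol At k. u p = u' p" "AE p in vol At k. w p = w' p" using eq AE_vol_iff[OF k] by blast+
 then have "AE p in vol At k. (cmod (u p - u' p))\<^sup>2 = 0" "AE p in vol At k. Re (cov_inner (k p) (w p - w' p) (w p - w' p)) = 0"
  by (eventually_elim, simp)+
 from integral_eq_zero_AE[OF this(1)] integral_eq_zero_AE[OF this(2)]
 have "N0 k (%p. u p - u' p) = 0" "N1 k (%p. w p - w' p) = 0" unfolding N0_def N1_def by auto
 then show "EX v x. (v, x) \<in> gc k & N0 k (%p. v p - u' p) < e & N1 k (%p. x p - w' p) < e" if "e > 0" for e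
  using uw that by metis
qed

lemma ext_deriv_add:
 assumes "vdiff u p" "vdiff v p"
 shows "dd (%p. u p + v p) p = dd u p + dd v p"
proof -
 let ?c = "chart_at At p"
 have "((%x. (u o cinv ?c) x + (v o cinv ?c) x) has_derivative
  (%h. frechet_derivative (u o cinv ?c) (at (cmap ?c p)) h + frechet_derivative (v o cinv ?c) (at (cmap ?c p)) h)) (at (cmap ?c p))"
  using assms unfolding vdiff_def frechet_derivative_works by (rule has_derivative_add)
 from frechet_derivative_at[OF this] show ?thesis
  by (simp add: ext_deriv_def comp_def vec_eq_iff fun_eq_iff)
qed

lemma smooth_fun_add: "smooth_fun At u ==> smooth_fun At v ==> smooth_fun At (%p. u p + v p)"
 unfolding smooth_fun_def smooth_on_def
proof (intro ballI allI)
 fix c k assume *: "\<forall>c\<in>At. ALL k. Ck_on k (cod c) (u o cinv c)" "\<forall>c\<in>At. ALL k. Ck_on k (cod c) (v o cinv c)" and c: "c \<in> At"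
 then show "Ck_on k (cod c) ((%p. u p + v p) o cinv c)"
  using Ck_on_add[OF open_cod[OF c], of k "u o cinv c" "v o cinv c"] by (simp add: comp_def)
qed

lemma grad_c_add:
 assumes k: "rough k" and u: "(u, w) \<in> gc k" and v: "(v, x) \<in> gc k"
 shows "(%p. u p + v p, %p. w p + x p) \<in> gc k"
 unfolding grad_c_iff[OF k]
proof (intro conjI allI impI)
 note U = grad_cD[OF k u] and V = grad_cD[OF k v]
 show "(%p. u p + v p) \<in> L2f k" "(%p. w p + x p) \<in> L2c k"
  using U V L2_fun_add(1)[OF k] L2_cov_add(1)[OF k] by auto
 fix e :: real assume "e > 0"
 then have e: "e / 4 > 0" by simp
 obtain ph where ph: "smooth_fun At ph" "compact (closure {p. ph p ~= 0})" "ph \<in> L2f k" "dd ph \<in> L2c k"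
  "N0 k (%p. ph p - u p) < e / 4" "N1 k (%p. dd ph p - w p) < e / 4"
  using u e unfolding grad_c_iff[OF k] by blast
 obtain ps where ps: "smooth_fun At ps" "compact (closure {p. ps p ~= 0})" "ps \<in> L2f k" "dd ps \<in> L2c k"
  "N0 k (%p. ps p - v p) < e / 4" "N1 k (%p. dd ps p - x p) < e / 4"
  using v e unfolding grad_c_iff[OF k] by blast
 let ?s = "%p. ph p + ps p"
 have d: "dd ?s = (%p. dd ph p + dd ps p)"
  using ext_deriv_add[OF smooth_vdiff smooth_vdiff, OF ph(1) ps(1)] by blast
 have "closure {p. ?s p ~= 0} \<subseteq> closure ({p. ph p ~= 0} Un {p. ps p ~= 0})" by (intro closure_mono) auto
 then have "closure {p. ?s p ~= 0} \<subseteq> closure {p. ph p ~= 0} Un closure {p. ps p ~= 0}" by simp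
 then have cs: "compact (closure {p. ?s p ~= 0})"
  using compact_Int_closed[OF compact_Un[OF ph(2) ps(2)] closed_closure, of "{p. ?s p ~= 0}"] by (simp add: Int_absorb1)
 have e1: "(%p. ?s p - (u p + v p)) = (%p. (ph p - u p) + (ps p - v p))"
  and e2: "(%p. dd ?s p - (w p + x p)) = (%p. (dd ph p - w p) + (dd ps p - x p))"
  by (simp_all add: d algebra_simps)
 have "N0 k (%p. ?s p - (u p + v p)) < e" "N1 k (%p. dd ?s p - (w p + x p)) < e"
  unfolding e1 e2
  using L2_fun_add(2)[OF k L2_fun_diff[OF k ph(3)] L2_fun_diff[OF k ps(3)], of u v]
   L2_cov_add(2)[OF k L2_cov_diff[OF k ph(4)] L2_cov_diff[OF k ps(4)], of w x] U V ph(5,6) ps(5,6) by auto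
 then show "EX ph. smooth_fun At ph & compact (closure {p. ph p ~= 0}) & ph \<in> L2f k & dd ph \<in> L2c k &
   N0 k (%p. ph p - (u p + v p)) < e & N1 k (%p. dd ph p - (w p + x p)) < e"
  using smooth_fun_add[OF ph(1) ps(1)] cs L2_fun_add(1)[OF k ph(3) ps(3)] L2_cov_add(1)[OF k ph(4) ps(4)] d
  by (intro exI[of _ ?s]) auto
qed

lemma nullM_in_chart:
 assumes c: "c \<in> At" and N: "N \<subseteq> cdom c" "negligible (cmap c ` N)"
 shows "nullM N"
 unfolding nullM_def
proof
 fix d assume d: "d \<in> At"
 have "negligible (lrep id c d ` (cmap c ` N Int ldom id c d))"
  by (rule loc_lip_on_negligible[OF lip_mapD[OF lip_map_id c d]]) (use N(2) in "auto intro: negligible_subset")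
 then show "negligible (cmap d ` (N Int cdom d))"
 proof (rule negligible_subset, intro subsetI)
  fix y assume "y \<in> cmap d ` (N Int cdom d)"
  then obtain p where p: "p \<in> N" "p \<in> cdom d" "y = cmap d p" by blast
  then have "y = lrep id c d (cmap c p)" "cmap c p \<in> ldom id c d"
   using N(1) c ldom_mem[of p c id d] by auto
  then show "y \<in> lrep id c d ` (cmap c ` N Int ldom id c d)" using p by blast
 qed
qed

text \<open>Prepares dominated convergence: ellipticity bounds the density from above, hence the
  volume of a compact set, and it bounds the dual form by the Euclidean norm of the
  components.\<close>

lemma chart_ball_bounds:
 assumes k: "rough k" and c: "c \<in> At" and R: "ball x R \<subseteq> cod c" and l: "l > 0"
  and ell: "negligible {y\<in>ball x R. ~ ell l u (mic k c (cinv c y))}"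
  and K: "compact K" "K \<subseteq> ball x R"
 shows "cinv c ` K \<in> sets (vol At k)" "emeasure (vol At k) (cinv c ` K) < \<infinity>"
  "AE p in vol At k. p \<in> cinv c ` K -->
   (ALL w. 0 <= Re (cov_inner (k p) w w) & Re (cov_inner (k p) w w) <= (norm (cic c p w))\<^sup>2 / l)"
proof -
 interpret sigma_algebra UNIV "LS" by (rule lebesgue_sets_algebra)
 let ?Q = "cinv c ` K" and ?B = "{y\<in>ball x R. ~ ell l u (mic k c (cinv c y))}"
 have Kc: "K \<subseteq> cod c" using K(2) R by auto
 have "closed ?Q" by (rule compact_imp_closed[OF compact_chart_image[OF c K(1) Kc]])
 from compl_sets[OF open_lebesgue[OF open_Compl[OF this]]]
 have Q: "?Q \<in> LS" by (simp add: Compl_eq_Diff_UNIV double_diff)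
 then show "?Q \<in> sets (vol At k)" using k by simp
 have Qc: "?Q \<subseteq> cdom c" using Kc c by auto
 have cQ: "cmap c ` ?Q = K"
 proof -
  have "cmap c ` ?Q = (%x. x) ` K" unfolding image_image using c Kc by (intro image_cong refl) auto
  then show ?thesis by simp
 qed
 define C where "C = (\<Sum>p\<in>{p. p permutes (UNIV :: 'n set)}. u ^ CARD('n))"
 have nB: "AE y in lebesgue. y ~: ?B" using ell by (auto simp: negligible_iff_null_sets dest: AE_not_in)
 have "emeasure (vol At k) ?Q = (\<integral>\<^sup>+y\<in>K. dens k c y \<partial>lebesgue)" using emeasure_vol[OF k c Q Qc] cQ by simp
 also have "... <= (\<integral>\<^sup>+y. ennreal (sqrt C) * indicator K y \<partial>lebesgue)"
 proof (rule nn_integral_mono_AE)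
  show "AE y in lebesgue. dens k c y * indicator K y <= ennreal (sqrt C) * indicator K y"
   using nB
  proof eventually_elim
   case (elim y)
   show ?case
   proof (cases "y \<in> K")
    case True
    then have "ell l u (mic k c (cinv c y))" using elim K(2) by blast
    then have "det (mic k c (cinv c y)) <= C" unfolding C_def using ell_det_bound abs_le_D1 by blast
    then show ?thesis using True by (simp add: dens_def ennreal_leI)
   qed simp
  qed
 qed
 also have "... = ennreal (sqrt C) * emeasure lebesgue K" using K(1) by (intro nn_integral_cmult_indicator) (simp add: compact_imp_closed lmeasurable_compact)
 also have "... < \<infinity>" using emeasure_bounded_finite[OF compact_imp_bounded[OF K(1)]] K(1)
  by (simp add: ennreal_mult_less_top emeasure_completion compact_imp_closed borel_closed)
 finally show "emeasure (vol At k) ?Q < \<infinity>" .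
 have "cmap c ` (cinv c ` ?B) = (%x. x) ` ?B" unfolding image_image using c R by (intro image_cong refl) auto
 then have "nullM (cinv c ` ?B)" using ell R c by (intro nullM_in_chart[OF c]) auto
 then have "AE p in vol At k. p ~: cinv c ` ?B" unfolding AE_vol_iff[OF k] by simp
 then show "AE p in vol At k. p \<in> ?Q -->
   (ALL w. 0 <= Re (cov_inner (k p) w w) & Re (cov_inner (k p) w w) <= (norm (cic c p w))\<^sup>2 / l)"
 proof eventually_elim
  case (elim p)
  show ?case
  proof (intro impI allI)
   fix w assume p: "p \<in> ?Q"
   then obtain y where y: "y \<in> K" "p = cinv c y" by blast
   then have e: "ell l u (mic k c p)" using elim K(2) by blast
   have pc: "p \<in> cdom c" using p Qc by blast
   have pd: "posdef (k p)" using ell_posdef[OF l e] metric_in_chart_posdef[OF c pc] by blast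
   show "0 <= Re (cov_inner (k p) w w) & Re (cov_inner (k p) w w) <= (norm (cic c p w))\<^sup>2 / l"
    using Re_cov_inner_nonneg[OF pd] Re_cov_inner_le[OF l e, of "cic c p w"]
     cov_inner_in_chart[where k=k, OF c pc pd, of w w] by simp
  qed
 qed
qed

lemma bounded_integrable:
 fixes h :: "'m => real"
 assumes k: "rough k" and Q: "Q \<in> sets (vol At k)" "emeasure (vol At k) Q < \<infinity>"
  and h: "lmeas h" "AE p in vol At k. norm (h p) <= b * indicator Q p"
 shows "integrable (vol At k) h"
proof (rule Bochner_Integration.integrable_bound)
 show "integrable (vol At k) (%p. b * indicator Q p)" using Q by (intro integrable_mult_right integrable_real_indicator)
 show "AE p in vol At k. norm (h p) <= norm (b * indicator Q p)" using h(2) by eventually_elim auto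
qed (use h(1) vol_measurable_iff[OF k] in blast)

lemma bounded_dominated:
 fixes h :: "nat => 'm => real"
 assumes k: "rough k" and Q: "Q \<in> sets (vol At k)" "emeasure (vol At k) Q < \<infinity>"
  and h: "!!j. lmeas (h j)" "!!j. AE p in vol At k. norm (h j p) <= b * indicator Q p" and z: "AE p in vol At k. (%j. h j p) \<longlonglongrightarrow> 0"
 shows "(%j. LINT p|vol At k. h j p) \<longlonglongrightarrow> 0"
proof -
 have "(%j. LINT p|vol At k. h j p) \<longlonglongrightarrow> (LINT p|vol At k. 0)"
 proof (rule integral_dominated_convergence[where w="%p. b * indicator Q p"])
  show "integrable (vol At k) (%p. b * indicator Q p)" using Q by (intro integrable_mult_right integrable_real_indicator)
 qed (use h z vol_measurable_iff[OF k] in auto)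
 then show ?thesis by simp
qed

lemma ext_deriv_zero:
 assumes V: "open V" "p \<in> V" "!!q. q \<in> V ==> u q = 0"
 shows "dd u p = 0"
proof -
 let ?c = "chart_at At p"
 note c = chart_at[of p]
 have "frechet_derivative (u o cinv ?c) (at (cmap ?c p)) = frechet_derivative (%_. 0) (at (cmap ?c p))"
 proof (rule frechet_derivative_cong_open)
  show "open (cmap ?c ` (V Int cdom ?c))" using V(1) open_dom[OF c(1)] by (intro open_image[OF c(1)]) auto
  show "cmap ?c p \<in> cmap ?c ` (V Int cdom ?c)" using V c by blast
  fix y assume "y \<in> cmap ?c ` (V Int cdom ?c)"
  then show "(u o cinv ?c) y = 0" using V(3) c(1) by auto
 qed
 then show ?thesis by (simp add: ext_deriv_def vec_eq_iff)
qed

lemma cgrad_chart_bound: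
 assumes c: "c \<in> At" "p \<in> cdom c" and L: "L-lipschitz_on UNIV U" and eq: "!!y. y \<in> cod c ==> (v o cinv c) y = U y"
  and D: "vdiff v p"
 shows "norm (cic c p (dd v p)) <= real CARD('n) * L" "(U has_derivative frechet_derivative U (at (cmap c p))) (at (cmap c p))"
  "cic c p (dd v p) = (\<chi> i. frechet_derivative U (at (cmap c p)) (axis i 1))"
proof -
 let ?y = "cmap c p"
 have y: "?y \<in> cod c" using c by blast
 have "v o cinv c differentiable at ?y" using D vdiff_chart(1)[OF c] by blast
 then obtain E where "(v o cinv c has_derivative E) (at ?y)" unfolding differentiable_def by blast
 then have "(U has_derivative E) (at ?y)"
  by (rule has_derivative_transform_within_open[OF _ open_cod[OF c(1)] y]) (rule eq)
 then show D': "(U has_derivative frechet_derivative U (at ?y)) (at ?y)"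
  unfolding frechet_derivative_works[symmetric] differentiable_def by blast
 have "frechet_derivative (v o cinv c) (at ?y) = frechet_derivative U (at ?y)"
  by (rule frechet_derivative_cong_open[OF open_cod[OF c(1)] y eq])
 then show e: "cic c p (dd v p) = (\<chi> i. frechet_derivative U (at ?y) (axis i 1))"
  using vdiff_chart(2)[OF c D] by (simp add: cgrad_def)
 have "norm (cic c p (dd v p)) <= (\<Sum>i\<in>UNIV. norm (frechet_derivative U (at ?y) (axis i 1)))"
  unfolding e norm_vec_def by (rule order_trans[OF L2_set_le_sum]) auto
 also have "... <= (\<Sum>i\<in>(UNIV::'n set). L)"
 proof (rule sum_mono)
  fix i
  show "norm (frechet_derivative U (at ?y) (axis i 1)) <= L"
   using derivative_lipschitz_bound[OF L open_UNIV UNIV_I D', of "axis i 1"] by simp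
 qed
 finally show "norm (cic c p (dd v p)) <= real CARD('n) * L" by simp
qed

text \<open>In the chart, mollification provides smooth functions with a common compact support and
  a common Lipschitz constant. Their gradients converge wherever \<open>v\<close> is differentiable,
  so almost everywhere, and dominated convergence over a compact set of finite volume yields both
  limits.\<close>

lemma lip_grad_local:
 assumes k: "rough k" and c: "c \<in> At" and R: "ball x R \<subseteq> cod c" and l: "l > 0"
  and ell: "negligible {y\<in>ball x R. ~ ell l m (mic k c (cinv c y))}"
  and v: "lip_fun v" "rh < R" "{p. v p ~= 0} \<subseteq> cinv c ` cball x rh"
 shows "(v, dd v) \<in> gc k"
proof -
 \<comment> \<open>The chart expression of \<open>v\<close>, extended by 0. As its support stays
   inside a closed ball within the chart, it is Lipschitz on the whole space and can be
   mollified.\<close>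
 define f where "f y = (if y \<in> cod c then v (cinv c y) else 0)" for y
 have rhR: "cball x rh \<subseteq> ball x R" using v(2) by (auto simp: subset_eq)
 have f0: "f y = 0" if "y ~: cball x rh" for y
 proof (rule ccontr)
  assume "f y ~= 0"
  then have y: "y \<in> cod c" "v (cinv c y) ~= 0" by (auto simp: f_def split: if_splits)
  then obtain z where z: "z \<in> cball x rh" "cinv c y = cinv c z" using v(3) by blast
  then have "y = z" using y c rhR R by (metis chart_map_inv subsetD)
  then show False using z that by simp
 qed
 have "loc_lip_on UNIV f"
 proof (rule loc_lip_on_local)
  fix y :: "real^'n"
  show "EX V. open V & y \<in> V & V \<subseteq> UNIV & loc_lip_on V f"
  proof (cases "y \<in> cod c")
   case True
   have "loc_lip_on (cod c) (v o cinv c)" using v(1) c unfolding lip_fun_def by blast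
   then have "loc_lip_on (cod c) f" by (rule loc_lip_on_cong) (simp add: f_def)
   then show ?thesis using True open_cod[OF c] by blast
  next
   case False
   have "loc_lip_on (- cball x rh) (%_. 0 :: complex)" by (rule lipschitz_loc_lip_on[of _ 0]) (auto simp: lipschitz_on_def)
   then have "loc_lip_on (- cball x rh) f" by (rule loc_lip_on_cong) (use f0 in auto)
   moreover have "y \<in> - cball x rh" using False rhR R by blast
   ultimately show ?thesis using loc_lip_on_open by blast
  qed
 qed
 then obtain L where L: "L-lipschitz_on UNIV f" using loc_lip_compact_support_lipschitz f0 by metis
 obtain U K' where U: "!!j::nat. smooth_on UNIV (U j)" "compact K'" "K' \<subseteq> ball x R" "cball x rh \<subseteq> K'"
  "!!j y. y ~: K' ==> U j y = 0" "!!j. L-lipschitz_on UNIV (U j)"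
  "!!y. (%j. U j y) \<longlonglongrightarrow> f y" "!!j y. norm (U j y - f y) <= L"
  "!!y D h. (f has_derivative D) (at y) ==> (%j. frechet_derivative (U j) (at y) h) \<longlonglongrightarrow> D h"
 proof (rule lipschitz_smooth_approximation[OF L compact_cball rhR open_ball f0])
  fix U K' assume *: "!!j::nat. smooth_on UNIV (U j)" "compact K'" "K' \<subseteq> ball x R" "cball x rh \<subseteq> K'"
   "!!j y. y ~: K' ==> U j y = 0" "!!j. L-lipschitz_on UNIV (U j)"
   "!!y. (%j. U j y) \<longlonglongrightarrow> f y" "!!j y. norm (U j y - f y) <= L"
   "!!y D h. (f has_derivative D) (at y) ==> (%j. frechet_derivative (U j) (at y) h) \<longlonglongrightarrow> D h"
  show thesis
  proof (rule that[of U K'])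
   fix y D h assume "(f has_derivative D) (at y)"
   from *(9)[OF this, of h] show "(%j. frechet_derivative (U j) (at y) h) \<longlonglongrightarrow> D h" .
  qed (rule *(1) *(2) *(3) *(4) *(6) *(7) *(8) | erule *(5))+
 qed
 define ph where "ph j = chart_ext c (U j)" for j
 let ?Q = "cinv c ` K'"
 have K'c: "K' \<subseteq> cod c" using U(3) R by blast
 note B = chart_ball_bounds[OF k c R l ell U(2,3)]
 have clQ: "closed ?Q" by (rule compact_imp_closed[OF compact_chart_image[OF c U(2) K'c]])
 have vext: "v p = (if p \<in> cdom c then f (cmap c p) else 0)" for p
 proof (cases "p \<in> cdom c")
  case False
  have "cinv c ` cball x rh \<subseteq> cdom c" using rhR R c by auto
  then have "v p = 0" using False v(3) by blast
  then show ?thesis using False by simp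
 qed (use c in "simp add: f_def")
 have v0: "v p = 0" if "p ~: ?Q" for p using v(3) U(4) that by blast
 have ph0: "ph j p = 0" if "p ~: ?Q" for j p
  using chart_ext_support[where U="U j" and K=K', OF c U(5)] that unfolding ph_def by blast
 have sm: "smooth_fun At (ph j)" for j unfolding ph_def by (rule chart_ext_smooth[OF c U(2) K'c U(5) U(1)])
 have cs: "compact (closure {p. ph j p ~= 0})" for j
  unfolding ph_def by (rule chart_ext_compact_support(1)[OF c U(2) K'c U(5)])
 have lm: "lmeas v" "lmeas (ph j)" and mc: "mcf (dd v)" "mcf (dd (ph j))" for j
  using lip_fun_lmeas lip_fun_mcf v(1) smooth_lip_fun[OF sm] by blast+
 have L0: "0 <= L" by (rule lipschitz_on_nonneg[OF L])
 have lmd: "lmeas (%p. ph j p - v p)" for j by (intro lmeas_diff lm)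
 have bd: "cmod (ph j p - v p) <= L * indicator ?Q p" for j p
  using U(8)[of j "cmap c p"] L0 v0[of p] ph0[of p j] by (cases "p \<in> ?Q") (auto simp: ph_def chart_ext_def vext)
 have bd2: "norm ((cmod (ph j p - v p))\<^sup>2) <= L\<^sup>2 * indicator ?Q p" for j p
 proof (cases "p \<in> ?Q")
  case True
  then have "cmod (ph j p - v p) <= L" using bd[of j p] by simp
  then have "(cmod (ph j p - v p))\<^sup>2 <= L\<^sup>2" by (intro power_mono) auto
  then show ?thesis using True by simp
 qed (use v0 ph0 in simp)
 have N0: "(%j. N0 k (%p. ph j p - v p)) \<longlonglongrightarrow> 0"
  unfolding N0_def
 proof (rule bounded_dominated[OF k B(1,2) lmeas_cmod_square[OF lmd]])
  show "AE p in vol At k. norm ((cmod (ph j p - v p))\<^sup>2) <= L\<^sup>2 * indicator ?Q p" for j using bd2 by (intro AE_I2)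
  show "AE p in vol At k. (%j. (cmod (ph j p - v p))\<^sup>2) \<longlonglongrightarrow> 0"
  proof (rule AE_I2)
   fix p
   have "(%j. ph j p) \<longlonglongrightarrow> v p"
    using U(7)[of "cmap c p"] by (cases "p \<in> cdom c") (auto simp: ph_def chart_ext_def vext)
   then have "(%j. (cmod (ph j p - v p))\<^sup>2) \<longlonglongrightarrow> (cmod (v p - v p))\<^sup>2" by (intro tendsto_intros)
   then show "(%j. (cmod (ph j p - v p))\<^sup>2) \<longlonglongrightarrow> 0" by simp
  qed
 qed
 have "bounded (f ` K')"
  using lipschitz_on_continuous_on[OF L] by (intro compact_imp_bounded compact_continuous_image U(2)) (auto intro: continuous_on_subset)
 then obtain b where b: "!!y. y \<in> K' ==> cmod (f y) <= b" unfolding bounded_iff by blast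
 have "norm ((cmod (v p))\<^sup>2) <= b\<^sup>2 * indicator ?Q p" for p
 proof (cases "p \<in> ?Q")
  case True
  then obtain y where y: "y \<in> K'" "p = cinv c y" by blast
  then have "v p = f y" using K'c c by (auto simp: vext)
  then show ?thesis using b[OF y(1)] True by (simp add: power_mono)
 qed (use v0 in simp)
 then have vL2: "v \<in> L2f k"
  unfolding L2_fun_iff[OF k] using bounded_integrable[OF k B(1,2) lmeas_cmod_square[OF lm(1)], of "b\<^sup>2"] lm(1) by simp
 have "integrable (vol At k) (%p. (cmod (ph j p - v p))\<^sup>2)" for j
  by (rule bounded_integrable[OF k B(1,2) lmeas_cmod_square[OF lmd], of _ "L\<^sup>2"]) (use bd2 in "intro AE_I2")
 then have "(%p. ph j p - v p) \<in> L2f k" for j unfolding L2_fun_iff[OF k] using lmd by blast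
 from L2_fun_add(1)[OF k this vL2] have phL2: "ph j \<in> L2f k" for j by simp
 let ?B = "real CARD('n) * L"
 have B0: "0 <= ?B" using L0 by simp
 have dv0: "dd v p = 0" and dph0: "dd (ph j) p = 0" if "p ~: ?Q" for p j
  by (rule ext_deriv_zero[OF open_Compl[OF clQ]]; use that v0 ph0 in simp)+
 have cd: "?Q \<subseteq> cdom c" using K'c c by auto
 have bv: "norm (cic c p (dd v p)) <= ?B" if "p \<in> cdom c" "vdiff v p" for p
  by (rule cgrad_chart_bound(1)[OF c that(1) L _ that(2)]) (simp add: f_def)
 have phU: "(ph j o cinv c) y = U j y" if "y \<in> cod c" for j y
  using that c by (simp add: ph_def chart_ext_def)
 have bph: "norm (cic c p (dd (ph j) p)) <= ?B" if "p \<in> cdom c" for p j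
  by (rule cgrad_chart_bound(1)[OF c that U(6) phU smooth_vdiff[OF sm]])
 have AEd: "AE p in vol At k. vdiff v p" unfolding AE_vol_iff[OF k] by (rule lip_fun_nullM[OF v(1)])
 have "AE p in vol At k. norm (Re (cov_inner (k p) (dd v p) (dd v p))) <= ?B\<^sup>2 / l * indicator ?Q p"
  using AEd B(3)
 proof eventually_elim
  case (elim p)
  show ?case
  proof (cases "p \<in> ?Q")
   case True
   then have "p \<in> cdom c" using cd by blast
   then have "(norm (cic c p (dd v p)))\<^sup>2 <= ?B\<^sup>2" using bv elim(1) by (intro power_mono) auto
   then have "(norm (cic c p (dd v p)))\<^sup>2 / l <= ?B\<^sup>2 / l" using l by (intro divide_right_mono) auto
   then show ?thesis using elim(2) True by (auto intro: order_trans)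
  qed (use dv0 in simp)
 qed
 from bounded_integrable[OF k B(1,2) Re_cov_inner_lmeas[OF k mc(1)] this]
 have dvL2: "dd v \<in> L2c k" unfolding L2_cov_iff using mc by blast
 let ?w = "%j p. dd (ph j) p - dd v p"
 have mw: "mcf (?w j)" for j by (intro mcf_diff mc)
 \<comment> \<open>On \<open>?Q\<close> the components of both gradients have norm at most
   \<open>?B\<close>; off the closed set \<open>?Q\<close> both functions vanish locally, and so do
   their gradients.\<close>
 have bw: "AE p in vol At k. norm (Re (cov_inner (k p) (?w j p) (?w j p))) <= (2 * ?B)\<^sup>2 / l * indicator ?Q p" for j
  using AEd B(3)
 proof eventually_elim
  case (elim p)
  show ?case
  proof (cases "p \<in> ?Q")
   case True
   then have p: "p \<in> cdom c" using cd by blast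
   have "norm (cic c p (?w j p)) <= norm (cic c p (dd (ph j) p)) + norm (cic c p (dd v p))"
    unfolding covector_in_chart_diff by (rule norm_triangle_ineq4)
   also have "... <= 2 * ?B" using bph[OF p, of j] bv[OF p elim(1)] by linarith
   finally have "(norm (cic c p (?w j p)))\<^sup>2 <= (2 * ?B)\<^sup>2" by (intro power_mono) auto
   then have "(norm (cic c p (?w j p)))\<^sup>2 / l <= (2 * ?B)\<^sup>2 / l" using l by (intro divide_right_mono) auto
   moreover have "norm (Re (cov_inner (k p) (?w j p) (?w j p))) <= (norm (cic c p (?w j p)))\<^sup>2 / l"
    using elim(2) True by (metis abs_of_nonneg real_norm_def)
   ultimately have "norm (Re (cov_inner (k p) (?w j p) (?w j p))) <= (2 * ?B)\<^sup>2 / l" by (rule order_trans[rotated])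
   then show ?thesis using True by (simp only: indicator_simps mult_1_right)
  qed (use dv0 dph0 in simp)
 qed
 have N1: "(%j. N1 k (?w j)) \<longlonglongrightarrow> 0"
  unfolding N1_def
 proof (rule bounded_dominated[OF k B(1,2) Re_cov_inner_lmeas[OF k mw] bw])
  show "AE p in vol At k. (%j. Re (cov_inner (k p) (?w j p) (?w j p))) \<longlonglongrightarrow> 0"
   using AEd B(3)
  proof eventually_elim
   case (elim p)
   show ?case
   proof (cases "p \<in> ?Q")
    case True
    then have p: "p \<in> cdom c" using cd by blast
    let ?y = "cmap c p"
    have fv: "(v o cinv c) y = f y" if "y \<in> cod c" for y using that by (simp add: f_def)
    note cv = cgrad_chart_bound(2,3)[OF c p L fv elim(1)]
    have "(%j. cic c p (?w j p) $ i) \<longlonglongrightarrow> 0" for i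
    proof -
     have "(%j. frechet_derivative (U j) (at ?y) (axis i 1)) \<longlonglongrightarrow> frechet_derivative f (at ?y) (axis i 1)" by (rule U(9)[OF cv(1)])
     note tendsto_diff[OF this tendsto_const[of "frechet_derivative f (at ?y) (axis i 1)"]]
     moreover have "cic c p (dd (ph j) p) = (\<chi> i. frechet_derivative (U j) (at ?y) (axis i 1))" for j
      by (rule cgrad_chart_bound(3)[OF c p U(6) phU smooth_vdiff[OF sm]])
     ultimately show ?thesis by (simp add: covector_in_chart_diff cv(2))
    qed
    then have "(%j. cic c p (?w j p)) \<longlonglongrightarrow> 0" by (intro vec_tendstoI) simp
    then have "(%j. (norm (cic c p (?w j p)))\<^sup>2 / l) \<longlonglongrightarrow> (norm (0 :: complex^'n))\<^sup>2 / l" by (intro tendsto_intros) (use l in auto)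
    then have s: "(%j. (norm (cic c p (?w j p)))\<^sup>2 / l) \<longlonglongrightarrow> 0" by simp
    show ?thesis
     by (rule real_tendsto_sandwich[OF _ _ tendsto_const s]) (use elim(2) True in "auto intro: always_eventually")
   qed (use dv0 dph0 in simp)
  qed
 qed
 from bounded_integrable[OF k B(1,2) Re_cov_inner_lmeas[OF k mw] bw]
 have "?w j \<in> L2c k" for j unfolding L2_cov_iff using mw by blast
 from L2_cov_add(1)[OF k this dvL2] have dphL2: "dd (ph j) \<in> L2c k" for j by simp
 show ?thesis unfolding grad_c_iff[OF k]
 proof (intro conjI vL2 dvL2 allI impI)
  fix e :: real assume e: "e > 0"
  from eventually_conj[OF order_tendstoD(2)[OF N0 e] order_tendstoD(2)[OF N1 e]]
  obtain j where "N0 k (%p. ph j p - v p) < e" "N1 k (?w j) < e"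
   using eventually_happens'[OF sequentially_bot] by blast
  then show "near k v (dd v) e"
   using sm cs phL2 dphL2 by blast
 qed
qed

text \<open>Multiplication by the cutoff confines the support of any Lipschitz function to a chart
  ball on which the metric is elliptic, the situation of \<open>lip_grad_local\<close>. A Lipschitz
  cutoff is sufficient, since products need only stay Lipschitz.\<close>

lemma lip_cutoff:
 assumes k: "rough k"
 obtains V be where "open V" "p \<in> V" "lip_fun be" "!!q. q \<in> V ==> be q = 1"
  "!!v. lip_fun v ==> (%q. be q * v q, dd (%q. be q * v q)) \<in> gc k"
proof -
 define c where "c = chart_at At p"
 have c: "c \<in> At" "p \<in> cdom c" unfolding c_def by (rule chart_at)+
 define x where "x = cmap c p"
 have "x \<in> cod c" using c by (simp add: x_def)
 then obtain r l m where r: "r > 0" "l > 0" "ball x r \<subseteq> cod c"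
  "negligible {y\<in>ball x r. ~ ell l m (mic k c (cinv c y))}"
  by (rule rough_ell[OF k c(1)])
 \<comment> \<open>Equal to 1 up to distance \<open>r / 3\<close> from the centre, equal to 0 from
   \<open>2 * r / 3\<close> on, and linear in the distance between, whence the Lipschitz constant
   \<open>3 / r\<close>.\<close>
 define h where "h y = complex_of_real (max 0 (min 1 (2 - 3 / r * dist x y)))" for y
 define be where "be = chart_ext c h"
 have h0: "h y = 0" if "y ~: cball x (2 * r / 3)" for y
 proof -
  have "2 < 3 / r * dist x y" using that r(1) by (simp add: field_simps)
  then show ?thesis by (simp add: h_def)
 qed
 have "(3 / r)-lipschitz_on UNIV h"
 proof (rule lipschitz_onI)
  fix y z :: "real^'n"
  have mm: "\<bar>max 0 (min 1 (2 - a)) - max 0 (min 1 (2 - b))\<bar> <= \<bar>a - b\<bar>" for a b :: real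
   by (simp add: max_def min_def abs_if)
  have "dist (h y) (h z) = \<bar>max 0 (min 1 (2 - 3 / r * dist x y)) - max 0 (min 1 (2 - 3 / r * dist x z))\<bar>"
   unfolding h_def dist_norm by (simp only: of_real_diff[symmetric] norm_of_real)
  also have "... <= \<bar>3 / r * dist x y - 3 / r * dist x z\<bar>" by (rule mm)
  also have "... = 3 / r * \<bar>dist x y - dist x z\<bar>" using r(1) unfolding right_diff_distrib[symmetric] abs_mult by simp
  also have "... <= 3 / r * dist y z"
   using r(1) dist_triangle[of x y z] dist_triangle[of x z y] by (intro mult_left_mono) (auto simp: dist_commute abs_le_iff)
  finally show "dist (h y) (h z) <= 3 / r * dist y z" .
 qed (use r in simp)
 then have hl: "loc_lip_on UNIV h" by (rule lipschitz_loc_lip_on[OF open_UNIV])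
 have K: "cball x (2 * r / 3) \<subseteq> cod c" using r(1,3) by (auto simp: subset_eq)
 have be: "lip_fun be" unfolding be_def by (rule chart_ext_lip_fun[OF c(1) compact_cball K h0 hl])
 show ?thesis
 proof (rule that[OF _ _ be])
  have b: "ball x (r / 3) \<subseteq> cod c" using r(1,3) by (auto simp: subset_eq)
  show "open (cinv c ` ball x (r / 3))" by (rule open_inv_image[OF c(1) open_ball b])
  show "p \<in> cinv c ` ball x (r / 3)" using c r(1) by (intro image_eqI[of _ _ x]) (auto simp: x_def)
  show "be q = 1" if q: "q \<in> cinv c ` ball x (r / 3)" for q
  proof -
   obtain y where y: "y \<in> ball x (r / 3)" "q = cinv c y" using q by blast
   then have "3 / r * dist x y <= 1" using r(1) by (simp add: field_simps)
   then have "h y = 1" by (simp add: h_def)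
   moreover have "y \<in> cod c" using y(1) b by blast
   ultimately show ?thesis using y(2) c(1) by (simp add: be_def chart_ext_def)
  qed
  fix v assume v: "lip_fun v"
  show "(%q. be q * v q, dd (%q. be q * v q)) \<in> gc k"
  proof (rule lip_grad_local[OF k c(1) r(3,2,4) lip_fun_mult[OF be v]])
   show "2 * r / 3 < r" using r(1) by simp
   show "{q. be q * v q ~= 0} \<subseteq> cinv c ` cball x (2 * r / 3)"
    using chart_ext_support[where U=h and K="cball x (2 * r / 3)", OF c(1) h0] by (auto simp: be_def)
  qed
 qed
qed

lemma grad_c_zero: "rough k ==> (%_. 0, dd (%_. 0)) \<in> gc k"
proof -
 assume k: "rough k"
 have d: "dd (%_. 0) = (%_. 0)" using ext_deriv_zero[OF open_UNIV, of _ "%_. 0"] by auto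
 have s: "smooth_fun At (%_. 0)" unfolding smooth_fun_def smooth_on_def comp_def using Ck_on_const[OF open_cod] by blast
 have "(%_. 0) \<in> L2f k" "(%_. 0) \<in> L2c k"
  using lip_fun_lmeas[OF smooth_lip_fun[OF s]] lip_fun_mcf[OF smooth_lip_fun[OF s]] by (auto simp: L2_fun_iff[OF k] L2_cov_iff d)
 then show ?thesis unfolding grad_c_iff[OF k] using s by (auto simp: d N0_def N1_def intro!: exI[of _ "%_. 0"])
qed

text \<open>Cutoffs are split off one at a time: in \<open>v = be * v + (1 - be) * v\<close> the
  first term lives in one chart, and the support of the second has lost the open set
  \<open>V\<close>. A finite subcover of the compact support is used up in this way, and no
  partition of unity is needed. The induction has to be over all \<open>v\<close>, since the
  function changes.\<close>

lemma lip_grad: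
 assumes k: "rough k" and v: "lip_fun v" "compact (closure {p. v p ~= 0})"
 shows "(v, dd v) \<in> gc k"
proof -
 define cut where "cut V be \<longleftrightarrow> lip_fun be & (\<forall>q\<in>V. be q = 1) &
  (ALL v. lip_fun v --> (%q. be q * v q, dd (%q. be q * v q)) \<in> gc k)" for V be
 define ok where "ok V \<longleftrightarrow> open V & (EX be. cut V be)" for V
 have "EX V. ok V & p \<in> V" for p
 proof (rule lip_cutoff[OF k, of p])
  fix V be assume "open V" "p \<in> V" and *: "lip_fun be" "!!q. q \<in> V ==> be q = 1"
   "!!v. lip_fun v ==> (%q. be q * v q, dd (%q. be q * v q)) \<in> gc k"
  moreover have "cut V be" unfolding cut_def by (intro conjI ballI allI impI *)
  ultimately show "EX V. ok V & p \<in> V" unfolding ok_def by blast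
 qed
 then have "closure {p. v p ~= 0} \<subseteq> \<Union>{V. ok V}" by blast
 moreover have "\<forall>V\<in>{V. ok V}. open V" by (simp add: ok_def)
 ultimately obtain T where T: "T \<subseteq> {V. ok V}" "finite T" "closure {p. v p ~= 0} \<subseteq> \<Union>T"
  using compactE[OF v(2)] by metis
 have "ALL v. lip_fun v --> closure {p. v p ~= 0} \<subseteq> \<Union>T --> (v, dd v) \<in> gc k"
  using T(2,1)
 proof (induction T)
  case empty
  show ?case
  proof (intro allI impI)
   fix v :: "'m => complex" assume "closure {p. v p ~= 0} \<subseteq> \<Union>{}"
   then have "v = (%_. 0)" using closure_subset by fastforce
   then show "(v, dd v) \<in> gc k" using grad_c_zero[OF k] by simp
  qed
 next
  case (insert V T)
  have V: "open V" using insert.prems by (simp add: ok_def)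
  obtain be where cut: "cut V be" using insert.prems by (auto simp: ok_def)
  have be: "lip_fun be" "!!q. q \<in> V ==> be q = 1"
   "!!v. lip_fun v ==> (%q. be q * v q, dd (%q. be q * v q)) \<in> gc k"
   using cut unfolding cut_def by simp_all
  show ?case
  proof (intro allI impI)
   fix v assume v: "lip_fun v" "closure {p. v p ~= 0} \<subseteq> \<Union>(insert V T)"
   let ?v2 = "%q. (1 - be q) * v q"
   have v2: "lip_fun ?v2" by (rule lip_fun_mult[OF lip_fun_const_diff[OF be(1)] v(1)])
   have "closure {p. ?v2 p ~= 0} \<subseteq> closure {p. v p ~= 0} Int - V"
    by (rule closure_minimal) (use V be(2) closure_subset in fastforce)+
   then have "closure {p. ?v2 p ~= 0} \<subseteq> \<Union>T" using v(2) by blast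
   then have "(?v2, dd ?v2) \<in> gc k" using insert.IH insert.prems v2 by blast
   from grad_c_add[OF k be(3)[OF v(1)] this]
   have g: "(%p. be p * v p + ?v2 p, %p. dd (%q. be q * v q) p + dd ?v2 p) \<in> gc k" .
   have e: "(%p. be p * v p + ?v2 p) = v" by (simp add: algebra_simps)
   \<comment> \<open>The differential of the sum splits only where both terms are differentiable;
     \<open>grad_c_AE\<close> disposes of the other points.\<close>
   have "nullM ({p. ~ vdiff (%q. be q * v q) p} Un {p. ~ vdiff ?v2 p})"
    by (intro nullM_Un lip_fun_nullM lip_fun_mult be(1) v(1) v2)
   then have "nullM {p. dd (%q. be q * v q) p + dd ?v2 p ~= dd v p}"
   proof (rule nullM_subset, intro subsetI)
    fix p assume p: "p \<in> {p. dd (%q. be q * v q) p + dd ?v2 p ~= dd v p}"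
    show "p \<in> {p. ~ vdiff (%q. be q * v q) p} Un {p. ~ vdiff ?v2 p}"
     using ext_deriv_add[of "%q. be q * v q" p ?v2] p unfolding e by auto
   qed
   from grad_c_AE[OF k g[unfolded e] _ this] show "(v, dd v) \<in> gc k" by simp
  qed
 qed
 then show ?thesis using v(1) T(3) by blast
qed

lemma lip_map_continuous:
 assumes F: "lip_map F" and V: "open V"
 shows "open (F -` V)"
proof (subst open_subopen, intro ballI)
 fix p assume p: "p \<in> F -` V"
 define c d where "c = chart_at At p" and "d = chart_at At (F p)"
 have c: "c \<in> At" "p \<in> cdom c" and d: "d \<in> At" "F p \<in> cdom d" unfolding c_def d_def by (rule chart_at)+
 let ?W = "ldom F c d Int lrep F c d -` (cmap d ` (V Int cdom d))"
 have oV: "open (cmap d ` (V Int cdom d))" using V open_dom[OF d(1)] by (intro open_image[OF d(1)]) auto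
 have W: "open ?W" by (rule continuous_open_preimage[OF loc_lip_on_continuous[OF lip_mapD[OF F c(1) d(1)]] open_ldom[OF F c(1) d(1)] oV])
 have sub: "?W \<subseteq> cod c" by (auto simp: ldom_def)
 show "EX T. open T & p \<in> T & T \<subseteq> F -` V"
 proof (intro exI conjI)
  show "open (cinv c ` ?W)" by (rule open_inv_image[OF c(1) W sub])
  show "p \<in> cinv c ` ?W"
   using p c d ldom_mem[of p c F d] by (intro image_eqI[of _ _ "cmap c p"]) auto
  show "cinv c ` ?W \<subseteq> F -` V"
  proof
   fix q assume "q \<in> cinv c ` ?W"
   then obtain y where y: "q = cinv c y" "y \<in> ldom F c d" "lrep F c d y \<in> cmap d ` (V Int cdom d)" by blast
   then have "F q \<in> cdom d" "cmap d (F q) \<in> cmap d ` (V Int cdom d)" using c(1) by (auto simp: mem_ldom lrep_def)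
   then show "q \<in> F -` V" using chart_inj[OF d(1)] by (auto simp: inj_on_def)
  qed
 qed
qed

end

text \<open>The pullback of a smooth approximant is no longer smooth, but it is Lipschitz with
  compact support, so \<open>lip_grad\<close> puts it with its differential into the closed
  gradient. The approximation errors are unchanged, because pullback is isometric on functions and
  on covectors.\<close>

lemma (in lip_pull) grad_c_pull:
 assumes uw: "(u, w) \<in> gc k2" and n: "nullM {p. u' p ~= u (F p)}" "nullM {p. w' p ~= pbc F w p}"
 shows "(u', w') \<in> gc k1"
proof -
 note U = grad_cD[OF rough2 uw]
 then have m: "lmeas u" "mcf w" by (auto simp: L2_fun_iff[OF rough2] L2_cov_iff)
 show ?thesis
 proof (rule grad_c_limit[OF rough1])
  show "u' \<in> L2f k1" "w' \<in> L2c k1" using U L2_fun_pull(1)[OF m(1) n(1)] L2_cov_pull(1)[OF m(2) n(2)] by auto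
  fix e :: real assume "e > 0"
  then obtain ph where ph: "smooth_fun At ph" "compact (closure {p. ph p ~= 0})" "ph \<in> L2f k2" "dd ph \<in> L2c k2"
   "N0 k2 (%p. ph p - u p) < e" "N1 k2 (%p. dd ph p - w p) < e"
   using uw unfolding grad_c_iff[OF rough2] by blast
  let ?v = "ph o F"
  have v: "lip_fun ?v" by (rule lip_fun_compose[OF lip_F smooth_lip_fun[OF ph(1)]])
  have cG: "continuous_on UNIV G" using lip_map_continuous[OF lip_G] by (simp add: continuous_on_open_vimage)
  have GS: "compact (G ` closure {q. ph q ~= 0})"
   by (rule compact_continuous_image[OF continuous_on_subset[OF cG] ph(2)]) simp
  have "{p. ?v p ~= 0} \<subseteq> G ` closure {q. ph q ~= 0}"
  proof
   fix p assume "p \<in> {p. ?v p ~= 0}"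
   then have "F p \<in> closure {q. ph q ~= 0}" using closure_subset[of "{q. ph q ~= 0}"] by auto
   then show "p \<in> G ` closure {q. ph q ~= 0}" using GF[of p] by (intro image_eqI[of _ _ "F p"]) auto
  qed
  then have "closure {p. ?v p ~= 0} \<subseteq> G ` closure {q. ph q ~= 0}" by (rule closure_minimal[OF _ compact_imp_closed[OF GS]])
  then have cs: "compact (closure {p. ?v p ~= 0})"
   using compact_Int_closed[OF GS closed_closure, of "{p. ?v p ~= 0}"] by (simp add: Int_absorb1)
  have g: "(?v, dd ?v) \<in> gc k1" by (rule lip_grad[OF rough1 v cs])
  have d: "dd ?v p = pbc F (dd ph) p" if "mdiff F p" for p
   using cgrad_compose(2)[OF lip_F chart_at(1) chart_at(1) chart_at(2) chart_at(2), of p ph] that smooth_vdiff[OF ph(1), of "F p"]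
   by (simp add: mdiff_def vdiff_def ext_deriv_cgrad pullback_covector_def differential_jac)
  have "N0 k1 (%p. ?v p - u' p) = N0 k2 (%p. ph p - u p)"
  proof (rule L2_fun_pull(2))
   show "lmeas (%p. ph p - u p)" using ph(3) m(1) by (intro lmeas_diff) (auto simp: L2_fun_iff[OF rough2])
   show "nullM {p. ?v p - u' p ~= ph (F p) - u (F p)}" by (rule nullM_subset[OF n(1)]) auto
  qed
  moreover have "N1 k1 (%p. dd ?v p - w' p) = N1 k2 (%p. dd ph p - w p)"
  proof (rule L2_cov_pull(2))
   show "mcf (%p. dd ph p - w p)" using ph(4) m(2) by (intro mcf_diff) (auto simp: L2_cov_iff)
   show "nullM {p. dd ?v p - w' p ~= pbc F (%p. dd ph p - w p) p}"
    by (rule nullM_subset[OF nullM_Un[OF n(2) nullM_not_mdiff[OF lip_F]]])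
     (auto simp: d pullback_covector_def matrix_vector_mult_diff_distrib)
  qed
  ultimately show "EX v x. (v, x) \<in> gc k1 & N0 k1 (%p. v p - u' p) < e & N1 k1 (%p. x p - w' p) < e"
   using g ph(5,6) by metis
 qed
qed

section \<open>Intertwined operators\<close>

definition pull_sect ::
  "('m, 'n::finite) chart set => ('m => 'm) => ('m, 'n) sect => ('m, 'n) sect" where
 "pull_sect At F h p = (fst (h (F p)), fst (snd (h (F p))), pullback_covector At F (snd o snd o h) p)"

text \<open>Equality almost everywhere makes the relation independent of representatives. With
  \<open>inv F\<close> in place of \<open>F\<close> it is the graph
  \<open>\<Phi>_op\<close>.\<close>

definition pulls ::
  "('m, 'n::finite) chart set => ('m => 'm) => ('m => real^'n^'n) => ('m => real^'n^'n) =>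
  ('m, 'n) sect => ('m, 'n) sect => bool" where
 "pulls At F k1 k2 h x \<longleftrightarrow> h \<in> H_space At k2 & x \<in> H_space At k1 & (AE p in vol At k1. x p = pull_sect At F h p)"

definition carries ::
  "('m, 'n::finite) chart set => ('m => 'm) => ('m => real^'n^'n) => ('m => real^'n^'n) =>
  ('m, 'n) oper => ('m, 'n) oper => bool" where
 "carries At F k1 k2 T T' \<longleftrightarrow>
  (ALL h x z y. pulls At F k1 k2 h x --> pulls At F k1 k2 z y --> (h, z) \<in> T --> (x, y) \<in> T')"

text \<open>Carrying is only an inclusion of graphs. Asked for in both directions, it expresses that
  the isometry takes one unbounded operator exactly onto the other, domains included, and it is
  symmetric by construction.\<close>

definition intertwined ::
  "('m, 'n::finite) chart set => ('m => 'm) => ('m => 'm) => ('m => real^'n^'n) => ('m => real^'n^'n) =>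
  ('m, 'n) oper => ('m, 'n) oper => bool" where
 "intertwined At F G k1 k2 T T' \<longleftrightarrow>
  T \<subseteq> H_space At k2 \<times> H_space At k2 & T' \<subseteq> H_space At k1 \<times> H_space At k1 &
  carries At F k1 k2 T T' & carries At G k2 k1 T' T"

lemma op_addI: "(h, y) \<in> T ==> (h, z) \<in> R ==> (h, %p. y p + z p) \<in> op_add T R"
 unfolding op_add_def by (rule CollectI, rule exI[of _ h], rule exI[of _ y], rule exI[of _ z]) simp

lemma op_scaleI: "(h, y) \<in> T ==> (h, %p. t *\<^sub>R y p) \<in> op_scale t T"
 unfolding op_scale_def by (rule CollectI, rule exI[of _ h], rule exI[of _ y]) simp

lemma intertwined_swap: "intertwined At F G k1 k2 T T' ==> intertwined At G F k2 k1 T' T"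
 unfolding intertwined_def by blast

lemma intertwinedD:
 assumes "intertwined At F G k1 k2 T T'"
 shows "T \<subseteq> H_space At k2 \<times> H_space At k2" "T' \<subseteq> H_space At k1 \<times> H_space At k1"
  "pulls At F k1 k2 h x ==> pulls At F k1 k2 z y ==> (h, z) \<in> T ==> (x, y) \<in> T'"
 using assms unfolding intertwined_def carries_def by blast+

context manifold
begin

definition measurable_sect :: "('m, 'n) sect => bool" where
 "measurable_sect h \<longleftrightarrow> lmeas (%p. fst (h p)) & lmeas (%p. fst (snd (h p))) & mcf (%p. snd (snd (h p)))"

lemma H_space_iff:
 "h \<in> H_space At k \<longleftrightarrow> (%p. fst (h p)) \<in> L2_fun At k & (%p. fst (snd (h p))) \<in> L2_fun At k & (%p. snd (snd (h p))) \<in> L2_cov At k"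
 by (simp add: H_space_def L2_pair_def comp_def)

lemma H_space_measurable: "rough k ==> h \<in> H_space At k ==> measurable_sect h"
 unfolding H_space_iff measurable_sect_def by (auto simp: L2_fun_iff L2_cov_iff)

lemma H_space_add: "rough k ==> h \<in> H_space At k ==> z \<in> H_space At k ==> (%p. h p + z p) \<in> H_space At k"
 unfolding H_space_iff using L2_fun_add(1) L2_cov_add(1) by (simp add: fst_add snd_add)

lemma measurable_sect_diff: "measurable_sect h ==> measurable_sect z ==> measurable_sect (%p. h p - z p)"
 unfolding measurable_sect_def by (auto simp: fst_diff snd_diff intro!: lmeas_diff mcf_diff)

lemma H_space_scale:
 assumes k: "rough k" and h: "h \<in> H_space At k"
 shows "(%p. t *\<^sub>R h p) \<in> H_space At k"
proof -
 have f: "(%p. t *\<^sub>R u p) \<in> L2_fun At k" if "u \<in> L2_fun At k" for u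
 proof -
  have "lmeas (%p. t *\<^sub>R u p)"
   using that by (intro lmeas_continuous[of u "%z. t *\<^sub>R z"]) (auto simp: L2_fun_iff[OF k] intro: continuous_intros)
  then show ?thesis using that by (auto simp: L2_fun_iff[OF k] power_mult_distrib)
 qed
 have c: "(%p. t *\<^sub>R w p) \<in> L2_cov At k" if w: "w \<in> L2_cov At k" for w
 proof -
  have "covector_in_chart At c p (t *\<^sub>R v) = t *\<^sub>R covector_in_chart At c p v" for c p v
   by (simp add: covector_in_chart_def matrix_vector_mult_def vec_eq_iff scaleR_sum_right)
  then have "mcf (%p. t *\<^sub>R w p)"
   using w unfolding L2_cov_iff measurable_covector_field_def
   by (simp only:) (intro ballI borel_measurable_scaleR borel_measurable_const, blast)
  moreover have "cov_inner G (t *\<^sub>R v) (t *\<^sub>R v) = complex_of_real (t\<^sup>2) * cov_inner G v v" for G and v :: "complex^'n"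
   unfolding cov_inner_def sum_distrib_left
   by (intro sum.cong refl) (simp add: scaleR_conv_of_real[where 'a=complex] power2_eq_square mult_ac)
  ultimately show ?thesis using w by (simp add: L2_cov_iff)
 qed
 show ?thesis using h f c unfolding H_space_iff by simp
qed

end

context lip_pull
begin

lemma nullM_parts:
 assumes "nullM {p. x p ~= pull_sect At F h p}"
 shows "nullM {p. fst (x p) ~= fst (h (F p))}" "nullM {p. fst (snd (x p)) ~= fst (snd (h (F p)))}"
  "nullM {p. snd (snd (x p)) ~= pullback_covector At F (%q. snd (snd (h q))) p}"
 by (rule nullM_subset[OF assms], force simp: pull_sect_def comp_def)+

lemma H_space_pull:
 assumes "measurable_sect h" "nullM {p. x p ~= pull_sect At F h p}"
 shows "x \<in> H_space At k1 \<longleftrightarrow> h \<in> H_space At k2" "measurable_sect x"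
proof -
 note n = nullM_parts[OF assms(2)]
 show "x \<in> H_space At k1 \<longleftrightarrow> h \<in> H_space At k2"
  using assms(1) L2_fun_pull(1)[OF _ n(1)] L2_fun_pull(1)[OF _ n(2)] L2_cov_pull(1)[OF _ n(3)]
  unfolding H_space_iff measurable_sect_def by blast
 show "measurable_sect x"
  unfolding measurable_sect_def
 proof (intro conjI)
  have m: "lmeas (%p. fst (h p))" "lmeas (%p. fst (snd (h p)))" "mcf (%q. snd (snd (h q)))"
   using assms(1) unfolding measurable_sect_def by auto
  show "lmeas (%p. fst (x p))"
   by (rule lmeas_AE[OF lmeas_pull[OF m(1)]], rule nullM_subset[OF n(1)]) auto
  show "lmeas (%p. fst (snd (x p)))"
   by (rule lmeas_AE[OF lmeas_pull[OF m(2)]], rule nullM_subset[OF n(2)]) auto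
  show "mcf (%p. snd (snd (x p)))"
   by (rule mcf_AE[OF mcf_pull[OF m(3)]], rule nullM_subset[OF n(3)]) auto
 qed
qed

lemma H_inner_pull:
 assumes h: "measurable_sect h" "nullM {p. x p ~= pull_sect At F h p}"
  and z: "measurable_sect z" "nullM {p. y p ~= pull_sect At F z p}"
 shows "H_inner At k1 x y = H_inner At k2 h z"
proof -
 note n = nullM_parts[OF h(2)] and m = nullM_parts[OF z(2)]
 have cnj: "lmeas (%p. cnj (u p))" if "lmeas u" for u
  using that by (intro lmeas_continuous[of u cnj]) (auto intro: continuous_intros)
 have f: "(LINT p|vol At k1. u' p * cnj (v' p)) = (LINT p|vol At k2. u p * cnj (v p))"
  if "lmeas u" "lmeas v" "nullM {p. u' p ~= u (F p)}" "nullM {p. v' p ~= v (F p)}" for u v u' v'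
 proof (rule integral_pull_AE(1)[of "%q. u q * cnj (v q)"])
  show "lmeas (%q. u q * cnj (v q))" by (intro lmeas_mult cnj that)
  show "nullM {p. u' p * cnj (v' p) ~= u (F p) * cnj (v (F p))}"
   by (rule nullM_subset[OF nullM_Un[OF that(3,4)]]) auto
 qed
 have c: "(LINT p|vol At k1. cov_inner (k1 p) (snd (snd (x p))) (snd (snd (y p)))) =
   (LINT q|vol At k2. cov_inner (k2 q) (snd (snd (h q))) (snd (snd (z q))))"
  using h z by (intro integral_pull_AE(1) cov_inner_lmeas rough2 nullM_cov_inner_pull[OF n(3) m(3)])
   (auto simp: measurable_sect_def)
 show ?thesis
  using h z f[OF _ _ n(1) m(1)] f[OF _ _ n(2) m(2)] c
  by (simp add: H_inner_def L2_fun_inner_def L2_pair_inner_def L2_cov_inner_def measurable_sect_def)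
qed

lemma pulls_iff: "pulls At F k1 k2 h x \<longleftrightarrow> h \<in> H_space At k2 & nullM {p. x p ~= pull_sect At F h p}"
 unfolding pulls_def AE_vol_iff[OF rough1] using H_space_pull(1) H_space_measurable[OF rough2] by blast

lemma pulls_pull: "h \<in> H_space At k2 ==> pulls At F k1 k2 h (pull_sect At F h)"
 by (simp add: pulls_iff)

lemma pull_sect_pull_sect: "good p ==> pull_sect At F (pull_sect At G x) p = x p"
proof -
 assume p: "good p"
 have "(%q. snd (snd (pull_sect At G x q))) = pullback_covector At G (%q. snd (snd (x q)))"
  by (simp add: pull_sect_def comp_def fun_eq_iff)
 moreover have "pullback_covector At F (pullback_covector At G (%q. snd (snd (x q)))) p = snd (snd (x p))"
  using p by (intro pullback_pullback) (auto simp: good_def)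
 ultimately show ?thesis by (simp add: pull_sect_def[of At F] comp_def) (simp add: pull_sect_def GF)
qed

lemma pulls_swap: "pulls At G k2 k1 x h ==> pulls At F k1 k2 h x"
proof -
 assume "pulls At G k2 k1 x h"
 then have h: "h \<in> H_space At k2" and n: "nullM {q. h q ~= pull_sect At G x q}"
  unfolding pulls_def AE_vol_iff[OF rough2] by auto
 have "nullM ({p. h (F p) ~= pull_sect At G x (F p)} Un {p. ~ good p})"
  using n nullM_pull[of "%q. h q ~= pull_sect At G x q"] nullM_bad by (intro nullM_Un) auto
 then have "nullM {p. x p ~= pull_sect At F h p}"
 proof (rule nullM_subset, intro subsetI)
  fix p assume p: "p \<in> {p. x p ~= pull_sect At F h p}"
  show "p \<in> {p. h (F p) ~= pull_sect At G x (F p)} Un {p. ~ good p}"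
  proof (rule ccontr)
   assume "p ~: {p. h (F p) ~= pull_sect At G x (F p)} Un {p. ~ good p}"
   then have "h (F p) = pull_sect At G x (F p)" "good p" by auto
   then have "pull_sect At F h p = pull_sect At F (pull_sect At G x) p"
    by (simp add: pull_sect_def[of At F] pullback_covector_def)
   then show False using p pull_sect_pull_sect[OF \<open>good p\<close>, of x] by simp
  qed
 qed
 then show ?thesis using h by (simp add: pulls_iff)
qed

end

context lip_pull
begin

interpretation sw: lip_pull At G F k2 k1 by (rule lip_pull_swap)

lemma pulls_swap_iff: "pulls At G k2 k1 x h \<longleftrightarrow> pulls At F k1 k2 h x"
 using pulls_swap sw.pulls_swap by blast

lemma pulls_onto: "x \<in> H_space At k1 ==> pulls At F k1 k2 (pull_sect At G x) x"
 using pulls_swap[OF sw.pulls_pull] .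

lemma pulls_inner: "pulls At F k1 k2 h x ==> pulls At F k1 k2 z y ==> H_inner At k1 x y = H_inner At k2 h z"
 unfolding pulls_iff by (intro H_inner_pull H_space_measurable[OF rough2]) auto

lemma pull_sect_diff: "pull_sect At F (%p. h p - z p) p = pull_sect At F h p - pull_sect At F z p"
 by (simp add: pull_sect_def pullback_covector_def matrix_vector_mult_diff_distrib)

lemma pulls_norm_diff:
 assumes "pulls At F k1 k2 h x" "pulls At F k1 k2 z y"
 shows "H_norm At k1 (%p. x p - y p) = H_norm At k2 (%p. h p - z p)"
proof -
 have "measurable_sect (%p. h p - z p)" using assms unfolding pulls_iff by (intro measurable_sect_diff H_space_measurable[OF rough2]) auto
 moreover have "nullM {p. x p - y p ~= pull_sect At F (%p. h p - z p) p}"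
 proof (rule nullM_subset)
  show "nullM ({p. x p ~= pull_sect At F h p} Un {p. y p ~= pull_sect At F z p})"
   using assms unfolding pulls_iff by (intro nullM_Un) auto
 qed (auto simp: pull_sect_diff)
 ultimately show ?thesis unfolding H_norm_def using H_inner_pull by simp
qed

lemma carries_comp:
 assumes "intertwined At F G k1 k2 T T'" "intertwined At F G k1 k2 R R'"
 shows "carries At F k1 k2 (T O R) (T' O R')"
 unfolding carries_def
proof (intro allI impI)
 fix h x z y assume p: "pulls At F k1 k2 h x" "pulls At F k1 k2 z y" and "(h, z) \<in> T O R"
 then obtain m where m: "(h, m) \<in> T" "(m, z) \<in> R" by blast
 then have "m \<in> H_space At k2" using assms unfolding intertwined_def by blast
 then show "(x, y) \<in> T' O R'" using intertwinedD(3)[OF assms(1) p(1) pulls_pull m(1)] intertwinedD(3)[OF assms(2) pulls_pull p(2) m(2)] by blast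
qed

lemma carries_converse: "intertwined At F G k1 k2 T T' ==> carries At F k1 k2 (T\<inverse>) (T'\<inverse>)"
 unfolding carries_def intertwined_def by blast

text \<open>\<open>op_add\<close> consists of literal sums, whereas \<open>y\<close> agrees with the
  pullback of \<open>z\<close> only almost everywhere. The discrepancy is moved into the second
  summand, for which \<open>y\<close> minus the pullback of the first is taken.\<close>

lemma carries_add:
 assumes "intertwined At F G k1 k2 T T'" "intertwined At F G k1 k2 R R'"
 shows "carries At F k1 k2 (op_add T R) (op_add T' R')"
 unfolding carries_def
proof (intro allI impI)
 fix h x z y assume p: "pulls At F k1 k2 h x" "pulls At F k1 k2 z y" and "(h, z) \<in> op_add T R"
 then obtain a b where ab: "(h, a) \<in> T" "(h, b) \<in> R" "z = (%p. a p + b p)" unfolding op_add_def by blast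
 then have H: "a \<in> H_space At k2" "b \<in> H_space At k2" using assms unfolding intertwined_def by blast+
 let ?a = "pull_sect At F a"
 have "b = (%p. z p - a p)" using ab(3) by simp
 then have "{p. y p - ?a p ~= pull_sect At F b p} = {p. y p ~= pull_sect At F z p}"
  by (simp add: pull_sect_diff)
 then have "pulls At F k1 k2 b (%p. y p - ?a p)" using p(2) H by (simp add: pulls_iff)
 from op_addI[OF intertwinedD(3)[OF assms(1) p(1) pulls_pull[OF H(1)] ab(1)] intertwinedD(3)[OF assms(2) p(1) this ab(2)]]
 have "(x, %p. ?a p + (y p - ?a p)) \<in> op_add T' R'" .
 then show "(x, y) \<in> op_add T' R'" by simp
qed

text \<open>As for sums, the null set on which \<open>y\<close> differs from a pullback is moved
  into the operand. This requires division by \<open>t\<close>.\<close>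

lemma carries_scale:
 assumes "intertwined At F G k1 k2 T T'" "t ~= 0"
 shows "carries At F k1 k2 (op_scale t T) (op_scale t T')"
 unfolding carries_def
proof (intro allI impI)
 fix h x z y assume p: "pulls At F k1 k2 h x" "pulls At F k1 k2 z y" and "(h, z) \<in> op_scale t T"
 then obtain a where a: "(h, a) \<in> T" "z = (%p. t *\<^sub>R a p)" unfolding op_scale_def by blast
 then have H: "a \<in> H_space At k2" using assms unfolding intertwined_def by blast
 have s: "pull_sect At F z p = t *\<^sub>R pull_sect At F a p" for p
  by (simp add: a(2) pull_sect_def pullback_covector_def matrix_vector_mult_def vec_eq_iff scaleR_sum_right)
 have "{p. (1 / t) *\<^sub>R y p ~= pull_sect At F a p} \<subseteq> {p. y p ~= pull_sect At F z p}"
  using assms(2) by (auto simp: s)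
 then have "pulls At F k1 k2 a (%p. (1 / t) *\<^sub>R y p)" using p(2) H nullM_subset unfolding pulls_iff by blast
 from op_scaleI[OF intertwinedD(3)[OF assms(1) p(1) this a(1)]]
 have "(x, %p. t *\<^sub>R (1 / t) *\<^sub>R y p) \<in> op_scale t T'" .
 then show "(x, y) \<in> op_scale t T'" using assms(2) by simp
qed

lemma carries_id: "carries At F k1 k2 (id_op At k2) (id_op At k1)"
 unfolding carries_def
proof (intro allI impI)
 fix h x z y assume p: "pulls At F k1 k2 h x" "pulls At F k1 k2 z y" and "(h, z) \<in> id_op At k2"
 then have "nullM {q. z q ~= h q}" unfolding id_op_def AE_vol_iff[OF rough2] by auto
 then have "nullM {p. z (F p) ~= h (F p)}" using nullM_pull[of "%q. z q ~= h q"] by simp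
 moreover have "nullM {p. x p ~= pull_sect At F h p}" "nullM {p. y p ~= pull_sect At F z p}" using p by (simp_all add: pulls_iff)
 ultimately have "nullM ({p. z (F p) ~= h (F p)} Un ({p. x p ~= pull_sect At F h p} Un {p. y p ~= pull_sect At F z p}))"
  by (intro nullM_Un)
 then have "nullM {p. y p ~= x p}"
  by (rule nullM_subset) (auto simp: pull_sect_def pullback_covector_def)
 then show "(x, y) \<in> id_op At k1" using p unfolding id_op_def AE_vol_iff[OF rough1] by (simp add: pulls_def)
qed

text \<open>Membership in the adjoint of \<open>T'\<close> is tested against the whole graph of
  \<open>T'\<close>. Since the pullback is onto, every pair in it comes from a pair in
  \<open>T\<close>, and inner products are preserved.\<close>

lemma carries_adjoint:
 assumes T: "intertwined At F G k1 k2 T T'"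
 shows "carries At F k1 k2 (adjoint_op At k2 T) (adjoint_op At k1 T')"
 unfolding carries_def
proof (intro allI impI)
 fix u u' v v' assume p: "pulls At F k1 k2 u u'" "pulls At F k1 k2 v v'" and a: "(u, v) \<in> adjoint_op At k2 T"
 have "H_inner At k1 z' u' = H_inner At k1 h' v'" if hz: "(h', z') \<in> T'" for h' z'
 proof -
  have "h' \<in> H_space At k1" "z' \<in> H_space At k1" using hz intertwinedD(2)[OF T] by blast+
  from pulls_onto[OF this(1)] pulls_onto[OF this(2)]
  obtain h z where q: "pulls At F k1 k2 h h'" "pulls At F k1 k2 z z'" by blast
  then have "(h, z) \<in> T"
   using intertwinedD(3)[OF intertwined_swap[OF T], of h' h z' z] hz by (simp add: pulls_swap_iff)
  then have "H_inner At k2 z u = H_inner At k2 h v" using a unfolding adjoint_op_def by blast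
  then show ?thesis using pulls_inner q p by simp
 qed
 then show "(u', v') \<in> adjoint_op At k1 T'" using p unfolding adjoint_op_def by (auto simp: pulls_def)
qed

text \<open>The vanishing first component and the identity part of \<open>S\<close> are equalities
  almost everywhere and transport with null sets; only the gradient part has analytic content,
  supplied by \<open>grad_c_pull\<close>.\<close>

lemma carries_Gamma: "carries At F k1 k2 (\<Gamma>_op At k2) (\<Gamma>_op At k1)"
 unfolding carries_def
proof (intro allI impI)
 fix h x z y assume p: "pulls At F k1 k2 h x" "pulls At F k1 k2 z y" and g: "(h, z) \<in> \<Gamma>_op At k2"
 have "nullM {p. fst (z p) ~= 0}" "nullM {p. fst (snd (z p)) ~= fst (h p)}"
  and S: "((%p. fst (h p)), (%p. snd (snd (z p)))) \<in> grad_c At k2"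
  using g unfolding \<Gamma>_op_def S_op_def AE_vol_iff[OF rough2] by (auto simp: comp_def)
 then have n: "nullM {p. fst (z (F p)) ~= 0}" "nullM {p. fst (snd (z (F p))) ~= fst (h (F p))}"
  using nullM_pull[of "%q. fst (z q) ~= 0"] nullM_pull[of "%q. fst (snd (z q)) ~= fst (h q)"] by auto
 have nx: "nullM {p. x p ~= pull_sect At F h p}" and ny: "nullM {p. y p ~= pull_sect At F z p}"
  using p by (simp_all add: pulls_iff)
 have "nullM {p. fst (y p) ~= 0}"
  by (rule nullM_subset[OF nullM_Un[OF n(1) nullM_parts(1)[OF ny]]]) auto
 moreover have "nullM {p. fst (snd (y p)) ~= fst (x p)}"
  by (rule nullM_subset[OF nullM_Un[OF n(2) nullM_Un[OF nullM_parts(2)[OF ny] nullM_parts(1)[OF nx]]]]) auto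
 moreover have "((%p. fst (x p)), (%p. snd (snd (y p)))) \<in> grad_c At k1"
  by (rule grad_c_pull[OF S nullM_parts(1)[OF nx] nullM_parts(3)[OF ny]])
 ultimately show "(x, y) \<in> \<Gamma>_op At k1"
  using p unfolding \<Gamma>_op_def S_op_def AE_vol_iff[OF rough1] by (auto simp: comp_def pulls_def H_space_def)
qed

end

section \<open>Intertwining of composite operators\<close>

context lip_pull
begin

interpretation sw: lip_pull At G F k2 k1 by (rule lip_pull_swap)

abbreviation tw where "tw \<equiv> intertwined At F G k1 k2"

lemma tw_comp:
 assumes "tw T T'" "tw R R'"
 shows "tw (T O R) (T' O R')"
 using carries_comp[OF assms] sw.carries_comp[OF assms[THEN intertwined_swap]] assms
 unfolding intertwined_def by blast

lemma tw_converse: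
 assumes "tw T T'"
 shows "tw (T\<inverse>) (T'\<inverse>)"
 using carries_converse[OF assms] sw.carries_converse[OF assms[THEN intertwined_swap]] assms
 unfolding intertwined_def by blast

lemma tw_add:
 assumes "tw T T'" "tw R R'"
 shows "tw (op_add T R) (op_add T' R')"
 using carries_add[OF assms] sw.carries_add[OF assms[THEN intertwined_swap]] assms
  H_space_add[OF rough1] H_space_add[OF rough2]
 unfolding intertwined_def op_add_def by blast

lemma tw_scale:
 assumes "tw T T'" "t ~= 0"
 shows "tw (op_scale t T) (op_scale t T')"
 using carries_scale[OF assms] sw.carries_scale[OF assms(1)[THEN intertwined_swap] assms(2)] assms
  H_space_scale[OF rough1] H_space_scale[OF rough2]
 unfolding intertwined_def op_scale_def by blast

lemma tw_id: "tw (id_op At k2) (id_op At k1)"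
 using carries_id sw.carries_id unfolding intertwined_def id_op_def by blast

lemma tw_adjoint:
 assumes "tw T T'"
 shows "tw (adjoint_op At k2 T) (adjoint_op At k1 T')"
 using carries_adjoint[OF assms] sw.carries_adjoint[OF assms[THEN intertwined_swap]]
 unfolding intertwined_def adjoint_op_def by blast

lemma tw_Gamma: "tw (\<Gamma>_op At k2) (\<Gamma>_op At k1)"
 using carries_Gamma sw.carries_Gamma unfolding intertwined_def \<Gamma>_op_def by blast

lemma tw_Pi:
 assumes "tw B1 B1'" "tw B2 B2'"
 shows "tw (\<Pi>_op At k2 B1 B2) (\<Pi>_op At k1 B1' B2')"
 unfolding \<Pi>_op_def by (intro tw_add tw_comp tw_adjoint tw_Gamma assms)

lemma tw_Q:
 assumes "tw P P'" "t > 0"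
 shows "tw (Q_op At k2 P t) (Q_op At k1 P' t)"
 unfolding Q_op_def using assms by (intro tw_comp tw_converse tw_add tw_id tw_scale) auto

text \<open>A section is determined by its pullback only up to a null set. The way back from the
  conjugated graph to \<open>B\<close> is therefore open only if \<open>B\<close> is closed under
  equality almost everywhere in both arguments.\<close>

lemma tw_conj:
 assumes B: "B \<subseteq> H_space At k2 \<times> H_space At k2"
  and closed: "!!h z h' z'. (h, z) \<in> B ==> h' \<in> H_space At k2 ==> z' \<in> H_space At k2 ==>
   AE p in vol At k2. h' p = h p ==> AE p in vol At k2. z' p = z p ==> (h', z') \<in> B"
 shows "tw B (conj_op {(h, x). pulls At F k1 k2 h x} B)"
proof -
 let ?\<Phi> = "{(h, x). pulls At F k1 k2 h x}"
 have eq: "AE p in vol At k2. h' p = h p" if "pulls At F k1 k2 h x" "pulls At F k1 k2 h' x" for h h' x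
 proof -
  have "AE p in vol At k2. h p = pull_sect At G x p" "AE p in vol At k2. h' p = pull_sect At G x p"
   using that unfolding pulls_swap_iff[symmetric] by (auto simp: pulls_def)
  then show ?thesis by eventually_elim simp
 qed
 have "carries At G k2 k1 (conj_op ?\<Phi> B) B"
  unfolding carries_def
 proof (intro allI impI)
  fix x h y z assume p: "pulls At G k2 k1 x h" "pulls At G k2 k1 y z" and "(x, y) \<in> conj_op ?\<Phi> B"
  then obtain h0 z0 where q: "pulls At F k1 k2 h0 x" "(h0, z0) \<in> B" "pulls At F k1 k2 z0 y" unfolding conj_op_def by blast
  note p' = p[unfolded pulls_swap_iff]
  show "(h, z) \<in> B" using p' by (intro closed[OF q(2) _ _ eq[OF q(1) p'(1)] eq[OF q(3) p'(2)]]) (auto simp: pulls_def)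
 qed
 moreover have "carries At F k1 k2 B (conj_op ?\<Phi> B)" unfolding carries_def conj_op_def by blast
 moreover have "conj_op ?\<Phi> B \<subseteq> H_space At k1 \<times> H_space At k1" unfolding conj_op_def by (auto simp: pulls_def)
 ultimately show ?thesis using B unfolding intertwined_def by blast
qed

section \<open>Transport of the quadratic estimate\<close>

text \<open>Every candidate \<open>w\<close> in the infimum on the right has a pullback of the same
  norm among the candidates on the left. The opposite inequality is this one with the roles
  exchanged.\<close>

lemma op_norm_sq_le:
 assumes T: "tw T T'" and p: "pulls At F k1 k2 u v"
 shows "op_norm_sq At k1 T' v <= op_norm_sq At k2 T u"
 unfolding op_norm_sq_def
proof (rule INF_mono)
 fix w assume "w \<in> T `` {u}"
 then have w: "(u, w) \<in> T" by blast
 then have "w \<in> H_space At k2" using T unfolding intertwined_def by blast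
 then have q: "pulls At F k1 k2 w (pull_sect At F w)" by (rule pulls_pull)
 have "H_norm At k1 (pull_sect At F w) = H_norm At k2 w" unfolding H_norm_def using pulls_inner[OF q q] by simp
 then show "\<exists>w'\<in>T' `` {v}. ennreal ((H_norm At k1 w')\<^sup>2) <= ennreal ((H_norm At k2 w)\<^sup>2)"
  using intertwinedD(3)[OF T p q w] by (intro bexI[of _ "pull_sect At F w"]) auto
qed

lemma H_closure_pull:
 assumes T: "tw T T'" and p: "pulls At F k1 k2 u v" and u: "u \<in> H_closure At k2 (Range T)"
 shows "v \<in> H_closure At k1 (Range T')"
 unfolding H_closure_def
proof (intro CollectI conjI allI impI)
 show "v \<in> H_space At k1" using p by (simp add: pulls_def)
 fix e :: real assume "e > 0"
 then obtain h y where y: "(h, y) \<in> T" "H_norm At k2 (%p. u p - y p) < e" using u unfolding H_closure_def by blast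
 then have H: "h \<in> H_space At k2" "y \<in> H_space At k2" using T unfolding intertwined_def by blast+
 note q = pulls_pull[OF H(1)] pulls_pull[OF H(2)]
 show "\<exists>y\<in>Range T'. H_norm At k1 (%p. v p - y p) < e"
  using intertwinedD(3)[OF T q y(1)] y(2) pulls_norm_diff[OF p q(2)] by (intro bexI[of _ "pull_sect At F y"]) auto
qed

end

context lip_pull
begin

interpretation sw: lip_pull At G F k2 k1 by (rule lip_pull_swap)

lemma op_norm_sq_pull:
 assumes "tw T T'" "pulls At F k1 k2 u v"
 shows "op_norm_sq At k1 T' v = op_norm_sq At k2 T u"
 using op_norm_sq_le[OF assms] sw.op_norm_sq_le[OF intertwined_swap[OF assms(1)], of v u] assms(2)
 by (simp add: pulls_swap_iff antisym)

text \<open>Norms, the closure of the range and the operators \<open>Q_op\<close> for all positive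
  \<open>t\<close> correspond under the isometry, so the integrals are equal and the constant
  \<open>C\<close> is unchanged.\<close>

lemma quadratic_estimate_pull:
 assumes P: "tw P P'" and q: "quadratic_estimate At k1 P'"
 shows "quadratic_estimate At k2 P"
proof -
 obtain C where C: "C \<ge> 1" and b: "!!u. u \<in> H_closure At k1 (Range P') ==>
    ennreal (inverse C * (H_norm At k1 u)\<^sup>2)
     <= (\<integral>\<^sup>+t\<in>{0<..}. op_norm_sq At k1 (Q_op At k1 P' t) u / ennreal t \<partial>lborel) &
    (\<integral>\<^sup>+t\<in>{0<..}. op_norm_sq At k1 (Q_op At k1 P' t) u / ennreal t \<partial>lborel)
     <= ennreal (C * (H_norm At k1 u)\<^sup>2)"
  using q unfolding quadratic_estimate_def by blast
 show ?thesis unfolding quadratic_estimate_def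
 proof (intro exI[of _ C] conjI[OF C] ballI)
  fix u assume u: "u \<in> H_closure At k2 (Range P)"
  then have "u \<in> H_space At k2" unfolding H_closure_def by blast
  then have p: "pulls At F k1 k2 u (pull_sect At F u)" (is "pulls _ _ _ _ _ ?v") by (rule pulls_pull)
  have n: "H_norm At k1 ?v = H_norm At k2 u" unfolding H_norm_def using pulls_inner[OF p p] by simp
  have "(\<integral>\<^sup>+t\<in>{0<..}. op_norm_sq At k1 (Q_op At k1 P' t) ?v / ennreal t \<partial>lborel) =
    (\<integral>\<^sup>+t\<in>{0<..}. op_norm_sq At k2 (Q_op At k2 P t) u / ennreal t \<partial>lborel)"
   by (intro nn_integral_cong) (auto simp: indicator_def op_norm_sq_pull[OF tw_Q[OF P] p])
  then show "ennreal (inverse C * (H_norm At k2 u)\<^sup>2)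
     <= (\<integral>\<^sup>+t\<in>{0<..}. op_norm_sq At k2 (Q_op At k2 P t) u / ennreal t \<partial>lborel) &
    (\<integral>\<^sup>+t\<in>{0<..}. op_norm_sq At k2 (Q_op At k2 P t) u / ennreal t \<partial>lborel)
     <= ennreal (C * (H_norm At k2 u)\<^sup>2)"
   using b[OF H_closure_pull[OF P p u]] n by simp
 qed
qed

lemma (in lip_pull) quadratic_estimate_conj:
 "quadratic_estimate At k2 (\<Pi>_op At k2 (B1_op At k2 a) (B2_op At k2 A)) \<longleftrightarrow>
 quadratic_estimate At k1
  (\<Pi>_op At k1 (conj_op {(h, x). pulls At F k1 k2 h x} (B1_op At k2 a))
    (conj_op {(h, x). pulls At F k1 k2 h x} (B2_op At k2 A)))"
proof -
 interpret sw: lip_pull At G F k2 k1 by (rule lip_pull_swap)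
 have 1: "tw (B1_op At k2 a) (conj_op {(h, x). pulls At F k1 k2 h x} (B1_op At k2 a))"
 proof (rule tw_conj)
  fix h z h' z' assume "(h, z) \<in> B1_op At k2 a" "h' \<in> H_space At k2" "z' \<in> H_space At k2"
   and e: "AE p in vol At k2. h' p = h p" "AE p in vol At k2. z' p = z p"
  moreover from this have "AE p in vol At k2. z p = (a p * fst (h p), 0)" by (simp add: B1_op_def)
  with e have "AE p in vol At k2. z' p = (a p * fst (h' p), 0)" by eventually_elim simp
  ultimately show "(h', z') \<in> B1_op At k2 a" by (simp add: B1_op_def)
 qed (auto simp: B1_op_def)
 have 2: "tw (B2_op At k2 A) (conj_op {(h, x). pulls At F k1 k2 h x} (B2_op At k2 A))"
 proof (rule tw_conj)
  fix h z h' z' assume "(h, z) \<in> B2_op At k2 A" "h' \<in> H_space At k2" "z' \<in> H_space At k2"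
   and e: "AE p in vol At k2. h' p = h p" "AE p in vol At k2. z' p = z p"
  moreover from this have "AE p in vol At k2. z p = (0, A p (snd (h p)))" by (simp add: B2_op_def)
  with e have "AE p in vol At k2. z' p = (0, A p (snd (h' p)))" by eventually_elim simp
  ultimately show "(h', z') \<in> B2_op At k2 A" by (simp add: B2_op_def)
 qed (auto simp: B2_op_def)
 note t = tw_Pi[OF 1 2]
 show ?thesis using quadratic_estimate_pull[OF t] sw.quadratic_estimate_pull[OF intertwined_swap[OF t]] by blast
qed

end

lemma quadratic_estimate_transfer:
 fixes At :: "('m::{t2_space, second_countable_topology}, 'n::finite) chart set"
 assumes M: "smooth_manifold At" and g: "continuous_metric At g"
  and F: "bij F" "manifold.lip_map At F" "manifold.lip_map At (inv F)" and gt: "gt = pullback_metric At F g"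
 shows "quadratic_estimate At gt (\<Pi>_op At gt (B1_op At gt a) (B2_op At gt A)) \<longleftrightarrow>
    quadratic_estimate At g
     (\<Pi>_op At g
       (conj_op (\<Phi>_op At gt g F) (B1_op At gt a))
       (conj_op (\<Phi>_op At gt g F) (B2_op At gt A)))"
proof -
 interpret manifold At by unfold_locales (rule M)
 have inv: "inv F (F p) = p" "F (inv F p) = p" for p
  using F(1) by (simp_all add: bij_is_inj bij_is_surj surj_f_inv_f)
 have "rough g" by (rule continuous_metric_rough[OF g])
 \<comment> \<open>\<open>\<Phi>_op\<close> leads from \<open>gt\<close> to \<open>g\<close> by
   pullback under \<open>inv F\<close>, so the instance with \<open>g\<close> as first metric is
   wanted. The defining relation of \<open>gt\<close> gives the opposite instance, from which it is
   obtained by swapping.\<close>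
 then interpret rev: lip_pull At F "inv F" gt g
  using F inv rough_pullback[OF F(2,3) inv] by unfold_locales (auto simp: gt)
 interpret lip_pull At "inv F" F g gt by (rule rev.lip_pull_swap)
 have "\<Phi>_op At gt g F = {(h, x). pulls At (inv F) g gt h x}"
  unfolding \<Phi>_op_def pulls_def pull_sect_def by blast
 then show ?thesis using quadratic_estimate_conj by simp
qed

section \<open>Lipeomorphisms are locally Lipschitz in charts\<close>

lemma ell_upper:
 fixes v :: "real^'n::finite"
 assumes "ell l u G" "u \<ge> 0"
 shows "v \<bullet> (G *v v) <= (real CARD('n))\<^sup>2 * u * (norm v)\<^sup>2"
proof -
 have "v \<bullet> (G *v v) = (\<Sum>i\<in>UNIV. \<Sum>j\<in>UNIV. v $ i * (G $ i $ j * v $ j))"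
  by (simp add: inner_vec_def matrix_vector_mult_def sum_distrib_left)
 also have "... <= (\<Sum>i\<in>(UNIV::'n set). \<Sum>j\<in>(UNIV::'n set). norm v * (u * norm v))"
 proof (intro sum_mono)
  fix i j
  have "\<bar>v $ i\<bar> * (\<bar>G $ i $ j\<bar> * \<bar>v $ j\<bar>) <= norm v * (u * norm v)"
   using assms component_le_norm_cart[of v] by (intro mult_mono) (auto simp: ell_def)
  then show "v $ i * (G $ i $ j * v $ j) <= norm v * (u * norm v)"
   using abs_ge_self[of "v $ i * (G $ i $ j * v $ j)"] by (simp add: abs_mult)
 qed
 also have "... = (real CARD('n))\<^sup>2 * u * (norm v)\<^sup>2" by (simp add: power2_eq_square)
 finally show ?thesis .
qed

lemma abs_continuous_on_scaleR:
 assumes "abs_continuous_on s t f"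
 shows "abs_continuous_on s t (%x. c *\<^sub>R f x)"
 unfolding abs_continuous_on_def
proof (intro allI impI)
 fix e :: real assume "e > 0"
 then have "e / (\<bar>c\<bar> + 1) > 0" by (simp add: add_nonneg_pos)
 then obtain de where de: "de > 0" "!!d T. d division_of T ==> T \<subseteq> {s..t} ==> (\<Sum>I\<in>d. measure lborel I) < de ==>
   (\<Sum>I\<in>d. norm (f (Sup I) - f (Inf I))) < e / (\<bar>c\<bar> + 1)"
  using assms[unfolded abs_continuous_on_def, rule_format, OF \<open>e / (\<bar>c\<bar> + 1) > 0\<close>] by blast
 have "(\<Sum>I\<in>d. norm (c *\<^sub>R f (Sup I) - c *\<^sub>R f (Inf I))) < e"
  if "d division_of T" "T \<subseteq> {s..t}" "(\<Sum>I\<in>d. measure lborel I) < de" for d T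
 proof -
  have "(\<Sum>I\<in>d. norm (c *\<^sub>R f (Sup I) - c *\<^sub>R f (Inf I))) = \<bar>c\<bar> * (\<Sum>I\<in>d. norm (f (Sup I) - f (Inf I)))"
   by (simp add: sum_distrib_left flip: scaleR_diff_right)
  also have "... <= (\<bar>c\<bar> + 1) * (\<Sum>I\<in>d. norm (f (Sup I) - f (Inf I)))" by (intro mult_right_mono sum_nonneg) auto
  also have "... < e" using de(2)[OF that] by (simp add: pos_less_divide_eq add_nonneg_pos mult.commute)
  finally show ?thesis .
 qed
 then show "\<exists>de>0. ALL d T. d division_of T & T \<subseteq> {s..t} & (\<Sum>I\<in>d. measure lborel I) < de -->
   (\<Sum>I\<in>d. norm (c *\<^sub>R f (Sup I) - c *\<^sub>R f (Inf I))) < e"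
  using de(1) by blast
qed

context manifold
begin

text \<open>\<open>velocity\<close> uses the chart selected at each point, which may jump
  erratically along the curve. The speed does not notice this and can be computed in any fixed
  chart.\<close>

lemma velocity_chart:
 assumes c: "c \<in> At" and T: "open T" "t \<in> T" "ga ` T \<subseteq> cdom c"
  and d: "(cmap c o ga has_vector_derivative s) (at t)"
 shows "velocity At ga t = frame At c (ga t) *v s"
  "velocity At ga t \<bullet> (g (ga t) *v velocity At ga t) = s \<bullet> (metric_in_chart At g c (ga t) *v s)"
proof -
 let ?a = "chart_at At (ga t)"
 note a = chart_at[of "ga t"]
 have p: "ga t \<in> cdom c" using T by blast
 have "((lrep id c ?a o (cmap c o ga)) has_derivative (%h. frame At c (ga t) *v (h *\<^sub>R s))) (at t)"
  using diff_chain_at[OF d[unfolded has_vector_derivative_def], of "lrep id c ?a" "%h. frame At c (ga t) *v h"]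
   has_derivative_jacobian[OF transition_differentiable[OF c a(1) p a(2)]]
  by (simp add: frame_jac jac_def comp_def)
 then have "((lrep id c ?a o (cmap c o ga)) has_vector_derivative (frame At c (ga t) *v s)) (at t)"
  by (simp add: has_vector_derivative_def matrix_vector_mult_scaleR)
 then have "(cmap ?a o ga has_vector_derivative (frame At c (ga t) *v s)) (at t)"
  by (rule has_vector_derivative_transform_within_open[OF _ T(1,2)])
   (use T(3) c in "auto simp: lrep_def")
 then show v: "velocity At ga t = frame At c (ga t) *v s" unfolding velocity_def by (rule vector_derivative_at)
 show "velocity At ga t \<bullet> (g (ga t) *v velocity At ga t) = s \<bullet> (metric_in_chart At g c (ga t) *v s)"
  unfolding v metric_in_chart_def by (simp only: matrix_vector_mul_assoc[symmetric] inner_transpose)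
qed

text \<open>Absolute continuity of a curve is demanded in every chart, so a segment drawn in
  \<open>c\<close> has to be inspected in \<open>d\<close> as well. Compactness of the interval
  turns the local Lipschitz constants of the transition map into one.\<close>

lemma segment_abs_continuous:
 assumes c: "c \<in> At" and d: "d \<in> At" and seg: "!!t. t \<in> {s..t'} ==> linepath x y t \<in> ldom id c d"
 shows "abs_continuous_on s t' (lrep id c d o linepath x y)"
proof -
 have "local_lipschitz {0::real} {s..t'} (%_. lrep id c d o linepath x y)"
 proof (rule local_lipschitzI)
  fix z :: real and t assume t: "t \<in> {s..t'}"
  obtain r L where r: "r > 0" "L-lipschitz_on (ball (linepath x y t) r) (lrep id c d)"
   using loc_lip_onE[OF lip_mapD[OF lip_map_id c d] seg[OF t]] by blast
  define K where "K = norm (y - x)"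
  have lp: "dist (linepath x y a) (linepath x y b) = K * dist a b" for a b
  proof -
   have "linepath x y a - linepath x y b = (a - b) *\<^sub>R (y - x)" by (simp add: linepath_def algebra_simps)
   then show ?thesis by (simp add: dist_norm K_def)
  qed
  have K: "K \<ge> 0" by (simp add: K_def)
  define u where "u = r / (2 * (K + 1))"
  have u: "u > 0" "K * u < r"
  proof -
   show "u > 0" using r(1) K by (simp add: u_def)
   have "0 <= K * r" using K r(1) by simp
   then have "K * r < r * (2 * (K + 1))" using r(1) by (simp add: algebra_simps)
   then show "K * u < r" unfolding u_def times_divide_eq_right using K by (subst pos_divide_less_eq) auto
  qed
  have "(L * K)-lipschitz_on (cball t u Int {s..t'}) (lrep id c d o linepath x y)"
  proof (rule lipschitz_on_compose)
   show "K-lipschitz_on (cball t u Int {s..t'}) (linepath x y)" by (rule lipschitz_onI) (use lp K in auto)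
   show "L-lipschitz_on (linepath x y ` (cball t u Int {s..t'})) (lrep id c d)"
   proof (rule lipschitz_on_subset[OF r(2)], clarsimp)
    fix b assume "dist t b <= u"
    then have "K * dist t b <= K * u" using K by (rule mult_left_mono)
    then show "dist (linepath x y t) (linepath x y b) < r" unfolding lp using u(2) by simp
   qed
  qed
  then show "\<exists>u>0. EX L. \<forall>z\<in>cball z u Int {0}. L-lipschitz_on (cball t u Int {s..t'}) (lrep id c d o linepath x y)"
   using u(1) by blast
 qed
 from local_lipschitz_compact_implies_lipschitz[OF this compact_Icc compact_sing[of "0::real"]]
 obtain L where "L-lipschitz_on {s..t'} (lrep id c d o linepath x y)" by auto
 then show ?thesis by (rule lipschitz_imp_abs_continuous)
qed

text \<open>The straight segment in the chart competes in the infimum, and its speed is bounded by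
  ellipticity; \<open>K\<close> is the square root of the constant in
  \<open>ell_upper\<close>.\<close>

lemma riem_dist_upper:
 assumes g: "continuous_metric At g" and c: "c \<in> At" and x0: "x0 \<in> cod c"
 obtains r K where "r > 0" "K \<ge> 0" "ball x0 r \<subseteq> cod c"
  "\<forall>x\<in>ball x0 r. \<forall>y\<in>ball x0 r. riem_dist At g (cinv c x) (cinv c y) <= ennreal (K * dist x y)"
proof -
 obtain r l u where r: "r > 0" "l > 0" "ball x0 r \<subseteq> cod c" "\<forall>y\<in>ball x0 r. ell l u (metric_in_chart At g c (cinv c y))"
  by (rule continuous_metric_ell[OF g c x0])
 have "\<bar>metric_in_chart At g c (cinv c x0) $ undefined $ undefined\<bar> <= u" using r(1,4) unfolding ell_def by force
 then have u: "u \<ge> 0" by linarith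
 define K where "K = real CARD('n) * sqrt u"
 have K: "K \<ge> 0" using u by (simp add: K_def)
 have "riem_dist At g (cinv c x) (cinv c y) <= ennreal (K * dist x y)" if xy: "x \<in> ball x0 r" "y \<in> ball x0 r" for x y
 proof -
  define T where "T = linepath x y -` ball x0 r"
  have T: "open T" unfolding T_def by (rule continuous_open_vimage) (auto intro: continuous_intros)
  have T01: "{0..1} \<subseteq> T"
  proof
   fix t :: real assume "t \<in> {0..1}"
   then have "linepath x y t \<in> closed_segment x y" by (rule linepath_in_path)
   then show "t \<in> T" using closed_segment_subset[OF xy convex_ball] by (auto simp: T_def)
  qed
  define ga where "ga t = cinv c (linepath x y t)" for t
  have Tc: "linepath x y t \<in> cod c" if "t \<in> T" for t using that r(3) by (auto simp: T_def)
  have gaT: "ga ` T \<subseteq> cdom c" using Tc c by (auto simp: ga_def)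
  have cl: "(cmap c o ga has_vector_derivative (y - x)) (at t)" if t: "t \<in> T" for t
  proof (rule has_vector_derivative_transform_within_open[OF _ T t])
   show "(linepath x y has_vector_derivative (y - x)) (at t)" by (rule has_vector_derivative_linepath_within)
   show "linepath x y s = (cmap c o ga) s" if "s \<in> T" for s using Tc[OF that] c by (simp add: ga_def)
  qed
  have "abs_continuous_curve At ga"
   unfolding abs_continuous_curve_def
  proof (intro conjI ballI allI impI)
   show "continuous_on {0..1} ga" unfolding ga_def
    by (rule continuous_on_compose2[OF cont_inv[OF c] continuous_on_linepath]) (use T01 Tc in blast)
   fix d s t assume d: "d \<in> At" and st: "0 <= s & s <= t & t <= 1 & ga ` {s..t} \<subseteq> cdom d"
   have "linepath x y a \<in> ldom id c d" if "a \<in> {s..t}" for a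
   proof -
    have "a \<in> T" using that st T01 by auto
    then show ?thesis using that st Tc c by (auto simp: mem_ldom ga_def)
   qed
   from segment_abs_continuous[OF c d this]
   show "abs_continuous_on s t (cmap d o ga)"
    by (simp add: comp_def lrep_def ga_def)
  qed
  then have "riem_dist At g (cinv c x) (cinv c y) <= curve_length At g ga"
   unfolding riem_dist_def by (intro INF_lower) (simp add: ga_def linepath_def)
  also have "... <= (\<integral>\<^sup>+t. ennreal (K * dist x y) * indicator {0..1::real} t \<partial>lebesgue)"
   unfolding curve_length_def
  proof (rule nn_integral_mono)
   fix t :: real
   show "ennreal (sqrt (velocity At ga t \<bullet> (g (ga t) *v velocity At ga t))) * indicator {0..1} t <= ennreal (K * dist x y) * indicator {0..1} t"
   proof (cases "t \<in> {0..1}")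
    case True
    then have t: "t \<in> T" using T01 by blast
    then have "ell l u (metric_in_chart At g c (ga t))" using r(4) by (simp add: ga_def T_def)
    from ell_upper[OF this u, of "y - x"]
    have "velocity At ga t \<bullet> (g (ga t) *v velocity At ga t) <= (real CARD('n))\<^sup>2 * u * (norm (y - x))\<^sup>2"
     unfolding velocity_chart(2)[OF c T t gaT cl[OF t]] .
    then have "sqrt (velocity At ga t \<bullet> (g (ga t) *v velocity At ga t)) <= sqrt ((real CARD('n))\<^sup>2 * u * (norm (y - x))\<^sup>2)" by simp
    also have "... = K * dist x y" by (simp add: K_def real_sqrt_mult dist_norm norm_minus_commute)
    finally show ?thesis using True by (simp add: ennreal_leI)
   qed simp
  qed
  also have "... = ennreal (K * dist x y)" by (simp add: nn_integral_cmult_indicator)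
  finally show ?thesis .
 qed
 then show thesis using r(1,3) K by (intro that[of r K]) auto
qed

text \<open>By ellipticity the speed is at least \<open>sqrt l\<close> times the Euclidean speed in
  the chart, and an absolutely continuous function moves no farther than the integral of its
  speed.\<close>

lemma curve_length_lower:
 assumes d: "d \<in> At" and ga: "abs_continuous_curve At ga" and t1: "0 <= t1" "t1 <= 1"
  and sub: "ga ` {0..t1} \<subseteq> cdom d" and l: "l > 0"
  and ell: "!!t. t \<in> {0..t1} ==> ell l u (metric_in_chart At g d (ga t))"
 shows "ennreal (sqrt l * dist (cmap d (ga 0)) (cmap d (ga t1))) <= curve_length At g ga"
proof -
 let ?si = "cmap d o ga"
 let ?q = "%t. sqrt (velocity At ga t \<bullet> (g (ga t) *v velocity At ga t))"
 have ac: "abs_continuous_on 0 t1 ?si" using ga d t1 sub unfolding abs_continuous_curve_def by blast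
 have "negligible ({0, t1} Un {t\<in>{0<..<t1}. ~ ?si differentiable at t})"
  by (intro negligible_Un abs_continuous_differentiable_ae[OF ac]) auto
 then have ae: "AE t in lebesgue. t ~: {0, t1} Un {t\<in>{0<..<t1}. ~ ?si differentiable at t}"
  unfolding negligible_iff_null_sets by (rule AE_not_in)
 \<comment> \<open>The factor is built into the curve instead of being taken out of the integral,
   which would call for measurability of the speed.\<close>
 let ?ta = "%t. sqrt l *\<^sub>R ?si t"
 have "ennreal (norm (?ta t1 - ?ta 0)) <= (\<integral>\<^sup>+t\<in>{0..t1}. ennreal (norm (vector_derivative ?ta (at t))) \<partial>lebesgue)"
  by (rule abs_continuous_increment_le[OF abs_continuous_on_scaleR[OF ac] t1(1)])
 also have "... <= curve_length At g ga"
  unfolding curve_length_def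
 proof (rule nn_integral_mono_AE)
  show "AE t in lebesgue. ennreal (norm (vector_derivative ?ta (at t))) * indicator {0..t1} t
    <= ennreal (?q t) * indicator {0..1} t"
   using ae
  proof eventually_elim
   case (elim t)
   show ?case
   proof (cases "t \<in> {0..t1}")
    case True
    then have t: "t \<in> {0<..<t1}" "?si differentiable at t" using elim by auto
    then have D: "(?si has_vector_derivative vector_derivative ?si (at t)) (at t)" by (simp add: vector_derivative_works)
    have "ga ` {0<..<t1} \<subseteq> cdom d" using sub by auto
    note v = velocity_chart(2)[OF d open_greaterThanLessThan t(1) this D, of g]
    let ?s = "vector_derivative ?si (at t)"
    have "l * (?s \<bullet> ?s) <= ?s \<bullet> (metric_in_chart At g d (ga t) *v ?s)" using ell[OF True] unfolding ell_def by blast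
    then have "sqrt (l * (?s \<bullet> ?s)) <= ?q t" unfolding v by simp
    then have "sqrt l * norm ?s <= ?q t" by (simp add: real_sqrt_mult norm_eq_sqrt_inner)
    moreover have "vector_derivative ?ta (at t) = sqrt l *\<^sub>R ?s"
     by (rule vector_derivative_at[OF bounded_linear.has_vector_derivative[OF bounded_linear_scaleR_right D]])
    ultimately have "ennreal (norm (vector_derivative ?ta (at t))) <= ennreal (?q t)"
     using l by (intro ennreal_leI) simp
    then show ?thesis using True t1 by simp
   qed simp
  qed
 qed
 finally show ?thesis using l by (simp add: dist_norm norm_minus_commute flip: scaleR_diff_right)
qed

text \<open>A curve to a point outside the coordinate ball, possibly outside the chart, has to reach
  the boundary sphere. Until this first exit time \<open>t1\<close> it stays in the closed ball,
  where chart and ellipticity are available, and this initial part alone has the required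
  length.\<close>

lemma riem_dist_lower:
 assumes d: "d \<in> At" and K: "cball y de \<subseteq> cod d" and de: "de > 0" and l: "l > 0"
  and ell: "!!z. z \<in> cball y de ==> ell l u (metric_in_chart At g d (cinv d z))"
  and q: "q ~: cinv d ` ball y de"
 shows "ennreal (sqrt l * de) <= riem_dist At g (cinv d y) q"
 unfolding riem_dist_def
proof (rule INF_greatest)
 fix ga assume "ga \<in> {ga. abs_continuous_curve At ga & ga 0 = cinv d y & ga 1 = q}"
 then have ga: "abs_continuous_curve At ga" "ga 0 = cinv d y" "ga 1 = q" by auto
 have ct: "continuous_on {0..1} ga" using ga(1) unfolding abs_continuous_curve_def by blast
 have b: "ball y de \<subseteq> cod d" using K ball_subset_cball by blast
 have yc: "y \<in> cod d" using b de by auto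
 let ?V = "cinv d ` ball y de"
 have V: "open ?V" by (rule open_inv_image[OF d open_ball b])
 have cK: "closed (cinv d ` cball y de)" by (rule compact_imp_closed[OF compact_chart_image[OF d compact_cball K]])
 define Z where "Z = {0..1} Int ga -` (- ?V)"
 have Z: "closed Z" unfolding Z_def by (rule continuous_closed_preimage[OF ct closed_atLeastAtMost]) (use V in auto)
 have "1 \<in> Z" using ga(3) q by (simp add: Z_def)
 have bZ: "bdd_below Z" by (rule bdd_belowI[of _ 0]) (auto simp: Z_def)
 define t1 where "t1 = Inf Z"
 have t1Z: "t1 \<in> Z" unfolding t1_def using closed_contains_Inf[OF _ bZ Z] `1 \<in> Z` by blast
 then have t1: "0 <= t1" "t1 <= 1" "ga t1 ~: ?V" by (auto simp: Z_def)
 have bef: "ga t \<in> ?V" if "0 <= t" "t < t1" for t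
 proof (rule ccontr)
  assume "ga t ~: ?V"
  then have "t \<in> Z" using that t1 by (simp add: Z_def)
  then have "t1 <= t" unfolding t1_def by (rule cInf_lower[OF _ bZ])
  then show False using that by simp
 qed
 have "t1 ~= 0" using t1(3) ga(2) de by auto
 then have t1p: "0 < t1" using t1 by simp
 \<comment> \<open>At the exit time the curve is still in the image of the closed ball: this image
   is compact, hence closed in the Hausdorff space \<open>M\<close>, and it contains all earlier
   points.\<close>
 have "ga t1 \<in> cinv d ` cball y de"
 proof (rule Lim_in_closed_set[OF cK])
  show "(ga \<longlongrightarrow> ga t1) (at t1 within {0..<t1})"
   using ct t1 unfolding continuous_on_def by (meson atLeastAtMost_iff atLeastLessThan_subseteq_atLeastAtMost_iff order.refl tendsto_within_subset)
  show "\<forall>\<^sub>F t in at t1 within {0..<t1}. ga t \<in> cinv d ` cball y de"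
   unfolding eventually_at_filter using bef by (intro always_eventually) (auto dest: bef)
  show "at t1 within {0..<t1} ~= bot"
   using t1p by (simp add: at_within_eq_bot_iff trivial_limit_within islimpt_greaterThanLessThan2 closure_def)
 qed
 then obtain z where z: "z \<in> cball y de" "ga t1 = cinv d z" by blast
 have in_K: "\<exists>z\<in>cball y de. ga t = cinv d z" if "t \<in> {0..t1}" for t
  using bef[of t] z that by (cases "t = t1") (auto simp: less_le)
 have "ennreal (sqrt l * dist (cmap d (ga 0)) (cmap d (ga t1))) <= curve_length At g ga"
 proof (rule curve_length_lower[OF d ga(1) t1(1,2) _ l])
  show "ga ` {0..t1} \<subseteq> cdom d"
  proof
   fix p assume "p \<in> ga ` {0..t1}"
   then obtain t where "t \<in> {0..t1}" "p = ga t" by blast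
   then obtain z where "z \<in> cball y de" "p = cinv d z" using in_K by blast
   then show "p \<in> cdom d" using K d by auto
  qed
  show "ell l u (metric_in_chart At g d (ga t))" if "t \<in> {0..t1}" for t using in_K[OF that] ell by auto
 qed
 moreover have "dist y z = de"
 proof -
  have "z ~: ball y de" using t1(3) z(2) by blast
  then show ?thesis using z(1) by auto
 qed
 moreover have "z \<in> cod d" using z(1) K by blast
 ultimately show "ennreal (sqrt l * de) <= curve_length At g ga" using z(2) ga(2) yc d by simp
qed

text \<open>The lower bound for the distance is used twice. With the fixed radius \<open>s\<close>
  it shows that points near \<open>x\<close> are not thrown out of the target chart; this is what
  makes \<open>ldom F c d\<close> open. With the distance of the two image points as radius it gives
  the Lipschitz estimate.\<close>

lemma dist_bound_lip_map:
 assumes g: "continuous_metric At g" and C: "C \<ge> 0"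
  and F: "!!p q. riem_dist At g (F p) (F q) <= ennreal C * riem_dist At g p q"
 shows "lip_map F"
 unfolding lip_map_def
proof (intro ballI)
 fix c d assume c: "c \<in> At" and d: "d \<in> At"
 show "loc_lip_on (ldom F c d) (lrep F c d)"
  unfolding loc_lip_on_def
 proof
  fix x assume x: "x \<in> ldom F c d"
  then have xc: "x \<in> cod c" and Fx: "F (cinv c x) \<in> cdom d" using c by (auto simp: mem_ldom)
  define y0 where "y0 = cmap d (F (cinv c x))"
  have y0: "y0 \<in> cod d" using Fx by (simp add: y0_def)
  obtain r1 K where r1: "r1 > 0" "K \<ge> 0" "ball x r1 \<subseteq> cod c"
   "\<forall>a\<in>ball x r1. \<forall>b\<in>ball x r1. riem_dist At g (cinv c a) (cinv c b) <= ennreal (K * dist a b)"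
   by (rule riem_dist_upper[OF g c xc])
  obtain r l u where r: "r > 0" "l > 0" "ball y0 r \<subseteq> cod d" "\<forall>y\<in>ball y0 r. ell l u (metric_in_chart At g d (cinv d y))"
   by (rule continuous_metric_ell[OF g d y0])
  \<comment> \<open>A ball of radius at most \<open>s\<close> around a point of
    \<open>ball y0 s\<close> stays within \<open>ball y0 r\<close>, where ellipticity holds with one
    constant \<open>l\<close>.\<close>
  define s where "s = r / 3"
  have s: "s > 0" using r(1) by (simp add: s_def)
  have sub: "cball y de \<subseteq> ball y0 r" if "y \<in> ball y0 s" "de <= s" for y de
  proof
   fix z assume "z \<in> cball y de"
   then have "dist y0 z < s + s" using that dist_triangle[of y0 z y] by auto
   then show "z \<in> ball y0 r" using s by (simp add: s_def)
  qed
  have low: "ennreal (sqrt l * de) <= riem_dist At g (cinv d y) q"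
   if "y \<in> ball y0 s" "0 < de" "de <= s" "q ~: cinv d ` ball y de" for y de q
   by (rule riem_dist_lower[OF d _ that(2) r(2) _ that(4)]) (use sub[OF that(1,3)] r(3,4) in blast)+
  \<comment> \<open>Two points of \<open>ball x ep\<close> are at most \<open>2 * ep\<close> apart,
    so their images have distance less than \<open>sqrt l * s\<close>, too little to leave a ball of
    radius \<open>s\<close>.\<close>
  define ep where "ep = min r1 (sqrt l * s / (2 * (C * K + 1)))"
  have CK: "C * K \<ge> 0" using C r1(2) by simp
  have ep: "ep > 0" "ep <= r1" "C * K * (2 * ep) < sqrt l * s"
  proof -
   show "ep > 0" "ep <= r1" using r1(1) r(2) s CK by (auto simp: ep_def)
   have "ep <= sqrt l * s / (2 * (C * K + 1))" by (simp add: ep_def)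
   then have "ep * (2 * (C * K + 1)) <= sqrt l * s" using CK by (simp add: pos_le_divide_eq)
   then show "C * K * (2 * ep) < sqrt l * s" using `ep > 0` by (simp add: algebra_simps)
  qed
  have up: "riem_dist At g (F (cinv c a)) (F (cinv c b)) <= ennreal (C * K * dist a b)"
   if "a \<in> ball x ep" "b \<in> ball x ep" for a b
  proof -
   have "a \<in> ball x r1" "b \<in> ball x r1" using that ep(2) by auto
   then have "riem_dist At g (cinv c a) (cinv c b) <= ennreal (K * dist a b)" using r1(4) by blast
   then have "ennreal C * riem_dist At g (cinv c a) (cinv c b) <= ennreal C * ennreal (K * dist a b)" by (rule mult_left_mono) simp
   also have "... = ennreal (C * K * dist a b)" using C r1(2) by (simp add: ennreal_mult' mult.assoc)
   finally show ?thesis using F order_trans by blast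
  qed
  have xb: "x \<in> ball x ep" using ep(1) by simp
  have small: "C * K * dist a b < sqrt l * s" if "a \<in> ball x ep" "b \<in> ball x ep" for a b
  proof -
   have "dist a b <= 2 * ep" using that dist_triangle[of a b x] by (auto simp: dist_commute)
   then have "C * K * dist a b <= C * K * (2 * ep)" using CK by (rule mult_left_mono)
   then show ?thesis using ep(3) by simp
  qed
  have near: "F (cinv c a) \<in> cinv d ` ball y0 s" if a: "a \<in> ball x ep" for a
  proof (rule ccontr)
   assume "F (cinv c a) ~: cinv d ` ball y0 s"
   from low[OF _ s order_refl this] have "ennreal (sqrt l * s) <= riem_dist At g (F (cinv c x)) (F (cinv c a))"
    using s d Fx by (simp add: y0_def)
   also have "... <= ennreal (C * K * dist x a)" by (rule up[OF xb a])
   finally show False using small[OF xb a] CK by (simp add: ennreal_le_iff)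
  qed
  have sd: "ball y0 s \<subseteq> cod d" using r(1,3) by (auto simp: s_def subset_eq)
  have lr: "lrep F c d a \<in> ball y0 s" "F (cinv c a) = cinv d (lrep F c d a)" "a \<in> ldom F c d" if a: "a \<in> ball x ep" for a
  proof -
   obtain z where z: "z \<in> ball y0 s" "F (cinv c a) = cinv d z" using near[OF a] by blast
   then have zc: "z \<in> cod d" using sd by blast
   then have "lrep F c d a = z" using z(2) d by (simp add: lrep_def)
   then show "lrep F c d a \<in> ball y0 s" "F (cinv c a) = cinv d (lrep F c d a)" using z by auto
   have "a \<in> ball x r1" using a ep(2) by auto
   then have "a \<in> cod c" using r1(3) by blast
   then show "a \<in> ldom F c d" using z(2) zc c d by (simp add: mem_ldom)
  qed
  have "(C * K / sqrt l)-lipschitz_on (ball x ep) (lrep F c d)"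
  proof (rule lipschitz_onI)
   fix a b assume ab: "a \<in> ball x ep" "b \<in> ball x ep"
   let ?y = "lrep F c d a" and ?z = "lrep F c d b"
   show "dist ?y ?z <= C * K / sqrt l * dist a b"
   proof (cases "?y = ?z")
    case False
    \<comment> \<open>The lower bound is available for radii up to \<open>s\<close> only, hence the
      truncation. The resulting estimate forces \<open>de < s\<close>, so in the end
      \<open>de\<close> is the distance itself.\<close>
    define de where "de = min (dist ?y ?z) s"
    have de: "0 < de" "de <= s" "de <= dist ?y ?z" using False s by (auto simp: de_def)
    have "F (cinv c b) ~: cinv d ` ball ?y de"
    proof
     assume "F (cinv c b) \<in> cinv d ` ball ?y de"
     then obtain w where w: "w \<in> ball ?y de" "cinv d ?z = cinv d w" using lr(2)[OF ab(2)] by auto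
     have "w \<in> cball ?y de" using w(1) by auto
     then have "w \<in> cod d" "?z \<in> cod d" using sub[OF lr(1)[OF ab(1)] de(2)] r(3) lr(1)[OF ab(2)] sd by blast+
     then have "w = ?z" using w(2) d by (metis chart_map_inv)
     then show False using w(1) de(3) by simp
    qed
    from low[OF lr(1)[OF ab(1)] de(1,2) this]
    have "ennreal (sqrt l * de) <= riem_dist At g (F (cinv c a)) (F (cinv c b))" using lr(2)[OF ab(1)] by simp
    also have "... <= ennreal (C * K * dist a b)" by (rule up[OF ab])
    finally have *: "sqrt l * de <= C * K * dist a b" using CK by (simp add: ennreal_le_iff)
    then have "sqrt l * de < sqrt l * s" using small[OF ab] by simp
    then have "de < s" using r(2) by simp
    then have "de = dist ?y ?z" by (auto simp: de_def min_def split: if_splits)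
    then show ?thesis using * r(2) by (simp add: pos_le_divide_eq mult.commute)
   next
    case True
    have "0 <= C * K / sqrt l * dist a b" using CK r(2) by (intro mult_nonneg_nonneg[of "C * K / sqrt l"] divide_nonneg_nonneg) auto
    then show ?thesis using True by simp
   qed
  qed (use CK r(2) in "simp add: divide_nonneg_nonneg")
  then show "\<exists>r>0. EX L. ball x r \<subseteq> ldom F c d & L-lipschitz_on (ball x r) (lrep F c d)"
   using ep(1) lr(3) by blast
 qed
qed

text \<open>Multiplied by \<open>C\<close>, the lower bound for \<open>F\<close> becomes the upper
  bound for its inverse. Distances may be infinite, so the cancellation takes place between the two
  constants and never involves a distance.\<close>

lemma lipeomorphism_lip_map:
 assumes g: "continuous_metric At g" and F: "lipeomorphism At g F"
 shows "bij F" "lip_map F" "lip_map (inv F)"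
proof -
 obtain C :: real where b: "bij F" and C: "C \<ge> 1"
  and lo: "!!x y. ennreal (inverse C) * riem_dist At g x y <= riem_dist At g (F x) (F y)"
  and up: "!!x y. riem_dist At g (F x) (F y) <= ennreal C * riem_dist At g x y"
  using F unfolding lipeomorphism_def by blast
 show "bij F" by (rule b)
 show "lip_map F" by (rule dist_bound_lip_map[OF g _ up]) (use C in simp)
 have FI: "F (inv F p) = p" for p using b by (simp add: bij_is_surj surj_f_inv_f)
 have "riem_dist At g (inv F p) (inv F q) <= ennreal C * riem_dist At g p q" for p q
 proof -
  have "ennreal C * (ennreal (inverse C) * riem_dist At g (inv F p) (inv F q)) <= ennreal C * riem_dist At g p q"
   using lo[of "inv F p" "inv F q"] by (intro mult_left_mono) (simp_all add: FI)
  moreover have "ennreal C * ennreal (inverse C) = 1" using C by (simp add: ennreal_mult'[symmetric])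
  ultimately show ?thesis by (simp add: mult.assoc[symmetric])
 qed
 then show "lip_map (inv F)" using C by (intro dist_bound_lip_map[OF g, of C]) auto
qed

end

theorem theorem5p17:
  fixes \<A> :: "('m::{t2_space, second_countable_topology}, 'n::finite) chart set"
    and g gt :: "'m \<Rightarrow> real^'n^'n"
    and F :: "'m \<Rightarrow> 'm"
    and a :: "'m \<Rightarrow> complex"
    and A :: "'m \<Rightarrow> complex \<times> (complex^'n) \<Rightarrow> complex \<times> (complex^'n)"
    and \<kappa>1 \<kappa>2 :: real
  assumes "smooth_manifold \<A>"
    and "continuous_metric \<A> g"
    and "complete_metric \<A> g"
    and "lipeomorphism \<A> g F"
    and "gt = pullback_metric \<A> F g"
    and "a \<in> Linf_fun \<A> gt"
    and "A \<in> Linf_endo \<A> gt"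
    and "\<kappa>1 > 0"
    and "\<kappa>2 > 0"
    and "\<And>v Sv. v \<in> W12 \<A> gt \<Longrightarrow> (v, Sv) \<in> S_op \<A> gt \<Longrightarrow>
           Re (L2_pair_inner \<A> gt (\<lambda>p. A p (Sv p)) Sv) \<ge> \<kappa>1 * (W12_norm \<A> gt v)\<^sup>2"
    and "\<And>u. u \<in> L2_fun \<A> gt \<Longrightarrow>
           Re (L2_fun_inner \<A> gt (\<lambda>p. a p * u p) u) \<ge> \<kappa>2 * (L2_fun_norm \<A> gt u)\<^sup>2"
  shows "quadratic_estimate \<A> gt (\<Pi>_op \<A> gt (B1_op \<A> gt a) (B2_op \<A> gt A)) \<longleftrightarrow>
         quadratic_estimate \<A> g
           (\<Pi>_op \<A> g
              (conj_op (\<Phi>_op \<A> gt g F) (B1_op \<A> gt a))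
              (conj_op (\<Phi>_op \<A> gt g F) (B2_op \<A> gt A)))"
proof -
  interpret manifold \<A> by unfold_locales (rule assms(1))
  show ?thesis
    by (rule quadratic_estimate_transfer[OF assms(1,2) lipeomorphism_lip_map[OF assms(2,4)] assms(5)])
qed

end
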